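(* Let $H \le S_n$ be a non-identity permutation group with minimal degree $m = m(H)$. 1) If $m \le \log_2 n$, then $|H| \le n^{10 n/m}$. 2) If $m \ge \log_2 n$, then $|H| \le 2^{10 n}$.
   Context: $S_n$ is the symmetric group on $\{1,\dots,n\}$. For $h\in S_n$, $\mathrm{supp}(h)=\{i : h(i)\ne i\}$. The minimal degree of a permutation group $1\neq H\le S_n$ is $m(H)=\min\{|\mathrm{supp}(h)| : 1\ne h\in H\}$. No transitivity or primitivity is assumed. *)

theory Defs
  imports Complex_Main "HOL-Algebra.Sym_Groups"
begin

(* Elements of sym_group n are functions on all of nat that fix every point outside {1..n},
   so this set is contained in {1..n} for them. *)
definition supp :: "(nat \<Rightarrow> nat) \<Rightarrow> nat set"
  where "supp h = {i. h i \<noteq> i}"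

(* Only meaningful for a finite H with H \<noteq> {id}; otherwise Min is applied to an
   empty or possibly infinite set. *)
definition minimal_degree :: "(nat \<Rightarrow> nat) set \<Rightarrow> nat"
  where "minimal_degree H = Min {card (supp h) | h. h \<in> H \<and> h \<noteq> id}"

lemma supp_subset:
  assumes "h \<in> carrier (sym_group n)"
  shows "supp h \<subseteq> {1..n}"
  using assms by (auto simp: supp_def sym_group_carrier permutes_def)

lemma minimal_degree_attained:
  assumes "subgroup H (sym_group n)" "H \<noteq> {id}"
  shows "\<exists>h\<in>H. h \<noteq> id \<and> card (supp h) = minimal_degree H"
    and "\<And>h. h \<in> H \<Longrightarrow> h \<noteq> id \<Longrightarrow> minimal_degree H \<le> card (supp h)"
proof -
  let ?S = "{card (supp h) | h. h \<in> H \<and> h \<noteq> id}"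
  have sub: "H \<subseteq> {p. p permutes {1..n}}"
    using subgroup.subset[OF assms(1)] by (auto simp: sym_group_def)
  have "finite H"
    by (rule finite_subset[OF sub]) (simp add: finite_permutations)
  hence fin: "finite ?S" by simp
  have "id \<in> H"
    using subgroup.one_closed[OF assms(1)] by (simp add: sym_group_one)
  with assms(2) have "?S \<noteq> {}" by blast
  from Min_in[OF fin this]
  show "\<exists>h\<in>H. h \<noteq> id \<and> card (supp h) = minimal_degree H"
    unfolding minimal_degree_def by (smt (verit, best) mem_Collect_eq)
  show "minimal_degree H \<le> card (supp h)" if "h \<in> H" "h \<noteq> id" for h
    unfolding minimal_degree_def using fin that by (auto intro: Min_le)
qed

end

theory Submission
  imports Defs "HOL-Computational_Algebra.Primes"
begin

text \<open>No classification of finite simple groups is used. A primitive group of degree \<open>d\<close> without 3-cycles has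
  order at most \<open>2 ^ (7 * (d - 1))\<close>: for small \<open>d\<close> by Bochert's argument, for groups that are not doubly
  transitive by Babai's method of distinguishing points, and for doubly transitive groups by bounding the degree
  of transitivity \<open>t\<close> and separating points by the orbits on triples of the stabiliser of \<open>t - 2\<close> points.

  For a general group \<open>H\<close> of degree \<open>n\<close> consider chains of \<open>K\<close>-invariant equivalence relations for subgroups \<open>K\<close>
  of \<open>H\<close>. Such a tower has a weight, at most \<open>n\<close>. As long as some section of the tower is not an alternating or
  symmetric group in a natural action of degree at least 9, the tower can be refined, or the section can be
  killed by passing to a subgroup whose index is at most \<open>2 ^ 7\<close> to the loss of weight. At the cost
  of a factor \<open>2 ^ (7 * n)\<close> all sections are therefore such giants, and no two of them are tied to each other.
  Then for a section acting on \<open>k\<close> blocks, the letters, let \<open>T\<close> be the set of the points whose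
  stabiliser fixes a letter. A suitable commutator acts as a 3-cycle on the letters and moves only points of \<open>T\<close>
  belonging to three letters, so \<open>m * k \<le> 3 * card T\<close> for the minimal degree \<open>m\<close>. On the other hand the product of the \<open>k\<close>
  with \<open>x \<in> T\<close> is at most the length of the orbit of \<open>x\<close>, hence at most \<open>n\<close>. Together this bounds the logarithm of the
  product of all \<open>k!\<close> by \<open>3 * n * ln n / m\<close>.\<close>

section \<open>Finite permutation groups\<close>

text \<open>The obstacle is that sections may depend on one another: a single alternating group can
  act through several of them. At one level this is harmless, since for sections with the same
  kernel the action on one determines the others, and they are counted once. Between two levels it
  could stop the descent that produces elements of small support. But killing the upper section of
  such a pair kills the lower one too, and the lower one, having many more conjugates, loses enough
  weight to pay even for a symmetric group. The weight is made for this account: a section of degree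
  \<open>d\<close> with \<open>k\<close> conjugates contributes \<open>k * (d - 1)\<close>, while
  killing it multiplies the index by at most the \<open>k\<close>-th power of its order. Hence an
  exponential bound \<open>2 ^ (7 * (d - 1))\<close> for primitive groups is enough. The 7 stems
  from Bochert's bound \<open>d ^ (d / 2)\<close>, which suffices up to degree 16000, just below
  \<open>2 ^ 14\<close>; from there on the other methods take over. The degree 9 is that of one
  letter and two disjoint sets of four, as used in \<open>degree_bound\<close>. The exponent 10 is 7
  for the passage to giants plus 3 for the commutator.\<close>

definition mov :: "('a \<Rightarrow> 'a) \<Rightarrow> 'a set"
  where "mov f = {x. f x \<noteq> x}"

definition pgroup :: "'a set \<Rightarrow> ('a \<Rightarrow> 'a) set \<Rightarrow> bool"
  where "pgroup \<Omega> G \<longleftrightarrow> finite \<Omega> \<and> id \<in> G \<and> (\<forall>g\<in>G. g permutes \<Omega>)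
           \<and> (\<forall>g\<in>G. \<forall>h\<in>G. g \<circ> h \<in> G) \<and> (\<forall>g\<in>G. inv' g \<in> G)"

definition orb :: "('a \<Rightarrow> 'a) set \<Rightarrow> 'a \<Rightarrow> 'a set"
  where "orb G x = (\<lambda>g. g x) ` G"

definition stab :: "('a \<Rightarrow> 'a) set \<Rightarrow> 'a \<Rightarrow> ('a \<Rightarrow> 'a) set"
  where "stab G x = {g \<in> G. g x = x}"

definition comm :: "('a \<Rightarrow> 'a) \<Rightarrow> ('a \<Rightarrow> 'a) \<Rightarrow> 'a \<Rightarrow> 'a"
  where "comm g h = g \<circ> h \<circ> inv' g \<circ> inv' h"

definition normal_in :: "('a \<Rightarrow> 'a) set \<Rightarrow> ('a \<Rightarrow> 'a) set \<Rightarrow> bool"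
  where "normal_in Y X \<longleftrightarrow> (\<forall>x\<in>X. \<forall>y\<in>Y. x \<circ> y \<circ> inv' x \<in> Y)"

lemma pgroup_finite: "pgroup \<Omega> G \<Longrightarrow> finite \<Omega>"
  and pgroup_id: "pgroup \<Omega> G \<Longrightarrow> id \<in> G"
  and pgroup_permutes: "pgroup \<Omega> G \<Longrightarrow> g \<in> G \<Longrightarrow> g permutes \<Omega>"
  and pgroup_comp: "pgroup \<Omega> G \<Longrightarrow> g \<in> G \<Longrightarrow> h \<in> G \<Longrightarrow> g \<circ> h \<in> G"
  and pgroup_inv: "pgroup \<Omega> G \<Longrightarrow> g \<in> G \<Longrightarrow> inv' g \<in> G"
  unfolding pgroup_def by auto

lemma pgroup_finite_group: "pgroup \<Omega> G \<Longrightarrow> finite G"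
  unfolding pgroup_def by (metis finite_permutations finite_subset mem_Collect_eq subsetI)

lemma pgroup_card_pos: "pgroup \<Omega> G \<Longrightarrow> card G > 0"
  using pgroup_finite_group pgroup_id card_gt_0_iff by blast

lemma pgroup_bij: "pgroup \<Omega> G \<Longrightarrow> g \<in> G \<Longrightarrow> bij g"
  using pgroup_permutes permutes_bij by blast

lemma pgroup_inv1: "pgroup \<Omega> G \<Longrightarrow> g \<in> G \<Longrightarrow> inv' g (g x) = x"
  and pgroup_inv2: "pgroup \<Omega> G \<Longrightarrow> g \<in> G \<Longrightarrow> g (inv' g x) = x"
  using pgroup_permutes permutes_inverses by metis+

lemma pgroup_invo1: "pgroup \<Omega> G \<Longrightarrow> g \<in> G \<Longrightarrow> inv' g \<circ> g = id"
  and pgroup_invo2: "pgroup \<Omega> G \<Longrightarrow> g \<in> G \<Longrightarrow> g \<circ> inv' g = id"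
  using pgroup_permutes permutes_inv_o by metis+

lemma pgroup_inj: "pgroup \<Omega> G \<Longrightarrow> g \<in> G \<Longrightarrow> g x = g y \<longleftrightarrow> x = y"
  using pgroup_inv1 by metis

lemma pgroup_in: "pgroup \<Omega> G \<Longrightarrow> g \<in> G \<Longrightarrow> g x \<in> \<Omega> \<longleftrightarrow> x \<in> \<Omega>"
  using pgroup_permutes permutes_in_image by metis

lemma pgroup_out: "pgroup \<Omega> G \<Longrightarrow> g \<in> G \<Longrightarrow> x \<notin> \<Omega> \<Longrightarrow> g x = x"
  using pgroup_permutes permutes_not_in by metis

text \<open>Inverses come for free by finiteness: composing with \<open>g\<close> maps
  \<open>K\<close> injectively into itself, hence onto, so \<open>id\<close> is attained.\<close>

lemma pgroup_subI:
  assumes G: "pgroup \<Omega> G" and K: "K \<subseteq> G" "id \<in> K"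
    and cl: "\<And>g h. g \<in> K \<Longrightarrow> h \<in> K \<Longrightarrow> g \<circ> h \<in> K"
  shows "pgroup \<Omega> K"
proof -
  have fin: "finite K" using K(1) pgroup_finite_group[OF G] finite_subset by blast
  have "inv' g \<in> K" if g: "g \<in> K" for g
  proof -
    have gG: "g \<in> G" using g K by auto
    have "inj_on (\<lambda>h. g \<circ> h) K"
      by (rule inj_onI) (metis pgroup_invo1[OF G gG] comp_assoc id_comp)
    moreover have "(\<lambda>h. g \<circ> h) ` K \<subseteq> K" using cl g by auto
    ultimately have "(\<lambda>h. g \<circ> h) ` K = K" using fin by (simp add: endo_inj_surj)
    then obtain h where "h \<in> K" "g \<circ> h = id" using K(2) by (metis imageE)
    then show ?thesis by (metis pgroup_invo1[OF G gG] comp_assoc id_comp comp_id)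
  qed
  then show ?thesis using G K cl unfolding pgroup_def by auto
qed

lemma pgroup_filter:
  assumes G: "pgroup \<Omega> G" and "P id" "\<And>g h. g \<in> G \<Longrightarrow> h \<in> G \<Longrightarrow> P g \<Longrightarrow> P h \<Longrightarrow> P (g \<circ> h)"
  shows "pgroup \<Omega> {g \<in> G. P g}"
  by (rule pgroup_subI[OF G]) (use assms pgroup_id[OF G] pgroup_comp[OF G] in auto)

lemma pgroup_stab: "pgroup \<Omega> G \<Longrightarrow> pgroup \<Omega> (stab G x)"
  unfolding stab_def by (rule pgroup_filter) auto

lemma pgroup_inter: "pgroup \<Omega> G \<Longrightarrow> pgroup \<Omega> H \<Longrightarrow> pgroup \<Omega> (G \<inter> H)"
  unfolding pgroup_def by auto

lemma pgroup_conj: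
  "pgroup \<Omega> G \<Longrightarrow> g \<in> G \<Longrightarrow> h \<in> G \<Longrightarrow> g \<circ> h \<circ> inv' g \<in> G"
  by (simp add: pgroup_comp pgroup_inv)

lemma pgroup_comm: "pgroup \<Omega> G \<Longrightarrow> g \<in> G \<Longrightarrow> h \<in> G \<Longrightarrow> comm g h \<in> G"
  by (simp add: comm_def pgroup_comp pgroup_inv)

text \<open>The hypothesis on \<open>F\<close> says that its fibres are left cosets of
  \<open>S\<close>. In this form one count serves orbits, images of pairs, induced actions and
  labellings.\<close>

lemma card_group_fiber:
  assumes G: "pgroup \<Omega> G" and S: "S \<subseteq> G"
    and F: "\<And>g h. g \<in> G \<Longrightarrow> h \<in> G \<Longrightarrow> F g = F h \<longleftrightarrow> inv' h \<circ> g \<in> S"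
    and y: "y \<in> F ` G"
  shows "card {g \<in> G. F g = y} = card S"
proof -
  obtain h where h: "h \<in> G" "y = F h" using y by blast
  have "{g \<in> G. F g = y} = (\<lambda>s. h \<circ> s) ` S"
  proof (intro equalityI subsetI)
    fix g assume "g \<in> {g \<in> G. F g = y}"
    then have g: "g \<in> G" "inv' h \<circ> g \<in> S" using F h by auto
    have "g = h \<circ> (inv' h \<circ> g)" using pgroup_invo2[OF G h(1)] by (simp add: comp_assoc[symmetric])
    then show "g \<in> (\<lambda>s. h \<circ> s) ` S" using g by blast
  next
    fix g assume "g \<in> (\<lambda>s. h \<circ> s) ` S"
    then obtain s where s: "s \<in> S" "g = h \<circ> s" by auto
    have gG: "g \<in> G" using s S h pgroup_comp[OF G] by auto
    have "inv' h \<circ> g = s" using s pgroup_invo1[OF G h(1)] by (simp add: comp_assoc[symmetric])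
    then show "g \<in> {g \<in> G. F g = y}" using F[OF gG h(1)] s h gG by auto
  qed
  moreover have "inj_on (\<lambda>s. h \<circ> s) S"
    by (rule inj_onI) (metis pgroup_invo1[OF G h(1)] comp_assoc id_comp)
  ultimately show ?thesis by (simp add: card_image)
qed

lemma card_group_image:
  assumes G: "pgroup \<Omega> G" and S: "S \<subseteq> G"
    and F: "\<And>g h. g \<in> G \<Longrightarrow> h \<in> G \<Longrightarrow> F g = F h \<longleftrightarrow> inv' h \<circ> g \<in> S"
  shows "card G = card (F ` G) * card S"
proof -
  have "(\<Sum>y\<in>F ` G. \<Sum>g\<in>{g \<in> G. F g = y}. (1::nat)) = (\<Sum>g\<in>G. 1)"
    by (rule sum.group) (use pgroup_finite_group[OF G] in auto)
  then have "card G = (\<Sum>y\<in>F ` G. card {g \<in> G. F g = y})" by simp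
  also have "\<dots> = (\<Sum>y\<in>F ` G. card S)" by (rule sum.cong[OF refl]) (rule card_group_fiber[OF G S F])
  finally show ?thesis by simp
qed

lemma orbit_stabilizer:
  assumes G: "pgroup \<Omega> G"
  shows "card G = card (orb G x) * card (stab G x)"
  unfolding orb_def
proof (rule card_group_image[OF G])
  show "stab G x \<subseteq> G" by (auto simp: stab_def)
  fix g h assume gh: "g \<in> G" "h \<in> G"
  show "(g x = h x) = (inv' h \<circ> g \<in> stab G x)"
    using gh pgroup_comp[OF G pgroup_inv[OF G gh(2)] gh(1)] pgroup_inv1[OF G gh(2)] pgroup_inv2[OF G gh(2)]
    by (auto simp: stab_def) (metis)
qed

lemma orb_self: "pgroup \<Omega> G \<Longrightarrow> x \<in> orb G x"
  unfolding orb_def using pgroup_id by (metis id_apply image_eqI)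

lemma orb_subset: "pgroup \<Omega> G \<Longrightarrow> x \<in> \<Omega> \<Longrightarrow> orb G x \<subseteq> \<Omega>"
  unfolding orb_def using pgroup_in by fastforce

lemma finite_orb: "pgroup \<Omega> G \<Longrightarrow> finite (orb G x)"
  unfolding orb_def using pgroup_finite_group by blast

lemma mov_inv:
  assumes "pgroup \<Omega> G" "g \<in> G"
  shows "mov (inv' g) = mov g"
proof -
  have "inv' g x = x \<longleftrightarrow> g x = x" for x
    using pgroup_inv1[OF assms, of x] pgroup_inv2[OF assms, of x] by metis
  then show ?thesis unfolding mov_def by auto
qed

lemma mov_subset: "pgroup \<Omega> G \<Longrightarrow> g \<in> G \<Longrightarrow> mov g \<subseteq> \<Omega>"
  unfolding mov_def using pgroup_out by fastforce

lemma mov_empty: "mov g = {} \<longleftrightarrow> g = id"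
  unfolding mov_def by (auto simp: fun_eq_iff)

text \<open>At any other point one of the two maps acts trivially where it matters and cancels. So
  two supports with small intersection are enough for a commutator of small support.\<close>

lemma mov_comm:
  assumes "bij g" "bij h"
  shows "mov (comm g h) \<subseteq> (mov g \<inter> mov h) \<union> g ` (mov g \<inter> mov h) \<union> h ` (mov g \<inter> mov h)"
proof
  fix x assume x: "x \<in> mov (comm g h)"
  have gi: "g (inv' g y) = y" "h (inv' h y) = y" "inv' g (g y) = y" "inv' h (h y) = y" for y
    using assms by (simp_all add: bij_is_surj surj_f_inv_f bij_is_inj)
  show "x \<in> (mov g \<inter> mov h) \<union> g ` (mov g \<inter> mov h) \<union> h ` (mov g \<inter> mov h)"
  proof (rule ccontr)
    assume n: "\<not> ?thesis"
    show False
    proof (cases "h x = x")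
      case True
      then have 1: "inv' h x = x" by (metis gi(4))
      let ?y = "inv' g x"
      have "?y \<notin> mov g \<inter> mov h" using n gi(1) by (metis UnI1 UnI2 imageI)
      then have "h ?y = ?y" using True gi(1) unfolding mov_def by force
      then have "comm g h x = x" unfolding comm_def by (simp add: 1 gi)
      then show False using x unfolding mov_def by auto
    next
      case False
      then have gx: "g x = x" using n unfolding mov_def by auto
      let ?y = "inv' h x"
      have ym: "h ?y \<noteq> ?y" using False gi(2) by metis
      have "?y \<notin> mov g \<inter> mov h" using n gi(2) by (metis UnI2 imageI)
      then have "g ?y = ?y" using ym unfolding mov_def by auto
      then have "inv' g ?y = ?y" by (metis gi(3))
      then have "comm g h x = x" unfolding comm_def by (simp add: gx gi)
      then show False using x unfolding mov_def by auto
    qed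
  qed
qed

lemma card_mov_comm:
  assumes "bij g" "bij h" "finite (mov g)"
  shows "card (mov (comm g h)) \<le> 3 * card (mov g \<inter> mov h)"
proof -
  let ?I = "mov g \<inter> mov h"
  have f: "finite ?I" using assms by auto
  have "card (mov (comm g h)) \<le> card (?I \<union> g ` ?I \<union> h ` ?I)"
    by (rule card_mono[OF _ mov_comm[OF assms(1,2)]]) (use f in auto)
  also have "\<dots> \<le> card ?I + card (g ` ?I) + card (h ` ?I)"
    by (meson card_Un_le le_trans add_le_mono1)
  also have "\<dots> \<le> card ?I + card ?I + card ?I"
    using card_image_le[OF f] by (meson add_mono le_refl)
  finally show ?thesis by simp
qed

subsection \<open>Three-cycles\<close>

definition cyc3 :: "'a \<Rightarrow> 'a \<Rightarrow> 'a \<Rightarrow> 'a \<Rightarrow> 'a"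
  where "cyc3 a b c = id(a := b, b := c, c := a)"

text \<open>Expresses that \<open>X\<close> contains the alternating group on \<open>O'\<close>. The
  formulation by 3-cycles avoids signs of permutations altogether.\<close>

definition alt3 :: "'a set \<Rightarrow> ('a \<Rightarrow> 'a) set \<Rightarrow> bool"
  where "alt3 O' X \<longleftrightarrow> (\<forall>a\<in>O'. \<forall>b\<in>O'. \<forall>c\<in>O'. a \<noteq> b \<longrightarrow> b \<noteq> c \<longrightarrow> a \<noteq> c \<longrightarrow> cyc3 a b c \<in> X)"

lemma alt3D: "alt3 O' X \<Longrightarrow> a \<in> O' \<Longrightarrow> b \<in> O' \<Longrightarrow> c \<in> O' \<Longrightarrow> a \<noteq> b \<Longrightarrow> b \<noteq> c \<Longrightarrow> a \<noteq> c \<Longrightarrow> cyc3 a b c \<in> X"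
  unfolding alt3_def by auto

lemma cyc3_apply:
  "a \<noteq> b \<Longrightarrow> a \<noteq> c \<Longrightarrow> cyc3 a b c a = b"
  "b \<noteq> c \<Longrightarrow> cyc3 a b c b = c"
  "cyc3 a b c c = a"
  "x \<noteq> a \<Longrightarrow> x \<noteq> b \<Longrightarrow> x \<noteq> c \<Longrightarrow> cyc3 a b c x = x"
  unfolding cyc3_def by auto

lemma cyc3_rotate: "a \<noteq> b \<Longrightarrow> b \<noteq> c \<Longrightarrow> a \<noteq> c \<Longrightarrow> cyc3 a b c = cyc3 b c a"
  unfolding cyc3_def by (auto simp: fun_eq_iff)

lemma cyc3_o_inverse: "a \<noteq> b \<Longrightarrow> b \<noteq> c \<Longrightarrow> a \<noteq> c \<Longrightarrow> cyc3 a b c \<circ> cyc3 a c b = id"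
  unfolding cyc3_def by (auto simp: fun_eq_iff)

lemma bij_cyc3: "a \<noteq> b \<Longrightarrow> b \<noteq> c \<Longrightarrow> a \<noteq> c \<Longrightarrow> bij (cyc3 a b c)"
  by (metis cyc3_o_inverse o_bij)

lemma inv_cyc3: "a \<noteq> b \<Longrightarrow> b \<noteq> c \<Longrightarrow> a \<noteq> c \<Longrightarrow> inv' (cyc3 a b c) = cyc3 a c b"
  by (metis cyc3_o_inverse inv_unique_comp)

lemma mov_cyc3: "a \<noteq> b \<Longrightarrow> b \<noteq> c \<Longrightarrow> a \<noteq> c \<Longrightarrow> mov (cyc3 a b c) = {a, b, c}"
  unfolding mov_def cyc3_def by auto

lemma conj_cyc3:
  assumes "bij g"
  shows "g \<circ> cyc3 a b c \<circ> inv' g = cyc3 (g a) (g b) (g c)"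
proof
  fix x
  have "inv' g x = y \<longleftrightarrow> x = g y" for y
    using assms by (metis bij_inv_eq_iff)
  then show "(g \<circ> cyc3 a b c \<circ> inv' g) x = cyc3 (g a) (g b) (g c) x"
    unfolding cyc3_def using assms by (auto simp: bij_is_surj surj_f_inv_f)
qed

text \<open>The extreme case of \<open>mov_comm\<close>: with a single common point the support
  shrinks to three points. This is the source of all 3-cycles that are constructed from elements of
  larger support.\<close>

lemma comm_cyc3:
  assumes "bij g" "bij h" "mov g \<inter> mov h = {x}"
  shows "comm g h = cyc3 x (g x) (h x)"
proof
  fix y
  have gi: "g (inv' g y) = y" "h (inv' h y) = y" "inv' g (g y) = y" "inv' h (h y) = y" for y
    using assms by (simp_all add: bij_is_surj surj_f_inv_f bij_is_inj)
  have mg: "g (g z) \<noteq> g z \<longleftrightarrow> g z \<noteq> z" "g (inv' g z) \<noteq> inv' g z \<longleftrightarrow> g z \<noteq> z" for z by (metis gi(3), metis gi(1) gi(3))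
  have mh: "h (h z) \<noteq> h z \<longleftrightarrow> h z \<noteq> z" "h (inv' h z) \<noteq> inv' h z \<longleftrightarrow> h z \<noteq> z" for z by (metis gi(4), metis gi(2) gi(4))
  have x: "g x \<noteq> x" "h x \<noteq> x" "\<And>z. g z \<noteq> z \<Longrightarrow> h z \<noteq> z \<Longrightarrow> z = x"
    using assms(3) unfolding mov_def by auto
  have ne: "g x \<noteq> h x" using x mg(1)[of x] mh(1)[of x] by metis
  consider "y = x" | "y = g x" | "y = h x" | "y \<noteq> x" "y \<noteq> g x" "y \<noteq> h x" by blast
  then show "comm g h y = cyc3 x (g x) (h x) y"
  proof cases
    case 1
    have "inv' h x \<noteq> x" using x(2) gi(2) by metis
    then have "g (inv' h x) = inv' h x" using x(2,3) mh(2)[of x] by metis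
    then have "inv' g (inv' h x) = inv' h x" by (metis gi(3))
    then have "comm g h x = g x" unfolding comm_def o_apply by (simp add: gi(2))
    then show ?thesis using 1 by (simp add: cyc3_def x(1)[symmetric] x(2)[symmetric])
  next
    case 2
    have "h (g x) = g x" using x mg(1)[of x] by metis
    then have a: "inv' h (g x) = g x" by (metis gi(4))
    have "g (h x) = h x" using x mh(1)[of x] by metis
    then have "inv' g (h x) = h x \<and> inv' g (g x) = x" by (metis gi(3))
    then have "comm g h (g x) = h x" unfolding comm_def o_apply a using \<open>g (h x) = h x\<close> by simp
    then show ?thesis using 2 x(1) ne by (simp add: cyc3_def)
  next
    case 3
    have "inv' g x \<noteq> x" using x(1) gi(1) by metis
    then have "h (inv' g x) = inv' g x" using x(1,3) mg(2)[of x] by metis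
    then have "comm g h (h x) = x" unfolding comm_def o_apply gi(4) by (simp add: gi(1))
    then show ?thesis using 3 x(2) ne by (simp add: cyc3_def)
  next
    case 4
    have "y \<notin> mov (comm g h)" using mov_comm[OF assms(1,2)] 4 assms(3) by auto
    then show ?thesis using 4 by (auto simp: mov_def cyc3_def)
  qed
qed

lemma alt3_triple:
  assumes X: "pgroup \<Omega> X" and c: "cyc3 a b c \<in> X" and d: "a \<noteq> b" "b \<noteq> c" "a \<noteq> c"
  shows "alt3 {a, b, c} X"
proof -
  have "cyc3 a c b \<in> X" using pgroup_inv[OF X c] inv_cyc3[OF d] by simp
  then show ?thesis unfolding alt3_def using c d
    by (smt (verit, ccfv_threshold) cyc3_rotate insertE singletonD)
qed

definition transitive_on :: "'a set \<Rightarrow> ('a \<Rightarrow> 'a) set \<Rightarrow> bool"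
  where "transitive_on \<Omega> G \<longleftrightarrow> (\<forall>x\<in>\<Omega>. \<forall>y\<in>\<Omega>. \<exists>g\<in>G. g x = y)"

definition primitive_on :: "'a set \<Rightarrow> ('a \<Rightarrow> 'a) set \<Rightarrow> bool"
  where "primitive_on \<Omega> G \<longleftrightarrow> transitive_on \<Omega> G \<and>
    (\<forall>B\<subseteq>\<Omega>. 2 \<le> card B \<longrightarrow> (\<forall>g\<in>G. g ` B = B \<or> g ` B \<inter> B = {}) \<longrightarrow> B = \<Omega>)"

text \<open>\<open>R a b\<close> records the presence of the 3-cycle \<open>(a b y)\<close>.
  Inversion makes it symmetric, and conjugation by the 3-cycle \<open>(a b c)\<close> of
  \<open>D\<close> turns \<open>R a b\<close> into \<open>R b c\<close>; so a single pair spreads to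
  all pairs.\<close>

lemma alt3_insert:
  assumes X: "pgroup \<Omega> X" and D: "alt3 D X" and pq: "p \<in> D" "q \<in> D" "p \<noteq> q" and y: "y \<notin> D"
    and c: "cyc3 p q y \<in> X"
  shows "alt3 (insert y D) X"
proof -
  define R where "R a b \<longleftrightarrow> cyc3 a b y \<in> X" for a b
  have R1: "R b a" if "R a b" "a \<in> D" "b \<in> D" "a \<noteq> b" for a b
  proof -
    have "a \<noteq> y" "b \<noteq> y" using that y by auto
    then have "inv' (cyc3 a b y) = cyc3 b a y"
      using inv_cyc3[of a b y] cyc3_rotate[of b a y] cyc3_rotate[of a y b] that by metis
    then show ?thesis using that pgroup_inv[OF X] unfolding R_def by metis
  qed
  have R2: "R b c" if "R a b" "a \<in> D" "b \<in> D" "a \<noteq> b" "c \<in> D" "c \<noteq> a" "c \<noteq> b" for a b c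
  proof -
    have n: "a \<noteq> y" "b \<noteq> y" "c \<noteq> y" using that y by auto
    have h: "cyc3 a b c \<in> X" using alt3D[OF D] that by metis
    have "cyc3 a b c \<circ> cyc3 a b y \<circ> inv' (cyc3 a b c) \<in> X"
      using pgroup_conj[OF X h] that unfolding R_def by auto
    then show ?thesis unfolding R_def conj_cyc3[OF pgroup_bij[OF X h]]
      using that n by (simp add: cyc3_def)
  qed
  have "R p q" using c by (simp add: R_def)
  have all: "R a b" if "a \<in> D" "b \<in> D" "a \<noteq> b" for a b
  proof -
    have pa: "R p b'" if "b' \<in> D" "b' \<noteq> p" for b'
      using R1 R2 \<open>R p q\<close> pq that by metis
    have "R a p" if "a \<noteq> p" using pa R1 that \<open>a \<in> D\<close> pq by metis
    then show ?thesis
      using pa R1 R2 that pq by metis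
  qed
  show ?thesis unfolding alt3_def
  proof (intro ballI impI)
    fix a b c assume abc: "a \<in> insert y D" "b \<in> insert y D" "c \<in> insert y D" "a \<noteq> b" "b \<noteq> c" "a \<noteq> c"
    consider "a = y" | "b = y" | "c = y" | "a \<noteq> y" "b \<noteq> y" "c \<noteq> y" by blast
    then show "cyc3 a b c \<in> X"
    proof cases
      case 1
      then have "cyc3 b c a \<in> X" using all abc unfolding R_def by auto
      then show ?thesis using cyc3_rotate abc by metis
    next
      case 2
      then have "cyc3 c a b \<in> X" using all abc unfolding R_def by auto
      then show ?thesis using cyc3_rotate abc by metis
    next
      case 3
      then show ?thesis using all abc unfolding R_def by auto
    next
      case 4
      then show ?thesis using alt3D[OF D] abc by auto
    qed
  qed
qed

lemma ex_third: 
  assumes "finite O'" "3 \<le> card O'" shows "\<exists>z\<in>O'. z \<noteq> x \<and> z \<noteq> y"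
proof (rule ccontr)
  assume "\<not> ?thesis"
  then have "O' \<subseteq> {x, y}" by auto
  then have "card O' \<le> card {x, y}" by (simp add: card_mono)
  also have "\<dots> \<le> 2" by (simp add: card_insert_if)
  finally show False using assms by simp
qed

text \<open>If only \<open>u\<close> lies in \<open>D\<close>, conjugating \<open>(p q u)\<close> by
  \<open>(u v w)\<close> gives \<open>(p q v)\<close>, which brings in \<open>v\<close>; afterwards
  \<open>(u v w)\<close> itself brings in \<open>w\<close>.\<close>

lemma alt3_extend:
  assumes X: "pgroup \<Omega> X" and D: "alt3 D X" "3 \<le> card D"
    and c: "cyc3 u v w \<in> X" "u \<noteq> v" "v \<noteq> w" "u \<noteq> w" "u \<in> D"
  shows "alt3 (insert v (insert w D)) X"
proof -
  have fin: "finite D" using D(2) card.infinite by fastforce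
  have one: "alt3 (insert w' E) X" if "alt3 E X" "u' \<in> E" "v' \<in> E" "cyc3 u' v' w' \<in> X" "u' \<noteq> v'" for E u' v' w'
  proof (cases "w' \<in> E")
    case True then show ?thesis using that by (simp add: insert_absorb)
  next
    case False then show ?thesis using alt3_insert[OF X that(1,2,3) _ False] that by auto
  qed
  consider "v \<in> D" | "w \<in> D" | "v \<notin> D" "w \<notin> D" by blast
  then show ?thesis
  proof cases
    case 1
    then show ?thesis using one[OF D(1) c(5) 1 c(1,2)] by (simp add: insert_absorb)
  next
    case 2
    have "cyc3 w u v \<in> X" using c cyc3_rotate by metis
    then show ?thesis using one[OF D(1) 2 c(5)] 2 c(4) by (simp add: insert_absorb)
  next
    case 3
    obtain p where p: "p \<in> D - {u}" using ex_third[OF fin D(2), of u u] by auto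
    obtain q where q: "q \<in> D - {u} - {p}" using ex_third[OF fin D(2), of u p] by auto
    have "cyc3 p q u \<in> X" using alt3D[OF D(1)] p q c by auto
    then have "cyc3 u v w \<circ> cyc3 p q u \<circ> inv' (cyc3 u v w) \<in> X" using pgroup_conj[OF X c(1)] by auto
    then have "cyc3 p q v \<in> X" unfolding conj_cyc3[OF pgroup_bij[OF X c(1)]]
      using p q 3 c by (auto simp: cyc3_def split: if_splits)
    then have 1: "alt3 (insert v D) X" using one[OF D(1)] p q by auto
    have "alt3 (insert w (insert v D)) X" by (rule one[OF 1 _ _ c(1)]) (use c in auto)
    then show ?thesis by (simp add: insert_commute)
  qed
qed

lemma maximal_set:
  assumes "finite C" "P A" "A \<subseteq> C"
  obtains D where "A \<subseteq> D" "D \<subseteq> C" "P D" "\<And>E. D \<subseteq> E \<Longrightarrow> E \<subseteq> C \<Longrightarrow> P E \<Longrightarrow> E = D"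
proof -
  let ?F = "{D. A \<subseteq> D \<and> D \<subseteq> C \<and> P D}"
  have "finite ?F" using assms(1) by (auto intro: finite_subset[of _ "Pow C"])
  moreover have "?F \<noteq> {}" using assms by auto
  ultimately have "\<exists>D\<in>?F. \<forall>E\<in>?F. D \<subseteq> E \<longrightarrow> D = E"
    by (rule finite_has_maximal)
  then obtain D where D: "D \<in> ?F" "\<forall>E\<in>?F. D \<subseteq> E \<longrightarrow> D = E" ..
  show ?thesis
  proof (rule that[of D])
    fix E assume "D \<subseteq> E" "E \<subseteq> C" "P E"
    then have "E \<in> ?F" using D(1) by auto
    then have "D = E" using D(2) \<open>D \<subseteq> E\<close> by blast
    then show "E = D" ..
  qed (use D(1) in auto)
qed

text \<open>Jordan's theorem for 3-cycles. A maximal set \<open>D\<close> all of whose 3-cycles lie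
  in \<open>G\<close> is a block: a translate that meets \<open>D\<close> without being equal to it
  has 3-cycles in \<open>G\<close> as well, and one of them would enlarge \<open>D\<close>.
  Primitivity leaves only the whole set.\<close>

lemma primitive_cyc3_alt3:
  assumes G: "pgroup \<Omega> G" and prim: "primitive_on \<Omega> G"
    and c: "cyc3 a b c \<in> G" "a \<noteq> b" "b \<noteq> c" "a \<noteq> c"
  shows "alt3 \<Omega> G"
proof -
  have abc: "{a, b, c} \<subseteq> \<Omega>"
    using mov_subset[OF G c(1)] mov_cyc3[OF c(2-4)] by auto
  obtain D where D: "{a, b, c} \<subseteq> D" "D \<subseteq> \<Omega>" "alt3 D G"
      "\<And>E. D \<subseteq> E \<Longrightarrow> E \<subseteq> \<Omega> \<Longrightarrow> alt3 E G \<Longrightarrow> E = D"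
    by (rule maximal_set[where P = "\<lambda>D. alt3 D G", OF pgroup_finite[OF G] alt3_triple[OF G c] abc]) blast
  have finD: "finite D" using D(2) pgroup_finite[OF G] finite_subset by blast
  have card: "3 \<le> card D"
    using card_mono[OF finD D(1)] c by auto
  have "g ` D = D" if g: "g \<in> G" and x: "x \<in> g ` D" "x \<in> D" for g x
  proof -
    have gD: "alt3 (g ` D) G"
      unfolding alt3_def
    proof (clarify)
      fix p q r assume h: "p \<in> D" "q \<in> D" "r \<in> D" "g p \<noteq> g q" "g q \<noteq> g r" "g p \<noteq> g r"
      then have "cyc3 p q r \<in> G" using alt3D[OF D(3)] by metis
      then show "cyc3 (g p) (g q) (g r) \<in> G"
        using pgroup_conj[OF G g] conj_cyc3[OF pgroup_bij[OF G g]] by metis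
    qed
    have cg: "card (g ` D) = card D" by (rule card_image) (use pgroup_inj[OF G g] in \<open>auto simp: inj_on_def\<close>)
    have "g ` D \<subseteq> D"
    proof
      fix y assume y: "y \<in> g ` D"
      show "y \<in> D"
      proof (rule ccontr)
        assume nD: "y \<notin> D"
        obtain z where z: "z \<in> g ` D" "z \<noteq> x" "z \<noteq> y"
          using ex_third[of "g ` D" x y] card cg finD by auto
        have "cyc3 x y z \<in> G" using alt3D[OF gD x(1) y z(1)] x nD z by metis
        then have "alt3 (insert y (insert z D)) G" using alt3_extend[OF G D(3) card] x nD z by metis
        moreover have "g ` D \<subseteq> \<Omega>" using D(2) pgroup_in[OF G g] by auto
        ultimately have "insert y (insert z D) = D" using D(2,4) y z by (meson insert_subset subset_insertI2 subset_refl in_mono)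
        then show False using nD by auto
      qed
    qed
    then show ?thesis using cg finD by (simp add: card_subset_eq)
  qed
  then have "\<forall>g\<in>G. g ` D = D \<or> g ` D \<inter> D = {}" by blast
  then have "D = \<Omega>" using prim card D(2) unfolding primitive_on_def by auto
  then show ?thesis using D(3) by simp
qed

lemma permutes_remove_fixed:
  assumes "p permutes S" "p a = a" shows "p permutes (S - {a})"
  using assms unfolding permutes_def by (metis Diff_iff singletonD)

lemma alt3_transitive:
  assumes X: "pgroup O' X" and alt: "alt3 O' X" and c: "3 \<le> card O'" and a: "a \<in> O'"
  shows "orb X a = O'"
proof
  show "orb X a \<subseteq> O'" by (rule orb_subset[OF X a])
  show "O' \<subseteq> orb X a"
  proof
    fix y assume y: "y \<in> O'"
    show "y \<in> orb X a"
    proof (cases "y = a")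
      case True then show ?thesis using orb_self[OF X] by auto
    next
      case False
      obtain z where z: "z \<in> O'" "z \<noteq> a" "z \<noteq> y" using ex_third[OF pgroup_finite[OF X] c, of a y] by auto
      have "cyc3 a y z \<in> X" using alt3D[OF alt a y z(1)] False z by metis
      moreover have "cyc3 a y z a = y" using False z by (simp add: cyc3_def)
      ultimately show ?thesis unfolding orb_def by (metis image_eqI)
    qed
  qed
qed

text \<open>Stabiliser chain: a point stabiliser inherits all 3-cycles on the remaining points, so
  every step contributes a full orbit until two points are left, where the factor 2 is lost.\<close>

lemma alt3_card:
  assumes "pgroup O' X" "alt3 O' X"
  shows "fact (card O') \<le> 2 * card X"
  using assms
proof (induction "card O'" arbitrary: O' X rule: less_induct)
  case less
  have fin: "finite O'" using less.prems pgroup_finite by auto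
  have pos: "card X > 0" using less.prems pgroup_card_pos by auto
  show ?case
  proof (cases "3 \<le> card O'")
    case False
    then have "card O' = 0 \<or> card O' = 1 \<or> card O' = 2" by auto
    then have "fact (card O') \<le> (2::nat)" by auto
    then show ?thesis using pos by linarith
  next
    case True
    then obtain a where a: "a \<in> O'" by fastforce
    have st: "pgroup (O' - {a}) (stab X a)"
      using pgroup_stab[OF less.prems(1), of a] permutes_remove_fixed[of _ O' a] fin
      unfolding pgroup_def by (simp add: stab_def)
    have alt: "alt3 (O' - {a}) (stab X a)"
      using less.prems(2) unfolding alt3_def stab_def by (auto simp: cyc3_def)
    have orb: "orb X a = O'" by (rule alt3_transitive[OF less.prems True a])
    have c: "card (O' - {a}) < card O'" using a fin by (simp only: card_Diff1_less)
    have "fact (card O') = card O' * fact (card (O' - {a}))"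
      using a fin True by (metis card.remove fact_Suc of_nat_id card_Suc_Diff1)
    also have "\<dots> \<le> card O' * (2 * card (stab X a))"
      using less.hyps[OF c st alt] by simp
    also have "\<dots> = 2 * card X" using orbit_stabilizer[OF less.prems(1), of a] orb by simp
    finally show ?thesis .
  qed
qed

text \<open>A counting substitute for the fact that squares are even: if \<open>f \<circ> f\<close>
  were missing, then \<open>X\<close>, its coset by \<open>f\<close> and the element
  \<open>f \<circ> f\<close> would together exceed \<open>fact (card O')\<close>.\<close>

lemma alt3_square:
  assumes X: "pgroup O' X" and alt: "alt3 O' X" and f: "f permutes O'"
  shows "f \<circ> f \<in> X"
proof (rule ccontr)
  assume n: "f \<circ> f \<notin> X"
  have fin: "finite O'" by (rule pgroup_finite[OF X])
  let ?P = "{p. p permutes O'}"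
  let ?Y = "(\<lambda>x. f \<circ> x) ` X"
  have fX: "f \<notin> X" using n pgroup_comp[OF X] by auto
  have inj: "inj_on (\<lambda>x. f \<circ> x) X"
    by (rule inj_onI) (metis permutes_inv_o(2)[OF f] comp_assoc id_comp)
  have finX: "finite X" by (rule pgroup_finite_group[OF X])
  have disj: "X \<inter> ?Y = {}"
  proof -
    have False if "x \<in> X" "f \<circ> x \<in> X" for x
    proof -
      have "(f \<circ> x) \<circ> inv' x \<in> X" using pgroup_comp[OF X that(2) pgroup_inv[OF X that(1)]] .
      then show False using fX pgroup_invo2[OF X that(1)] by (simp add: comp_assoc)
    qed
    then show ?thesis by auto
  qed
  have "f \<circ> f \<notin> ?Y"
  proof
    assume "f \<circ> f \<in> ?Y"
    then obtain x where "x \<in> X" "f \<circ> f = f \<circ> x" by auto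
    then have "f = x" by (metis permutes_inv_o(2)[OF f] comp_assoc id_comp)
    then show False using fX \<open>x \<in> X\<close> by auto
  qed
  moreover have sub: "insert (f \<circ> f) (X \<union> ?Y) \<subseteq> ?P"
    using pgroup_permutes[OF X] f permutes_compose by auto
  ultimately have "card X + card ?Y + 1 \<le> card ?P"
    using n disj finX card_mono[OF finite_permutations[OF fin] sub] by (simp add: card_Un_disjoint)
  also have "card ?P = fact (card O')" using fin by (simp add: card_permutations)
  also have "\<dots> \<le> 2 * card X" by (rule alt3_card[OF X alt])
  finally show False using card_image[OF inj] by simp
qed

lemma cyc3_commutator:
  assumes "distinct [a, b, c, d, e]"
  shows "comm (cyc3 a b d) (cyc3 a c e) = cyc3 a b c"
proof -
  have "mov (cyc3 a b d) \<inter> mov (cyc3 a c e) = {a}" using assms by (auto simp: mov_cyc3)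
  then show ?thesis
    using comm_cyc3[of "cyc3 a b d" "cyc3 a c e" a] assms by (simp add: bij_cyc3 cyc3_apply)
qed

lemma ex_not_in:
  assumes "finite C" "card (set xs) < card C" shows "\<exists>z\<in>C. z \<notin> set xs"
  using assms by (meson card_mono leD subsetI List.finite_set)

lemma ex_not_in_list:
  assumes "finite C" "length xs < card C" shows "\<exists>z\<in>C. z \<notin> set xs"
  by (rule ex_not_in[OF assms(1)]) (use assms card_length[of xs] in linarith)

text \<open>A form of the simplicity of alternating groups. The commutator of an element of
  \<open>Y\<close> with a 3-cycle moves at most five points; with two fixed points to spare, a
  second commutator is itself a 3-cycle. This is what degree 7 is for.\<close>

lemma alt3_normal:
  assumes X: "pgroup O' X" and alt: "alt3 O' X" and Y: "pgroup O' Y" and nor: "normal_in Y X"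
    and card: "7 \<le> card O'" and y: "y \<in> Y" "y \<noteq> id"
  shows "alt3 O' Y"
proof -
  have fin: "finite O'" by (rule pgroup_finite[OF X])
  have norm: "x \<circ> z \<circ> inv' x \<in> Y" if "x \<in> X" "z \<in> Y" for x z
    using nor that unfolding normal_in_def by auto
  have cY: "comm z x \<in> Y" if "x \<in> X" "z \<in> Y" for x z
    using pgroup_comp[OF Y that(2) norm[OF that(1) pgroup_inv[OF Y that(2)]]]
    by (simp add: comm_def comp_assoc)
  obtain a where a: "y a \<noteq> a" using y(2) by (auto simp: fun_eq_iff)
  define b where "b = y a"
  have aO: "a \<in> O'" "b \<in> O'" using a pgroup_out[OF Y y(1)] pgroup_in[OF Y y(1)] b_def by metis+
  obtain c where c: "c \<in> O'" "c \<notin> set [a, b, y b]"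
    using ex_not_in_list[OF fin, of "[a, b, y b]"] card by auto
  have t: "cyc3 a b c \<in> X" using alt3D[OF alt aO c(1)] a c b_def by auto
  define z where "z = comm y (cyc3 a b c)"
  have zY: "z \<in> Y" unfolding z_def by (rule cY[OF t y(1)])
  have d: "a \<noteq> b" "b \<noteq> c" "a \<noteq> c" using a b_def c by auto
  have bij: "bij y" "bij (cyc3 a b c)" using pgroup_bij[OF Y y(1)] bij_cyc3[OF d] by auto
  have z_eq: "z = cyc3 b (y b) (y c) \<circ> cyc3 a c b"
    unfolding z_def comm_def using conj_cyc3[OF bij(1), of a b c] inv_cyc3[OF d] b_def by simp
  have "z \<noteq> id"
  proof
    assume "z = id"
    then have "z a = a" by simp
    then have "cyc3 b (y b) (y c) c = a" unfolding z_eq using d by (simp add: cyc3_def)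
    moreover have "c \<noteq> y b" "c \<noteq> b" using c by auto
    ultimately have 1: "c = y c" using d unfolding cyc3_def by (auto split: if_splits)
    have "z b = b" using \<open>z = id\<close> by simp
    then have "cyc3 b (y b) (y c) a = b" unfolding z_eq using d by (simp add: cyc3_def)
    then show False using 1 d unfolding cyc3_def by (auto split: if_splits)
  qed
  then obtain x where x: "z x \<noteq> x" by (auto simp: fun_eq_iff)
  have mz: "mov z \<subseteq> set [a, b, c, y b, y c]"
  proof
    fix x assume "x \<in> mov z"
    then have "z x \<noteq> x" by (simp add: mov_def)
    then show "x \<in> set [a, b, c, y b, y c]" unfolding z_eq cyc3_def by (auto split: if_splits)
  qed
  obtain e where e: "e \<in> O'" "e \<notin> set [a, b, c, y b, y c]"
    using ex_not_in_list[OF fin, of "[a, b, c, y b, y c]"] card by auto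
  obtain f where f: "f \<in> O'" "f \<notin> set [e, a, b, c, y b, y c]"
    using ex_not_in_list[OF fin, of "[e, a, b, c, y b, y c]"] card by auto
  have ze: "z e = e" "z f = f" using e f mz unfolding mov_def by auto
  have xO: "x \<in> O'" using pgroup_out[OF Y zY] x by metis
  have de: "x \<noteq> e" "e \<noteq> f" "x \<noteq> f" using x ze f by auto
  have h: "cyc3 x e f \<in> X" using alt3D[OF alt xO e(1) f(1)] de by auto
  have int: "mov z \<inter> mov (cyc3 x e f) = {x}"
    using x ze de mov_cyc3[OF de] unfolding mov_def by auto
  have "comm z (cyc3 x e f) = cyc3 x (z x) e"
    using comm_cyc3[OF pgroup_bij[OF Y zY] bij_cyc3[OF de] int] de by (simp add: cyc3_apply)
  then have base: "cyc3 x (z x) e \<in> Y" using cY[OF h zY] by simp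
  have dd: "x \<noteq> z x" "z x \<noteq> e" "x \<noteq> e" using x de ze pgroup_inj[OF Y zY] by metis+
  have step: "cyc3 p q s \<in> Y"
    if "cyc3 p q r \<in> Y" "p \<in> O'" "q \<in> O'" "r \<in> O'" "s \<in> O'" "distinct [p, q, r, s]" for p q r s
  proof -
    obtain t where t: "t \<in> O'" "t \<notin> set [p, q, r, s]"
      using ex_not_in_list[OF fin, of "[p, q, r, s]"] card by auto
    have "cyc3 r s t \<in> X" using alt3D[OF alt] that t by auto
    then have "cyc3 r s t \<circ> cyc3 p q r \<circ> inv' (cyc3 r s t) \<in> Y" using norm that by auto
    moreover have "bij (cyc3 r s t)" using that t by (intro bij_cyc3) auto
    ultimately show ?thesis using conj_cyc3[of "cyc3 r s t" p q r] that t by (simp add: cyc3_def split: if_splits)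
  qed
  have sub: "{x, z x, e} \<subseteq> O'" using xO e pgroup_in[OF Y zY] by auto
  obtain D where D: "{x, z x, e} \<subseteq> D" "D \<subseteq> O'" "alt3 D Y"
      "\<And>E. D \<subseteq> E \<Longrightarrow> E \<subseteq> O' \<Longrightarrow> alt3 E Y \<Longrightarrow> E = D"
    by (rule maximal_set[where P = "\<lambda>D. alt3 D Y", OF fin alt3_triple[OF Y base dd] sub]) blast
  have "O' \<subseteq> D"
  proof
    fix s assume s: "s \<in> O'"
    show "s \<in> D"
    proof (rule ccontr)
      assume ns: "s \<notin> D"
      have "cyc3 x (z x) s \<in> Y" by (rule step[OF base]) (use sub s ns D(1) dd in auto)
      then have "alt3 (insert s D) Y" using alt3_insert[OF Y D(3) _ _ _ ns, of x "z x"] D(1) dd by auto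
      then have "insert s D = D" using D(2,4) s by (meson insert_subset subset_insertI)
      then show False using ns by auto
    qed
  qed
  then show ?thesis using D(2,3) by auto
qed

section \<open>Isomorphisms between groups that contain all 3-cycles\<close>

lemma cyc3_start:
  assumes "s \<in> {x, y, z}" "x \<noteq> y" "y \<noteq> z" "x \<noteq> z"
  obtains v w where "cyc3 x y z = cyc3 s v w" "s \<noteq> v" "v \<noteq> w" "s \<noteq> w"
proof -
  have "cyc3 x y z = cyc3 y z x" "cyc3 x y z = cyc3 z x y"
    using cyc3_rotate[of x y z] cyc3_rotate[of y z x] assms by auto
  then show ?thesis using that[of y z] that[of z x] that[of x y] assms by auto
qed

text \<open>A product of two 3-cycles has order 3 if they are disjoint, 5 if they share one point,
  and 1, 2 or 3 otherwise. So it never has an orbit of length 4, nor one of length 2 beside a longer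
  one; \<open>iso_cyc3\<close> exploits exactly this.\<close>

lemma cyc3_prod_order:
  assumes "x \<noteq> y" "y \<noteq> z" "x \<noteq> z" "u \<noteq> v" "v \<noteq> w" "u \<noteq> w"
  defines "W \<equiv> cyc3 x y z \<circ> cyc3 u v w"
  shows "W \<circ> W = id \<or> W \<circ> W \<circ> W = id \<or> W \<circ> W \<circ> W \<circ> W \<circ> W = id"
proof -
  have main: "W \<circ> W = id \<or> W \<circ> W \<circ> W = id \<or> W \<circ> W \<circ> W \<circ> W \<circ> W = id"
    if "W = cyc3 x y z \<circ> cyc3 x v w" "x \<noteq> y" "y \<noteq> z" "x \<noteq> z" "x \<noteq> v" "v \<noteq> w" "x \<noteq> w" for W and x y z v w :: 'a
  proof -
    consider "v = y" "w = z" | "v = z" "w = y" | "v = y" "w \<noteq> z" | "w = y" "v \<noteq> z" | "v = z" "w \<noteq> y" | "w = z" "v \<noteq> y"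
      | "v \<noteq> y" "v \<noteq> z" "w \<noteq> y" "w \<noteq> z" by blast
    then show ?thesis
    proof cases
      case 1
      have "W (W (W a)) = a" for a using that 1 by (simp add: cyc3_def)
      then show ?thesis by (simp add: fun_eq_iff)
    next
      case 2
      have "W (W a) = a" for a using that 2 by (simp add: cyc3_def)
      then show ?thesis by (simp add: fun_eq_iff)
    next
      case 3
      have "W (W a) = a" for a using that 3 by (simp add: cyc3_def)
      then show ?thesis by (simp add: fun_eq_iff)
    next
      case 4
      have "W (W (W a)) = a" for a using that 4 by (simp add: cyc3_def)
      then show ?thesis by (simp add: fun_eq_iff)
    next
      case 5
      have "W (W (W a)) = a" for a using that 5 by (simp add: cyc3_def)
      then show ?thesis by (simp add: fun_eq_iff)
    next
      case 6
      have "W (W a) = a" for a using that 6 by (simp add: cyc3_def)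
      then show ?thesis by (simp add: fun_eq_iff)
    next
      case 7
      have W: "W x = v" "W v = w" "W w = y" "W y = z" "W z = x"
          "\<And>a. a \<notin> {x, v, w, y, z} \<Longrightarrow> W a = a"
        using 7 that by (auto simp: cyc3_def)
      have "W (W (W (W (W a)))) = a" for a
      proof (cases "a \<in> {x, v, w, y, z}")
        case True then show ?thesis by (elim insertE) (simp_all add: W(1-5))
      next
        case False then show ?thesis by (simp only: W(6) not_False_eq_True)
      qed
      then show ?thesis by (simp add: fun_eq_iff)
    qed
  qed
  show ?thesis
  proof (cases "{x, y, z} \<inter> {u, v, w} = {}")
    case True
    then have "x \<noteq> u" "x \<noteq> v" "x \<noteq> w" "y \<noteq> u" "y \<noteq> v" "y \<noteq> w" "z \<noteq> u" "z \<noteq> v" "z \<noteq> w" by auto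
    note n = this this[symmetric] assms(1-6) assms(1-6)[symmetric]
    have "W (W (W a)) = a" for a
    proof -
      consider "a = x" | "a = y" | "a = z" | "a = u" | "a = v" | "a = w"
        | "a \<noteq> x" "a \<noteq> y" "a \<noteq> z" "a \<noteq> u" "a \<noteq> v" "a \<noteq> w" by blast
      then show ?thesis unfolding W_def by cases (simp_all add: cyc3_apply n)
    qed
    then show ?thesis by (simp add: fun_eq_iff)
  next
    case False
    then obtain s where s: "s \<in> {x, y, z}" "s \<in> {u, v, w}" by blast
    obtain y' z' where 1: "cyc3 x y z = cyc3 s y' z'" "s \<noteq> y'" "y' \<noteq> z'" "s \<noteq> z'"
      using cyc3_start[OF s(1) assms(1-3)] by blast
    obtain v' w' where 2: "cyc3 u v w = cyc3 s v' w'" "s \<noteq> v'" "v' \<noteq> w'" "s \<noteq> w'"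
      using cyc3_start[OF s(2) assms(4-6)] by blast
    show ?thesis by (rule main[of W s y' z' v' w']) (use 1 2 in \<open>auto simp: W_def\<close>)
  qed
qed

lemma hom_inv:
  assumes X: "pgroup C X" and X': "pgroup C' X'" and \<phi>: "\<phi> ` X = X'"
    and hom: "\<And>g h. g \<in> X \<Longrightarrow> h \<in> X \<Longrightarrow> \<phi> (g \<circ> h) = \<phi> g \<circ> \<phi> h"
  shows "\<phi> id = id" and "\<And>g. g \<in> X \<Longrightarrow> \<phi> (inv' g) = inv' (\<phi> g)"
proof -
  have i: "\<phi> id \<in> X'" using \<phi> pgroup_id[OF X] by auto
  have "\<phi> id \<circ> \<phi> id = \<phi> id" using hom[OF pgroup_id[OF X] pgroup_id[OF X]] by simp
  then show 1: "\<phi> id = id" using pgroup_invo1[OF X' i] by (metis comp_assoc id_comp)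
  fix g assume g: "g \<in> X"
  then have g': "\<phi> g \<in> X'" using \<phi> by auto
  have "\<phi> g \<circ> \<phi> (inv' g) = id"
    using hom[OF g pgroup_inv[OF X g]] pgroup_invo2[OF X g] 1 by simp
  then show "\<phi> (inv' g) = inv' (\<phi> g)" using pgroup_invo1[OF X' g'] by (metis comp_assoc id_comp comp_id)
qed

text \<open>The image \<open>s\<close> of a 3-cycle has order 3; the task is to exclude a second
  cycle. For every \<open>r\<close> the commutator \<open>W\<close> is a product of two 3-cycles,
  but for a suitable involution \<open>\<rho>\<close> its image \<open>V\<close> has orbits that no
  such product can have. Two 3-cycles and the spare point \<open>e\<close> make up the degree
  7.\<close>

lemma iso_cyc3:
  assumes X: "pgroup C X" and X': "pgroup C' X'" and \<phi>: "bij_betw \<phi> X X'"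
    and hom: "\<And>g h. g \<in> X \<Longrightarrow> h \<in> X \<Longrightarrow> \<phi> (g \<circ> h) = \<phi> g \<circ> \<phi> h"
    and alt': "alt3 C' X'" and card: "7 \<le> card C'"
    and u: "cyc3 x y z \<in> X" and d: "x \<noteq> y" "y \<noteq> z" "x \<noteq> z"
  obtains p q r where "\<phi> (cyc3 x y z) = cyc3 p q r" "p \<noteq> q" "q \<noteq> r" "p \<noteq> r" "{p, q, r} \<subseteq> C'"
proof -
  have im: "\<phi> ` X = X'" using \<phi> by (simp add: bij_betw_def)
  have fin: "finite C'" by (rule pgroup_finite[OF X'])
  note hid = hom_inv[OF X X' im hom]
  define t where "t = cyc3 x y z"
  have tX: "t \<in> X" using u t_def by simp
  define s where "s = \<phi> t"
  have sX: "s \<in> X'" using tX im s_def by auto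
  have bs: "bij s" by (rule pgroup_bij[OF X' sX])
  have inj: "\<And>a b. s a = s b \<longleftrightarrow> a = b" by (rule pgroup_inj[OF X' sX])
  have t3: "t \<circ> t \<circ> t = id" unfolding t_def using d by (auto simp: fun_eq_iff cyc3_def)
  have "\<phi> (t \<circ> t \<circ> t) = s \<circ> s \<circ> s"
    unfolding s_def hom[OF pgroup_comp[OF X tX tX] tX] hom[OF tX tX] ..
  then have "s \<circ> s \<circ> s = id" by (simp only: t3 hid(1))
  from fun_cong[OF this] have s3: "s (s (s a)) = a" for a by simp
  have invs: "inv' s a = s (s a)" for a
    using s3[of a] pgroup_inv1[OF X' sX, of "s (s a)"] by simp
  have "t \<noteq> id" unfolding t_def using d by (metis cyc3_apply(1) id_apply)
  then have "s \<noteq> id" using \<phi> hid(1) tX pgroup_id[OF X] unfolding s_def bij_betw_def inj_on_def by metis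
  then obtain p1 where p1: "s p1 \<noteq> p1" by (auto simp: fun_eq_iff)
  define p2 where "p2 = s p1" define p3 where "p3 = s p2"
  have tri: "a \<noteq> s a \<and> s a \<noteq> s (s a) \<and> a \<noteq> s (s a)" if "s a \<noteq> a" for a
  proof (intro conjI)
    show "a \<noteq> s a" using that by simp
    show "s a \<noteq> s (s a)" using that inj[of a "s a"] by simp
    show "a \<noteq> s (s a)" using that s3[of a] by fastforce
  qed
  have p: "p1 \<noteq> p2" "p2 \<noteq> p3" "p1 \<noteq> p3" "s p3 = p1"
    using tri[OF p1] s3 unfolding p2_def p3_def by auto
  have sp: "s p1 = p2" "s p2 = p3" by (simp_all add: p2_def p3_def)
  have mC: "\<And>a. s a \<noteq> a \<Longrightarrow> a \<in> C'" using pgroup_out[OF X' sX] by metis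
  have pC: "p1 \<in> C'" "p2 \<in> C'" "p3 \<in> C'" using mC[of p1] mC[of p2] mC[of p3] p sp by auto
  show ?thesis
  proof (cases "\<forall>q. q \<notin> {p1, p2, p3} \<longrightarrow> s q = q")
    case True
    have "s = cyc3 p1 p2 p3"
    proof
      fix a show "s a = cyc3 p1 p2 p3 a"
        using True p sp by (cases "a \<in> {p1, p2, p3}") (auto simp: cyc3_def)
    qed
    then show ?thesis using that p pC unfolding s_def t_def by auto
  next
    case False
    then obtain q1 where q1: "q1 \<notin> {p1, p2, p3}" "s q1 \<noteq> q1" by auto
    define q2 where "q2 = s q1" define q3 where "q3 = s q2"
    have q: "q1 \<noteq> q2" "q2 \<noteq> q3" "q1 \<noteq> q3" "s q3 = q1"
      using tri[OF q1(2)] s3 unfolding q2_def q3_def by auto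
    have sq: "s q1 = q2" "s q2 = q3" by (simp_all add: q2_def q3_def)
    have qp: "q2 \<notin> {p1, p2, p3}" "q3 \<notin> {p1, p2, p3}"
    proof -
      have "s a \<in> {p1, p2, p3} \<longleftrightarrow> a \<in> {p1, p2, p3}" for a
        using p(4) inj[of a p1] inj[of a p2] inj[of a p3] sp by auto
      then show "q2 \<notin> {p1, p2, p3}" "q3 \<notin> {p1, p2, p3}" using q1(1) unfolding q2_def q3_def by blast+
    qed
    have qC: "q1 \<in> C'" using mC q1 by metis
    obtain e where e: "e \<in> C'" "e \<notin> set [p1, p2, p3, q1, q2, q3]"
      using ex_not_in_list[OF fin, of "[p1, p2, p3, q1, q2, q3]"] card by auto
    \<comment> \<open>The intended involution is the double transposition
      \<open>(p1 q1)(p2 e)\<close>. As the square of this 4-cycle it belongs to \<open>X'\<close> by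
      \<open>alt3_square\<close>.\<close>
    define c4 where "c4 = id(p1 := p2, p2 := q1, q1 := e, e := p1)"
    have dd: "distinct [p1, p2, p3, q1, q2, q3, e]" using p q qp q1 e by auto
    have "bij c4" unfolding c4_def using dd
      by (intro o_bij[of "id(p2 := p1, q1 := p2, e := q1, p1 := e)"]) (auto simp: fun_eq_iff)
    then have c4: "c4 permutes C'"
      unfolding permutes_def bij_iff c4_def using pC qC e by auto
    define \<rho> where "\<rho> = c4 \<circ> c4"
    have \<rho>X: "\<rho> \<in> X'" unfolding \<rho>_def by (rule alt3_square[OF X' alt' c4])
    have \<rho>: "\<rho> p1 = q1" "\<rho> q1 = p1" "\<rho> p2 = e" "\<rho> e = p2"
        "\<And>a. a \<notin> {p1, q1, p2, e} \<Longrightarrow> \<rho> a = a"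
      unfolding \<rho>_def c4_def using dd by auto
    have \<rho>f: "\<rho> p3 = p3" "\<rho> q2 = q2" "\<rho> q3 = q3" by (rule \<rho>(5); use dd in auto)+
    have "\<rho> (\<rho> a) = a" for a
    proof (cases "a \<in> {p1, q1, p2, e}")
      case True then show ?thesis by (elim insertE) (simp_all add: \<rho>(1-4))
    next
      case False then show ?thesis by (simp only: \<rho>(5) not_False_eq_True)
    qed
    then have i\<rho>: "inv' \<rho> a = \<rho> a" for a
      using pgroup_inv1[OF X' \<rho>X, of "\<rho> a"] by simp
    obtain r where r: "r \<in> X" "\<phi> r = \<rho>" using \<rho>X im by blast
    define W where "W = comm t r"
    have "W = t \<circ> (r \<circ> inv' t \<circ> inv' r)" by (simp add: W_def comm_def comp_assoc)
    also have "\<dots> = cyc3 x y z \<circ> cyc3 (r x) (r z) (r y)"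
      unfolding t_def inv_cyc3[OF d] conj_cyc3[OF pgroup_bij[OF X r(1)]] ..
    finally have W: "W = cyc3 x y z \<circ> cyc3 (r x) (r z) (r y)" .
    have Wo: "W \<circ> W = id \<or> W \<circ> W \<circ> W = id \<or> W \<circ> W \<circ> W \<circ> W \<circ> W = id"
      unfolding W by (rule cyc3_prod_order) (use d pgroup_inj[OF X r(1)] in auto)
    have WX: "W \<in> X" unfolding W_def by (rule pgroup_comm[OF X tX r(1)])
    define V where "V = \<phi> W"
    have hV: "\<phi> (W \<circ> W) = V \<circ> V" "\<phi> (W \<circ> W \<circ> W) = V \<circ> V \<circ> V"
        "\<phi> (W \<circ> W \<circ> W \<circ> W \<circ> W) = V \<circ> V \<circ> V \<circ> V \<circ> V"
      unfolding V_def by (simp_all only: hom WX pgroup_comp[OF X])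
    have Vo: "V \<circ> V = id \<or> V \<circ> V \<circ> V = id \<or> V \<circ> V \<circ> V \<circ> V \<circ> V = id"
      using Wo hV hid(1) by metis
    have "V = comm s \<rho>" unfolding V_def W_def comm_def s_def
      by (simp only: hom hid(2) tX r pgroup_comp[OF X] pgroup_inv[OF X])
    then have V: "V a = s (\<rho> (s (s (\<rho> a))))" for a by (simp only: comm_def invs i\<rho> o_apply)
    \<comment> \<open>If \<open>s\<close> fixes \<open>e\<close>, then \<open>V\<close> contains the
      4-cycle \<open>(p2 p3 e q2)\<close>; otherwise it interchanges \<open>p1\<close> and
      \<open>q1\<close> and has a longer orbit through \<open>p2\<close>. Neither is compatible with
      the order of \<open>W\<close>.\<close>
    have False
    proof (cases "s e = e")
      case True
      have "V p2 = p3" "V p3 = e" "V e = q2" "V q2 = p2"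
        unfolding V using dd by (simp_all add: \<rho>(1-4) \<rho>f p(4) q(4) sp sq True)
      then have "V (V p2) \<noteq> p2" "V (V (V p2)) \<noteq> p2" "V (V (V (V (V p2)))) \<noteq> p2" using dd by auto
      then show False using Vo by (metis comp_apply id_apply)
    next
      case False
      define e2 where "e2 = s e" define e3 where "e3 = s e2"
      have e': "e \<noteq> e2" "e2 \<noteq> e3" "e \<noteq> e3" "s e3 = e"
        using tri[OF False] s3 unfolding e2_def e3_def by auto
      have se: "s e = e2" "s e2 = e3" by (simp_all add: e2_def e3_def)
      have "e3 \<notin> {p1, q1, p2, e}"
      proof -
        have "s e3 = e" by (rule e')
        then show ?thesis using e' dd sp sq by auto
      qed
      then have e3f: "\<rho> e3 = e3" by (rule \<rho>(5)) 
      have "V p2 = e" "V e = q2" "V p1 = q1" "V q1 = p1"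
        unfolding V using dd by (simp_all add: \<rho>(1-4) \<rho>f e3f p(4) q(4) sp sq e' se)
      then have "V (V p2) \<noteq> p2" "V (V (V p1)) \<noteq> p1" "V (V (V (V (V p1)))) \<noteq> p1" using dd by auto
      then show False using Vo by (metis comp_apply id_apply)
    qed
    then show ?thesis ..
  qed
qed

lemma cyc3_same_set:
  assumes "{a, b, c} = {u, v, w}" "a \<noteq> b" "b \<noteq> c" "a \<noteq> c" "u \<noteq> v" "v \<noteq> w" "u \<noteq> w"
  shows "cyc3 a b c = cyc3 u v w \<or> cyc3 a b c = cyc3 u w v"
proof -
  obtain y z where yz: "cyc3 a b c = cyc3 u y z" "u \<noteq> y" "y \<noteq> z" "u \<noteq> z"
    using cyc3_start[of u a b c] assms by auto
  have "{u, y, z} = {u, v, w}"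
    using mov_cyc3[OF yz(2-4)] mov_cyc3[OF assms(2-4)] yz(1) assms(1) by simp
  then have "y = v \<and> z = w \<or> y = w \<and> z = v" using yz assms(5-7) by (auto simp: doubleton_eq_iff insert_eq_iff)
  then show ?thesis using yz(1) by auto
qed

lemma disjoint_mov_commute:
  assumes "bij g" "bij h" "mov g \<inter> mov h = {}"
  shows "g \<circ> h = h \<circ> g"
proof
  fix x
  have gi: "g (g x) = g x \<longleftrightarrow> g x = x" "h (h x) = h x \<longleftrightarrow> h x = x"
    using assms(1,2) by (auto simp: bij_def inj_eq)
  have "g x = x \<or> h x = x" "g (h x) = h x \<or> h (h x) = h x" "g (g x) = g x \<or> h (g x) = g x"
    using assms(3) unfolding mov_def by blast+
  then show "(g \<circ> h) x = (h \<circ> g) x" using gi by (metis comp_apply)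
qed

lemma pgroup_card_le:
  assumes "pgroup O' X" shows "card X \<le> fact (card O')"
proof -
  have "X \<subseteq> {p. p permutes O'}" using pgroup_permutes[OF assms] by auto
  then have "card X \<le> card {p. p permutes O'}"
    by (rule card_mono[OF finite_permutations[OF pgroup_finite[OF assms]]])
  then show ?thesis using pgroup_finite[OF assms] by (simp add: card_permutations)
qed

text \<open>The isomorphism is given together with its inverse, so that \<open>swap\<close> makes
  every lemma available in both directions. The aim is \<open>letter_match\<close>: such an
  isomorphism is induced by a bijection of the letters. In degree 6 this fails because of the
  exceptional automorphism.\<close>

locale alt_iso =
  fixes C :: "'a set" and X and \<phi> :: "('a \<Rightarrow> 'a) \<Rightarrow> 'b \<Rightarrow> 'b" and C' X' and \<psi> :: "('b \<Rightarrow> 'b) \<Rightarrow> 'a \<Rightarrow> 'a"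
  assumes X: "pgroup C X" and X': "pgroup C' X'" and alt: "alt3 C X" and alt': "alt3 C' X'"
    and card: "7 \<le> card C" and card': "7 \<le> card C'"
    and \<phi>im: "\<And>g. g \<in> X \<Longrightarrow> \<phi> g \<in> X'" and \<psi>im: "\<And>g. g \<in> X' \<Longrightarrow> \<psi> g \<in> X"
    and \<psi>\<phi>: "\<And>g. g \<in> X \<Longrightarrow> \<psi> (\<phi> g) = g" and \<phi>\<psi>: "\<And>g. g \<in> X' \<Longrightarrow> \<phi> (\<psi> g) = g"
    and hom: "\<And>g h. g \<in> X \<Longrightarrow> h \<in> X \<Longrightarrow> \<phi> (g \<circ> h) = \<phi> g \<circ> \<phi> h"
begin

lemma hom': "g \<in> X' \<Longrightarrow> h \<in> X' \<Longrightarrow> \<psi> (g \<circ> h) = \<psi> g \<circ> \<psi> h"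
  using hom[OF \<psi>im \<psi>im] \<phi>\<psi> \<psi>\<phi> \<psi>im pgroup_comp[OF X] by metis

lemma swap: "alt_iso C' X' \<psi> C X \<phi>"
  by unfold_locales (use X X' alt alt' card card' \<phi>im \<psi>im \<psi>\<phi> \<phi>\<psi> hom' in auto)

lemma bij_\<psi>: "bij_betw \<psi> X' X"
  by (rule bij_betwI[of _ _ _ \<phi>]) (use \<phi>im \<psi>im \<psi>\<phi> \<phi>\<psi> in auto)

lemma bij_\<phi>: "bij_betw \<phi> X X'"
  by (rule bij_betwI[of _ _ _ \<psi>]) (use \<phi>im \<psi>im \<psi>\<phi> \<phi>\<psi> in auto)

lemma im_\<psi>: "\<psi> ` X' = X" and im_\<phi>: "\<phi> ` X = X'"
  using bij_\<psi> bij_\<phi> by (auto simp: bij_betw_def)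

lemma \<phi>_id: "\<phi> id = id"
  by (rule hom_inv(1)[OF X X' im_\<phi>]) (rule hom)

lemma \<phi>_inv: "g \<in> X \<Longrightarrow> \<phi> (inv' g) = inv' (\<phi> g)"
  by (rule hom_inv(2)[OF X X' im_\<phi>]) (rule hom)

lemma \<psi>_inv: "g \<in> X' \<Longrightarrow> \<psi> (inv' g) = inv' (\<psi> g)"
  by (rule hom_inv(2)[OF X' X im_\<psi>]) (rule hom')

definition "tri' c' = {t. \<exists>u v w. t = cyc3 u v w \<and> u \<noteq> v \<and> v \<noteq> w \<and> u \<noteq> w \<and> {u, v, w} \<subseteq> C' - {c'}}"
definition "tri c = {t. \<exists>u v w. t = cyc3 u v w \<and> u \<noteq> v \<and> v \<noteq> w \<and> u \<noteq> w \<and> {u, v, w} \<subseteq> C - {c}}"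

lemma tri'_X': "t \<in> tri' c' \<Longrightarrow> t \<in> X'"
  unfolding tri'_def using alt' unfolding alt3_def by auto

lemma tri_cyc3:
  assumes "t \<in> tri' c'"
  obtains p q r where "\<psi> t = cyc3 p q r" "p \<noteq> q" "q \<noteq> r" "p \<noteq> r" "{p, q, r} \<subseteq> C"
proof -
  obtain u v w where t: "t = cyc3 u v w" "u \<noteq> v" "v \<noteq> w" "u \<noteq> w" using assms unfolding tri'_def by auto
  have "cyc3 u v w \<in> X'" using tri'_X' assms t by auto
  from iso_cyc3[OF X' X bij_\<psi> hom' alt card this t(2-4)] that t(1) show ?thesis by blast
qed

text \<open>Disjoint images commute, hence so do the 3-cycles themselves; but 3-cycles that meet
  commute only if they are equal or inverse to each other, and then their images have the same
  support.\<close>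

lemma linked:
  assumes t1: "t1 \<in> tri' c'" and t2: "t2 \<in> tri' c'" and m: "mov t1 \<inter> mov t2 \<noteq> {}"
  shows "mov (\<psi> t1) \<inter> mov (\<psi> t2) \<noteq> {}"
proof
  assume dis: "mov (\<psi> t1) \<inter> mov (\<psi> t2) = {}"
  have tX: "t1 \<in> X'" "t2 \<in> X'" using t1 t2 tri'_X' by auto
  have sX: "\<psi> t1 \<in> X" "\<psi> t2 \<in> X" using tX \<psi>im by auto
  have "\<psi> t1 \<circ> \<psi> t2 = \<psi> t2 \<circ> \<psi> t1"
    by (rule disjoint_mov_commute[OF pgroup_bij[OF X sX(1)] pgroup_bij[OF X sX(2)] dis])
  then have "\<psi> (t1 \<circ> t2) = \<psi> (t2 \<circ> t1)" using hom' tX by simp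
  then have com: "t1 \<circ> t2 = t2 \<circ> t1" using \<phi>\<psi> pgroup_comp[OF X'] tX by metis
  obtain a b c where a: "t1 = cyc3 a b c" "a \<noteq> b" "b \<noteq> c" "a \<noteq> c" using t1 unfolding tri'_def by auto
  obtain u v w where u: "t2 = cyc3 u v w" "u \<noteq> v" "v \<noteq> w" "u \<noteq> w" using t2 unfolding tri'_def by auto
  have mm: "mov t1 = {a, b, c}" "mov t2 = {u, v, w}" using mov_cyc3 a u by metis+
  have st: "t1 x \<in> mov t2" if "x \<in> mov t2" for x
  proof -
    have "t2 (t1 x) = t1 (t2 x)" using com by (metis comp_apply)
    then show ?thesis using that pgroup_inj[OF X' tX(1)] unfolding mov_def by auto
  qed
  obtain s where s: "s \<in> {a, b, c}" "s \<in> mov t2" using m mm by blast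
  obtain y z where yz: "cyc3 a b c = cyc3 s y z" "s \<noteq> y" "y \<noteq> z" "s \<noteq> z" using cyc3_start[OF s(1) a(2-4)] .
  have "t1 s = y" "t1 y = z" using a(1) yz by (simp_all add: cyc3_apply)
  then have "{s, y, z} \<subseteq> mov t2" using st s(2) by auto
  moreover have "{s, y, z} = {a, b, c}" using mov_cyc3[OF yz(2-4)] mm a(1) yz(1) by simp
  ultimately have "{a, b, c} \<subseteq> {u, v, w}" using mm by simp
  moreover have "card {a, b, c} = 3" "card {u, v, w} = 3" using a u by auto
  ultimately have eq: "{u, v, w} = {a, b, c}" by (metis card_subset_eq finite.emptyI finite.insertI)
  have "t2 = t1 \<or> t2 = inv' t1" using cyc3_same_set[OF eq] a u inv_cyc3[OF a(2-4)] by auto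
  then have "mov (\<psi> t2) = mov (\<psi> t1)"
  proof
    assume h: "t2 = inv' t1"
    have "\<psi> t2 = inv' (\<psi> t1)" using \<psi>_inv[OF tX(1)] h by simp
    then show ?thesis using mov_inv[OF X sX(1)] by simp
  qed simp
  then have "\<psi> t1 = id" using dis mov_empty[of "\<psi> t1"] by simp
  then show False using tri_cyc3[OF t1] cyc3_apply(1) by (metis id_apply)
qed

lemma stab_card:
  assumes c': "c' \<in> C'"
  shows "card X = card C' * card {g \<in> X. \<phi> g c' = c'}"
proof -
  have "card X = card X'" using bij_\<phi> bij_betw_same_card by blast
  also have "\<dots> = card C' * card (stab X' c')"
    using orbit_stabilizer[OF X', of c'] alt3_transitive[OF X' alt' _ c'] card' by simp
  also have "card (stab X' c') = card {g \<in> X. \<phi> g c' = c'}"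
  proof -
    have "bij_betw \<psi> (stab X' c') {g \<in> X. \<phi> g c' = c'}"
      by (rule bij_betwI[of _ _ _ \<phi>]) (use \<phi>im \<psi>im \<psi>\<phi> \<phi>\<psi> in \<open>auto simp: stab_def\<close>)
    then show ?thesis by (rule bij_betw_same_card)
  qed
  finally show ?thesis .
qed

text \<open>The 3-cycles avoiding \<open>c'\<close> are linked to each other, so their images all
  live on one maximal set \<open>D\<close> whose 3-cycles belong to \<open>S\<close>, the subgroup
  that corresponds to the stabiliser of \<open>c'\<close>. As \<open>S\<close> has index
  \<open>card C'\<close>, at least 7, it cannot contain half of the symmetric group on
  \<open>C\<close>, and \<open>D\<close> misses a letter.\<close>

lemma missed_letter:
  assumes c': "c' \<in> C'"
  obtains c where "c \<in> C" "\<psi> ` tri' c' \<subseteq> tri c"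
proof -
  have finC: "finite C" and finC': "finite C'" using X X' pgroup_finite by auto
  define S where "S = {g \<in> X. \<phi> g c' = c'}"
  have S: "pgroup C S" unfolding S_def
    by (rule pgroup_filter[OF X]) (simp_all add: hom \<phi>_id)
  have triS: "\<psi> t \<in> S" if "t \<in> tri' c'" for t
    using tri'_X'[OF that] \<psi>im \<phi>\<psi> that unfolding S_def tri'_def by (auto simp: cyc3_apply)
  obtain p where p: "p \<in> C'" "p \<notin> set [c']" using ex_not_in_list[OF finC', of "[c']"] card' by auto
  obtain q where q: "q \<in> C'" "q \<notin> set [c', p]" using ex_not_in_list[OF finC', of "[c', p]"] card' by auto
  obtain r where r: "r \<in> C'" "r \<notin> set [c', p, q]" using ex_not_in_list[OF finC', of "[c', p, q]"] card' by auto
  define t0 where "t0 = cyc3 p q r"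
  have t0: "t0 \<in> tri' c'" unfolding tri'_def t0_def using p q r by (auto intro!: exI)
  obtain a b c where abc: "\<psi> t0 = cyc3 a b c" "a \<noteq> b" "b \<noteq> c" "a \<noteq> c" "{a, b, c} \<subseteq> C"
    using tri_cyc3[OF t0] .
  have "cyc3 a b c \<in> S" using triS[OF t0] abc(1) by simp
  from alt3_triple[OF S this abc(2-4)] have base: "alt3 {a, b, c} S" .
  obtain D where D: "{a, b, c} \<subseteq> D" "D \<subseteq> C" "alt3 D S" "\<And>E. D \<subseteq> E \<Longrightarrow> E \<subseteq> C \<Longrightarrow> alt3 E S \<Longrightarrow> E = D"
    by (rule maximal_set[where P = "\<lambda>D. alt3 D S", OF finC base abc(5)]) blast
  have "card {a, b, c} \<le> card D" using D(1,2) finC finite_subset card_mono by metis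
  then have cD: "3 \<le> card D" using abc by auto
  have step: "mov (\<psi> t2) \<subseteq> D"
    if st: "t1 \<in> tri' c'" "t2 \<in> tri' c'" "mov t1 \<inter> mov t2 \<noteq> {}" "mov (\<psi> t1) \<subseteq> D" for t1 t2
  proof -
    obtain u v w where u: "\<psi> t2 = cyc3 u v w" "u \<noteq> v" "v \<noteq> w" "u \<noteq> w" "{u, v, w} \<subseteq> C"
      using tri_cyc3[OF st(2)] .
    have mu: "mov (\<psi> t2) = {u, v, w}" using u mov_cyc3 by metis
    obtain s where s: "s \<in> {u, v, w}" "s \<in> D" using linked[OF st(1-3)] st(4) mu by blast
    obtain y z where yz: "cyc3 u v w = cyc3 s y z" "s \<noteq> y" "y \<noteq> z" "s \<noteq> z" using cyc3_start[OF s(1) u(2-4)] .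
    have m: "{s, y, z} = {u, v, w}" using mov_cyc3[OF yz(2-4)] mu u(1) yz(1) by simp
    have "cyc3 s y z \<in> S" using triS[OF st(2)] u(1) yz(1) by simp
    from alt3_extend[OF S D(3) cD this yz(2-4) s(2)] have "alt3 (insert y (insert z D)) S" .
    then have "insert y (insert z D) = D" using D(2,4) m u(5) by (metis insert_subset subset_insertI2 subset_refl)
    then show ?thesis using mu m s(2) by auto
  qed
  have all: "mov (\<psi> t) \<subseteq> D" if t: "t \<in> tri' c'" for t
  proof -
    have m0: "mov (\<psi> t0) \<subseteq> D" using abc D(1) mov_cyc3 by metis
    obtain u v w where u: "t = cyc3 u v w" "u \<noteq> v" "v \<noteq> w" "u \<noteq> w" "{u, v, w} \<subseteq> C' - {c'}"
      using t unfolding tri'_def by auto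
    have mt: "mov t = {u, v, w}" "mov t0 = {p, q, r}"
      unfolding u(1) t0_def by (rule mov_cyc3[OF u(2-4)], rule mov_cyc3) (use p q r in auto)
    show ?thesis
    proof (cases "p = u")
      case True
      then show ?thesis using step[OF t0 t _ m0] mt by auto
    next
      case False
      obtain s where s: "s \<in> C'" "s \<notin> set [c', p, u]" using ex_not_in_list[OF finC', of "[c', p, u]"] card' by auto
      define t1 where "t1 = cyc3 p u s"
      have t1: "t1 \<in> tri' c'" unfolding tri'_def t1_def using p s u False by (auto intro!: exI)
      have mt1: "mov t1 = {p, u, s}" unfolding t1_def using s False by (intro mov_cyc3) auto
      have "mov (\<psi> t1) \<subseteq> D" using step[OF t0 t1 _ m0] mt mt1 by auto
      then show ?thesis using step[OF t1 t] mt mt1 by auto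
    qed
  qed
  have "D \<noteq> C"
  proof
    assume "D = C"
    then have "fact (card C) \<le> 2 * card S" using alt3_card[OF S] D(3) by simp
    moreover have "card C' * card S \<le> fact (card C)"
      using stab_card[OF c'] pgroup_card_le[OF X] unfolding S_def by simp
    moreover have "7 * card S \<le> card C' * card S" using card' by simp
    ultimately show False using pgroup_card_pos[OF S] by linarith
  qed
  then obtain x where x: "x \<in> C" "x \<notin> D" using D(2) by auto
  have "\<psi> t \<in> tri x" if t: "t \<in> tri' c'" for t
  proof -
    obtain u v w where u: "\<psi> t = cyc3 u v w" "u \<noteq> v" "v \<noteq> w" "u \<noteq> w" "{u, v, w} \<subseteq> C"
      using tri_cyc3[OF t] .
    then have "{u, v, w} \<subseteq> C - {x}" using all[OF t] mov_cyc3[OF u(2-4)] x by auto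
    then show ?thesis unfolding tri_def using u by blast
  qed
  then show ?thesis using that x(1) by auto
qed

end

lemma tri_unique:
  assumes "finite C" "7 \<le> card C" "c1 \<in> C"
    "{t. \<exists>u v w. t = cyc3 u v w \<and> u \<noteq> v \<and> v \<noteq> w \<and> u \<noteq> w \<and> {u, v, w} \<subseteq> C - {c2}}
      \<subseteq> {t. \<exists>u v w. t = cyc3 u v w \<and> u \<noteq> v \<and> v \<noteq> w \<and> u \<noteq> w \<and> {u, v, w} \<subseteq> C - {c1}}"
  shows "c1 = c2"
proof (rule ccontr)
  assume n: "c1 \<noteq> c2"
  obtain q where q: "q \<in> C" "q \<notin> set [c1, c2]" using ex_not_in_list[OF assms(1), of "[c1, c2]"] assms(2) by auto
  obtain r where r: "r \<in> C" "r \<notin> set [c1, c2, q]" using ex_not_in_list[OF assms(1), of "[c1, c2, q]"] assms(2) by auto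
  have "cyc3 c1 q r \<in> {t. \<exists>u v w. t = cyc3 u v w \<and> u \<noteq> v \<and> v \<noteq> w \<and> u \<noteq> w \<and> {u, v, w} \<subseteq> C - {c2}}"
    using n q r assms(3) by (intro CollectI exI[of _ c1] exI[of _ q] exI[of _ r]) auto
  from subsetD[OF assms(4) this] obtain u v w
    where u: "cyc3 c1 q r = cyc3 u v w" "u \<noteq> v" "v \<noteq> w" "u \<noteq> w" "{u, v, w} \<subseteq> C - {c1}"
    by (elim CollectE exE conjE)
  have "mov (cyc3 c1 q r) = {c1, q, r}" using q r by (intro mov_cyc3) auto
  then show False using u mov_cyc3[OF u(2-4)] by auto
qed

context alt_iso
begin

text \<open>Missing a letter in both directions, the 3-cycles that avoid \<open>c\<close> correspond
  exactly to those that avoid \<open>c'\<close>. An element fixes a letter iff conjugation by it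
  preserves the set of 3-cycles avoiding that letter, and this property is carried over by the
  isomorphism.\<close>

lemma letter_match:
  assumes c': "c' \<in> C'"
  obtains c where "c \<in> C" "\<And>g. g \<in> X \<Longrightarrow> g c = c \<longleftrightarrow> \<phi> g c' = c'"
proof -
  interpret sw: alt_iso C' X' \<psi> C X \<phi> by (rule swap)
  have defs: "sw.tri' = tri" "sw.tri = tri'"
    by (auto simp: sw.tri'_def sw.tri_def tri_def tri'_def fun_eq_iff)
  have finC: "finite C" and finC': "finite C'" using X X' pgroup_finite by auto
  obtain c where c: "c \<in> C" "\<psi> ` tri' c' \<subseteq> tri c" using missed_letter[OF c'] .
  obtain d where d: "d \<in> C'" "\<phi> ` tri c \<subseteq> tri' d" using sw.missed_letter[OF c(1)] unfolding defs .
  have "tri' c' \<subseteq> tri' d"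
  proof
    fix t assume t: "t \<in> tri' c'"
    then have "\<phi> (\<psi> t) \<in> tri' d" using c(2) d(2) by auto
    then show "t \<in> tri' d" using \<phi>\<psi> tri'_X' t by simp
  qed
  then have "d = c'" using tri_unique[OF finC' card' d(1), of c'] unfolding tri'_def by auto
  with d(2) have eq2: "\<phi> ` tri c \<subseteq> tri' c'" by simp
  have conj: "g \<circ> t \<circ> inv' g \<in> tri (g x)" if g: "g \<in> X" and t: "t \<in> tri x" for g t x
  proof -
    obtain u v w where u: "t = cyc3 u v w" "u \<noteq> v" "v \<noteq> w" "u \<noteq> w" "{u, v, w} \<subseteq> C - {x}"
      using t unfolding tri_def by auto
    then show ?thesis unfolding tri_def u(1) conj_cyc3[OF pgroup_bij[OF X g]]
      using pgroup_inj[OF X g] pgroup_in[OF X g]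
      by (intro CollectI exI[of _ "g u"] exI[of _ "g v"] exI[of _ "g w"]) auto
  qed
  have conj': "g \<circ> t \<circ> inv' g \<in> tri' (g x)" if g: "g \<in> X'" and t: "t \<in> tri' x" for g t x
  proof -
    obtain u v w where u: "t = cyc3 u v w" "u \<noteq> v" "v \<noteq> w" "u \<noteq> w" "{u, v, w} \<subseteq> C' - {x}"
      using t unfolding tri'_def by auto
    then show ?thesis unfolding tri'_def u(1) conj_cyc3[OF pgroup_bij[OF X' g]]
      using pgroup_inj[OF X' g] pgroup_in[OF X' g]
      by (intro CollectI exI[of _ "g u"] exI[of _ "g v"] exI[of _ "g w"]) auto
  qed
  have triX: "t \<in> X" if "t \<in> tri x" for t x using sw.tri'_X' that unfolding defs by auto
  have key: "g c = c \<longleftrightarrow> \<phi> g c' = c'" if g: "g \<in> X" for g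
  proof
    assume gc: "g c = c"
    have "tri' c' \<subseteq> tri' (\<phi> g c')"
    proof
      fix t assume t: "t \<in> tri' c'"
      have ig: "inv' g c = c" using gc pgroup_inv1[OF X g, of c] by simp
      have "\<psi> t \<in> tri c" using c(2) t by auto
      from conj[OF pgroup_inv[OF X g] this] have a: "inv' g \<circ> \<psi> t \<circ> g \<in> tri c"
        using ig inv_inv_eq[OF pgroup_bij[OF X g]] by simp
      have tX: "\<psi> t \<in> X" using \<psi>im tri'_X' t by auto
      have "\<phi> (inv' g \<circ> \<psi> t \<circ> g) \<in> tri' c'" using a eq2 by auto
      then have "inv' (\<phi> g) \<circ> t \<circ> \<phi> g \<in> tri' c'"
        by (simp only: hom g tX pgroup_inv[OF X g] pgroup_comp[OF X] \<phi>_inv \<phi>\<psi> tri'_X'[OF t])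
      from conj'[OF \<phi>im[OF g] this] have "\<phi> g \<circ> (inv' (\<phi> g) \<circ> t \<circ> \<phi> g) \<circ> inv' (\<phi> g) \<in> tri' (\<phi> g c')" .
      moreover have "\<phi> g \<circ> (inv' (\<phi> g) \<circ> t \<circ> \<phi> g) \<circ> inv' (\<phi> g) = t"
        using pgroup_inv2[OF X' \<phi>im[OF g]] by (simp add: fun_eq_iff)
      ultimately show "t \<in> tri' (\<phi> g c')" by simp
    qed
    then show "\<phi> g c' = c'"
      using tri_unique[OF finC' card', of "\<phi> g c'" c'] c' pgroup_in[OF X' \<phi>im[OF g]] unfolding tri'_def by auto
  next
    assume gc: "\<phi> g c' = c'"
    have "tri c \<subseteq> tri (g c)"
    proof
      fix t assume t: "t \<in> tri c"
      have ig: "inv' (\<phi> g) c' = c'" using gc pgroup_inv1[OF X' \<phi>im[OF g], of c'] by simp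
      have "\<phi> t \<in> tri' c'" using eq2 t by auto
      from conj'[OF pgroup_inv[OF X' \<phi>im[OF g]] this] have a: "inv' (\<phi> g) \<circ> \<phi> t \<circ> \<phi> g \<in> tri' c'"
        using ig inv_inv_eq[OF pgroup_bij[OF X' \<phi>im[OF g]]] by simp
      have tX: "\<phi> t \<in> X'" "\<phi> g \<in> X'" using \<phi>im triX t g by auto
      have "\<psi> (inv' (\<phi> g) \<circ> \<phi> t \<circ> \<phi> g) \<in> tri c" using a c(2) by auto
      then have "inv' g \<circ> t \<circ> g \<in> tri c"
        by (simp only: hom' g tX pgroup_inv[OF X' tX(2)] pgroup_comp[OF X'] \<psi>_inv \<psi>\<phi> triX[OF t])
      from conj[OF g this] have "g \<circ> (inv' g \<circ> t \<circ> g) \<circ> inv' g \<in> tri (g c)" .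
      moreover have "g \<circ> (inv' g \<circ> t \<circ> g) \<circ> inv' g = t"
        using pgroup_inv2[OF X g] by (simp add: fun_eq_iff)
      ultimately show "t \<in> tri (g c)" by simp
    qed
    then show "g c = c"
      using tri_unique[OF finC card, of "g c" c] c(1) pgroup_in[OF X g] unfolding tri_def by auto
  qed
  show ?thesis by (rule that[OF c(1)]) (rule key)
qed

end

section \<open>Orders of primitive groups without three-cycles\<close>

definition base_of :: "('a \<Rightarrow> 'a) set \<Rightarrow> 'a set \<Rightarrow> bool"
  where "base_of G B \<longleftrightarrow> (\<forall>g\<in>G. (\<forall>b\<in>B. g b = b) \<longrightarrow> g = id)"

lemma base_bound:
  assumes G: "pgroup \<Omega> G" and B: "B \<subseteq> \<Omega>" "base_of G B"
  shows "card G \<le> card \<Omega> ^ card B"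
proof -
  have fin: "finite \<Omega>" "finite B" using pgroup_finite[OF G] B(1) finite_subset by auto
  let ?r = "\<lambda>g. restrict g B"
  have "inj_on ?r G"
  proof (rule inj_onI)
    fix g h assume gh: "g \<in> G" "h \<in> G" "?r g = ?r h"
    have "\<forall>b\<in>B. (inv' h \<circ> g) b = b"
    proof
      fix b assume "b \<in> B"
      then have "g b = h b" using gh(3) by (metis restrict_apply')
      then show "(inv' h \<circ> g) b = b" using pgroup_inv1[OF G gh(2)] by simp
    qed
    then have "inv' h \<circ> g = id" using B(2) pgroup_comp[OF G pgroup_inv[OF G gh(2)] gh(1)] unfolding base_of_def by auto
    then show "g = h" using pgroup_invo2[OF G gh(2)] by (metis comp_assoc comp_id id_comp)
  qed
  moreover have "?r ` G \<subseteq> B \<rightarrow>\<^sub>E \<Omega>" using B(1) pgroup_in[OF G] by auto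
  ultimately have "card G \<le> card (B \<rightarrow>\<^sub>E \<Omega>)"
    using fin by (intro card_inj_on_le[of ?r]) (auto intro!: finite_PiE)
  also have "\<dots> = card \<Omega> ^ card B" using fin by (simp add: card_PiE)
  finally show ?thesis .
qed

definition no_cyc3 :: "('a \<Rightarrow> 'a) set \<Rightarrow> bool"
  where "no_cyc3 G \<longleftrightarrow> (\<forall>a b c. a \<noteq> b \<longrightarrow> b \<noteq> c \<longrightarrow> a \<noteq> c \<longrightarrow> cyc3 a b c \<notin> G)"

text \<open>Bochert's argument: for a smallest base \<open>B\<close> with \<open>2 * card B > card \<Omega>\<close> there are
  elements whose supports meet in exactly one point.\<close>

lemma small_base:
  assumes G: "pgroup \<Omega> G" and no: "no_cyc3 G"
  obtains B where "B \<subseteq> \<Omega>" "base_of G B" "2 * card B \<le> card \<Omega>"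
proof -
  have fin: "finite \<Omega>" by (rule pgroup_finite[OF G])
  have "base_of G \<Omega>"
    unfolding base_of_def fun_eq_iff id_apply using pgroup_out[OF G] by metis
  then have "\<exists>B. B \<subseteq> \<Omega> \<and> base_of G B" by blast
  then obtain B where B: "B \<subseteq> \<Omega>" "base_of G B"
    and min: "\<And>C. C \<subseteq> \<Omega> \<Longrightarrow> base_of G C \<Longrightarrow> card B \<le> card C"
    using ex_has_least_nat[of "\<lambda>B. B \<subseteq> \<Omega> \<and> base_of G B" _ card] by metis
  have finB: "finite B" using B(1) fin finite_subset by auto
  show ?thesis
  proof (cases "2 * card B \<le> card \<Omega>")
    case True then show ?thesis using that B by auto
  next
    case False
    then have "card (\<Omega> - B) < card B" using B(1) fin finB by (simp add: card_Diff_subset)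
    then have "\<not> base_of G (\<Omega> - B)" using min[of "\<Omega> - B"] by auto
    then obtain g where g: "g \<in> G" "\<forall>b\<in>\<Omega> - B. g b = b" "g \<noteq> id" unfolding base_of_def by blast
    then obtain x where x: "g x \<noteq> x" by (auto simp: fun_eq_iff)
    have mg: "mov g \<subseteq> B" using mov_subset[OF G g(1)] g(2) unfolding mov_def by auto
    then have xB: "x \<in> B" using x unfolding mov_def by auto
    have "card (B - {x}) < card B" using xB finB by (simp only: card_Diff1_less)
    then have "\<not> base_of G (B - {x})" using min[of "B - {x}"] B(1) by auto
    then obtain h where h: "h \<in> G" "\<forall>b\<in>B - {x}. h b = b" "h \<noteq> id" unfolding base_of_def by blast
    have "h x \<noteq> x" using B(2) h xB unfolding base_of_def by blast
    then have int: "mov g \<inter> mov h = {x}" using mg h(2) x unfolding mov_def by auto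
    have c: "comm g h = cyc3 x (g x) (h x)" by (rule comm_cyc3[OF pgroup_bij[OF G g(1)] pgroup_bij[OF G h(1)] int])
    have "h (g x) = g x" using int x pgroup_inj[OF G g(1), of "g x" x] unfolding mov_def by blast
    then have "g x \<noteq> h x" using x pgroup_inj[OF G h(1)] by metis
    then have "comm g h \<notin> G" using no c x \<open>h x \<noteq> x\<close> unfolding no_cyc3_def by metis
    then show ?thesis using pgroup_comm[OF G g(1) h(1)] by blast
  qed
qed

lemma pow_le_medium:
  fixes d :: nat
  assumes "2 \<le> d" "d \<le> 16000"
  shows "d ^ d \<le> 2 ^ (14 * (d - 1))"
proof -
  consider "d \<le> 13" | "13 < d" "d \<le> 8192" | "8192 < d" by linarith
  then show ?thesis
  proof cases
    case 1
    have "d ^ d \<le> (2 ^ 4) ^ d" by (rule power_mono) (use 1 in auto)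
    also have "\<dots> = 2 ^ (4 * d)" by (simp add: power_mult)
    also have "\<dots> \<le> 2 ^ (14 * (d - 1))" by (rule power_increasing) (use assms in auto)
    finally show ?thesis .
  next
    case 2
    have "d ^ d \<le> (2 ^ 13) ^ d" by (rule power_mono) (use 2 in auto)
    also have "\<dots> = 2 ^ (13 * d)" by (simp add: power_mult)
    also have "\<dots> \<le> 2 ^ (14 * (d - 1))" by (rule power_increasing) (use 2 in auto)
    finally show ?thesis .
  next
    case 3
    \<comment> \<open>The exponent \<open>419 / 30\<close> lies slightly above the binary logarithm
      of 16000 and below 14; the remaining gap pays for \<open>d - 1\<close> in place of
      \<open>d\<close>.\<close>
    have n: "(16000::nat) ^ 30 \<le> 2 ^ 419" by simp
    have "(d ^ d) ^ 30 = (d ^ 30) ^ d" by (simp add: power_mult[symmetric] mult.commute)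
    also have "\<dots> \<le> (2 ^ 419) ^ d"
      by (rule power_mono) (use n power_mono[OF assms(2), of 30] in auto)
    also have "\<dots> = 2 ^ (419 * d)" by (simp add: power_mult)
    also have "\<dots> \<le> 2 ^ ((14 * (d - 1)) * 30)" by (rule power_increasing) (use 3 in auto)
    also have "\<dots> = (2 ^ (14 * (d - 1))) ^ 30" by (rule power_mult)
    finally show ?thesis by (simp add: power_mono_iff)
  qed
qed

text \<open>A base consisting of at most half of the points gives order at most
  \<open>d ^ (d / 2)\<close>. This stays within the target as long as the binary logarithm of
  \<open>d\<close> is less than 14 by a small margin.\<close>

lemma bound_medium:
  assumes G: "pgroup \<Omega> G" and no: "no_cyc3 G" and d: "2 \<le> card \<Omega>" "card \<Omega> \<le> 16000"
  shows "card G \<le> 2 ^ (7 * (card \<Omega> - 1))"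
proof -
  let ?d = "card \<Omega>"
  obtain B where B: "B \<subseteq> \<Omega>" "base_of G B" "2 * card B \<le> ?d" using small_base[OF G no] .
  have "(card G)\<^sup>2 \<le> (?d ^ card B)\<^sup>2" by (rule power_mono[OF base_bound[OF G B(1,2)]]) simp
  also have "\<dots> = ?d ^ (2 * card B)" by (simp add: power_mult[symmetric] mult.commute)
  also have "\<dots> \<le> ?d ^ ?d" by (rule power_increasing) (use B d in auto)
  also have "\<dots> \<le> 2 ^ (14 * (?d - 1))" by (rule pow_le_medium[OF d])
  also have "\<dots> = (2 ^ (7 * (?d - 1)))\<^sup>2" by (simp add: power_mult[symmetric] mult.commute mult.left_commute)
  finally show ?thesis by (simp add: power_mono_iff)
qed

section \<open>Averaging, hitting sets and estimates of logarithms\<close>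

lemma ex_ge_average:
  fixes f :: "'a \<Rightarrow> real" and c :: real
  assumes "finite A" "A \<noteq> {}" "c * card A \<le> sum f A"
  shows "\<exists>x\<in>A. c \<le> f x"
proof (rule ccontr)
  assume "\<not> ?thesis"
  then have "sum f A < (\<Sum>x\<in>A. c)" by (intro sum_strict_mono) (use assms in auto)
  then show False using assms(3) by (simp add: mult.commute)
qed

lemma ex_le_average:
  fixes f :: "'a \<Rightarrow> real" and c :: real
  assumes "finite A" "A \<noteq> {}" "sum f A \<le> c * card A"
  shows "\<exists>x\<in>A. f x \<le> c"
  using ex_ge_average[of A "- c" "\<lambda>x. - f x"] assms by (simp add: sum_negf)

lemma sum_card_swap:
  assumes "finite A" "finite B"
  shows "(\<Sum>a\<in>A. card {b \<in> B. P a b}) = (\<Sum>b\<in>B. card {a \<in> A. P a b})"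
proof -
  have "(\<Sum>a\<in>A. card {b \<in> B. P a b}) = (\<Sum>a\<in>A. \<Sum>b\<in>B. if P a b then 1 else 0)"
    by (rule sum.cong) (use assms in \<open>auto simp: sum.If_cases Int_def\<close>)
  also have "\<dots> = (\<Sum>b\<in>B. \<Sum>a\<in>A. if P a b then 1 else 0)" by (rule sum.swap)
  also have "\<dots> = (\<Sum>b\<in>B. card {a \<in> A. P a b})"
    by (rule sum.cong) (use assms in \<open>auto simp: sum.If_cases Int_def\<close>)
  finally show ?thesis .
qed

text \<open>Greedy choice: some point lies in at least the fraction
  \<open>\<delta> / card \<Omega>\<close> of the sets not met so far. After \<open>s\<close> steps
  at most \<open>card I / card \<Omega> ^ 2\<close> of the sets are left, which is less than one.
  The bound on \<open>card I\<close> fits families indexed by pairs of distinct points.\<close>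

lemma hitting_set:
  fixes \<delta> :: real
  assumes fin: "finite \<Omega>" "finite I" and A: "\<And>i. i \<in> I \<Longrightarrow> A i \<subseteq> \<Omega>" "\<And>i. i \<in> I \<Longrightarrow> \<delta> \<le> card (A i)"
    and \<delta>: "\<delta> > 0" and s: "2 * real (card \<Omega>) / \<delta> * ln (real (card \<Omega>)) \<le> real s" and I: "card I < card \<Omega> ^ 2" and d: "card \<Omega> > 0"
  obtains B where "B \<subseteq> \<Omega>" "card B \<le> s" "\<And>i. i \<in> I \<Longrightarrow> A i \<inter> B \<noteq> {}"
proof (cases "I = {}")
  case True then show ?thesis using that[of "{}"] by auto
next
  case ne: False
  let ?d = "real (card \<Omega>)"
  have dle: "\<delta> \<le> ?d"
  proof -
    obtain i where "i \<in> I" using ne by auto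
    then have "\<delta> \<le> card (A i)" "card (A i) \<le> card \<Omega>" using A card_mono[OF fin(1)] by auto
    then show ?thesis by linarith
  qed
  let ?\<theta> = "1 - \<delta> / ?d"
  have th0: "0 \<le> ?\<theta>" using dle d by (simp add: field_simps)
  have "\<exists>B\<subseteq>\<Omega>. card B \<le> k \<and> card {i \<in> I. A i \<inter> B = {}} \<le> ?\<theta> ^ k * card I" for k
  proof (induction k)
    case 0 show ?case by (intro exI[of _ "{}"]) auto
  next
    case (Suc k)
    then obtain B where B: "B \<subseteq> \<Omega>" "card B \<le> k" "card {i \<in> I. A i \<inter> B = {}} \<le> ?\<theta> ^ k * card I" by auto
    let ?U = "{i \<in> I. A i \<inter> B = {}}"
    have fU: "finite ?U" using fin by auto
    have "\<delta> * card ?U = (\<Sum>i\<in>?U. \<delta>)" by simp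
    also have "\<dots> \<le> (\<Sum>i\<in>?U. real (card (A i)))" by (rule sum_mono) (use A in auto)
    also have "\<dots> = (\<Sum>i\<in>?U. real (card {x \<in> \<Omega>. x \<in> A i}))"
      by (rule sum.cong) (use A(1) in \<open>auto intro!: arg_cong[where f = card]\<close>)
    also have "\<dots> = real (\<Sum>i\<in>?U. card {x \<in> \<Omega>. x \<in> A i})" by simp
    also have "\<dots> = real (\<Sum>x\<in>\<Omega>. card {i \<in> ?U. x \<in> A i})" by (simp only: sum_card_swap[OF fU fin(1)])
    finally have "(\<delta> / ?d * card ?U) * card \<Omega> \<le> (\<Sum>x\<in>\<Omega>. real (card {i \<in> ?U. x \<in> A i}))" using d by simp
    then obtain x where x: "x \<in> \<Omega>" "\<delta> / ?d * card ?U \<le> card {i \<in> ?U. x \<in> A i}"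
      using ex_ge_average[OF fin(1)] d by (metis (no_types, lifting) card.empty less_irrefl)
    have split: "card ?U = card {i \<in> ?U. x \<in> A i} + card {i \<in> I. A i \<inter> insert x B = {}}"
      using fU fin(2) by (subst card_Un_disjoint[symmetric]) (auto intro!: arg_cong[where f = card])
    have "card {i \<in> I. A i \<inter> insert x B = {}} \<le> ?\<theta> * card ?U"
      using x(2) split by (simp add: algebra_simps)
    also have "\<dots> \<le> ?\<theta> * (?\<theta> ^ k * card I)" by (rule mult_left_mono[OF B(3) th0])
    finally have "card {i \<in> I. A i \<inter> insert x B = {}} \<le> ?\<theta> ^ Suc k * card I" by (simp add: mult.assoc)
    moreover have "card (insert x B) \<le> Suc k" using B(2) by (simp add: card_insert_if finite_subset[OF B(1) fin(1)])
    ultimately show ?case using B(1) x(1) by (intro exI[of _ "insert x B"]) auto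
  qed
  then obtain B where B: "B \<subseteq> \<Omega>" "card B \<le> s" "card {i \<in> I. A i \<inter> B = {}} \<le> ?\<theta> ^ s * card I" by blast
  have "?\<theta> ^ s \<le> exp (- (\<delta> / ?d)) ^ s"
    by (rule power_mono[OF _ th0]) (use exp_ge_add_one_self[of "- (\<delta> / ?d)"] in simp)
  also have "\<dots> = exp (- (\<delta> / ?d * s))" by (simp add: exp_of_nat_mult[symmetric] mult.commute)
  also have "\<dots> \<le> exp (- (2 * ln ?d))"
  proof -
    have "\<delta> / ?d * (2 * ?d / \<delta> * ln ?d) \<le> \<delta> / ?d * s" by (rule mult_left_mono[OF s]) (use \<delta> in auto)
    then show ?thesis using \<delta> d by simp
  qed
  also have "\<dots> = 1 / ?d ^ 2"
    using d by (simp add: exp_minus exp_double inverse_eq_divide)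
  finally have "?\<theta> ^ s * card I \<le> 1 / ?d ^ 2 * card I" by (rule mult_right_mono) auto
  also have "\<dots> < 1"
  proof -
    have "real (card I) < ?d ^ 2" using I by (metis of_nat_less_iff of_nat_power)
    then show ?thesis using d by (simp add: field_simps)
  qed
  finally have "card {i \<in> I. A i \<inter> B = {}} < 1" using B(3) by linarith
  then have "{i \<in> I. A i \<inter> B = {}} = {}" using fin(2) by auto
  then show ?thesis using that[OF B(1,2)] by blast
qed

text \<open>From the tangent to \<open>ln\<close> at \<open>exp 2.4\<close>, a point close to the
  least value 11.24 that the fourth root can take. The constant 0.87 is sharp enough for both
  estimates of large degree.\<close>

lemma ln_le_root4:
  fixes d :: real
  assumes "16000 \<le> d"
  shows "ln d \<le> 0.87 * d powr (1/4)" "11.24 \<le> d powr (1/4)"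
proof -
  let ?q = "d powr (1/4)"
  have "(11.24::real) = (11.24 powr 4) powr (1/4)" by (simp only: powr_powr) simp
  also have "\<dots> \<le> ?q" by (rule powr_mono2) (use assms in \<open>auto simp: power_divide\<close>)
  finally show q: "11.24 \<le> ?q" .
  have "(1.22::real) \<le> exp 0.2"
    using exp_lower_Taylor_quadratic[of "0.2::real"] by (simp add: power2_eq_square)
  then have "1.22 ^ 12 \<le> exp (0.2::real) ^ 12" by (rule power_mono) auto
  also have "\<dots> = exp 2.4" by (simp add: exp_of_nat_mult[symmetric])
  finally have e: "(10.8::real) \<le> exp 2.4" by (simp add: power_divide)
  have "ln d = 4 * ln ?q" using assms by (simp add: ln_powr)
  moreover have "ln ?q \<le> ?q / exp 2.4 + 1.4"
  proof -
    have "0 < ?q" using assms by simp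
    then have "ln (?q / exp 2.4) \<le> ?q / exp 2.4 - 1" by (intro ln_le_minus_one divide_pos_pos) auto
    then show ?thesis using \<open>0 < ?q\<close> by (simp add: ln_div)
  qed
  moreover have "?q / exp 2.4 \<le> ?q / 10.8" by (rule divide_left_mono) (use e q in auto)
  ultimately show "ln d \<le> 0.87 * ?q" using q by simp
qed

lemma ln2_ge_two_thirds: "2/3 \<le> ln (2::real)"
proof -
  have "(1/2::real) \<le> (1 - 1/15) ^ 10" by (simp add: power_divide)
  also have "\<dots> \<le> exp (- (1/15)) ^ 10"
    by (rule power_mono) (use exp_ge_add_one_self[of "- (1/15) :: real"] in auto)
  also have "\<dots> = exp (- (2/3))" by (simp add: exp_of_nat_mult[symmetric])
  finally have "exp (2/3) \<le> (2::real)" by (simp add: exp_minus field_simps)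
  then have "ln (exp (2/3)) \<le> ln (2::real)" by (subst ln_le_cancel_iff) auto
  then show ?thesis by simp
qed

text \<open>Here \<open>14/3\<close> is 7 times 2/3, the latter being a lower bound for
  \<open>ln 2\<close>.\<close>

lemma exp_bound_to_pow:
  assumes "real N \<le> real d ^ b" "real b * ln d \<le> 14/3 * (real d - 1)" "1 \<le> d"
  shows "N \<le> 2 ^ (7 * (d - 1))"
proof -
  have "real N \<le> exp (real b * ln d)" using assms by (simp add: exp_of_nat_mult)
  also have "\<dots> \<le> exp (7 * (real d - 1) * ln 2)"
  proof -
    have "14/3 * (real d - 1) \<le> 7 * (real d - 1) * ln 2"
      using ln2_ge_two_thirds assms(3) mult_left_mono[of "2/3" "ln 2" "7 * (real d - 1)"] by simp
    then show ?thesis using assms(2) by simp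
  qed
  also have "\<dots> = 2 powr (7 * (real d - 1))" by (simp add: powr_def)
  also have "\<dots> = 2 ^ (7 * (d - 1))" using assms(3) by (simp add: powr_realpow[symmetric] of_nat_diff)
  finally show ?thesis by (metis of_nat_le_iff of_nat_numeral of_nat_power)
qed

subsection \<open>Primitive groups that are not doubly transitive\<close>

text \<open>Following Babai, two points are distinguished by a third one if they lie in different orbits of
  its stabiliser; all pairs of points are distinguished by about \<open>sqrt (card \<Omega>)\<close> points.\<close>

locale uniprimitive =
  fixes \<Omega> :: "'a set" and G
  assumes G: "pgroup \<Omega> G" and prim: "primitive_on \<Omega> G"
begin

definition "eqv z x y \<longleftrightarrow> (\<exists>g\<in>G. g z = z \<and> g x = y)"
definition "D x y = {z \<in> \<Omega>. \<not> eqv z x y}"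
text \<open>Adjacency in the undirected orbital graph of the pair \<open>(p, q)\<close>, whose edges
  are the translates of \<open>{p, q}\<close>.\<close>

definition "Ed p q u v \<longleftrightarrow> (\<exists>g\<in>G. g p = u \<and> g q = v \<or> g p = v \<and> g q = u)"
definition "N p q u = {v. Ed p q u v}"

lemma fin: "finite \<Omega>" by (rule pgroup_finite[OF G])

lemma trans: "x \<in> \<Omega> \<Longrightarrow> y \<in> \<Omega> \<Longrightarrow> \<exists>g\<in>G. g x = y"
  using prim unfolding primitive_on_def transitive_on_def by auto

lemma eqv_refl: "eqv z x x"
  unfolding eqv_def by (rule bexI[OF _ pgroup_id[OF G]]) simp

lemma eqv_sym: "eqv z x y \<Longrightarrow> eqv z y x"
  unfolding eqv_def using pgroup_inv[OF G] pgroup_inv1[OF G] by metis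

lemma eqv_trans: "eqv z x y \<Longrightarrow> eqv z y w \<Longrightarrow> eqv z x w"
  unfolding eqv_def using pgroup_comp[OF G] by (metis comp_apply)

lemma eqv_conj: assumes g: "g \<in> G" shows "eqv (g z) (g x) (g y) \<longleftrightarrow> eqv z x y"
proof
  assume "eqv z x y"
  then obtain h where h: "h \<in> G" "h z = z" "h x = y" unfolding eqv_def by auto
  then show "eqv (g z) (g x) (g y)" unfolding eqv_def
    using pgroup_conj[OF G g h(1)] by (intro bexI[of _ "g \<circ> h \<circ> inv' g"]) (auto simp: pgroup_inv1[OF G g])
next
  assume "eqv (g z) (g x) (g y)"
  then obtain h where h: "h \<in> G" "h (g z) = g z" "h (g x) = g y" unfolding eqv_def by auto
  then show "eqv z x y" unfolding eqv_def
    using pgroup_comp[OF G pgroup_inv[OF G g] pgroup_comp[OF G h(1) g]]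
    by (intro bexI[of _ "inv' g \<circ> (h \<circ> g)"]) (auto simp: pgroup_inv1[OF G g])
qed

lemma finite_D: "finite (D x y)" unfolding D_def using fin by auto

lemma D_sym: "D x y = D y x" unfolding D_def using eqv_sym by auto

text \<open>With symmetry and invariance this makes \<open>card (D x y)\<close> a metric that
  \<open>G\<close> preserves, which \<open>D_large\<close> compares with distances in orbital
  graphs.\<close>

lemma D_tri: "card (D x w) \<le> card (D x y) + card (D y w)"
proof -
  have "D x w \<subseteq> D x y \<union> D y w" unfolding D_def using eqv_trans by blast
  then have "card (D x w) \<le> card (D x y \<union> D y w)" by (rule card_mono[rotated]) (simp add: finite_D)
  also have "\<dots> \<le> card (D x y) + card (D y w)" by (rule card_Un_le)
  finally show ?thesis .
qed

lemma card_D_conj: assumes g: "g \<in> G" shows "card (D (g x) (g y)) = card (D x y)"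
proof -
  have "D (g x) (g y) = g ` D x y"
  proof
    show "g ` D x y \<subseteq> D (g x) (g y)" unfolding D_def using eqv_conj[OF g] pgroup_in[OF G g] by auto
    show "D (g x) (g y) \<subseteq> g ` D x y"
    proof
      fix z assume z: "z \<in> D (g x) (g y)"
      have gz: "g (inv' g z) = z" by (rule pgroup_inv2[OF G g])
      then have "inv' g z \<in> D x y"
        using z eqv_conj[OF g, of "inv' g z" x y] pgroup_in[OF G g, of "inv' g z"] unfolding D_def by auto
      then show "z \<in> g ` D x y" using gz by (metis image_eqI)
    qed
  qed
  moreover have "inj_on g (D x y)" using pgroup_inj[OF G g] by (auto simp: inj_on_def)
  ultimately show ?thesis by (simp add: card_image)
qed

lemma D_self: "D x x = {}" unfolding D_def using eqv_refl by auto

lemma D_mem: "x \<in> \<Omega> \<Longrightarrow> x \<noteq> y \<Longrightarrow> x \<in> D x y" unfolding D_def eqv_def by auto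

lemma Ed_sym: "Ed p q u v \<Longrightarrow> Ed p q v u" unfolding Ed_def by auto

lemma Ed_conj: assumes "h \<in> G" "Ed p q u v" shows "Ed p q (h u) (h v)"
proof -
  obtain g where "g \<in> G" "g p = u \<and> g q = v \<or> g p = v \<and> g q = u" using assms(2) unfolding Ed_def by auto
  then show ?thesis unfolding Ed_def using pgroup_comp[OF G assms(1)] by (intro bexI[of _ "h \<circ> g"]) auto
qed

lemma Ed_conj_iff: assumes "h \<in> G" shows "Ed p q (h u) (h v) \<longleftrightarrow> Ed p q u v"
  using Ed_conj[OF assms] Ed_conj[OF pgroup_inv[OF G assms], of p q "h u" "h v"] pgroup_inv1[OF G assms] by metis

lemma Ed_self: "Ed p q p q" unfolding Ed_def using pgroup_id[OF G] by (intro bexI[of _ id]) auto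

lemma Ed_card: "Ed p q u v \<Longrightarrow> card (D u v) = card (D p q)"
  unfolding Ed_def using card_D_conj D_sym by metis

lemma Ed_in: "p \<in> \<Omega> \<Longrightarrow> q \<in> \<Omega> \<Longrightarrow> Ed p q u v \<Longrightarrow> u \<in> \<Omega> \<and> v \<in> \<Omega>"
  unfolding Ed_def using pgroup_in[OF G] by metis

lemma Ed_ne: "p \<noteq> q \<Longrightarrow> Ed p q u v \<Longrightarrow> u \<noteq> v"
  unfolding Ed_def using pgroup_inj[OF G] by metis

lemma N_sub: "p \<in> \<Omega> \<Longrightarrow> q \<in> \<Omega> \<Longrightarrow> N p q u \<subseteq> \<Omega>"
  unfolding N_def by (auto dest: Ed_in)

lemma card_N: assumes "u \<in> \<Omega>" "v \<in> \<Omega>" shows "card (N p q u) = card (N p q v)"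
proof -
  obtain g where g: "g \<in> G" "g u = v" using trans[OF assms] by auto
  have "N p q v = g ` N p q u"
  proof
    show "g ` N p q u \<subseteq> N p q v" unfolding N_def using Ed_conj[OF g(1), of p q u] g(2) by auto
    show "N p q v \<subseteq> g ` N p q u"
    proof
      fix w assume w: "w \<in> N p q v"
      have gw: "g (inv' g w) = w" by (rule pgroup_inv2[OF G g(1)])
      then have "inv' g w \<in> N p q u" using w g(2) Ed_conj_iff[OF g(1), of p q u "inv' g w"] unfolding N_def by auto
      then show "w \<in> g ` N p q u" using gw by (metis image_eqI)
    qed
  qed
  moreover have "inj_on g (N p q u)" using pgroup_inj[OF G g(1)] by (auto simp: inj_on_def)
  ultimately show ?thesis by (simp add: card_image)
qed

text \<open>A connected component of an orbital graph is a block, so primitivity allows only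
  one.\<close>

lemma connected:
  assumes pq: "p \<in> \<Omega>" "q \<in> \<Omega>" "p \<noteq> q" and uv: "u \<in> \<Omega>" "v \<in> \<Omega>"
  shows "(Ed p q)\<^sup>*\<^sup>* u v"
proof -
  let ?R = "(Ed p q)\<^sup>*\<^sup>*"
  have sym: "?R x y \<Longrightarrow> ?R y x" for x y
    by (induction rule: rtranclp_induct) (auto intro: converse_rtranclp_into_rtranclp Ed_sym)
  have conj: "?R (g x) (g y)" if "g \<in> G" "?R x y" for g x y
    using that(2) by (induction rule: rtranclp_induct) (auto intro: rtranclp.rtrancl_into_rtrancl Ed_conj[OF that(1)])
  define B where "B = {y \<in> \<Omega>. ?R p y}"
  have "{p, q} \<subseteq> B" unfolding B_def using pq Ed_self by auto
  then have "card {p, q} \<le> card B" by (rule card_mono[rotated]) (simp add: B_def fin)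
  then have "2 \<le> card B" using pq by simp
  moreover have "g ` B = B \<or> g ` B \<inter> B = {}" if g: "g \<in> G" for g
  proof (rule disjCI)
    assume "g ` B \<inter> B \<noteq> {}"
    then obtain y where y: "y \<in> B" "g y \<in> B" by auto
    have "?R (g p) (g y)" using conj[OF g] y(1) unfolding B_def by auto
    then have pgp: "?R p (g p)" using y(2) sym unfolding B_def by (metis (no_types, lifting) mem_Collect_eq rtranclp_trans)
    have "g ` B \<subseteq> B" using conj[OF g] pgp pgroup_in[OF G g] unfolding B_def by (auto intro: rtranclp_trans)
    moreover have "card (g ` B) = card B" by (rule card_image) (use pgroup_inj[OF G g] in \<open>auto simp: inj_on_def\<close>)
    ultimately show "g ` B = B" by (rule card_subset_eq[rotated]) (simp add: B_def fin)
  qed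
  ultimately have "B = \<Omega>" using prim unfolding primitive_on_def by (metis (no_types, lifting) B_def mem_Collect_eq subsetI)
  then have "?R p u" "?R p v" using uv unfolding B_def by auto
  then show ?thesis using sym rtranclp_trans by metis
qed

definition "gdist p q z u = (LEAST n. (Ed p q ^^ n) z u)"

lemma gdist_path:
  assumes "p \<in> \<Omega>" "q \<in> \<Omega>" "p \<noteq> q" "z \<in> \<Omega>" "u \<in> \<Omega>"
  shows "(Ed p q ^^ gdist p q z u) z u"
proof -
  have "\<exists>n. (Ed p q ^^ n) z u" using connected[OF assms] rtranclp_power by metis
  then show ?thesis unfolding gdist_def by (rule LeastI_ex)
qed

lemma gdist_le: "(Ed p q ^^ n) z u \<Longrightarrow> gdist p q z u \<le> n"
  unfolding gdist_def by (rule Least_le)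

lemma relpow_conj:
  assumes g: "g \<in> G" shows "(Ed p q ^^ n) z u \<Longrightarrow> (Ed p q ^^ n) (g z) (g u)"
  by (induction n arbitrary: u) (auto intro: Ed_conj[OF g] relcomppI)

lemma gdist_conj: assumes g: "g \<in> G" shows "gdist p q (g z) (g u) = gdist p q z u"
proof -
  have "(Ed p q ^^ n) (g z) (g u) \<longleftrightarrow> (Ed p q ^^ n) z u" for n
    using relpow_conj[OF g] relpow_conj[OF pgroup_inv[OF G g], where z = "g z" and u = "g u"] pgroup_inv1[OF G g] by auto
  then show ?thesis unfolding gdist_def by simp
qed

lemma gdist_step:
  assumes "p \<in> \<Omega>" "q \<in> \<Omega>" "p \<noteq> q" "z \<in> \<Omega>" "u \<in> \<Omega>" "Ed p q u v"
  shows "gdist p q z v \<le> gdist p q z u + 1"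
  using gdist_le[where n = "Suc (gdist p q z u)" and u = v] gdist_path[OF assms(1-5)] assms(6) by auto

lemma gdist_pred:
  assumes "p \<in> \<Omega>" "q \<in> \<Omega>" "p \<noteq> q" "z \<in> \<Omega>" "u \<in> \<Omega>" "u \<noteq> z"
  shows "\<exists>v. Ed p q u v \<and> v \<in> \<Omega> \<and> gdist p q z v < gdist p q z u"
proof -
  have "gdist p q z u \<noteq> 0" using gdist_path[OF assms(1-5)] assms(6) by (metis relpowp_0_E)
  then obtain n where n: "gdist p q z u = Suc n" using not0_implies_Suc by blast
  then obtain v where v: "(Ed p q ^^ n) z v" "Ed p q v u"
    using gdist_path[OF assms(1-5)] by (metis relpowp_Suc_E)
  then show ?thesis using n gdist_le[OF v(1)] Ed_sym[OF v(2)] Ed_in[OF assms(1,2) v(2)] by auto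
qed

text \<open>Counting edges between different spheres around each vertex.\<close>

lemma radial:
  assumes pq: "p \<in> \<Omega>" "q \<in> \<Omega>" "p \<noteq> q"
  shows "2 * (card \<Omega> - 1) \<le> card (D p q) * card (N p q p)"
proof -
  let ?E = "{(u, v). u \<in> \<Omega> \<and> v \<in> N p q u}"
  have E: "?E = Sigma \<Omega> (N p q)" by auto
  have fN: "finite (N p q u)" for u by (rule finite_subset[OF N_sub[OF pq(1,2)] fin])
  have finE: "finite ?E" unfolding E using fin fN by auto
  have cE: "card ?E = card \<Omega> * card (N p q p)"
    unfolding E using fin fN card_N[OF _ pq(1)] by (simp add: card_SigmaI)
  \<comment> \<open>The stabiliser of \<open>z\<close> preserves the distance from \<open>z\<close>,
    so \<open>z\<close> distinguishes the ends of every edge between different spheres. Each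
    \<open>u\<close> other than \<open>z\<close> has an edge to a point nearer to \<open>z\<close>;
    counting both orientations gives the factor 2.\<close>
  have lower: "2 * (card \<Omega> - 1) \<le> card {e \<in> ?E. z \<in> D (fst e) (snd e)}" if z: "z \<in> \<Omega>" for z
  proof -
    let ?d = "gdist p q z"
    define v where "v u = (SOME v. Ed p q u v \<and> v \<in> \<Omega> \<and> ?d v < ?d u)" for u
    have v: "Ed p q u (v u) \<and> v u \<in> \<Omega> \<and> ?d (v u) < ?d u" if "u \<in> \<Omega> - {z}" for u
      unfolding v_def by (rule someI_ex) (use gdist_pred[OF pq z, of u] that in auto)
    have sep: "z \<in> D a b" if "?d a \<noteq> ?d b" for a b
      unfolding D_def using z that gdist_conj[of _ p q z a] unfolding eqv_def by auto metis
    let ?A = "(\<lambda>u. (u, v u)) ` (\<Omega> - {z})" let ?B = "(\<lambda>u. (v u, u)) ` (\<Omega> - {z})"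
    have "?A \<subseteq> {e \<in> ?E. z \<in> D (fst e) (snd e)}"
      using v sep by (fastforce simp: N_def)
    moreover have "?B \<subseteq> {e \<in> ?E. z \<in> D (fst e) (snd e)}"
      using v sep Ed_sym by (fastforce simp: N_def)
    moreover have "?A \<inter> ?B = {}"
    proof -
      have False if "u \<in> \<Omega> - {z}" "u' \<in> \<Omega> - {z}" "u = v u'" "v u = u'" for u u'
        using v[OF that(1)] v[OF that(2)] that(3,4) by auto
      then show ?thesis by fastforce
    qed
    moreover have "card ?A = card \<Omega> - 1" "card ?B = card \<Omega> - 1"
      using fin z by (subst card_image; auto simp: inj_on_def)+
    ultimately show ?thesis
      using card_mono[of "{e \<in> ?E. z \<in> D (fst e) (snd e)}" "?A \<union> ?B"] finE fin
      by (simp add: card_Un_disjoint)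
  qed
  have "card \<Omega> * (2 * (card \<Omega> - 1)) = (\<Sum>z\<in>\<Omega>. 2 * (card \<Omega> - 1))" by simp
  also have "\<dots> \<le> (\<Sum>z\<in>\<Omega>. card {e \<in> ?E. z \<in> D (fst e) (snd e)})" by (rule sum_mono) (rule lower)
  also have "\<dots> = (\<Sum>e\<in>?E. card {z \<in> \<Omega>. z \<in> D (fst e) (snd e)})" by (rule sum_card_swap[OF fin finE])
  also have "\<dots> = (\<Sum>e\<in>?E. card (D p q))"
  proof (rule sum.cong[OF refl])
    fix e assume "e \<in> ?E"
    then have "Ed p q (fst e) (snd e)" by (auto simp: N_def)
    moreover have "{z \<in> \<Omega>. z \<in> D (fst e) (snd e)} = D (fst e) (snd e)" by (auto simp: D_def)
    ultimately show "card {z \<in> \<Omega>. z \<in> D (fst e) (snd e)} = card (D p q)" using Ed_card by simp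
  qed
  also have "\<dots> = card \<Omega> * (card (D p q) * card (N p q p))" by (simp add: cE)
  finally show ?thesis using pq fin by (metis card_gt_0_iff empty_iff mult_le_cancel1)
qed

end

lemma stab_stab: "stab (stab G p) q = stab (stab G q) p"
  unfolding stab_def by auto

lemma orb_stab_conj:
  assumes G: "pgroup \<Omega> G" and h: "h \<in> G"
  shows "orb (stab G (h z)) (h x) = h ` orb (stab G z) x"
proof
  show "h ` orb (stab G z) x \<subseteq> orb (stab G (h z)) (h x)"
  proof (clarsimp simp: orb_def stab_def)
    fix g assume "g \<in> G" "g z = z"
    then show "h (g x) \<in> (\<lambda>g. g (h x)) ` {g \<in> G. g (h z) = h z}"
      using pgroup_conj[OF G h] by (intro image_eqI[of _ _ "h \<circ> g \<circ> inv' h"]) (auto simp: pgroup_inv1[OF G h])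
  qed
  show "orb (stab G (h z)) (h x) \<subseteq> h ` orb (stab G z) x"
  proof (clarsimp simp: orb_def stab_def)
    fix g assume g: "g \<in> G" "g (h z) = h z"
    let ?k = "inv' h \<circ> (g \<circ> h)"
    have "?k \<in> G" using pgroup_comp[OF G pgroup_inv[OF G h] pgroup_comp[OF G g(1) h]] .
    moreover have "?k z = z" using g(2) pgroup_inv1[OF G h] by simp
    moreover have "g (h x) = h (?k x)" using pgroup_inv2[OF G h] by simp
    ultimately show "g (h x) \<in> h ` (\<lambda>g. g x) ` {g \<in> G. g z = z}" by blast
  qed
qed

context uniprimitive
begin

lemma orb_all: assumes "x \<in> \<Omega>" shows "orb G x = \<Omega>"
  using orb_subset[OF G assms] trans[OF assms] unfolding orb_def by (auto simp: image_iff) (metis)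

lemma paired_suborbit: assumes "p \<in> \<Omega>" "q \<in> \<Omega>"
  shows "card (orb (stab G p) q) = card (orb (stab G q) p)"
proof -
  have "card \<Omega> * card (stab G p) = card \<Omega> * card (stab G q)"
    using orbit_stabilizer[OF G, of p] orbit_stabilizer[OF G, of q] orb_all assms by metis
  moreover have "card \<Omega> > 0" using assms fin card_gt_0_iff by blast
  ultimately have "card (stab G p) = card (stab G q)" by simp
  then have "card (orb (stab G p) q) * card (stab (stab G p) q) = card (orb (stab G q) p) * card (stab (stab G p) q)"
    using orbit_stabilizer[OF pgroup_stab[OF G], of p q] orbit_stabilizer[OF pgroup_stab[OF G], of q p] stab_stab[of G q p] by simp
  moreover have "card (stab (stab G p) q) > 0" by (rule pgroup_card_pos[OF pgroup_stab[OF pgroup_stab[OF G]]])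
  ultimately show ?thesis by simp
qed

text \<open>The neighbours of \<open>p\<close> form the suborbit of \<open>q\<close> and the one
  paired with it, and paired suborbits have the same length.\<close>

lemma deg_le: assumes pq: "p \<in> \<Omega>" "q \<in> \<Omega>"
  shows "card (N p q p) \<le> 2 * card (orb (stab G p) q)"
proof -
  let ?B = "{g p | g. g \<in> G \<and> g q = p}"
  have sub: "N p q p \<subseteq> orb (stab G p) q \<union> ?B"
    unfolding N_def Ed_def orb_def stab_def by auto
  have B: "finite ?B \<and> card ?B \<le> card (orb (stab G p) q)"
  proof (cases "?B = {}")
    case True
    show ?thesis unfolding True by simp
  next
    case False
    then obtain h where h: "h \<in> G" "h q = p" by auto
    have Bsub: "?B \<subseteq> orb (stab G p) (h p)"
    proof (clarsimp)
      fix g assume g: "g \<in> G" "p = g q"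
      let ?s = "g \<circ> inv' h"
      have "?s \<in> stab G p" unfolding stab_def
        using g h pgroup_comp[OF G g(1) pgroup_inv[OF G h(1)]] pgroup_inv1[OF G h(1), of q] by auto
      moreover have "?s (h p) = g (g q)" using g(2) pgroup_inv1[OF G h(1)] by simp
      ultimately show "g (g q) \<in> orb (stab G (g q)) (h (g q))" using g(2) unfolding orb_def by (metis image_eqI)
    qed
    have co: "card (orb (stab G p) (h p)) = card (orb (stab G p) q)"
    proof -
      have "orb (stab G (h q)) (h p) = h ` orb (stab G q) p" by (rule orb_stab_conj[OF G h(1)])
      moreover have "inj_on h (orb (stab G q) p)" using pgroup_inj[OF G h(1)] by (auto simp: inj_on_def)
      ultimately show ?thesis using h(2) paired_suborbit[OF pq] by (simp add: card_image)
    qed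
    have "finite (orb (stab G p) (h p))" by (rule finite_orb[OF pgroup_stab[OF G]])
    then show ?thesis using finite_subset[OF Bsub] card_mono[OF _ Bsub] co by simp
  qed
  have fo: "finite (orb (stab G p) q)" by (rule finite_orb[OF pgroup_stab[OF G]])
  have "card (N p q p) \<le> card (orb (stab G p) q \<union> ?B)" by (rule card_mono[OF _ sub]) (use B fo in auto)
  also have "\<dots> \<le> card (orb (stab G p) q) + card ?B" by (rule card_Un_le)
  finally show ?thesis using B by simp
qed

lemma eqv_orb: "{y. eqv z x y} = orb (stab G z) x"
  unfolding eqv_def orb_def stab_def by auto

lemma path_D:
  assumes "(Ed p q ^^ n) x y" shows "card (D x y) \<le> n * card (D p q)"
  using assms
proof (induction n arbitrary: y)
  case 0 then show ?case by (auto simp: D_self)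
next
  case (Suc n)
  then obtain w where w: "(Ed p q ^^ n) x w" "Ed p q w y" by (metis relpowp_Suc_E)
  then show ?case using Suc.IH[OF w(1)] D_tri[of x y w] Ed_card[OF w(2)] by simp
qed

text \<open>The value at \<open>(p, q)\<close> is compared with the maximum \<open>M\<close>. Along
  each edge of the orbital graph the metric grows by at most \<open>card (D p q)\<close>, so a point
  far from \<open>a\<close> in the metric needs a long geodesic. Disjoint neighbourhoods along it
  consist of points near \<open>a\<close>, and there are few of these. So the degree is at most a
  multiple of \<open>card (D p q)\<close>, and \<open>radial\<close> finishes.\<close>

lemma D_large:
  assumes z0: "z0 \<in> \<Omega>" "x0 \<in> \<Omega>" "y0 \<in> \<Omega>" "x0 \<noteq> z0" "y0 \<noteq> z0" "\<not> eqv z0 x0 y0"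
    and pq: "p \<in> \<Omega>" "q \<in> \<Omega>" "p \<noteq> q"
  shows "card \<Omega> - 1 \<le> 8 * (card (D p q))\<^sup>2"
proof -
  let ?d = "card \<Omega>" let ?\<mu> = "card (D p q)"
  have dpos: "?d > 0" using z0 fin card_gt_0_iff by blast
  have fo: "finite (orb (stab G z) x)" for z x by (rule finite_orb[OF pgroup_stab[OF G]])
  have osub: "orb (stab G z) x \<subseteq> \<Omega>" if "x \<in> \<Omega>" for z x
    by (rule orb_subset[OF pgroup_stab[OF G] that])
  define MS where "MS = (\<lambda>(x, y). card (D x y)) ` (\<Omega> \<times> \<Omega>)"
  have MSf: "finite MS" "MS \<noteq> {}" unfolding MS_def using fin z0 by auto
  define M where "M = Max MS"
  have Mmax: "card (D x y) \<le> M" if "x \<in> \<Omega>" "y \<in> \<Omega>" for x y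
    unfolding M_def by (rule Max_ge[OF MSf(1)]) (use that in \<open>auto simp: MS_def\<close>)
  obtain a b where ab: "a \<in> \<Omega>" "b \<in> \<Omega>" "M = card (D a b)"
  proof -
    have "M \<in> MS" unfolding M_def by (rule Max_in[OF MSf])
    then show ?thesis using that unfolding MS_def by auto
  qed
  define OS where "OS = (\<lambda>(z, x). card (orb (stab G z) x)) ` {(z, x). z \<in> \<Omega> \<and> x \<in> \<Omega> \<and> x \<noteq> z}"
  have "finite {(z, x). z \<in> \<Omega> \<and> x \<in> \<Omega> \<and> x \<noteq> z}"
    by (rule finite_subset[of _ "\<Omega> \<times> \<Omega>"]) (use fin in auto)
  then have OSf: "finite OS" "OS \<noteq> {}" unfolding OS_def using z0(1,2,4) by auto
  define m0 where "m0 = Max OS"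
  have m0max: "card (orb (stab G z) x) \<le> m0" if "x \<in> \<Omega>" "z \<in> \<Omega>" "x \<noteq> z" for x z
    unfolding m0_def by (rule Max_ge[OF OSf(1)]) (use that in \<open>auto simp: OS_def\<close>)
  obtain zm wm where zm: "zm \<in> \<Omega>" "wm \<in> \<Omega>" "wm \<noteq> zm" "m0 = card (orb (stab G zm) wm)"
  proof -
    have "m0 \<in> OS" unfolding m0_def by (rule Max_in[OF OSf])
    then show ?thesis using that unfolding OS_def by auto
  qed
  have m0pos: "1 \<le> m0" using zm(4) fo orb_self[OF pgroup_stab[OF G]] card_gt_0_iff by (metis One_nat_def Suc_leI empty_iff)
  have m0max': "card (orb (stab G z) x) \<le> m0" if "x \<in> \<Omega>" "z \<in> \<Omega>" for x z
  proof (cases "x = z")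
    case True
    then have "orb (stab G z) x \<subseteq> {z}" unfolding orb_def stab_def by auto
    then have "card (orb (stab G z) x) \<le> 1" by (metis card_mono finite.emptyI finite_insert card.empty card_insert_disjoint empty_iff One_nat_def)
    then show ?thesis using m0pos by simp
  qed (use m0max that in auto)
  have m0d: "m0 \<le> ?d" using zm osub fin by (simp add: card_mono)
  \<comment> \<open>Averaging over all triples: for fixed \<open>x\<close> and \<open>z\<close> at
    least \<open>card \<Omega> - m0\<close> points \<open>y\<close> lie outside the suborbit of
    \<open>x\<close>, hence some pair is distinguished by that many points.\<close>
  have Mq: "?d - m0 \<le> M"
  proof -
    have cnt: "?d - m0 \<le> card {y \<in> \<Omega>. \<not> eqv z x y}" if "x \<in> \<Omega>" "z \<in> \<Omega>" for x z
    proof -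
      have "{y \<in> \<Omega>. \<not> eqv z x y} = \<Omega> - orb (stab G z) x" using eqv_orb[of z x] by blast
      then have "card {y \<in> \<Omega>. \<not> eqv z x y} = ?d - card (orb (stab G z) x)"
        using osub[OF that(1)] fo by (simp add: card_Diff_subset)
      then show ?thesis using m0max'[OF that] by simp
    qed
    have "?d * (?d * (?d - m0)) = (\<Sum>x\<in>\<Omega>. \<Sum>z\<in>\<Omega>. ?d - m0)" by simp
    also have "\<dots> \<le> (\<Sum>x\<in>\<Omega>. \<Sum>z\<in>\<Omega>. card {y \<in> \<Omega>. \<not> eqv z x y})" by (intro sum_mono cnt)
    also have "\<dots> = (\<Sum>x\<in>\<Omega>. \<Sum>y\<in>\<Omega>. card (D x y))"
      unfolding D_def by (rule sum.cong[OF refl]) (rule sum_card_swap[OF fin fin])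
    also have "\<dots> \<le> (\<Sum>x\<in>\<Omega>. \<Sum>y\<in>\<Omega>. M)" by (intro sum_mono Mmax)
    also have "\<dots> = ?d * (?d * M)" by simp
    finally show ?thesis using dpos by simp
  qed
  \<comment> \<open>The points near \<open>a\<close>; there are at most \<open>2 * M\<close> of
    them. If a longest suborbit has more than half of the points, any two such suborbits meet, which
    makes the common value \<open>DB\<close> on them at least \<open>M / 2\<close>; so
    \<open>S\<close> avoids the one around \<open>a\<close>.\<close>
  define S where "S = {y \<in> \<Omega>. 2 * card (D a y) < M}"
  have S: "card S \<le> 2 * M"
  proof (cases "2 * m0 \<le> ?d")
    case True
    have "card S \<le> ?d" unfolding S_def using fin by (intro card_mono) auto
    then show ?thesis using True Mq by simp
  next
    case False
    define DB where "DB = card (D zm wm)"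
    have big: "\<exists>w\<in>\<Omega>. card (orb (stab G y) w) = m0 \<and> (\<forall>c\<in>orb (stab G y) w. card (D y c) = DB)" if y: "y \<in> \<Omega>" for y
    proof -
      obtain h where h: "h \<in> G" "h zm = y" using trans[OF zm(1) y] by auto
      have e: "orb (stab G y) (h wm) = h ` orb (stab G zm) wm" using orb_stab_conj[OF G h(1), of zm wm] h(2) by simp
      have "card (orb (stab G y) (h wm)) = m0" unfolding e zm(4)
        by (rule card_image) (use pgroup_inj[OF G h(1)] in \<open>auto simp: inj_on_def\<close>)
      moreover have "card (D y c) = DB" if cc: "c \<in> orb (stab G y) (h wm)" for c
      proof -
        obtain k where k: "k \<in> G" "k zm = zm" "c = h (k wm)" using cc unfolding e unfolding orb_def stab_def by auto
        then show ?thesis using card_D_conj[OF h(1), of zm "k wm"] card_D_conj[OF k(1), of zm wm] h(2) unfolding DB_def by simp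
      qed
      moreover have "h wm \<in> \<Omega>" using zm(2) pgroup_in[OF G h(1)] by auto
      ultimately show ?thesis by blast
    qed
    obtain wa where wa: "wa \<in> \<Omega>" "card (orb (stab G a) wa) = m0" "\<forall>c\<in>orb (stab G a) wa. card (D a c) = DB"
      using big[OF ab(1)] by auto
    have le2: "card (D a y) \<le> 2 * DB" if y: "y \<in> \<Omega>" for y
    proof -
      obtain wy where wy: "wy \<in> \<Omega>" "card (orb (stab G y) wy) = m0" "\<forall>c\<in>orb (stab G y) wy. card (D y c) = DB"
        using big[OF y] by auto
      have "orb (stab G a) wa \<inter> orb (stab G y) wy \<noteq> {}"
      proof
        assume "orb (stab G a) wa \<inter> orb (stab G y) wy = {}"
        then have "card (orb (stab G a) wa \<union> orb (stab G y) wy) = m0 + m0" using fo wa wy by (simp add: card_Un_disjoint)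
        moreover have "card (orb (stab G a) wa \<union> orb (stab G y) wy) \<le> ?d" using osub wa wy fin by (simp add: card_mono)
        ultimately show False using False by simp
      qed
      then obtain c where "c \<in> orb (stab G a) wa" "c \<in> orb (stab G y) wy" by auto
      then show ?thesis using wa(3) wy(3) D_tri[of a y c] D_sym[of c y] by simp
    qed
    have "S \<subseteq> \<Omega> - orb (stab G a) wa" unfolding S_def using wa(3) le2[OF ab(2)] ab(3) by auto
    then have "card S \<le> card (\<Omega> - orb (stab G a) wa)" using fin by (simp add: card_mono)
    also have "\<dots> = ?d - m0" using osub[OF wa(1)] fo wa(2) by (simp add: card_Diff_subset)
    finally show ?thesis using Mq by simp
  qed
  \<comment> \<open>Here it enters that \<open>G\<close> is not doubly transitive: beside a longest
    suborbit of \<open>z0\<close> there is another one, shorter than \<open>M\<close>. Its orbital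
    graph has degree at most \<open>2 * M\<close>, and \<open>radial\<close> applies to that
    graph.\<close>
  have MM: "?d - 1 \<le> M * M"
  proof -
    have "\<exists>w\<in>{x0, y0}. card (orb (stab G z0) w) + 1 \<le> ?d - m0 + 1 \<and> card (orb (stab G z0) w) + 1 \<le> ?d - m0"
    proof -
      obtain h where h: "h \<in> G" "h zm = z0" using trans[OF zm(1) z0(1)] by auto
      let ?O = "orb (stab G z0) (h wm)"
      have cO: "card ?O = m0"
        using orb_stab_conj[OF G h(1), of zm wm] h(2) pgroup_inj[OF G h(1)] zm(4) by (simp add: card_image inj_on_def)
      have hw: "h wm \<in> \<Omega>" "h wm \<noteq> z0"
        using zm(2,3) h(2) pgroup_in[OF G h(1), of wm] pgroup_inj[OF G h(1), of wm zm] by auto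
      have z0O: "z0 \<notin> orb (stab G z0) w" if "w \<noteq> z0" for w
      proof
        assume "z0 \<in> orb (stab G z0) w"
        then obtain g where "g \<in> G" "g z0 = z0" "g w = z0" unfolding orb_def stab_def by auto
        then show False using that pgroup_inj[OF G, of g w z0] by simp
      qed
      have dis: "orb (stab G z0) w \<inter> ?O = {}" if "\<not> eqv z0 w (h wm)" for w
        using that eqv_orb[of z0 w] eqv_orb[of z0 "h wm"] eqv_sym eqv_trans by blast
      have "\<not> eqv z0 x0 (h wm) \<or> \<not> eqv z0 y0 (h wm)"
        using z0(6) eqv_sym[of z0 y0 "h wm"] eqv_trans[of z0 x0 "h wm" y0] by auto
      then obtain w where w: "w \<in> {x0, y0}" "\<not> eqv z0 w (h wm)" by auto
      have w': "w \<in> \<Omega>" "w \<noteq> z0" using w(1) z0 by auto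
      have "insert z0 (orb (stab G z0) w) \<subseteq> \<Omega> - ?O" using osub[OF w'(1)] z0O[OF hw(2)] dis[OF w(2)] z0(1) by auto
      then have "card (insert z0 (orb (stab G z0) w)) \<le> card (\<Omega> - ?O)" using fin by (simp add: card_mono)
      also have "\<dots> = ?d - m0" using osub[OF hw(1)] fo cO by (simp add: card_Diff_subset)
      finally show ?thesis using w(1) z0O[OF w'(2)] fo by auto
    qed
    then obtain w where w: "w \<in> {x0, y0}" "card (orb (stab G z0) w) + 1 \<le> ?d - m0" by auto
    have w': "w \<in> \<Omega>" "w \<noteq> z0" using w(1) z0 by auto
    have "2 * (?d - 1) \<le> card (D z0 w) * card (N z0 w z0)" by (rule radial[OF z0(1) w'(1)]) (use w' in simp)
    also have "\<dots> \<le> M * (2 * card (orb (stab G z0) w))"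
      by (rule mult_mono[OF Mmax[OF z0(1) w'(1)] deg_le[OF z0(1) w'(1)]]) auto
    also have "\<dots> \<le> M * (2 * M)" using w(2) Mq by (intro mult_left_mono) auto
    finally show ?thesis by simp
  qed
  have Mpos: "M > 0"
  proof -
    have "card (D z0 x0) > 0" using D_mem[OF z0(1), of x0] z0 finite_D card_gt_0_iff by blast
    then show ?thesis using Mmax[OF z0(1,2)] by simp
  qed
  \<comment> \<open>The least distance from \<open>a\<close> in the graph of a point outside
    \<open>S\<close>; everything strictly nearer lies in \<open>S\<close>.\<close>
  define s where "s = (LEAST n. \<exists>y\<in>\<Omega>. M \<le> 2 * card (D a y) \<and> gdist p q a y = n)"
  have ex: "\<exists>n. \<exists>y\<in>\<Omega>. M \<le> 2 * card (D a y) \<and> gdist p q a y = n" using ab by force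
  obtain y where y: "y \<in> \<Omega>" "M \<le> 2 * card (D a y)" "gdist p q a y = s"
    using LeastI_ex[OF ex] unfolding s_def by auto
  have smin: "w \<in> S" if "w \<in> \<Omega>" "gdist p q a w < s" for w
    using not_less_Least[of "gdist p q a w" "\<lambda>n. \<exists>y\<in>\<Omega>. M \<le> 2 * card (D a y) \<and> gdist p q a y = n"] that
    unfolding s_def S_def by auto
  have path: "(Ed p q ^^ s) a y" using gdist_path[OF pq ab(1) y(1)] y(3) by simp
  have "card (D a y) \<le> s * ?\<mu>" by (rule path_D[OF path])
  with y(2) have Ms: "M \<le> 2 * (s * ?\<mu>)" by linarith
  then have spos: "s \<noteq> 0" using Mpos by (cases s) auto
  show ?thesis
  proof (cases "s = 1")
    case True
    then have "M * M \<le> (2 * ?\<mu>) * (2 * ?\<mu>)" using Ms by (intro mult_mono) auto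
    then show ?thesis using MM by (simp add: power2_eq_square)
  next
    case False
    then have s2: "2 \<le> s" using spos by simp
    obtain f where f: "f 0 = a" "f s = y" "\<And>i. i < s \<Longrightarrow> Ed p q (f i) (f (Suc i))"
      using path relpowp_fun_conv[of s "Ed p q" a y] by auto
    have fin\<Omega>: "f i \<in> \<Omega>" if "i \<le> s" for i
      using that f ab(1) Ed_in[OF pq(1,2)] by (cases i) (auto, metis Suc_le_lessD)
    have up: "gdist p q a (f i) \<le> i" if "i \<le> s" for i
      using that
    proof (induction i)
      case 0
      then show ?case using gdist_le[where n = 0 and z = a and u = a and p = p and q = q] f(1) by simp
    next
      case (Suc i)
      then show ?case using gdist_step[OF pq ab(1) fin\<Omega>[of i] f(3)[of i]] by simp
    qed
    have down: "s - j \<le> gdist p q a (f (s - j))" if "j \<le> s" for j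
      using that
    proof (induction j)
      case 0 then show ?case using y(3) f(2) by simp
    next
      case (Suc j)
      have e: "Ed p q (f (s - Suc j)) (f (s - j))" using f(3)[of "s - Suc j"] Suc.prems by (simp add: Suc_diff_Suc)
      have "gdist p q a (f (s - j)) \<le> gdist p q a (f (s - Suc j)) + 1"
        by (rule gdist_step[OF pq ab(1) fin\<Omega> e]) simp
      then show ?case using Suc by simp
    qed
    have gd: "gdist p q a (f i) = i" if "i \<le> s" for i
      using up[OF that] down[of "s - i"] that by simp
    let ?\<rho> = "card (N p q p)"
    define Nb where "Nb u = insert u (N p q u)" for u
    have fN: "finite (N p q u)" for u by (rule finite_subset[OF N_sub[OF pq(1,2)] fin])
    have cNb: "card (Nb u) = ?\<rho> + 1" if "u \<in> \<Omega>" for u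
      using fN card_N[OF that pq(1)] Ed_ne[OF pq(3)] unfolding Nb_def by (simp add: N_def card_insert_if) blast
    have Nbd: "w \<in> \<Omega> \<and> gdist p q a w \<le> i + 1 \<and> i \<le> gdist p q a w + 1" if "w \<in> Nb (f i)" "i \<le> s" for w i
    proof (cases "w = f i")
      case True then show ?thesis using gd fin\<Omega> that(2) by simp
    next
      case False
      then have e: "Ed p q (f i) w" using that(1) unfolding Nb_def N_def by simp
      have wO: "w \<in> \<Omega>" using Ed_in[OF pq(1,2) e] by simp
      show ?thesis using gdist_step[OF pq ab(1) fin\<Omega>[OF that(2)] e] gdist_step[OF pq ab(1) wO Ed_sym[OF e]] gd[OF that(2)] wO by simp
    qed
    \<comment> \<open>Closed neighbourhoods of every third vertex of the geodesic are disjoint, and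
      \<open>3 * j + 2 \<le> s\<close> keeps them at distance less than \<open>s\<close>, hence
      inside \<open>S\<close>. There are \<open>c\<close> of them, with \<open>s \<le> 4 * c\<close>
      because \<open>s\<close> is at least 2.\<close>
    define c where "c = (s + 1) div 3"
    have cs: "3 * j + 2 \<le> s" if "j < c" for j using that unfolding c_def by presburger
    have "(\<Union>j<c. Nb (f (3 * j))) \<subseteq> S"
    proof
      fix w assume "w \<in> (\<Union>j<c. Nb (f (3 * j)))"
      then obtain j where j: "j < c" "w \<in> Nb (f (3 * j))" by auto
      show "w \<in> S" using Nbd[OF j(2)] cs[OF j(1)] by (intro smin) auto
    qed
    moreover have "finite S" unfolding S_def using fin by auto
    moreover have "card (\<Union>j<c. Nb (f (3 * j))) = (\<Sum>j<c. card (Nb (f (3 * j))))"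
    proof (rule card_UN_disjoint)
      show "\<forall>i\<in>{..<c}. finite (Nb (f (3 * i)))" unfolding Nb_def using fN by auto
      show "\<forall>i\<in>{..<c}. \<forall>j\<in>{..<c}. i \<noteq> j \<longrightarrow> Nb (f (3 * i)) \<inter> Nb (f (3 * j)) = {}"
      proof (intro ballI impI)
        fix i j assume ij: "i \<in> {..<c}" "j \<in> {..<c}" "i \<noteq> j"
        show "Nb (f (3 * i)) \<inter> Nb (f (3 * j)) = {}"
        proof (rule ccontr)
          assume "Nb (f (3 * i)) \<inter> Nb (f (3 * j)) \<noteq> {}"
          then obtain w where w: "w \<in> Nb (f (3 * i))" "w \<in> Nb (f (3 * j))" by auto
          show False using Nbd[OF w(1)] Nbd[OF w(2)] cs[of i] cs[of j] ij by auto
        qed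
      qed
    qed simp
    moreover have "(\<Sum>j<c. card (Nb (f (3 * j)))) = (\<Sum>j<c. ?\<rho> + 1)"
    proof (rule sum.cong[OF refl])
      fix j assume "j \<in> {..<c}"
      then have "3 * j \<le> s" using cs[of j] by simp
      then show "card (Nb (f (3 * j))) = ?\<rho> + 1" by (intro cNb fin\<Omega>)
    qed
    ultimately have "(\<Sum>j<c. ?\<rho> + 1) \<le> card S" by (metis card_mono)
    then have "c * (?\<rho> + 1) \<le> card S" by simp
    with S have cM: "c * (?\<rho> + 1) \<le> 2 * M" by linarith
    have s4: "s \<le> 4 * c" unfolding c_def using s2 by presburger
    have "c * (?\<rho> + 1) \<le> 2 * (2 * (s * ?\<mu>))" using cM Ms by linarith
    also have "\<dots> \<le> 2 * (2 * (4 * c * ?\<mu>))" using s4 by (intro mult_left_mono mult_right_mono) auto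
    finally have "c * (?\<rho> + 1) \<le> c * (16 * ?\<mu>)" by (simp add: algebra_simps)
    moreover have "c > 0" unfolding c_def using s2 by auto
    ultimately have "?\<rho> + 1 \<le> 16 * ?\<mu>" by (metis mult_le_cancel1)
    then have "?\<mu> * ?\<rho> \<le> ?\<mu> * (16 * ?\<mu>)" by (intro mult_le_mono2) simp
    with radial[OF pq] have "2 * (?d - 1) \<le> ?\<mu> * (16 * ?\<mu>)" by (rule le_trans)
    also have "\<dots> = 2 * (8 * ?\<mu>\<^sup>2)" by (simp add: power2_eq_square)
    finally show ?thesis by (simp only: mult_le_cancel1)
  qed
qed

text \<open>A set meeting all \<open>D x y\<close> with \<open>x \<noteq> y\<close> is a base.\<close>

lemma order_bound:
  assumes z0: "z0 \<in> \<Omega>" "x0 \<in> \<Omega>" "y0 \<in> \<Omega>" "x0 \<noteq> z0" "y0 \<noteq> z0" "\<not> eqv z0 x0 y0"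
    and d: "16000 < card \<Omega>"
  shows "card G \<le> 2 ^ (7 * (card \<Omega> - 1))"
proof -
  let ?d = "real (card \<Omega>)"
  \<comment> \<open>The factor 0.353 is just below \<open>1 / sqrt 8\<close>, the constant of
    \<open>D_large\<close>; the difference absorbs the \<open>- 1\<close> there.\<close>
  define \<delta> where "\<delta> = 0.353 * sqrt ?d"
  let ?I = "{(x, y). x \<in> \<Omega> \<and> y \<in> \<Omega> \<and> x \<noteq> y}"
  have dl: "\<delta> \<le> card (D x y)" if "x \<in> \<Omega>" "y \<in> \<Omega>" "x \<noteq> y" for x y
  proof -
    have "real (card \<Omega> - 1) \<le> real (8 * (card (D x y))\<^sup>2)" using D_large[OF z0 that] of_nat_le_iff by blast
    then have "?d - 1 \<le> 8 * (real (card (D x y)))\<^sup>2" using d by (simp add: of_nat_diff)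
    moreover have "8 * \<delta>\<^sup>2 = 8 * 0.353\<^sup>2 * ?d" unfolding \<delta>_def power_mult_distrib by simp
    ultimately have "\<delta>\<^sup>2 \<le> (real (card (D x y)))\<^sup>2" using d by (simp add: power2_eq_square)
    then show ?thesis by (rule power2_le_imp_le) simp
  qed
  have \<delta>: "\<delta> > 0" unfolding \<delta>_def using d by auto
  define s where "s = nat \<lceil>2 * ?d / \<delta> * ln ?d\<rceil>"
  have s: "2 * ?d / \<delta> * ln ?d \<le> real s" unfolding s_def by linarith
  have "?I \<subset> \<Omega> \<times> \<Omega>" using z0 by auto
  then have cI: "card ?I < card \<Omega> ^ 2" using psubset_card_mono[of "\<Omega> \<times> \<Omega>" ?I] fin by (simp add: card_cartesian_product power2_eq_square)
  have fI: "finite ?I" by (rule finite_subset[of _ "\<Omega> \<times> \<Omega>"]) (use fin in auto)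
  obtain B where B: "B \<subseteq> \<Omega>" "card B \<le> s" "\<And>i. i \<in> ?I \<Longrightarrow> (case i of (x, y) \<Rightarrow> D x y) \<inter> B \<noteq> {}"
    by (rule hitting_set[OF fin fI, of "\<lambda>(x, y). D x y" \<delta> s])
      (use dl \<delta> s cI d in \<open>auto simp: D_def\<close>)
  have "base_of G B" unfolding base_of_def
  proof (intro ballI impI)
    fix g assume g: "g \<in> G" "\<forall>b\<in>B. g b = b"
    show "g = id"
    proof
      fix x show "g x = id x"
      proof (cases "x \<in> \<Omega>")
        case True
        show ?thesis
        proof (rule ccontr)
          assume "g x \<noteq> id x"
          then have "(x, g x) \<in> ?I" using True pgroup_in[OF G g(1)] by auto
          from B(3)[OF this] obtain b where "b \<in> D x (g x)" "b \<in> B" by auto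
          then show False using g unfolding D_def eqv_def by auto
        qed
      qed (simp add: pgroup_out[OF G g(1)])
    qed
  qed
  then have "card G \<le> card \<Omega> ^ card B" by (rule base_bound[OF G B(1)])
  also have "\<dots> \<le> card \<Omega> ^ s" by (rule power_increasing[OF B(2)]) (use d in auto)
  finally have "real (card G) \<le> ?d ^ s" by (metis of_nat_le_iff of_nat_power)
  then show ?thesis
  proof (rule exp_bound_to_pow)
    let ?q = "?d powr (1/4)"
    have q: "ln ?d \<le> 0.87 * ?q" "11.24 \<le> ?q" using ln_le_root4[of ?d] d by auto
    have q2: "?q * ?q = sqrt ?d" using d by (simp add: powr_add[symmetric] powr_half_sqrt)
    have ln0: "0 \<le> ln ?d" using d by simp
    have "ln ?d * ln ?d \<le> (0.87 * ?q) * (0.87 * ?q)" by (rule mult_mono[OF q(1) q(1)]) (use ln0 in auto)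
    then have l2: "ln ?d * ln ?d \<le> 0.7569 * sqrt ?d" using q2 by (simp add: algebra_simps)
    have ld: "ln ?d \<le> 0.01 * ?d"
    proof -
      have "(126::real) \<le> sqrt ?d" by (rule real_le_rsqrt) (use d in simp)
      then have "sqrt ?d * 126 \<le> sqrt ?d * sqrt ?d" by (rule mult_left_mono) simp
      moreover have "?q * 11.24 \<le> ?q * ?q" by (rule mult_left_mono[OF q(2)]) simp
      ultimately show ?thesis using q(1) q2 by simp
    qed
    have "real s \<le> 2 * ?d / \<delta> * ln ?d + 1" unfolding s_def using \<delta> ln0 by (simp add: ceiling_correct le_of_int_ceiling)
    then have "real s * ln ?d \<le> (2 * ?d / \<delta> * ln ?d + 1) * ln ?d" by (rule mult_right_mono[OF _ ln0])
    also have "\<dots> = 2 * ?d / \<delta> * (ln ?d * ln ?d) + ln ?d" by (simp add: algebra_simps)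
    \<comment> \<open>The leading coefficient \<open>2 * 0.7569 / 0.353\<close> is about 4.29, where
      0.7569 is the square of 0.87; together with 0.01 it leaves room below
      \<open>14/3\<close>.\<close>
    also have "\<dots> \<le> 2 * ?d / \<delta> * (0.7569 * sqrt ?d) + 0.01 * ?d"
      by (intro add_mono mult_left_mono l2 ld) (use \<delta> in auto)
    also have "2 * ?d / \<delta> * (0.7569 * sqrt ?d) = 2 * 0.7569 / 0.353 * ?d"
      unfolding \<delta>_def using d by (simp add: field_simps)
    finally show "real s * ln ?d \<le> 14/3 * (?d - 1)" using d by simp
  qed (use d in auto)
qed

end

subsection \<open>Doubly transitive groups\<close>

text \<open>Transitivity as the extension of partial injections with at most \<open>k\<close>
  points. This works with sets in place of tuples and is monotone in \<open>k\<close> by its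
  form.\<close>

definition ktrans :: "'a set \<Rightarrow> ('a \<Rightarrow> 'a) set \<Rightarrow> nat \<Rightarrow> bool"
  where "ktrans \<Omega> G k \<longleftrightarrow> (\<forall>B\<subseteq>\<Omega>. card B \<le> k \<longrightarrow>
    (\<forall>f. inj_on f B \<longrightarrow> f ` B \<subseteq> \<Omega> \<longrightarrow> (\<exists>g\<in>G. \<forall>b\<in>B. g b = f b)))"

lemma ktransD: "ktrans \<Omega> G k \<Longrightarrow> B \<subseteq> \<Omega> \<Longrightarrow> card B \<le> k \<Longrightarrow> inj_on f B \<Longrightarrow> f ` B \<subseteq> \<Omega>
    \<Longrightarrow> \<exists>g\<in>G. \<forall>b\<in>B. g b = f b"
  unfolding ktrans_def by auto

lemma ktrans2D:
  assumes "ktrans \<Omega> G k" "2 \<le> k" "x \<in> \<Omega>" "y \<in> \<Omega>" "x \<noteq> y" "a \<in> \<Omega>" "b \<in> \<Omega>" "a \<noteq> b"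
  obtains g where "g \<in> G" "g x = a" "g y = b"
proof -
  let ?f = "\<lambda>z. if z = x then a else b"
  have "\<exists>g\<in>G. \<forall>z\<in>{x, y}. g z = ?f z"
    by (rule ktransD[OF assms(1)]) (use assms in \<open>auto simp: inj_on_def\<close>)
  then show ?thesis using that assms(5) by auto
qed

text \<open>For uniformly chosen \<open>g\<close> the pair \<open>(g x, g y)\<close> is uniformly
  distributed over the ordered pairs of distinct points.\<close>

lemma pair_count:
  assumes G: "pgroup \<Omega> G" and t: "ktrans \<Omega> G k" "2 \<le> k" and xy: "x \<in> \<Omega>" "y \<in> \<Omega>" "x \<noteq> y"
    and Q: "Q \<subseteq> {(a, b). a \<in> \<Omega> \<and> b \<in> \<Omega> \<and> a \<noteq> b}"
  shows "card {g \<in> G. (g x, g y) \<in> Q} * (card \<Omega> * (card \<Omega> - 1)) = card Q * card G"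
proof -
  have fin: "finite \<Omega>" by (rule pgroup_finite[OF G])
  let ?P = "{(a, b). a \<in> \<Omega> \<and> b \<in> \<Omega> \<and> a \<noteq> b}"
  let ?F = "\<lambda>g. (g x, g y)"
  let ?S = "{g \<in> G. g x = x \<and> g y = y}"
  have S: "?S \<subseteq> G" by auto
  have F: "?F g = ?F h \<longleftrightarrow> inv' h \<circ> g \<in> ?S" if "g \<in> G" "h \<in> G" for g h
    using that pgroup_comp[OF G pgroup_inv[OF G that(2)] that(1)] pgroup_inv1[OF G that(2)] pgroup_inv2[OF G that(2)]
    by auto metis+
  have im: "?F ` G = ?P"
  proof
    show "?F ` G \<subseteq> ?P" using xy pgroup_in[OF G] pgroup_inj[OF G] by auto
    show "?P \<subseteq> ?F ` G"
    proof clarify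
      fix a b assume "a \<in> \<Omega>" "b \<in> \<Omega>" "a \<noteq> b"
      then obtain g where "g \<in> G" "g x = a" "g y = b" using ktrans2D[OF t xy] by metis
      then show "(a, b) \<in> ?F ` G" by force
    qed
  qed
  have cP: "card ?P = card \<Omega> * (card \<Omega> - 1)"
  proof -
    have "?P = Sigma \<Omega> (\<lambda>a. \<Omega> - {a})" by auto
    then show ?thesis using fin by (simp add: card_SigmaI)
  qed
  have fQ: "finite Q" by (rule finite_subset[OF Q]) (rule finite_subset[of _ "\<Omega> \<times> \<Omega>"], use fin in auto)
  have fG: "finite G" by (rule pgroup_finite_group[OF G])
  have "(\<Sum>e\<in>Q. \<Sum>g\<in>{g \<in> {g \<in> G. ?F g \<in> Q}. ?F g = e}. (1::nat)) = (\<Sum>g\<in>{g \<in> G. ?F g \<in> Q}. 1)"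
    by (rule sum.group) (use fG fQ in auto)
  then have "card {g \<in> G. ?F g \<in> Q} = (\<Sum>e\<in>Q. card {g \<in> {g \<in> G. ?F g \<in> Q}. ?F g = e})" by simp
  also have "\<dots> = (\<Sum>e\<in>Q. card ?S)"
  proof (rule sum.cong[OF refl])
    fix e assume e: "e \<in> Q"
    then have "{g \<in> {g \<in> G. ?F g \<in> Q}. ?F g = e} = {g \<in> G. ?F g = e}" by auto
    moreover have "card {g \<in> G. ?F g = e} = card ?S"
      by (rule card_group_fiber[OF G S F]) (use e Q im in auto)
    ultimately show "card {g \<in> {g \<in> G. ?F g \<in> Q}. ?F g = e} = card ?S" by simp
  qed
  finally have "card {g \<in> G. ?F g \<in> Q} = card Q * card ?S" by simp
  moreover have "card G = card (?F ` G) * card ?S" by (rule card_group_image[OF G S F])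
  then have "card G = card \<Omega> * (card \<Omega> - 1) * card ?S" unfolding im cP .
  ultimately show ?thesis by (simp only: mult_ac)
qed

section \<open>Minimal degree of doubly transitive groups\<close>

lemma card3_cycle:
  assumes G: "pgroup \<Omega> G" and g: "g \<in> G" and c: "card (mov g) = 3"
  shows "\<exists>a b c. a \<noteq> b \<and> b \<noteq> c \<and> a \<noteq> c \<and> g = cyc3 a b c"
proof -
  have inj: "\<And>x y. g x = g y \<longleftrightarrow> x = y" by (rule pgroup_inj[OF G g])
  have mm: "g x \<in> mov g \<longleftrightarrow> x \<in> mov g" for x unfolding mov_def using inj by auto
  obtain a u v where m: "mov g = {a, u, v}" "a \<noteq> u" "u \<noteq> v" "a \<noteq> v" using c by (auto simp: card_3_iff)
  define b where "b = g a" define c where "c = g b"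
  have b: "b \<in> mov g" "b \<noteq> a" using mm[of a] m unfolding b_def mov_def by auto
  have cb: "c \<in> mov g" "c \<noteq> b" using mm[of b] b inj[of b a] b_def unfolding c_def mov_def by auto
  have "c \<noteq> a"
  proof
    assume ca: "c = a"
    obtain w where w: "w \<in> mov g" "w \<noteq> a" "w \<noteq> b" using m b by auto
    have "g w \<in> mov g" "g w \<noteq> w" "g w \<noteq> a" "g w \<noteq> b"
      using mm[of w] w inj[of w b] inj[of w a] ca unfolding c_def b_def mov_def by auto
    then show False using m w b by auto
  qed
  then have abc: "mov g = {a, b, c}" using m b cb by auto
  have "g c \<in> {a, b, c}" "g c \<noteq> b" "g c \<noteq> c" using mm[of c] abc cb inj[of c a] inj[of c b] \<open>c \<noteq> a\<close> unfolding b_def c_def by auto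
  then have "g c = a" by auto
  have "g = cyc3 a b c"
  proof
    fix x show "g x = cyc3 a b c x"
      using \<open>g c = a\<close> abc b_def c_def unfolding cyc3_def mov_def by auto
  qed
  then show ?thesis using b(2) cb(2) \<open>c \<noteq> a\<close> by metis
qed

lemma card2_swap:
  assumes G: "pgroup \<Omega> G" and g: "g \<in> G" and c: "card (mov g) = 2"
  shows "\<exists>a b. a \<noteq> b \<and> g a = b \<and> g b = a \<and> mov g = {a, b}"
proof -
  have inj: "\<And>x y. g x = g y \<longleftrightarrow> x = y" by (rule pgroup_inj[OF G g])
  have mm: "g x \<in> mov g \<longleftrightarrow> x \<in> mov g" for x unfolding mov_def using inj by auto
  obtain a b where m: "mov g = {a, b}" "a \<noteq> b" using c by (auto simp: card_2_iff)
  have "g a \<in> {a, b}" "g b \<in> {a, b}" "g a \<noteq> a" "g b \<noteq> b" using mm[of a] mm[of b] m by (auto simp: mov_def)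
  then show ?thesis using m by auto
qed

text \<open>Averaging the support of a commutator over conjugates \<open>inv' \<tau> \<circ> g \<circ> \<tau>\<close> that move \<open>x\<close> and fix \<open>g x\<close>.\<close>

lemma min_degree:
  assumes G: "pgroup \<Omega> G" and t: "ktrans \<Omega> G 2" and no: "no_cyc3 G" and d: "1000 \<le> card \<Omega>"
    and k: "k \<in> G" "k \<noteq> id"
  shows "10 * card \<Omega> < 41 * card (mov k)"
proof -
  let ?d = "card \<Omega>"
  have fin: "finite \<Omega>" by (rule pgroup_finite[OF G])
  have fG: "finite G" by (rule pgroup_finite_group[OF G])
  obtain g where g: "g \<in> G" "g \<noteq> id" and min: "\<And>h. h \<in> G \<Longrightarrow> h \<noteq> id \<Longrightarrow> card (mov g) \<le> card (mov h)"
    using ex_has_least_nat[of "\<lambda>g. g \<in> G \<and> g \<noteq> id" k "\<lambda>g. card (mov g)"] k by metis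
  define S where "S = mov g" define m where "m = card S"
  have S: "S \<subseteq> \<Omega>" "finite S" using mov_subset[OF G g(1)] fin finite_subset unfolding S_def by auto
  have inj: "\<And>x y. g x = g y \<longleftrightarrow> x = y" by (rule pgroup_inj[OF G g(1)])
  have Sne: "S \<noteq> {}" using g(2) mov_empty[of g] unfolding S_def by simp
  then obtain x where x: "x \<in> S" by auto
  define y where "y = g x"
  have y: "y \<in> S" "y \<noteq> x" using x inj unfolding y_def S_def mov_def by auto
  have m2: "2 \<le> m" using card_mono[OF S(2), of "{x, y}"] x y unfolding m_def by auto
  have "m \<noteq> 3" using card3_cycle[OF G g(1)] no g(1) unfolding m_def S_def no_cyc3_def by metis
  \<comment> \<open>A transposition and a conjugate that shares exactly one point with it have a
    3-cycle as commutator.\<close>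
  moreover have "m \<noteq> 2"
  proof
    assume "m = 2"
    then obtain a b where ab: "a \<noteq> b" "g a = b" "g b = a" "mov g = {a, b}" using card2_swap[OF G g(1)] unfolding m_def S_def by auto
    obtain c where c: "c \<in> \<Omega>" "c \<notin> set [a, b]" using ex_not_in_list[OF fin, of "[a, b]"] d by auto
    have abO: "a \<in> \<Omega>" "b \<in> \<Omega>" using ab(4) S(1) unfolding S_def by auto
    obtain s where s: "s \<in> G" "s a = a" "s b = c" using ktrans2D[OF t order_refl abO ab(1) abO(1) c(1)] c by auto
    define h where "h = s \<circ> g \<circ> inv' s"
    have hG: "h \<in> G" unfolding h_def by (rule pgroup_conj[OF G s(1) g(1)])
    have invs: "inv' s z = w \<longleftrightarrow> z = s w" for z w using pgroup_inv1[OF G s(1)] pgroup_inv2[OF G s(1)] by metis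
    have ha: "h a = c" unfolding h_def using s ab invs[of a a] by simp
    have "mov h \<subseteq> {a, c}"
    proof
      fix z assume "z \<in> mov h"
      then have "g (inv' s z) \<noteq> inv' s z" unfolding mov_def h_def using invs[of z "g (inv' s z)"] by auto
      then have "inv' s z \<in> {a, b}" using ab(4) unfolding mov_def by auto
      then show "z \<in> {a, c}" using invs[of z a] invs[of z b] s by auto
    qed
    moreover have "a \<in> mov h" using ha c unfolding mov_def by auto
    ultimately have int: "mov g \<inter> mov h = {a}" using ab(4) c by auto
    have "comm g h = cyc3 a b c"
      using comm_cyc3[OF pgroup_bij[OF G g(1)] pgroup_bij[OF G hG] int] ab(2) ha by simp
    then show False using pgroup_comm[OF G g(1) hG] no ab(1) c unfolding no_cyc3_def by auto
  qed
  ultimately have m4: "4 \<le> m" using m2 by simp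
  have xO: "x \<in> \<Omega>" "y \<in> \<Omega>" using x y S by auto
  have md: "m \<le> ?d" unfolding m_def by (rule card_mono[OF fin S(1)])
  \<comment> \<open>For \<open>\<tau>\<close> in \<open>A\<close> the conjugate moves
    \<open>x\<close> and fixes \<open>y = g x\<close>. If it commuted with \<open>g\<close>, it
    would have to fix \<open>x\<close>; so the commutator is nontrivial and moves at least
    \<open>m\<close> points.\<close>
  define A where "A = {\<tau> \<in> G. \<tau> x \<in> S \<and> \<tau> y \<notin> S}"
  have pt: "m \<le> 3 * card {z \<in> S. \<tau> z \<in> S}" if "\<tau> \<in> A" for \<tau>
  proof -
    have \<tau>: "\<tau> \<in> G" "\<tau> x \<in> S" "\<tau> y \<notin> S" using that unfolding A_def by auto
    let ?h = "inv' \<tau> \<circ> g \<circ> \<tau>"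
    have h: "?h \<in> G" using pgroup_comp[OF G pgroup_comp[OF G pgroup_inv[OF G \<tau>(1)] g(1)] \<tau>(1)] .
    have hz: "?h z = z \<longleftrightarrow> \<tau> z \<notin> S" for z
      unfolding S_def mov_def using pgroup_inv1[OF G \<tau>(1)] pgroup_inv2[OF G \<tau>(1)] by (auto, metis)
    have I: "S \<inter> mov ?h = {z \<in> S. \<tau> z \<in> S}" using hz unfolding mov_def by auto
    have "comm g ?h \<noteq> id"
    proof
      assume e: "comm g ?h = id"
      have "g \<circ> ?h = ?h \<circ> g"
      proof
        fix z
        have "comm g ?h (?h (g z)) = g (?h z)"
          unfolding comm_def o_apply[of _ _ "?h (g z)"] o_apply[of "g \<circ> ?h"] o_apply[of g]
          using pgroup_inv1[OF G h] pgroup_inv1[OF G g(1)] by (simp add: o_def)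
        then show "(g \<circ> ?h) z = (?h \<circ> g) z" using e by simp
      qed
      then have "g (?h x) = ?h (g x)" by (metis comp_apply)
      then have "?h x = x" using hz[of y] \<tau>(3) inj unfolding y_def by simp
      then show False using hz[of x] \<tau>(2) by simp
    qed
    then have "m \<le> card (mov (comm g ?h))" unfolding m_def S_def by (rule min[OF pgroup_comm[OF G g(1) h]])
    also have "\<dots> \<le> 3 * card (mov g \<inter> mov ?h)"
      by (rule card_mov_comm[OF pgroup_bij[OF G g(1)] pgroup_bij[OF G h]]) (use S in \<open>simp add: S_def\<close>)
    finally show ?thesis using I unfolding S_def by simp
  qed
  let ?P = "?d * (?d - 1)"
  have fA: "finite A" unfolding A_def using fG by auto
  have cA: "card A * ?P = m * (?d - m) * card G"
  proof -
    have "A = {\<tau> \<in> G. (\<tau> x, \<tau> y) \<in> S \<times> (\<Omega> - S)}" unfolding A_def using pgroup_in[OF G] xO by auto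
    moreover have "card (S \<times> (\<Omega> - S)) = m * (?d - m)"
      using S fin unfolding m_def by (simp add: card_cartesian_product card_Diff_subset)
    ultimately show ?thesis using pair_count[OF G t order_refl xO y(2)[symmetric], of "S \<times> (\<Omega> - S)"] S by auto
  qed
  \<comment> \<open>For \<open>z = x\<close> the condition on \<open>\<tau> y\<close> is dropped,
    \<open>z = y\<close> is excluded by the definition of \<open>A\<close>, and for the remaining
    \<open>z\<close> only the pair \<open>(\<tau> x, \<tau> z)\<close> is used.\<close>
  have each: "card {\<tau> \<in> A. \<tau> z \<in> S} * ?P \<le> (if z = x then m * (?d - 1) else if z = y then 0 else m * (m - 1)) * card G"
    if z: "z \<in> S" for z
  proof -
    consider "z = x" | "z = y" "z \<noteq> x" | "z \<noteq> x" "z \<noteq> y" by blast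
    then show ?thesis
    proof cases
      case 1
      let ?Q = "{(a, b). a \<in> S \<and> b \<in> \<Omega> \<and> a \<noteq> b}"
      have "?Q = Sigma S (\<lambda>a. \<Omega> - {a})" by auto
      then have cQ: "card ?Q = m * (?d - 1)" using S fin unfolding m_def
        by (simp add: card_SigmaI) (simp add: subset_eq card_Diff_singleton)
      have "card {\<tau> \<in> A. \<tau> z \<in> S} \<le> card {\<tau> \<in> G. (\<tau> x, \<tau> y) \<in> ?Q}"
        by (rule card_mono) (use fG xO y(2) pgroup_in[OF G] pgroup_inj[OF G] in \<open>auto simp: A_def\<close>)
      then have "card {\<tau> \<in> A. \<tau> z \<in> S} * ?P \<le> card {\<tau> \<in> G. (\<tau> x, \<tau> y) \<in> ?Q} * ?P" by (rule mult_right_mono) simp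
      also have "\<dots> = m * (?d - 1) * card G"
        using pair_count[OF G t order_refl xO y(2)[symmetric], of ?Q] S cQ by auto
      finally show ?thesis using 1 by simp
    next
      case 2
      then have "{\<tau> \<in> A. \<tau> z \<in> S} = {}" unfolding A_def by auto
      then have "card {\<tau> \<in> A. \<tau> z \<in> S} = 0" by (simp only: card.empty)
      then show ?thesis by (simp only: mult_0 le0)
    next
      case 3
      let ?Q = "{(a, b). a \<in> S \<and> b \<in> S \<and> a \<noteq> b}"
      have "?Q = Sigma S (\<lambda>a. S - {a})" by auto
      then have cQ: "card ?Q = m * (m - 1)" using S unfolding m_def by (simp add: card_SigmaI)
      have zO: "z \<in> \<Omega>" using z S by auto
      have "card {\<tau> \<in> A. \<tau> z \<in> S} \<le> card {\<tau> \<in> G. (\<tau> x, \<tau> z) \<in> ?Q}"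
        by (rule card_mono) (use fG 3 pgroup_inj[OF G] in \<open>auto simp: A_def\<close>)
      then have "card {\<tau> \<in> A. \<tau> z \<in> S} * ?P \<le> card {\<tau> \<in> G. (\<tau> x, \<tau> z) \<in> ?Q} * ?P" by (rule mult_right_mono) simp
      also have "\<dots> = m * (m - 1) * card G"
        using pair_count[OF G t order_refl xO(1) zO 3(1)[symmetric], of ?Q] S cQ by auto
      finally show ?thesis using 3 by simp
    qed
  qed
  have "m * card A = (\<Sum>\<tau>\<in>A. m)" by simp
  also have "\<dots> \<le> (\<Sum>\<tau>\<in>A. 3 * card {z \<in> S. \<tau> z \<in> S})" by (rule sum_mono) (rule pt)
  also have "\<dots> = 3 * (\<Sum>z\<in>S. card {\<tau> \<in> A. \<tau> z \<in> S})"
    by (simp add: sum_distrib_left[symmetric] sum_card_swap[OF fA S(2)])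
  finally have "m * card A * ?P \<le> 3 * (\<Sum>z\<in>S. card {\<tau> \<in> A. \<tau> z \<in> S}) * ?P" by (rule mult_right_mono) simp
  also have "\<dots> = 3 * (\<Sum>z\<in>S. card {\<tau> \<in> A. \<tau> z \<in> S} * ?P)" by (simp add: sum_distrib_right)
  also have "\<dots> \<le> 3 * (\<Sum>z\<in>S. (if z = x then m * (?d - 1) else if z = y then 0 else m * (m - 1)) * card G)"
    by (intro mult_left_mono sum_mono each) auto
  also have "(\<Sum>z\<in>S. (if z = x then m * (?d - 1) else if z = y then 0 else m * (m - 1)) * card G)
      = (m * (?d - 1) + (m - 2) * (m * (m - 1))) * card G"
  proof -
    have "(\<Sum>z\<in>S. (if z = x then m * (?d - 1) else if z = y then 0 else m * (m - 1)))
        = m * (?d - 1) + (\<Sum>z\<in>S - {x}. (if z = y then 0 else m * (m - 1)))"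
      using S(2) x by (subst sum.remove[of S x]) (auto intro!: sum.cong)
    also have "(\<Sum>z\<in>S - {x}. (if z = y then 0 else m * (m - 1))) = (\<Sum>z\<in>S - {x} - {y}. m * (m - 1))"
      using S(2) y by (subst sum.remove[of "S - {x}" y]) (auto intro!: sum.cong)
    also have "\<dots> = (m - 2) * (m * (m - 1))"
    proof -
      have "card (S - {x} - {y}) = m - 2" using S(2) x y unfolding m_def by (simp add: card_Diff_singleton)
      then show ?thesis by simp
    qed
    finally show ?thesis by (simp add: sum_distrib_right[symmetric])
  qed
  finally have "m * (m * (?d - m)) * card G \<le> 3 * (m * (?d - 1) + (m - 2) * (m * (m - 1))) * card G"
    using cA by (simp add: mult.assoc)
  then have "m * (m * (?d - m)) \<le> 3 * (m * (?d - 1) + (m - 2) * (m * (m - 1)))"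
    using pgroup_card_pos[OF G] by simp
  then have "m * (m * (?d - m)) \<le> m * (3 * ((?d - 1) + (m - 2) * (m - 1)))" by (simp add: algebra_simps)
  then have "0 < m \<longrightarrow> m * (?d - m) \<le> 3 * ((?d - 1) + (m - 2) * (m - 1))" by (simp only: mult_le_cancel1)
  moreover have "0 < m" using m4 by simp
  ultimately have "m * (?d - m) \<le> 3 * ((?d - 1) + (m - 2) * (m - 1))" by blast
  then have "real (m * (?d - m)) \<le> real (3 * ((?d - 1) + (m - 2) * (m - 1)))" by (simp only: of_nat_le_iff)
  then have ineq: "real m * (real ?d - 4 * real m + 9) \<le> 3 * real ?d + 3"
  proof -
    have "real (m * (?d - m)) = real m * (real ?d - real m)" using md by (simp add: of_nat_diff)
    moreover have "real (3 * ((?d - 1) + (m - 2) * (m - 1))) = 3 * ((real ?d - 1) + (real m - 2) * (real m - 1))"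
    proof -
      have "real (?d - 1) = real ?d - 1" "real (m - 2) = real m - 2" "real (m - 1) = real m - 1"
        using m4 d by (simp_all add: of_nat_diff)
      then show ?thesis by (simp only: of_nat_mult of_nat_add of_nat_numeral)
    qed
    ultimately show ?thesis using \<open>real (m * (?d - m)) \<le> _\<close> by (simp add: algebra_simps)
  qed
  \<comment> \<open>The left side of \<open>ineq\<close> is concave in \<open>m\<close> and exceeds
    the right side at \<open>m = 4\<close> and at \<open>m = 10 * ?d / 41\<close>, hence in between.
    The two products of nonnegative factors say this in linear terms; values of \<open>m\<close>
    below 4 were excluded before.\<close>
  have "10 * ?d < 41 * m"
  proof (rule ccontr)
    assume "\<not> ?thesis"
    then have "41 * real m \<le> 10 * real ?d" by simp
    then have "0 \<le> (real m - 4) * (10 * real ?d - 41 * real m)" using m4 by (intro mult_nonneg_nonneg) auto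
    then have "41 * (real m * real m) \<le> 164 * real m + 10 * (real m * real ?d) - 40 * real ?d"
      by (simp add: algebra_simps)
    moreover have "0 \<le> (real m - 4) * (real ?d - 287)" using m4 d by (intro mult_nonneg_nonneg) auto
    then have "287 * real m \<le> 1148 + real m * real ?d - 4 * real ?d" by (simp add: algebra_simps)
    moreover have "real m * real ?d + 9 * real m \<le> 3 + 3 * real ?d + 4 * (real m * real m)"
      using ineq by (simp add: algebra_simps)
    moreover have "1000 \<le> real ?d" using d by simp
    ultimately show False by linarith
  qed
  then show ?thesis using min[OF k] unfolding m_def S_def by simp
qed

section \<open>The degree of transitivity\<close>

lemma prime_power_dvd_Lcm:
  fixes p :: nat
  assumes "prime p" "finite A" "p ^ k dvd Lcm A" "k > 0" "0 \<notin> A"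
  shows "\<exists>x\<in>A. p ^ k dvd x"
  using assms(2,3,5)
proof (induction A rule: finite_induct)
  case empty
  then show ?case using assms(1,4) prime_gt_1_nat[of p] by simp
next
  case (insert x A)
  have nz: "x \<noteq> 0" "Lcm A \<noteq> 0" using insert.prems(2) insert.hyps(1) by (auto simp: Lcm_0_iff)
  have "p ^ k dvd lcm x (Lcm A)" using insert.prems(1) by simp
  moreover have pe: "prime_elem p" using assms(1) by simp
  moreover have "lcm x (Lcm A) \<noteq> 0" using nz by simp
  ultimately have "k \<le> multiplicity p (lcm x (Lcm A))"
    using power_dvd_iff_le_multiplicity by (metis multiplicity_geI prime_elem_not_unit)
  then have "k \<le> multiplicity p x \<or> k \<le> multiplicity p (Lcm A)"
    using multiplicity_lcm[OF nz, of p] assms(1) by (auto simp: max_def split: if_splits)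
  then show ?case
  proof
    assume "k \<le> multiplicity p x"
    then have "p ^ k dvd x" using multiplicity_dvd' by blast
    then show ?thesis by auto
  next
    assume "k \<le> multiplicity p (Lcm A)"
    then have "p ^ k dvd Lcm A" using multiplicity_dvd' by blast
    then show ?thesis using insert.IH insert.prems(2) by auto
  qed
qed

lemma prod_dvd_coprime:
  fixes f :: "'b \<Rightarrow> nat"
  assumes "finite A" "\<And>a. a \<in> A \<Longrightarrow> f a dvd n" "\<And>a b. a \<in> A \<Longrightarrow> b \<in> A \<Longrightarrow> a \<noteq> b \<Longrightarrow> coprime (f a) (f b)"
  shows "prod f A dvd n"
  using assms
proof (induction A rule: finite_induct)
  case (insert a A)
  have "coprime (f a) (prod f A)" by (rule prod_coprime_right) (use insert in auto)
  then show ?case using insert by (auto intro!: divides_mult)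
qed simp

text \<open>The first twelve primes. In \<open>transitivity_bound\<close> each contributes about
  \<open>ln z\<close>, which is half of \<open>ln (card \<Omega>)\<close>; the total of 6 times
  \<open>ln (card \<Omega>)\<close> has to beat 4.1 times, up to a constant that twelve primes keep
  small enough.\<close>

definition pset :: "nat set"
  where "pset = {2, 3, 5, 7, 11, 13, 17, 19, 23, 29, 31, 37}"

lemma pset: "finite pset" "card pset = 12" "\<And>p. p \<in> pset \<Longrightarrow> prime p" "\<And>p. p \<in> pset \<Longrightarrow> 2 \<le> p \<and> p \<le> 37"
    "\<Prod>pset = 7420738134810"
proof -
  have "prime (2::nat)" "prime (3::nat)" "prime (5::nat)" "prime (7::nat)" "prime (11::nat)" "prime (13::nat)"
    "prime (17::nat)" "prime (19::nat)" "prime (23::nat)" "prime (29::nat)" "prime (31::nat)" "prime (37::nat)" by simp_all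
  then show "\<And>p. p \<in> pset \<Longrightarrow> prime p" unfolding pset_def by blast
qed (auto simp: pset_def)

lemma ex_power_between:
  fixes p z :: nat assumes "2 \<le> p" "1 \<le> z"
  shows "\<exists>a. p ^ a \<le> z \<and> z < p ^ Suc a"
proof -
  have "\<exists>n. z < p ^ n" using assms(1) by (meson less_le_trans one_less_numeral_iff power_gt_expt semiring_norm(76) less_exp order_less_le_trans power_mono zero_le)
  then obtain n where n: "z < p ^ n" "\<And>k. k < n \<Longrightarrow> \<not> z < p ^ k" using exists_least_iff[of "\<lambda>n. z < p ^ n"] by blast
  then have "n \<noteq> 0" using assms(2) by (metis power_0 leD)
  then obtain a where "n = Suc a" using not0_implies_Suc by blast
  then show ?thesis using n by (intro exI[of _ a]) (auto simp: not_less)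
qed

lemma period_le:
  assumes G: "pgroup \<Omega> G" and g: "g \<in> G" and x: "x \<in> \<Omega>"
  shows "least_power g x \<le> card \<Omega>"
proof -
  have p: "permutation g" using pgroup_permutes[OF G g] pgroup_finite[OF G] permutation_permutes by blast
  have "distinct (support g x)" using cycle_of_permutation[OF p] by simp
  from distinct_card[OF this] have "card (set (support g x)) = least_power g x" by simp
  moreover have "set (support g x) \<subseteq> \<Omega>"
  proof -
    have "(g ^^ i) x \<in> \<Omega>" for i by (induction i) (use x pgroup_in[OF G g] in auto)
    then show ?thesis by auto
  qed
  ultimately show ?thesis using card_mono[OF pgroup_finite[OF G]] by metis
qed

text \<open>A \<open>k\<close>-transitive group contains an element with cycles of twelve pairwise coprime prime power lengths.
  One of its powers then has small support, because a point lies in a cycle whose length is divisible by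
  only few of these prime powers.\<close>

lemma transitivity_bound:
  assumes G: "pgroup \<Omega> G" and md: "\<And>g. g \<in> G \<Longrightarrow> g \<noteq> id \<Longrightarrow> 10 * card \<Omega> < 41 * card (mov g)"
    and z: "7 * card \<Omega> \<le> z * z" "12 * z \<le> card \<Omega>" and d: "16000 \<le> card \<Omega>"
  shows "\<not> ktrans \<Omega> G (12 * z)"
proof
  assume kt: "ktrans \<Omega> G (12 * z)"
  let ?d = "card \<Omega>"
  have fin: "finite \<Omega>" by (rule pgroup_finite[OF G])
  have z1: "37 < z"
  proof (rule ccontr)
    assume "\<not> ?thesis"
    then have "z * z \<le> 37 * 37" by (intro mult_le_mono) auto
    then show False using z d by simp
  qed
  \<comment> \<open>\<open>q p\<close> is to be the largest power of \<open>p\<close> not exceeding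
    \<open>z\<close>. It is larger than \<open>z / p\<close>, and the twelve lengths sum to at most
    \<open>12 * z\<close>.\<close>
  define a where "a p = (SOME a. p ^ a \<le> z \<and> z < p ^ Suc a)" for p
  define q where "q p = p ^ a p" for p
  have aq: "p ^ a p \<le> z \<and> z < p ^ Suc (a p)" if "p \<in> pset" for p
    unfolding a_def by (rule someI_ex) (use ex_power_between pset(4)[OF that] z1 in auto)
  have q: "q p \<le> z" "z < q p * p" if "p \<in> pset" for p using aq[OF that] unfolding q_def by (auto simp: mult.commute)
  have apos: "a p > 0" if "p \<in> pset" for p
    using aq[OF that] pset(4)[OF that] z1 by (cases "a p") auto
  have q1: "q p > 0" if "p \<in> pset" for p using pset(4)[OF that] unfolding q_def by simp
  have cop: "coprime (q p) (q r)" if "p \<in> pset" "r \<in> pset" "p \<noteq> r" for p r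
    unfolding q_def using primes_coprime[OF pset(3)[OF that(1)] pset(3)[OF that(2)] that(3)] by simp
  \<comment> \<open>A disjoint union of index cycles of lengths \<open>q p\<close>; below,
    \<open>nx\<close> rotates each of them and \<open>f\<close> is the same rotation carried to
    points of \<open>\<Omega>\<close>.\<close>
  define I where "I = Sigma pset (\<lambda>p. {..<q p})"
  have fI: "finite I" unfolding I_def using pset(1) by auto
  have "card I = (\<Sum>p\<in>pset. q p)" unfolding I_def using pset(1) by (simp add: card_SigmaI)
  also have "\<dots> \<le> (\<Sum>p\<in>pset. z)" by (rule sum_mono) (rule q)
  finally have cI: "card I \<le> 12 * z" using pset(2) by simp
  then obtain e where e: "e ` I \<subseteq> \<Omega>" "inj_on e I" using card_le_inj[OF fI fin] z(2) by (metis le_trans)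
  define nx where "nx i = (fst i, (snd i + 1) mod q (fst i))" for i :: "nat \<times> nat"
  have nxI: "nx i \<in> I" if "i \<in> I" for i
    using that q1 unfolding nx_def I_def by auto
  have nxinj: "inj_on nx I"
  proof (rule inj_onI)
    fix i j assume ij: "i \<in> I" "j \<in> I" "nx i = nx j"
    then obtain p u v where p: "i = (p, u)" "j = (p, v)" "u < q p" "v < q p" "(u + 1) mod q p = (v + 1) mod q p"
      unfolding nx_def I_def by auto
    then have "u = v" by (metis Suc_eq_plus1 mod_Suc mod_less nat.inject old.nat.distinct(2))
    then show "i = j" using p by simp
  qed
  define f where "f x = e (nx (inv_into I e x))" for x
  have fe: "f (e i) = e (nx i)" if "i \<in> I" for i unfolding f_def using inv_into_f_f[OF e(2) that] by simp
  have "\<exists>g\<in>G. \<forall>b\<in>e ` I. g b = f b"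
  proof (rule ktransD[OF kt e(1)])
    show "card (e ` I) \<le> 12 * z" using cI card_image_le[OF fI, of e] by linarith
    show "inj_on f (e ` I)"
    proof (rule inj_onI)
      fix x y assume xy: "x \<in> e ` I" "y \<in> e ` I" "f x = f y"
      then obtain i j where ij: "i \<in> I" "j \<in> I" "x = e i" "y = e j" by blast
      then have "e (nx i) = e (nx j)" using xy(3) fe by simp
      then have "nx i = nx j" by (rule inj_onD[OF e(2) _ nxI[OF ij(1)] nxI[OF ij(2)]])
      then show "x = y" using inj_onD[OF nxinj _ ij(1,2)] ij by simp
    qed
    show "f ` e ` I \<subseteq> \<Omega>" using fe nxI e(1) by auto
  qed
  then obtain g where g: "g \<in> G" "\<And>i. i \<in> I \<Longrightarrow> g (e i) = e (nx i)" using fe by auto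
  have perm: "permutation g" using pgroup_permutes[OF G g(1)] fin permutation_permutes by blast
  have gp: "(g ^^ n) (e (p, 0)) = e (p, n mod q p)" if "p \<in> pset" for p n
  proof (induction n)
    case 0 then show ?case by simp
  next
    case (Suc n)
    have "(p, n mod q p) \<in> I" using q1[OF that] that unfolding I_def by auto
    then show ?case using Suc g(2) unfolding nx_def by (simp add: mod_Suc_eq)
  qed
  define l where "l x = least_power g x" for x
  have ld: "(g ^^ n) x = x \<longleftrightarrow> l x dvd n" for x n unfolding l_def using least_power_dvd[OF perm] by simp
  have lpos: "l x > 0" for x unfolding l_def by (rule least_power_of_permutation(2)[OF perm])
  have gn: "g ^^ n \<in> G" for n
  proof (induction n)
    case 0 show ?case using pgroup_id[OF G] by (simp only: funpow.simps(1))
  next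
    case (Suc n) then show ?case using pgroup_comp[OF G g(1)] by (simp only: funpow.simps(2))
  qed
  define X where "X p = {x \<in> \<Omega>. q p dvd l x}" for p
  have big: "10 * ?d < 41 * card (X p)" if p: "p \<in> pset" for p
  proof -
    \<comment> \<open>This power kills every cycle whose length is not divisible by
      \<open>q p\<close>, but not the prescribed cycle of length \<open>q p\<close>. So it is
      nontrivial with support in \<open>X p\<close>, and the minimal degree bounds
      \<open>card (X p)\<close> from below.\<close>
    let ?L = "Lcm (l ` (\<Omega> - X p))"
    have nd: "\<not> q p dvd ?L"
    proof
      assume "q p dvd ?L"
      then have "\<exists>y\<in>l ` (\<Omega> - X p). p ^ a p dvd y"
        unfolding q_def by (intro prime_power_dvd_Lcm[OF pset(3)[OF p]]) (use fin apos[OF p] lpos in \<open>auto, metis less_irrefl\<close>)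
      then show False unfolding X_def q_def by auto
    qed
    have "mov (g ^^ ?L) \<subseteq> X p"
    proof
      fix x assume x: "x \<in> mov (g ^^ ?L)"
      have "x \<in> \<Omega>" using x mov_subset[OF G gn] by auto
      moreover have "\<not> l x dvd ?L" using x ld[of ?L x] unfolding mov_def by auto
      ultimately show "x \<in> X p" using dvd_Lcm[of "l x" "l ` (\<Omega> - X p)"] by auto
    qed
    moreover have "g ^^ ?L \<noteq> id"
    proof
      assume "g ^^ ?L = id"
      then have "e (p, ?L mod q p) = e (p, 0)" using gp[OF p, of ?L] by simp
      then have "(p, ?L mod q p) = (p, 0)"
        by (rule inj_onD[OF e(2)]) (use p q1[OF p] in \<open>auto simp: I_def\<close>)
      then show False using nd by auto
    qed
    ultimately show ?thesis using md[OF gn, of ?L] card_mono[of "X p" "mov (g ^^ ?L)"] fin unfolding X_def by auto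
  qed
  have each: "(\<Sum>p\<in>{p \<in> pset. x \<in> X p}. ln (real (q p))) \<le> ln (real ?d)" if x: "x \<in> \<Omega>" for x
  proof -
    let ?P = "{p \<in> pset. x \<in> X p}"
    have "prod q ?P dvd l x" by (rule prod_dvd_coprime) (use pset(1) cop in \<open>auto simp: X_def\<close>)
    then have "prod q ?P \<le> l x" using lpos by (simp add: dvd_imp_le)
    also have "\<dots> \<le> ?d" unfolding l_def by (rule period_le[OF G g(1) x])
    finally have le: "real (prod q ?P) \<le> real ?d" by (simp only: of_nat_le_iff)
    have "(\<Sum>p\<in>?P. ln (real (q p))) = ln (\<Prod>p\<in>?P. real (q p))"
      by (rule ln_prod[symmetric]) (use q1 pset(1) in auto)
    also have "\<dots> \<le> ln (real ?d)"
    proof (subst ln_le_cancel_iff)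
      show "0 < (\<Prod>p\<in>?P. real (q p))" by (rule prod_pos) (use q1 in auto)
      show "0 < real ?d" using d by simp
      show "(\<Prod>p\<in>?P. real (q p)) \<le> real ?d" using le by simp
    qed
    finally show ?thesis .
  qed
  have lnq: "ln (real (q p)) \<ge> ln (real z) - ln (real p)" "ln (real (q p)) \<ge> 0" if "p \<in> pset" for p
  proof -
    have "real z \<le> real (q p * p)" using q(2)[OF that] by (simp only: of_nat_le_iff)
    then have "ln (real z) \<le> ln (real (q p) * real p)" using z1 by (simp add: ln_le_cancel_iff)
    also have "\<dots> = ln (real (q p)) + ln (real p)" using q1[OF that] pset(4)[OF that] by (simp add: ln_mult)
    finally show "ln (real (q p)) \<ge> ln (real z) - ln (real p)" by simp
    show "ln (real (q p)) \<ge> 0" using q1[OF that] by (simp add: Suc_leI)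
  qed
  \<comment> \<open>Double counting with weights \<open>ln (q p)\<close>: from below by the sizes of
    the sets \<open>X p\<close>, from above because the \<open>q p\<close> with \<open>x\<close> in
    \<open>X p\<close> have a product that divides the cycle length of \<open>x\<close>.\<close>
  have "(\<Sum>p\<in>pset. ln (real (q p)) * (10 / 41 * ?d)) \<le> (\<Sum>p\<in>pset. ln (real (q p)) * card (X p))"
  proof (rule sum_mono)
    fix p assume p: "p \<in> pset"
    have "10 / 41 * real ?d \<le> real (card (X p))" using big[OF p] by linarith
    then show "ln (real (q p)) * (10 / 41 * ?d) \<le> ln (real (q p)) * card (X p)"
      by (rule mult_left_mono) (rule lnq[OF p])
  qed
  also have "\<dots> = (\<Sum>p\<in>pset. \<Sum>x\<in>\<Omega>. if x \<in> X p then ln (real (q p)) else 0)"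
  proof (rule sum.cong[OF refl])
    fix p
    have "(\<Sum>x\<in>\<Omega>. if x \<in> X p then ln (real (q p)) else 0) = (\<Sum>x\<in>\<Omega> \<inter> X p. ln (real (q p)))"
      by (rule sum.inter_restrict[OF fin, symmetric])
    also have "\<Omega> \<inter> X p = X p" unfolding X_def by auto
    finally show "ln (real (q p)) * card (X p) = (\<Sum>x\<in>\<Omega>. if x \<in> X p then ln (real (q p)) else 0)" by simp
  qed
  also have "\<dots> = (\<Sum>x\<in>\<Omega>. \<Sum>p\<in>pset. if x \<in> X p then ln (real (q p)) else 0)" by (rule sum.swap)
  also have "\<dots> \<le> (\<Sum>x\<in>\<Omega>. ln (real ?d))"
  proof (rule sum_mono)
    fix x assume x: "x \<in> \<Omega>"
    have "(\<Sum>p\<in>pset. if x \<in> X p then ln (real (q p)) else 0) = (\<Sum>p\<in>{p \<in> pset. x \<in> X p}. ln (real (q p)))"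
      using pset(1) by (simp add: sum.inter_filter)
    then show "(\<Sum>p\<in>pset. if x \<in> X p then ln (real (q p)) else 0) \<le> ln (real ?d)" using each[OF x] by simp
  qed
  finally have "(\<Sum>p\<in>pset. ln (real (q p))) * (10 / 41 * ?d) \<le> real ?d * ln (real ?d)"
    unfolding sum_distrib_right[symmetric] by simp
  then have "real ?d * (10 / 41 * (\<Sum>p\<in>pset. ln (real (q p)))) \<le> real ?d * ln (real ?d)" by (simp add: mult_ac)
  then have up: "10 * (\<Sum>p\<in>pset. ln (real (q p))) \<le> 41 * ln (real ?d)" using d by simp
  have "(\<Sum>p\<in>pset. ln (real z) - ln (real p)) \<le> (\<Sum>p\<in>pset. ln (real (q p)))" by (rule sum_mono) (rule lnq)
  moreover have "(\<Sum>p\<in>pset. ln (real p)) = ln (7420738134810::real)"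
  proof -
    have "(\<Sum>p\<in>pset. ln (real p)) = ln (\<Prod>p\<in>pset. real p)"
      by (rule ln_prod[symmetric]) (use pset(1,4) in fastforce)+
    also have "(\<Prod>p\<in>pset. real p) = real (\<Prod>pset)" by simp
    finally show ?thesis using pset(5) by simp
  qed
  ultimately have low: "12 * ln (real z) - ln (7420738134810::real) \<le> (\<Sum>p\<in>pset. ln (real (q p)))"
    by (simp add: sum_subtractf pset(2))
  have zz: "ln 7 + ln (real ?d) \<le> 2 * ln (real z)"
  proof -
    have "7 * real ?d \<le> real z * real z" using z(1) by (metis of_nat_le_iff of_nat_mult of_nat_numeral)
    then have "ln (7 * real ?d) \<le> ln (real z * real z)" using d by (subst ln_le_cancel_iff) auto
    then show ?thesis using d z1 by (simp add: ln_mult)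
  qed
  \<comment> \<open>Ten times the sum of the \<open>ln (q p)\<close> is at least
    \<open>60 * (ln 7 + ln d)\<close> minus ten times the logarithm of the product of the primes,
    and at most \<open>41 * ln d\<close>. The 19 is the difference of 60 and 41.\<close>
  have num: "10 * ln (7420738134810::real) < 60 * ln 7 + 19 * ln (real ?d)"
  proof -
    have "(7420738134810::real) ^ 10 < 7 ^ 60 * 16000 ^ 19" by simp
    also have "\<dots> \<le> 7 ^ 60 * real ?d ^ 19" using d by (intro mult_left_mono power_mono) auto
    finally have "ln ((7420738134810::real) ^ 10) < ln (7 ^ 60 * real ?d ^ 19)" using d by (subst ln_less_cancel_iff) auto
    moreover have "ln ((7420738134810::real) ^ 10) = 10 * ln 7420738134810" using ln_realpow[of "7420738134810::real" 10] by simp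
    moreover have "ln (7 ^ 60 * real ?d ^ 19) = ln (7 ^ 60) + ln (real ?d ^ 19)" 
    proof -
      have "0 < (7::real) ^ 60" "0 < real ?d ^ 19" using d by simp_all
      then show ?thesis by (simp only: ln_mult_pos)
    qed
    moreover have "ln ((7::real) ^ 60) = 60 * ln 7" using ln_realpow[of "7::real" 60] by simp
    moreover have "ln (real ?d ^ 19) = 19 * ln (real ?d)" using ln_realpow[of "real ?d" 19] d by simp
    ultimately show ?thesis by linarith
  qed
  show False using up low zz num by linarith
qed

section \<open>Bases of groups with an invariant relation on triples\<close>

lemma sum_off_diag:
  fixes c :: nat
  assumes "finite A" "a \<in> A"
  shows "(\<Sum>b\<in>A. if a = b then 0 else c) = (card A - 1) * c"
proof -
  have "(\<Sum>b\<in>A. if a = b then 0 else c) = (\<Sum>b\<in>A - {a}. c)"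
    by (rule sum.mono_neutral_cong_right) (use assms in auto)
  then show ?thesis using assms by (simp add: card_Diff_singleton)
qed

text \<open>A set of points such that any two points outside are separated, for a group that is
  doubly but not triply transitive. The pair \<open>(w, u)\<close> separates \<open>x\<close> and \<open>y\<close> if the triples \<open>(w, u, x)\<close> and
  \<open>(w, u, y)\<close> lie in different orbits. First choose the \<open>w\<close> such that every two points are separated by
  many \<open>u\<close>, driving down an exponential potential, and then the \<open>u\<close> as a hitting set.\<close>

locale not_3trans =
  fixes \<Omega> :: "'a set" and G and \<Theta> :: "('a \<times> 'a \<times> 'a) set"
  assumes G: "pgroup \<Omega> G" and t2: "ktrans \<Omega> G 2"
    and \<Theta>: "\<Theta> \<subseteq> {(w, u, x). w \<in> \<Omega> \<and> u \<in> \<Omega> \<and> x \<in> \<Omega> \<and> w \<noteq> u \<and> u \<noteq> x \<and> w \<noteq> x}"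
    and \<Theta>_inv: "\<And>g w u x. g \<in> G \<Longrightarrow> (g w, g u, g x) \<in> \<Theta> \<longleftrightarrow> (w, u, x) \<in> \<Theta>"
    and \<Theta>_ne: "\<Theta> \<noteq> {}"
    and \<Theta>_half: "2 * card \<Theta> \<le> card {(w, u, x). w \<in> \<Omega> \<and> u \<in> \<Omega> \<and> x \<in> \<Omega> \<and> w \<noteq> u \<and> u \<noteq> x \<and> w \<noteq> x}"
    and D_large: "100 \<le> card \<Omega>"
begin

abbreviation "D \<equiv> card \<Omega>"

lemma fin: "finite \<Omega>" by (rule pgroup_finite[OF G])

lemma fin\<Theta>: "finite \<Theta>"
  by (rule finite_subset[OF \<Theta>]) (rule finite_subset[of _ "\<Omega> \<times> \<Omega> \<times> \<Omega>"], use fin in auto)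

lemma move:
  assumes "x \<in> \<Omega>" "y \<in> \<Omega>" "x \<noteq> y" "a \<in> \<Omega>" "b \<in> \<Omega>" "a \<noteq> b"
  obtains g where "g \<in> G" "g x = a" "g y = b"
  using ktrans2D[OF t2 order_refl assms] .

lemma card_inv:
  assumes "g \<in> G" "\<And>v. v \<in> \<Omega> \<Longrightarrow> P (g v) \<longleftrightarrow> Q v"
  shows "card {v \<in> \<Omega>. P v} = card {v \<in> \<Omega>. Q v}"
proof -
  have "{v \<in> \<Omega>. P v} = g ` {v \<in> \<Omega>. Q v}"
  proof
    show "g ` {v \<in> \<Omega>. Q v} \<subseteq> {v \<in> \<Omega>. P v}" using assms pgroup_in[OF G] by auto
    show "{v \<in> \<Omega>. P v} \<subseteq> g ` {v \<in> \<Omega>. Q v}"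
    proof
      fix v assume v: "v \<in> {v \<in> \<Omega>. P v}"
      have gv: "g (inv' g v) = v" by (rule pgroup_inv2[OF G assms(1)])
      then have "inv' g v \<in> \<Omega>" using v pgroup_in[OF G assms(1), of "inv' g v"] by auto
      then show "v \<in> g ` {v \<in> \<Omega>. Q v}" using v gv assms(2)[of "inv' g v"] by (intro image_eqI[of _ _ "inv' g v"]) auto
    qed
  qed
  moreover have "inj_on g {v \<in> \<Omega>. Q v}" using pgroup_inj[OF G assms(1)] by (auto simp: inj_on_def)
  ultimately show ?thesis by (simp add: card_image)
qed

text \<open>The number of ways to complete two distinct entries to a triple of
  \<open>\<Theta>\<close>. By double transitivity it depends neither on the entries nor on the
  position that is missing, as \<open>r1\<close>, \<open>r2\<close> and \<open>r3\<close>
  show.\<close>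

definition "\<rho> = card \<Theta> div (D * (D - 1))"

lemma pairs_count:
  assumes P: "\<And>a b v g. g \<in> G \<Longrightarrow> P (g a) (g b) (g v) \<longleftrightarrow> P a b v"
    and dg: "\<And>a v. \<not> P a a v"
    and ab: "a \<in> \<Omega>" "b \<in> \<Omega>" "a \<noteq> b"
  shows "card {(a, b, v). a \<in> \<Omega> \<and> b \<in> \<Omega> \<and> v \<in> \<Omega> \<and> P a b v} = D * (D - 1) * card {v \<in> \<Omega>. P a b v}"
proof -
  have c: "card {v \<in> \<Omega>. P a' b' v} = (if a' = b' then 0 else card {v \<in> \<Omega>. P a b v})" if h: "a' \<in> \<Omega>" "b' \<in> \<Omega>" for a' b'
  proof (cases "a' = b'")
    case True then show ?thesis using dg by simp
  next
    case False
    obtain g where g: "g \<in> G" "g a = a'" "g b = b'" by (rule move[OF ab h False])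
    have "card {v \<in> \<Omega>. P a' b' v} = card {v \<in> \<Omega>. P a b v}"
      by (rule card_inv[OF g(1)]) (use P[OF g(1), of a b] g in auto)
    then show ?thesis using False by simp
  qed
  have "{(a, b, v). a \<in> \<Omega> \<and> b \<in> \<Omega> \<and> v \<in> \<Omega> \<and> P a b v} = Sigma \<Omega> (\<lambda>a. Sigma \<Omega> (\<lambda>b. {v \<in> \<Omega>. P a b v}))" by auto
  then have "card {(a, b, v). a \<in> \<Omega> \<and> b \<in> \<Omega> \<and> v \<in> \<Omega> \<and> P a b v} = (\<Sum>a'\<in>\<Omega>. \<Sum>b'\<in>\<Omega>. card {v \<in> \<Omega>. P a' b' v})"
    using fin by (simp add: card_SigmaI)
  also have "\<dots> = (\<Sum>a'\<in>\<Omega>. \<Sum>b'\<in>\<Omega>. if a' = b' then 0 else card {v \<in> \<Omega>. P a b v})"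
    by (intro sum.cong refl c)
  also have "\<dots> = (\<Sum>a'\<in>\<Omega>. (D - 1) * card {v \<in> \<Omega>. P a b v})"
    by (intro sum.cong refl sum_off_diag fin)
  finally show ?thesis by simp
qed

lemma DD_pos: "D * (D - 1) > 0" using D_large by simp

lemma eq_div_of_mult: "c = k * x \<Longrightarrow> 0 < k \<Longrightarrow> x = c div k" for c k x :: nat by simp

lemma r1: assumes "w \<in> \<Omega>" "u \<in> \<Omega>" "w \<noteq> u" shows "card {x \<in> \<Omega>. (w, u, x) \<in> \<Theta>} = \<rho>"
proof -
  have "card {(w, u, x). w \<in> \<Omega> \<and> u \<in> \<Omega> \<and> x \<in> \<Omega> \<and> (w, u, x) \<in> \<Theta>} = D * (D - 1) * card {x \<in> \<Omega>. (w, u, x) \<in> \<Theta>}"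
    by (rule pairs_count[OF _ _ assms]) (use \<Theta> \<Theta>_inv in auto)
  moreover have "{(w, u, x). w \<in> \<Omega> \<and> u \<in> \<Omega> \<and> x \<in> \<Omega> \<and> (w, u, x) \<in> \<Theta>} = \<Theta>" using \<Theta> by auto
  ultimately show ?thesis unfolding \<rho>_def by (intro eq_div_of_mult[OF _ DD_pos]) simp
qed

lemma r2: assumes "u \<in> \<Omega>" "x \<in> \<Omega>" "u \<noteq> x" shows "card {w \<in> \<Omega>. (w, u, x) \<in> \<Theta>} = \<rho>"
proof -
  have "card {(u, x, w). u \<in> \<Omega> \<and> x \<in> \<Omega> \<and> w \<in> \<Omega> \<and> (w, u, x) \<in> \<Theta>} = D * (D - 1) * card {w \<in> \<Omega>. (w, u, x) \<in> \<Theta>}"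
    by (rule pairs_count[OF _ _ assms]) (use \<Theta> \<Theta>_inv in auto)
  moreover have "bij_betw (\<lambda>(u, x, w). (w, u, x)) {(u, x, w). u \<in> \<Omega> \<and> x \<in> \<Omega> \<and> w \<in> \<Omega> \<and> (w, u, x) \<in> \<Theta>} \<Theta>"
    by (rule bij_betwI[of _ _ _ "\<lambda>(w, u, x). (u, x, w)"]) (use \<Theta> in auto)
  then have "card {(u, x, w). u \<in> \<Omega> \<and> x \<in> \<Omega> \<and> w \<in> \<Omega> \<and> (w, u, x) \<in> \<Theta>} = card \<Theta>" by (rule bij_betw_same_card)
  ultimately show ?thesis unfolding \<rho>_def by (intro eq_div_of_mult[OF _ DD_pos]) simp
qed

lemma r3: assumes "w \<in> \<Omega>" "x \<in> \<Omega>" "w \<noteq> x" shows "card {u \<in> \<Omega>. (w, u, x) \<in> \<Theta>} = \<rho>"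
proof -
  have "card {(w, x, u). w \<in> \<Omega> \<and> x \<in> \<Omega> \<and> u \<in> \<Omega> \<and> (w, u, x) \<in> \<Theta>} = D * (D - 1) * card {u \<in> \<Omega>. (w, u, x) \<in> \<Theta>}"
    by (rule pairs_count[OF _ _ assms]) (use \<Theta> \<Theta>_inv in auto)
  moreover have "bij_betw (\<lambda>(w, x, u). (w, u, x)) {(w, x, u). w \<in> \<Omega> \<and> x \<in> \<Omega> \<and> u \<in> \<Omega> \<and> (w, u, x) \<in> \<Theta>} \<Theta>"
    by (rule bij_betwI[of _ _ _ "\<lambda>(w, u, x). (w, x, u)"]) (use \<Theta> in auto)
  then have "card {(w, x, u). w \<in> \<Omega> \<and> x \<in> \<Omega> \<and> u \<in> \<Omega> \<and> (w, u, x) \<in> \<Theta>} = card \<Theta>" by (rule bij_betw_same_card)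
  ultimately show ?thesis unfolding \<rho>_def by (intro eq_div_of_mult[OF _ DD_pos]) simp
qed

lemma r2_le: "u \<in> \<Omega> \<Longrightarrow> x \<in> \<Omega> \<Longrightarrow> card {w \<in> \<Omega>. (w, u, x) \<in> \<Theta>} \<le> \<rho>"
  and r3_le: "w \<in> \<Omega> \<Longrightarrow> x \<in> \<Omega> \<Longrightarrow> card {u \<in> \<Omega>. (w, u, x) \<in> \<Theta>} \<le> \<rho>"
proof -
  show "card {w \<in> \<Omega>. (w, u, x) \<in> \<Theta>} \<le> \<rho>" if "u \<in> \<Omega>" "x \<in> \<Omega>"
  proof (cases "u = x")
    case True then have "{w \<in> \<Omega>. (w, u, x) \<in> \<Theta>} = {}" using \<Theta> by auto
    then show ?thesis by (simp only: card.empty le0)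
  qed (use r2 that in auto)
  show "card {u \<in> \<Omega>. (w, u, x) \<in> \<Theta>} \<le> \<rho>" if "w \<in> \<Omega>" "x \<in> \<Omega>"
  proof (cases "w = x")
    case True then have "{u \<in> \<Omega>. (w, u, x) \<in> \<Theta>} = {}" using \<Theta> by auto
    then show ?thesis by (simp only: card.empty le0)
  qed (use r3 that in auto)
qed

lemma card_\<Theta>: "card \<Theta> = D * (D - 1) * \<rho>"
proof -
  obtain w u x where e: "(w, u, x) \<in> \<Theta>" using \<Theta>_ne by auto
  then have wu: "w \<in> \<Omega>" "u \<in> \<Omega>" "w \<noteq> u" using \<Theta> by auto
  have "card {(w, u, x). w \<in> \<Omega> \<and> u \<in> \<Omega> \<and> x \<in> \<Omega> \<and> (w, u, x) \<in> \<Theta>} = D * (D - 1) * card {x \<in> \<Omega>. (w, u, x) \<in> \<Theta>}"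
    by (rule pairs_count[OF _ _ wu]) (use \<Theta> \<Theta>_inv in auto)
  moreover have "{(w, u, x). w \<in> \<Omega> \<and> u \<in> \<Omega> \<and> x \<in> \<Omega> \<and> (w, u, x) \<in> \<Theta>} = \<Theta>" using \<Theta> by auto
  ultimately show ?thesis using r1[OF wu] by simp
qed

lemma \<rho>_pos: "\<rho> \<ge> 1"
proof -
  have "card \<Theta> > 0" using \<Theta>_ne fin\<Theta> by (simp add: card_gt_0_iff)
  then show ?thesis using card_\<Theta> by (cases \<rho>) auto
qed

lemma \<rho>_half: "2 * \<rho> \<le> D"
proof -
  have "{(w, u, x). w \<in> \<Omega> \<and> u \<in> \<Omega> \<and> x \<in> \<Omega> \<and> w \<noteq> u \<and> u \<noteq> x \<and> w \<noteq> x} \<subseteq> Sigma \<Omega> (\<lambda>w. Sigma (\<Omega> - {w}) (\<lambda>u. \<Omega>))" by auto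
  then have "card {(w, u, x). w \<in> \<Omega> \<and> u \<in> \<Omega> \<and> x \<in> \<Omega> \<and> w \<noteq> u \<and> u \<noteq> x \<and> w \<noteq> x} \<le> card (Sigma \<Omega> (\<lambda>w. Sigma (\<Omega> - {w}) (\<lambda>u. \<Omega>)))"
    by (rule card_mono[rotated]) (use fin in auto)
  also have "\<dots> = D * (D - 1) * D" using fin by (simp add: card_SigmaI)
  finally have "D * (D - 1) * (2 * \<rho>) \<le> D * (D - 1) * D" using \<Theta>_half card_\<Theta> by (simp only: mult_ac)
  then show ?thesis using DD_pos by (metis mult_le_cancel1)
qed

definition "S w x y = {u \<in> \<Omega>. ((w, u, x) \<in> \<Theta>) \<noteq> ((w, u, y) \<in> \<Theta>)}"

lemma finS: "finite (S w x y)" unfolding S_def using fin by auto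

lemma card_S_le: assumes "w \<in> \<Omega>" "x \<in> \<Omega>" "y \<in> \<Omega>" shows "card (S w x y) \<le> 2 * \<rho>"
proof -
  have "S w x y \<subseteq> {u \<in> \<Omega>. (w, u, x) \<in> \<Theta>} \<union> {u \<in> \<Omega>. (w, u, y) \<in> \<Theta>}" unfolding S_def by auto
  then have "card (S w x y) \<le> card ({u \<in> \<Omega>. (w, u, x) \<in> \<Theta>} \<union> {u \<in> \<Omega>. (w, u, y) \<in> \<Theta>})"
    by (rule card_mono[rotated]) (use fin in auto)
  also have "\<dots> \<le> card {u \<in> \<Omega>. (w, u, x) \<in> \<Theta>} + card {u \<in> \<Omega>. (w, u, y) \<in> \<Theta>}" by (rule card_Un_le)
  finally show ?thesis using r3_le[OF assms(1,2)] r3_le[OF assms(1,3)] by simp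
qed

lemma mult_S_le: assumes "u \<in> \<Omega>" "x \<in> \<Omega>" "y \<in> \<Omega>" shows "card {w \<in> \<Omega>. u \<in> S w x y} \<le> 2 * \<rho>"
proof -
  have "{w \<in> \<Omega>. u \<in> S w x y} \<subseteq> {w \<in> \<Omega>. (w, u, x) \<in> \<Theta>} \<union> {w \<in> \<Omega>. (w, u, y) \<in> \<Theta>}" unfolding S_def by auto
  then have "card {w \<in> \<Omega>. u \<in> S w x y} \<le> card ({w \<in> \<Omega>. (w, u, x) \<in> \<Theta>} \<union> {w \<in> \<Omega>. (w, u, y) \<in> \<Theta>})"
    by (rule card_mono[rotated]) (use fin in auto)
  also have "\<dots> \<le> card {w \<in> \<Omega>. (w, u, x) \<in> \<Theta>} + card {w \<in> \<Omega>. (w, u, y) \<in> \<Theta>}" by (rule card_Un_le)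
  finally show ?thesis using r2_le[OF assms(1,2)] r2_le[OF assms(1,3)] by simp
qed

text \<open>The sum is the same for all pairs of distinct points, so it may be averaged over them.
  For each \<open>(w, u)\<close> the \<open>\<rho>\<close> completions are separated from the
  \<open>D - \<rho>\<close> other points, in both orders, and \<open>\<rho>\<close> is at most half
  of \<open>D\<close>.\<close>

lemma sum_S: assumes xy: "x \<in> \<Omega>" "y \<in> \<Omega>" "x \<noteq> y" shows "\<rho> * D \<le> (\<Sum>w\<in>\<Omega>. card (S w x y))"
proof -
  have inv: "(\<Sum>w\<in>\<Omega>. card (S w a b)) = (\<Sum>w\<in>\<Omega>. card (S w x y))" if ab: "a \<in> \<Omega>" "b \<in> \<Omega>" "a \<noteq> b" for a b
  proof -
    obtain g where g: "g \<in> G" "g x = a" "g y = b" by (rule move[OF xy ab])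
    have "(\<Sum>w\<in>\<Omega>. card (S w x y)) = (\<Sum>w\<in>\<Omega>. card (S (g w) a b))"
    proof (rule sum.cong[OF refl])
      fix w
      show "card (S w x y) = card (S (g w) a b)" unfolding S_def
        by (rule card_inv[OF g(1), symmetric]) (use \<Theta>_inv[OF g(1)] g(2,3) in metis)
    qed
    also have "\<dots> = (\<Sum>w\<in>\<Omega>. card (S w a b))"
      by (rule sum.reindex_bij_betw[OF permutes_imp_bij[OF pgroup_permutes[OF G g(1)]]])
    finally show ?thesis by simp
  qed
  let ?A = "\<Sum>w\<in>\<Omega>. card (S w x y)"
  have cnt: "2 * (\<rho> * (D - \<rho>)) \<le> card {(x, y). x \<in> \<Omega> \<and> y \<in> \<Omega> \<and> ((w, u, x) \<in> \<Theta>) \<noteq> ((w, u, y) \<in> \<Theta>)}"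
    if wu: "w \<in> \<Omega>" "u \<in> \<Omega> - {w}" for w u
  proof -
    let ?X = "{x \<in> \<Omega>. (w, u, x) \<in> \<Theta>}"
    have X: "?X \<subseteq> \<Omega>" "card ?X = \<rho>" "finite ?X" using r1 wu fin by auto
    have c: "card (\<Omega> - ?X) = D - \<rho>" using X fin by (simp add: card_Diff_subset)
    have "{(x, y). x \<in> \<Omega> \<and> y \<in> \<Omega> \<and> ((w, u, x) \<in> \<Theta>) \<noteq> ((w, u, y) \<in> \<Theta>)} = ?X \<times> (\<Omega> - ?X) \<union> (\<Omega> - ?X) \<times> ?X" by auto
    moreover have "card (?X \<times> (\<Omega> - ?X) \<union> (\<Omega> - ?X) \<times> ?X) = card (?X \<times> (\<Omega> - ?X)) + card ((\<Omega> - ?X) \<times> ?X)"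
      by (rule card_Un_disjoint) (use fin in auto)
    ultimately show ?thesis using X(2) c by (simp add: card_cartesian_product)
  qed
  have "D * (D - 1) * (2 * (\<rho> * (D - \<rho>))) = (\<Sum>w\<in>\<Omega>. \<Sum>u\<in>\<Omega> - {w}. 2 * (\<rho> * (D - \<rho>)))"
    using fin by (simp add: card_Diff_singleton)
  also have "\<dots> \<le> (\<Sum>w\<in>\<Omega>. \<Sum>u\<in>\<Omega> - {w}. card {(x, y). x \<in> \<Omega> \<and> y \<in> \<Omega> \<and> ((w, u, x) \<in> \<Theta>) \<noteq> ((w, u, y) \<in> \<Theta>)})"
    by (intro sum_mono cnt)
  also have "\<dots> \<le> (\<Sum>w\<in>\<Omega>. \<Sum>u\<in>\<Omega>. card {(x, y). x \<in> \<Omega> \<and> y \<in> \<Omega> \<and> ((w, u, x) \<in> \<Theta>) \<noteq> ((w, u, y) \<in> \<Theta>)})"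
    by (intro sum_mono sum_mono2) (use fin in auto)
  also have "\<dots> = (\<Sum>w\<in>\<Omega>. \<Sum>u\<in>\<Omega>. card {e \<in> \<Omega> \<times> \<Omega>. u \<in> S w (fst e) (snd e)})"
    by (intro sum.cong refl arg_cong[where f = card]) (auto simp: S_def)
  also have "\<dots> = (\<Sum>w\<in>\<Omega>. \<Sum>e\<in>\<Omega> \<times> \<Omega>. card {u \<in> \<Omega>. u \<in> S w (fst e) (snd e)})"
    by (intro sum.cong refl sum_card_swap) (use fin in auto)
  also have "\<dots> = (\<Sum>w\<in>\<Omega>. \<Sum>e\<in>\<Omega> \<times> \<Omega>. card (S w (fst e) (snd e)))"
    by (intro sum.cong refl arg_cong[where f = card]) (auto simp: S_def)
  also have "\<dots> = (\<Sum>e\<in>\<Omega> \<times> \<Omega>. \<Sum>w\<in>\<Omega>. card (S w (fst e) (snd e)))" by (rule sum.swap)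
  also have "\<dots> = (\<Sum>a\<in>\<Omega>. \<Sum>b\<in>\<Omega>. \<Sum>w\<in>\<Omega>. card (S w a b))"
    using sum.cartesian_product[of "\<lambda>a b. \<Sum>w\<in>\<Omega>. card (S w a b)" \<Omega> \<Omega>] by (simp only: case_prod_unfold)
  also have "\<dots> = (\<Sum>a\<in>\<Omega>. \<Sum>b\<in>\<Omega>. if a = b then 0 else ?A)"
  proof (intro sum.cong refl)
    fix a b assume ab: "a \<in> \<Omega>" "b \<in> \<Omega>"
    show "(\<Sum>w\<in>\<Omega>. card (S w a b)) = (if a = b then 0 else ?A)"
      using inv[OF ab] by (cases "a = b") (auto simp: S_def)
  qed
  also have "\<dots> = D * (D - 1) * ?A"
  proof -
    have "(\<Sum>b\<in>\<Omega>. if a = b then 0 else ?A) = (D - 1) * ?A" if "a \<in> \<Omega>" for a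
      by (rule sum_off_diag[OF fin that])
    then show ?thesis by simp
  qed
  finally have "2 * (\<rho> * (D - \<rho>)) \<le> ?A" using DD_pos by (metis mult_le_cancel1)
  moreover have "\<rho> * D \<le> \<rho> * (2 * (D - \<rho>))" using \<rho>_half by (intro mult_le_mono2) simp
  moreover have "\<rho> * (2 * (D - \<rho>)) = 2 * (\<rho> * (D - \<rho>))" by (simp only: mult_ac)
  ultimately show ?thesis by linarith
qed

definition "V W x y = (\<Union>w\<in>W. S w x y)"

definition "bad \<eta> W = {(x, y). x \<in> \<Omega> \<and> y \<in> \<Omega> \<and> x \<noteq> y \<and> real (card (V W x y)) < \<eta>}"

text \<open>The divisor \<open>2 * \<rho>\<close> bounds the size of a single
  \<open>S w x y\<close>. So one further \<open>w\<close> increases the exponent by an amount in the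
  unit interval, where the exponential may be replaced by its chord.\<close>

definition "pot \<eta> W = (\<Sum>e\<in>bad \<eta> W. exp (- (real (card (V W (fst e) (snd e))) / (2 * real \<rho>))))"

lemma V_sub: "V W x y \<subseteq> \<Omega>" unfolding V_def S_def by auto

lemma finV: "finite (V W x y)" by (rule finite_subset[OF V_sub fin])

lemma fin_bad: "finite (bad \<eta> W)"
  by (rule finite_subset[of _ "\<Omega> \<times> \<Omega>"]) (use fin in \<open>auto simp: bad_def\<close>)

text \<open>A combination of \<open>exp (- t) * (1 + t) \<le> 1\<close> and
  \<open>exp (- t) * t \<le> exp (- 1)\<close> with the weights \<open>1 - t\<close> and
  \<open>t\<close>, for which the left sides add up to \<open>exp (- t)\<close>. The constant 0.63
  is a lower bound for \<open>1 - exp (- 1)\<close>.\<close>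

lemma exp_chord: fixes t :: real assumes "0 \<le> t" "t \<le> 1" shows "exp (- t) \<le> 1 - 0.63 * t"
proof -
  have "exp (- t) * (1 + t) \<le> exp (- t) * exp t" "exp (- t) * (1 + (t - 1)) \<le> exp (- t) * exp (t - 1)"
    by (intro mult_left_mono exp_ge_add_one_self, simp)+
  then have "exp (- t) * (1 + t) \<le> 1" "exp (- t) * t \<le> exp (- 1)"
    by (simp_all add: exp_add[symmetric])
  then have "(1 - t) * (exp (- t) * (1 + t)) \<le> (1 - t) * 1" "t * (exp (- t) * t) \<le> t * exp (- 1)"
    by (intro mult_left_mono; use assms in simp)+
  then have "(1 - t) * (exp (- t) * (1 + t)) + t * (exp (- t) * t) \<le> (1 - t) + t * exp (- 1)" by simp
  moreover have "(1 - t) * (exp (- t) * (1 + t)) + t * (exp (- t) * t) = exp (- t)" by (simp add: algebra_simps)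
  ultimately have "exp (- t) \<le> (1 - t) + t * exp (- 1)" by simp
  moreover have "exp (- 1) \<le> (0.37::real)"
  proof -
    have "181/162 \<le> exp (1/9::real)" using exp_lower_Taylor_quadratic[of "1/9::real"] by (simp add: power2_eq_square)
    then have "(181/162) ^ 9 \<le> exp (1/9::real) ^ 9" by (rule power_mono) simp
    also have "\<dots> = exp 1" by (simp add: exp_of_nat_mult[symmetric])
    finally have "1 / 0.37 \<le> exp (1::real)" by (simp add: power_divide)
    then show ?thesis by (simp add: exp_minus field_simps)
  qed
  ultimately have "exp (- t) \<le> (1 - t) + t * 0.37" using mult_left_mono[of "exp (- 1)" "0.37" t] assms(1) by simp
  then show ?thesis by simp
qed

text \<open>For a bad pair fewer than \<open>D / 4\<close> points are used up, and each is repeated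
  for at most \<open>2 * \<rho>\<close> of the \<open>w\<close>; so at least half of the amount in
  \<open>sum_S\<close> consists of new points. The factor 0.8425 is
  \<open>1 - 0.63 / 4\<close>.\<close>

lemma pot_step:
  assumes \<eta>: "\<eta> \<le> real D / 4"
  shows "\<exists>w\<in>\<Omega>. pot \<eta> (insert w W) \<le> 0.8425 * pot \<eta> W"
proof -
  let ?c = "2 * real \<rho>"
  have cpos: "?c > 0" using \<rho>_pos by simp
  let ?f = "\<lambda>W e. exp (- (real (card (V W (fst e) (snd e))) / ?c))"
  have step: "(\<Sum>w\<in>\<Omega>. ?f (insert w W) e) \<le> 0.8425 * ?f W e * D" if e: "e \<in> bad \<eta> W" for e
  proof -
    obtain x y where xy: "e = (x, y)" "x \<in> \<Omega>" "y \<in> \<Omega>" "x \<noteq> y" "real (card (V W x y)) < \<eta>" using e unfolding bad_def by auto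
    let ?V = "V W x y"
    define T where "T w = real (card (S w x y - ?V)) / ?c" for w
    have ins: "V (insert w W) x y = ?V \<union> (S w x y - ?V)" for w unfolding V_def by auto
    have cardV: "card (V (insert w W) x y) = card ?V + card (S w x y - ?V)" for w
      unfolding ins using finV finS by (intro card_Un_disjoint) auto
    have T01: "0 \<le> T w" "T w \<le> 1" if "w \<in> \<Omega>" for w
    proof -
      have "card (S w x y - ?V) \<le> card (S w x y)" by (rule card_mono[OF finS]) auto
      also have "\<dots> \<le> 2 * \<rho>" by (rule card_S_le[OF that xy(2,3)])
      finally show "T w \<le> 1" unfolding T_def using cpos by simp
      show "0 \<le> T w" unfolding T_def by simp
    qed
    have sumT: "real D / 4 \<le> (\<Sum>w\<in>\<Omega>. T w)"
    proof -
      have "(\<Sum>w\<in>\<Omega>. card (S w x y \<inter> ?V)) = (\<Sum>w\<in>\<Omega>. card {u \<in> ?V. u \<in> S w x y})"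
        by (intro sum.cong refl arg_cong[where f = card]) auto
      also have "\<dots> = (\<Sum>u\<in>?V. card {w \<in> \<Omega>. u \<in> S w x y})" by (rule sum_card_swap[OF fin finV])
      also have "\<dots> \<le> (\<Sum>u\<in>?V. 2 * \<rho>)" by (intro sum_mono mult_S_le) (use xy V_sub in auto)
      finally have 1: "(\<Sum>w\<in>\<Omega>. card (S w x y \<inter> ?V)) \<le> card ?V * (2 * \<rho>)" by simp
      have "(\<Sum>w\<in>\<Omega>. card (S w x y)) = (\<Sum>w\<in>\<Omega>. card (S w x y - ?V) + card (S w x y \<inter> ?V))"
      proof (rule sum.cong[OF refl])
        fix w
        show "card (S w x y) = card (S w x y - ?V) + card (S w x y \<inter> ?V)"
          using finS by (subst card_Un_disjoint[symmetric]) (auto simp: Un_Diff_Int)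
      qed
      also have "\<dots> = (\<Sum>w\<in>\<Omega>. card (S w x y - ?V)) + (\<Sum>w\<in>\<Omega>. card (S w x y \<inter> ?V))" by (rule sum.distrib)
      finally have "\<rho> * D \<le> (\<Sum>w\<in>\<Omega>. card (S w x y - ?V)) + card ?V * (2 * \<rho>)"
        using sum_S[OF xy(2-4)] 1 by linarith
      then have "real (\<rho> * D) \<le> real ((\<Sum>w\<in>\<Omega>. card (S w x y - ?V)) + card ?V * (2 * \<rho>))" by (simp only: of_nat_le_iff)
      moreover have "real (card ?V) * ?c \<le> real D / 4 * ?c" by (rule mult_right_mono) (use xy(5) \<eta> in auto)
      moreover have "real D / 4 * ?c = real \<rho> * D / 2" by simp
      ultimately have "real \<rho> * D / 2 \<le> (\<Sum>w\<in>\<Omega>. real (card (S w x y - ?V)))" by (simp only: of_nat_add of_nat_mult of_nat_sum of_nat_numeral; linarith)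
      then have "real \<rho> * D / 2 / ?c \<le> (\<Sum>w\<in>\<Omega>. real (card (S w x y - ?V))) / ?c" using cpos by (rule divide_right_mono[OF _ less_imp_le])
      then show ?thesis unfolding T_def using cpos by (simp add: sum_divide_distrib)
    qed
    have "(\<Sum>w\<in>\<Omega>. ?f (insert w W) e) = (\<Sum>w\<in>\<Omega>. ?f W e * exp (- T w))"
      by (intro sum.cong refl) (simp add: xy(1) cardV T_def exp_add[symmetric] add_divide_distrib)
    also have "\<dots> \<le> (\<Sum>w\<in>\<Omega>. ?f W e * (1 - 0.63 * T w))"
      by (intro sum_mono mult_left_mono exp_chord T01) auto
    also have "\<dots> = ?f W e * (D - 0.63 * (\<Sum>w\<in>\<Omega>. T w))"
      by (simp only: sum_distrib_left[symmetric] sum_subtractf sum_constant of_nat_1 mult_1_right)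
    also have "\<dots> \<le> ?f W e * (0.8425 * D)"
      by (rule mult_left_mono) (use sumT in auto)
    finally show ?thesis by (simp add: mult_ac)
  qed
  have "(\<Sum>w\<in>\<Omega>. pot \<eta> (insert w W)) \<le> (\<Sum>w\<in>\<Omega>. \<Sum>e\<in>bad \<eta> W. ?f (insert w W) e)"
  proof (rule sum_mono)
    fix w
    have "bad \<eta> (insert w W) \<subseteq> bad \<eta> W"
    proof -
      have "card (V W x y) \<le> card (V (insert w W) x y)" for x y
        by (rule card_mono[OF finV]) (auto simp: V_def)
      then show ?thesis unfolding bad_def by (auto intro: le_less_trans[rotated])
    qed
    then show "pot \<eta> (insert w W) \<le> (\<Sum>e\<in>bad \<eta> W. ?f (insert w W) e)"
      unfolding pot_def by (intro sum_mono2 fin_bad) auto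
  qed
  also have "\<dots> = (\<Sum>e\<in>bad \<eta> W. \<Sum>w\<in>\<Omega>. ?f (insert w W) e)" by (rule sum.swap)
  also have "\<dots> \<le> (\<Sum>e\<in>bad \<eta> W. 0.8425 * ?f W e * D)" by (rule sum_mono) (rule step)
  also have "\<dots> = 0.8425 * pot \<eta> W * D" unfolding pot_def by (simp add: sum_distrib_left sum_distrib_right)
  finally show ?thesis using ex_le_average[OF fin, of "\<lambda>w. pot \<eta> (insert w W)"] D_large by fastforce
qed

text \<open>After \<open>s\<close> steps the potential is below \<open>exp (- (\<eta> / 2))\<close>,
  which every single bad pair would exceed; so no bad pair is left, and all sets
  \<open>V W x y\<close> are large enough for \<open>hitting_set\<close>. The constant 0.1575 is
  \<open>1 - 0.8425\<close>.\<close>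

lemma small_base:
  assumes \<eta>: "0 < \<eta>" "\<eta> \<le> real D / 4" and s: "2 * ln (real D) + \<eta> / 2 \<le> 0.1575 * real s"
    and s': "2 * real D / \<eta> * ln (real D) \<le> real s'"
  obtains B where "B \<subseteq> \<Omega>" "base_of G B" "card B \<le> s + s'"
proof -
  have "\<exists>W\<subseteq>\<Omega>. card W \<le> k \<and> pot \<eta> W \<le> 0.8425 ^ k * card (bad \<eta> {})" for k
  proof (induction k)
    case 0
    show ?case by (intro exI[of _ "{}"]) (auto simp: pot_def V_def)
  next
    case (Suc k)
    then obtain W where W: "W \<subseteq> \<Omega>" "card W \<le> k" "pot \<eta> W \<le> 0.8425 ^ k * card (bad \<eta> {})" by auto
    obtain w where w: "w \<in> \<Omega>" "pot \<eta> (insert w W) \<le> 0.8425 * pot \<eta> W" using pot_step[OF \<eta>(2)] by auto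
    have "card (insert w W) \<le> Suc k" using W finite_subset[OF W(1) fin] by (simp add: card_insert_if)
    moreover have "pot \<eta> (insert w W) \<le> 0.8425 ^ Suc k * card (bad \<eta> {})" using w(2) W(3) by simp
    ultimately show ?case using W(1) w(1) by (intro exI[of _ "insert w W"]) auto
  qed
  then obtain W where W: "W \<subseteq> \<Omega>" "card W \<le> s" "pot \<eta> W \<le> 0.8425 ^ s * card (bad \<eta> {})" by blast
  let ?I = "{(x, y). x \<in> \<Omega> \<and> y \<in> \<Omega> \<and> x \<noteq> y}"
  have fI: "finite ?I" by (rule finite_subset[of _ "\<Omega> \<times> \<Omega>"]) (use fin in auto)
  have cI: "card ?I < D ^ 2"
  proof -
    have "\<Omega> \<noteq> {}" using D_large by auto
    then have "?I \<subset> \<Omega> \<times> \<Omega>" by auto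
    then show ?thesis using psubset_card_mono[of "\<Omega> \<times> \<Omega>" ?I] fin by (simp add: card_cartesian_product power2_eq_square)
  qed
  have "bad \<eta> {} \<subseteq> ?I" unfolding bad_def by auto
  then have cb: "card (bad \<eta> {}) < D ^ 2" using card_mono[OF fI] cI by (meson le_less_trans)
  have good: "\<eta> \<le> card (V W x y)" if xy: "x \<in> \<Omega>" "y \<in> \<Omega>" "x \<noteq> y" for x y
  proof (rule ccontr)
    assume nt: "\<not> ?thesis"
    then have e: "(x, y) \<in> bad \<eta> W" unfolding bad_def using xy by auto
    have "exp (- (\<eta> / 2)) \<le> exp (- (real (card (V W x y)) / (2 * real \<rho>)))"
    proof -
      have "real (card (V W x y)) / (2 * real \<rho>) \<le> real (card (V W x y)) / 2"
        using \<rho>_pos by (intro divide_left_mono) auto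
      also have "\<dots> \<le> \<eta> / 2" using nt by simp
      finally show ?thesis by simp
    qed
    also have "\<dots> \<le> pot \<eta> W" unfolding pot_def
      using member_le_sum[OF e, of "\<lambda>e. exp (- (real (card (V W (fst e) (snd e))) / (2 * real \<rho>)))"] fin_bad by simp
    also have "\<dots> \<le> 0.8425 ^ s * card (bad \<eta> {})" by (rule W(3))
    also have "\<dots> < 0.8425 ^ s * real D ^ 2"
    proof (intro mult_strict_left_mono)
      show "real (card (bad \<eta> {})) < real D ^ 2" using cb by (simp only: of_nat_power[symmetric] of_nat_less_iff)
    qed simp
    also have "\<dots> \<le> exp (- (0.1575 * s)) * real D ^ 2"
    proof (rule mult_right_mono)
      have "(0.8425::real) \<le> exp (- 0.1575)" using exp_ge_add_one_self[of "- 0.1575 :: real"] by simp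
      then have "(0.8425::real) ^ s \<le> exp (- 0.1575) ^ s" by (rule power_mono) simp
      also have "\<dots> = exp (- (0.1575 * s))" by (simp add: exp_of_nat_mult[symmetric] mult.commute)
      finally show "(0.8425::real) ^ s \<le> exp (- (0.1575 * s))" .
    qed simp
    also have "\<dots> = exp (2 * ln (real D) - 0.1575 * s)"
    proof -
      have "exp (2 * ln (real D)) = real D ^ 2"
        using D_large exp_of_nat_mult[of 2 "ln (real D)"] by simp
      then show ?thesis by (simp only: exp_diff exp_minus divide_inverse mult.commute)
    qed
    also have "\<dots> \<le> exp (- (\<eta> / 2))" using s by simp
    finally show False by simp
  qed
  obtain U where U: "U \<subseteq> \<Omega>" "card U \<le> s'" "\<And>i. i \<in> ?I \<Longrightarrow> (case i of (x, y) \<Rightarrow> V W x y) \<inter> U \<noteq> {}"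
    by (rule hitting_set[OF fin fI, of "\<lambda>(x, y). V W x y" \<eta> s'])
      (use good \<eta>(1) s' cI D_large in \<open>auto dest: subsetD[OF V_sub]\<close>)
  have "base_of G (W \<union> U)" unfolding base_of_def
  proof (intro ballI impI)
    fix g assume g: "g \<in> G" "\<forall>b\<in>W \<union> U. g b = b"
    show "g = id"
    proof
      fix x show "g x = id x"
      proof (cases "x \<in> \<Omega>")
        case True
        show ?thesis
        proof (rule ccontr)
          assume "g x \<noteq> id x"
          then have "(x, g x) \<in> ?I" using True pgroup_in[OF G g(1)] by auto
          from U(3)[OF this] obtain u w where "u \<in> U" "w \<in> W" "u \<in> S w x (g x)" unfolding V_def by auto
          then show False using g \<Theta>_inv[OF g(1), of w u x] unfolding S_def by auto
        qed
      qed (simp add: pgroup_out[OF G g(1)])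
    qed
  qed
  moreover have "card (W \<union> U) \<le> s + s'" using card_Un_le[of W U] W(2) U(2) by linarith
  ultimately show ?thesis using that[of "W \<union> U"] W(1) U(1) by auto
qed

end

section \<open>The bound for doubly transitive and for all primitive groups\<close>

lemma ktrans_mono: "ktrans \<Omega> G k \<Longrightarrow> j \<le> k \<Longrightarrow> ktrans \<Omega> G j"
  unfolding ktrans_def by (meson le_trans)

lemma pgroup_fixing:
  assumes G: "pgroup \<Omega> G"
  shows "pgroup (\<Omega> - B) {g \<in> G. \<forall>b\<in>B. g b = b}"
proof -
  have "pgroup \<Omega> {g \<in> G. \<forall>b\<in>B. g b = b}" by (rule pgroup_filter[OF G]) auto
  moreover have "g permutes (\<Omega> - B)" if "g permutes \<Omega>" "\<forall>b\<in>B. g b = b" for g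
    using that unfolding permutes_def by (metis DiffI)
  ultimately show ?thesis unfolding pgroup_def by auto
qed

lemma ktrans_fixing:
  assumes fin: "finite \<Omega>" and k: "ktrans \<Omega> G k" and B: "B \<subseteq> \<Omega>" "card B + j \<le> k"
  shows "ktrans (\<Omega> - B) {g \<in> G. \<forall>b\<in>B. g b = b} j"
  unfolding ktrans_def
proof (intro allI impI)
  fix A f assume A: "A \<subseteq> \<Omega> - B" "card A \<le> j" "inj_on f A" "f ` A \<subseteq> \<Omega> - B"
  let ?f = "\<lambda>x. if x \<in> B then x else f x"
  have "card (A \<union> B) \<le> k" using card_Un_le[of A B] A(2) B(2) by linarith
  moreover have "inj_on ?f (A \<union> B)" using A(1,3,4) by (auto simp: inj_on_def)
  moreover have "?f ` (A \<union> B) \<subseteq> \<Omega>" using A(4) B(1) by auto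
  ultimately obtain g where g: "g \<in> G" "\<forall>x\<in>A \<union> B. g x = ?f x"
    using ktransD[OF k, of "A \<union> B" ?f] A(1) B(1) by auto
  have "\<forall>x\<in>A. g x = f x" using g(2) A(1) by auto
  moreover have "\<forall>b\<in>B. g b = b" using g(2) by auto
  ultimately show "\<exists>g\<in>{g \<in> G. \<forall>b\<in>B. g b = b}. \<forall>x\<in>A. g x = f x" using g(1) by auto
qed

text \<open>A partial injection on \<open>t + 1\<close> points that no element extends is
  normalised: by \<open>t\<close>-transitivity, \<open>t - 2\<close> of its points and their images
  are both moved onto \<open>C\<close>. The three points left over give triples that the pointwise
  stabiliser of \<open>C\<close> cannot map to each other.\<close>

lemma sharp_transitivity:
  assumes G: "pgroup \<Omega> G" and t: "ktrans \<Omega> G t" "2 \<le> t" "\<not> ktrans \<Omega> G (Suc t)"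
    and C: "C \<subseteq> \<Omega>" "card C = t - 2"
  obtains a b c a' b' c' where "{a, b, c} \<subseteq> \<Omega> - C" "{a', b', c'} \<subseteq> \<Omega> - C" "distinct [a, b, c]" "distinct [a', b', c']"
    "\<And>g. g \<in> G \<Longrightarrow> \<forall>x\<in>C. g x = x \<Longrightarrow> \<not> (g a = a' \<and> g b = b' \<and> g c = c')"
proof -
  have fin: "finite \<Omega>" by (rule pgroup_finite[OF G])
  obtain B f where B: "B \<subseteq> \<Omega>" "card B \<le> Suc t" "inj_on f B" "f ` B \<subseteq> \<Omega>" "\<And>g. g \<in> G \<Longrightarrow> \<not> (\<forall>b\<in>B. g b = f b)"
    using t(3) unfolding ktrans_def by auto
  have finB: "finite B" using B(1) fin finite_subset by auto
  have cB: "card B = Suc t"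
  proof (rule ccontr)
    assume "card B \<noteq> Suc t"
    then have "card B \<le> t" using B(2) by linarith
    then show False using ktransD[OF t(1) B(1) _ B(3,4)] B(5) by auto
  qed
  obtain B1 where B1: "B1 \<subseteq> B" "card B1 = t - 2"
    using obtain_subset_with_card_n[of "t - 2" B] cB by (metis diff_le_self le_SucI)
  have fB1: "finite B1" using B1(1) finB finite_subset by auto
  have "card (B - B1) = 3" using B1 fB1 cB t(2) by (simp add: card_Diff_subset)
  then obtain a b c where abc: "B - B1 = {a, b, c}" "a \<noteq> b" "a \<noteq> c" "b \<noteq> c"
    by (auto simp: card_3_iff)
  have fC: "finite C" using C(1) fin finite_subset by auto
  obtain h where h: "bij_betw h B1 C" using finite_same_card_bij[OF fB1 fC] B1(2) C(2) by auto
  have "\<exists>g\<in>G. \<forall>x\<in>B1. g x = h x"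
    by (rule ktransD[OF t(1)]) (use B1 B(1) h C(1) in \<open>auto simp: bij_betw_def\<close>)
  then obtain g1 where g1: "g1 \<in> G" "\<And>x. x \<in> B1 \<Longrightarrow> g1 x = h x" by auto
  have inj1: "inj_on f B1" by (rule inj_on_subset[OF B(3) B1(1)])
  have "\<exists>g\<in>G. \<forall>x\<in>f ` B1. g x = (h \<circ> inv_into B1 f) x"
  proof (rule ktransD[OF t(1)])
    show "f ` B1 \<subseteq> \<Omega>" using B1(1) B(4) by auto
    show "card (f ` B1) \<le> t" using card_image_le[OF fB1, of f] B1(2) by linarith
    have e: "(h \<circ> inv_into B1 f) (f x) = h x" if "x \<in> B1" for x using that inj1 by simp
    show "inj_on (h \<circ> inv_into B1 f) (f ` B1)"
      using h by (auto simp: inj_on_def bij_betw_def e simp del: comp_apply)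
    show "(h \<circ> inv_into B1 f) ` f ` B1 \<subseteq> \<Omega>" using h C(1) by (auto simp: bij_betw_def e simp del: comp_apply)
  qed
  then obtain g2 where g2: "g2 \<in> G" "\<And>x. x \<in> B1 \<Longrightarrow> g2 (f x) = h x" using inj1 by auto
  have abcB: "a \<in> B" "b \<in> B" "c \<in> B" "a \<notin> B1" "b \<notin> B1" "c \<notin> B1" using abc(1) by auto
  have out1: "g1 x \<in> \<Omega> - C" if "x \<in> B" "x \<notin> B1" for x
  proof -
    have "g1 x \<notin> C"
    proof
      assume "g1 x \<in> C"
      then obtain y where "y \<in> B1" "g1 x = h y" using h by (auto simp: bij_betw_def)
      then show False using g1(2)[of y] pgroup_inj[OF G g1(1), of x y] that by simp
    qed
    then show ?thesis using that B(1) pgroup_in[OF G g1(1)] by auto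
  qed
  have out2: "g2 (f x) \<in> \<Omega> - C" if "x \<in> B" "x \<notin> B1" for x
  proof -
    have "g2 (f x) \<notin> C"
    proof
      assume "g2 (f x) \<in> C"
      then obtain y where y: "y \<in> B1" "g2 (f x) = h y" using h by (auto simp: bij_betw_def)
      then have "f x = f y" using g2(2)[OF y(1)] pgroup_inj[OF G g2(1), of "f x" "f y"] by simp
      then show False using inj_onD[OF B(3)] that y(1) B1(1) by blast
    qed
    then show ?thesis using that B(4) pgroup_in[OF G g2(1)] by auto
  qed
  show ?thesis
  proof (rule that[of "g1 a" "g1 b" "g1 c" "g2 (f a)" "g2 (f b)" "g2 (f c)"])
    show "{g1 a, g1 b, g1 c} \<subseteq> \<Omega> - C" "{g2 (f a), g2 (f b), g2 (f c)} \<subseteq> \<Omega> - C"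
      using out1 out2 abcB by blast+
    show "distinct [g1 a, g1 b, g1 c]" using abc pgroup_inj[OF G g1(1)] by simp
    show "distinct [g2 (f a), g2 (f b), g2 (f c)]"
      using abc(2-4) abcB pgroup_inj[OF G g2(1)] inj_on_eq_iff[OF B(3)] by simp
    fix g assume g: "g \<in> G" "\<forall>x\<in>C. g x = x"
    show "\<not> (g (g1 a) = g2 (f a) \<and> g (g1 b) = g2 (f b) \<and> g (g1 c) = g2 (f c))"
    proof
      assume e: "g (g1 a) = g2 (f a) \<and> g (g1 b) = g2 (f b) \<and> g (g1 c) = g2 (f c)"
      have "(inv' g2 \<circ> (g \<circ> g1)) x = f x" if x: "x \<in> B" for x
      proof -
        have "g (g1 x) = g2 (f x)"
        proof (cases "x \<in> B1")
          case True
          then have "h x \<in> C" using h by (auto simp: bij_betw_def)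
          then show ?thesis using g1(2)[OF True] g2(2)[OF True] g(2) by simp
        next
          case False
          then have "x \<in> {a, b, c}" using abc(1) x by blast
          then show ?thesis using e by auto
        qed
        then show ?thesis by (simp add: pgroup_inv1[OF G g2(1)])
      qed
      moreover have "inv' g2 \<circ> (g \<circ> g1) \<in> G" using g(1) g1(1) g2(1) pgroup_comp[OF G] pgroup_inv[OF G] by auto
      ultimately show False using B(5) by blast
    qed
  qed
qed

text \<open>The three groups of terms stand for the degree of transitivity, the points
  \<open>w\<close> chosen by the potential and the hitting set. In terms of the fourth root
  \<open>q\<close> of \<open>d\<close> the sum is a cubic, and multiplication by \<open>L\<close>
  makes it at most \<open>3.915 * d\<close>.\<close>

lemma transitive_bound_numeric:
  fixes d t L :: real
  assumes d: "16000 \<le> d" and L: "L = ln d"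
    and t: "t \<le> 33 * sqrt d + (12.7 * L + 6.35 * sqrt d + 1) + (sqrt d * L + 1)"
  shows "t * L \<le> 14/3 * (d - 1)"
proof -
  define q where "q = d powr (1/4)"
  have q: "L \<le> 0.87 * q" "11.24 \<le> q" using ln_le_root4[OF d] L unfolding q_def by auto
  have sq: "sqrt d = q * q" unfolding q_def using d by (simp add: powr_add[symmetric] powr_half_sqrt)
  have dq: "d = (q * q) * (q * q)" using sq d by (metis real_sqrt_mult_self abs_of_nonneg order_trans zero_le_numeral)
  have L0: "0 \<le> L" using L d by simp
  have "t \<le> 33 * (q * q) + (12.7 * (0.87 * q) + 6.35 * (q * q) + 1) + ((q * q) * (0.87 * q) + 1)"
  proof -
    have "(q * q) * L \<le> (q * q) * (0.87 * q)" by (rule mult_left_mono) (use q in auto)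
    then show ?thesis using t q(1) unfolding sq by linarith
  qed
  also have "\<dots> = 2 + 11.049 * q + 39.35 * (q * q) + 0.87 * (q * q * q)" by (simp add: algebra_simps)
  finally have tb: "t \<le> 2 + 11.049 * q + 39.35 * (q * q) + 0.87 * (q * q * q)" .
  have q2: "11.24 * q \<le> q * q" using q(2) by (intro mult_right_mono) auto
  have q3: "11.24 * (q * q) \<le> q * q * q" using mult_right_mono[OF q(2), of "q * q"] by (simp add: mult_ac)
  have "t \<le> 4.5 * c" if "t \<le> 2 + 11.049 * q + 39.35 * b + 0.87 * c" "11.24 * q \<le> b" "11.24 * b \<le> c" for b c
    using that q(2) by simp
  from this[OF tb q2 q3] have "t \<le> 4.5 * (q * q * q)" .
  then have "t * L \<le> 4.5 * (q * q * q) * L" by (rule mult_right_mono[OF _ L0])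
  also have "\<dots> \<le> 4.5 * (q * q * q) * (0.87 * q)" by (rule mult_left_mono[OF q(1)]) (use q in auto)
  also have "\<dots> = 3.915 * d" unfolding dq by simp
  also have "\<dots> \<le> 14/3 * (d - 1)" using d by simp
  finally show ?thesis .
qed

text \<open>If \<open>t\<close> is the exact degree of transitivity, fixing \<open>t - 2\<close>
  points leaves a doubly but not triply transitive group, whose orbits on triples yield the relation
  for \<open>not_3trans\<close>. The fixed points and the base found there form a base of
  \<open>G\<close>.\<close>

lemma doubly_transitive_bound:
  assumes G: "pgroup \<Omega> G" and t2: "ktrans \<Omega> G 2" and no: "no_cyc3 G" and d: "16000 < card \<Omega>"
  shows "card G \<le> 2 ^ (7 * (card \<Omega> - 1))"
proof -
  let ?d = "real (card \<Omega>)"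
  have fin: "finite \<Omega>" by (rule pgroup_finite[OF G])
  \<comment> \<open>The square of 2.7 exceeds 7, as \<open>transitivity_bound\<close> requires, and
    \<open>12 * z\<close> stays below \<open>33 * sqrt ?d\<close>.\<close>
  define z where "z = nat \<lceil>2.7 * sqrt ?d\<rceil>"
  have sd: "126 \<le> sqrt ?d" by (rule real_le_rsqrt) (use d in auto)
  have ss: "sqrt ?d * sqrt ?d = ?d" by simp
  have z: "2.7 * sqrt ?d \<le> real z" "real z \<le> 2.7 * sqrt ?d + 1" unfolding z_def using sd by linarith+
  have zz: "7 * card \<Omega> \<le> z * z"
  proof -
    have "(2.7 * sqrt ?d) * (2.7 * sqrt ?d) \<le> real z * real z" by (rule mult_mono) (use z sd in auto)
    then have "7 * ?d \<le> real z * real z" using ss by simp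
    then have "real (7 * card \<Omega>) \<le> real (z * z)" by simp
    then show ?thesis by (simp only: of_nat_le_iff)
  qed
  have zd: "12 * z \<le> card \<Omega>"
  proof -
    have "126 * sqrt ?d \<le> sqrt ?d * sqrt ?d" by (rule mult_right_mono) (use sd in auto)
    then have "real (12 * z) \<le> ?d" using z(2) ss sd by simp
    then show ?thesis by (simp only: of_nat_le_iff)
  qed
  have nk: "\<not> ktrans \<Omega> G (12 * z)"
    by (rule transitivity_bound[OF G _ zz zd]) (use min_degree[OF G t2 no] d in auto)
  define k where "k = (LEAST k. \<not> ktrans \<Omega> G k)"
  have k: "\<not> ktrans \<Omega> G k" "k \<le> 12 * z" "\<And>j. j < k \<Longrightarrow> ktrans \<Omega> G j"
    unfolding k_def using LeastI[of "\<lambda>k. \<not> ktrans \<Omega> G k", OF nk] Least_le[of "\<lambda>k. \<not> ktrans \<Omega> G k", OF nk] not_less_Least by auto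
  have k2: "2 < k" using k(1) ktrans_mono[OF t2] by (meson not_le)
  define t where "t = k - 1"
  have t: "ktrans \<Omega> G t" "2 \<le> t" "\<not> ktrans \<Omega> G (Suc t)" "t < 12 * z" using k k2 unfolding t_def by auto
  have "t - 2 \<le> card \<Omega>" using t(4) zd by linarith
  then obtain C where C: "C \<subseteq> \<Omega>" "card C = t - 2" using obtain_subset_with_card_n by metis
  have fC: "finite C" using C(1) fin finite_subset by auto
  define G' where "G' = {g \<in> G. \<forall>x\<in>C. g x = x}"
  define \<Omega>' where "\<Omega>' = \<Omega> - C"
  have G': "pgroup \<Omega>' G'" unfolding G'_def \<Omega>'_def by (rule pgroup_fixing[OF G])
  have t2': "ktrans \<Omega>' G' 2" unfolding G'_def \<Omega>'_def
    by (rule ktrans_fixing[OF fin t(1) C(1)]) (use C(2) t(2) in simp)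
  have fin': "finite \<Omega>'" using fin unfolding \<Omega>'_def by simp
  have cD: "card \<Omega>' = card \<Omega> - (t - 2)" unfolding \<Omega>'_def using card_Diff_subset[OF fC C(1)] C(2) by simp
  have D: "100 \<le> card \<Omega>'" "card \<Omega>' \<le> card \<Omega>"
  proof -
    have "12 * real z \<le> 33 * sqrt ?d" using z(2) sd by linarith
    moreover have "126 * sqrt ?d \<le> sqrt ?d * sqrt ?d" by (rule mult_right_mono) (use sd in auto)
    ultimately have "real t + 100 \<le> ?d" using t(4) ss sd by linarith
    then show "100 \<le> card \<Omega>'" unfolding cD by linarith
    show "card \<Omega>' \<le> card \<Omega>" unfolding cD by simp
  qed
  obtain a b c a' b' c' where tr: "{a, b, c} \<subseteq> \<Omega>'" "{a', b', c'} \<subseteq> \<Omega>'" "distinct [a, b, c]" "distinct [a', b', c']"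
    "\<And>g. g \<in> G' \<Longrightarrow> \<not> (g a = a' \<and> g b = b' \<and> g c = c')"
    using sharp_transitivity[OF G t(1-3) C] unfolding \<Omega>'_def G'_def by (smt (verit) mem_Collect_eq)
  define T where "T = {(w, u, x). w \<in> \<Omega>' \<and> u \<in> \<Omega>' \<and> x \<in> \<Omega>' \<and> w \<noteq> u \<and> u \<noteq> x \<and> w \<noteq> x}"
  define \<Theta>0 where "\<Theta>0 = (\<lambda>g. (g a, g b, g c)) ` G'"
  have finT: "finite T" by (rule finite_subset[of _ "\<Omega>' \<times> \<Omega>' \<times> \<Omega>'"]) (use fin' in \<open>auto simp: T_def\<close>)
  have sub0: "\<Theta>0 \<subseteq> T" unfolding \<Theta>0_def T_def using tr(1,3) pgroup_in[OF G'] pgroup_inj[OF G'] by auto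
  have ne0: "\<Theta>0 \<noteq> {}" unfolding \<Theta>0_def using pgroup_id[OF G'] by auto
  have ne1: "T - \<Theta>0 \<noteq> {}"
  proof -
    have "(a', b', c') \<in> T" unfolding T_def using tr(2,4) by auto
    moreover have "(a', b', c') \<notin> \<Theta>0" unfolding \<Theta>0_def using tr(5) by auto
    ultimately show ?thesis by blast
  qed
  have inv0: "(g w, g u, g x) \<in> \<Theta>0 \<longleftrightarrow> (w, u, x) \<in> \<Theta>0" if g: "g \<in> G'" for g w u x
  proof
    assume "(w, u, x) \<in> \<Theta>0"
    then obtain h where "h \<in> G'" "w = h a" "u = h b" "x = h c" unfolding \<Theta>0_def by auto
    then show "(g w, g u, g x) \<in> \<Theta>0" unfolding \<Theta>0_def using pgroup_comp[OF G' g] by (intro image_eqI[of _ _ "g \<circ> h"]) auto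
  next
    assume "(g w, g u, g x) \<in> \<Theta>0"
    then obtain h where h: "h \<in> G'" "g w = h a" "g u = h b" "g x = h c" unfolding \<Theta>0_def by auto
    have "w = inv' g (h a)" "u = inv' g (h b)" "x = inv' g (h c)"
      using h(2-4)[symmetric] pgroup_inv1[OF G' g] by auto
    then show "(w, u, x) \<in> \<Theta>0" unfolding \<Theta>0_def
      using pgroup_comp[OF G' pgroup_inv[OF G' g] h(1)] by (intro image_eqI[of _ _ "inv' g \<circ> h"]) auto
  qed
  have invT: "(g w, g u, g x) \<in> T \<longleftrightarrow> (w, u, x) \<in> T" if g: "g \<in> G'" for g w u x
    unfolding T_def using pgroup_in[OF G' g] pgroup_inj[OF G' g] by simp
  have cT: "card T = card \<Theta>0 + card (T - \<Theta>0)"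
    using card_mono[OF finT sub0] finite_subset[OF sub0 finT] sub0 by (simp add: card_Diff_subset)
  \<comment> \<open>An orbit on triples or its complement has at most half of all triples; both are
    invariant and nonempty.\<close>
  obtain \<Theta> where \<Theta>: "\<Theta> \<subseteq> T" "\<Theta> \<noteq> {}" "2 * card \<Theta> \<le> card T"
    "\<And>g w u x. g \<in> G' \<Longrightarrow> (g w, g u, g x) \<in> \<Theta> \<longleftrightarrow> (w, u, x) \<in> \<Theta>"
  proof (cases "2 * card \<Theta>0 \<le> card T")
    case True
    show ?thesis by (rule that[of \<Theta>0]) (use True sub0 ne0 inv0 in auto)
  next
    case False
    show ?thesis
      by (rule that[of "T - \<Theta>0"]) (use False cT ne1 inv0 invT in \<open>simp_all add: Diff_subset\<close>)
  qed
  interpret N3: not_3trans \<Omega>' G' \<Theta>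
    by (unfold_locales) (use G' t2' \<Theta> D(1) in \<open>simp_all add: T_def\<close>)
  let ?D = "real (card \<Omega>')"
  have Dp: "100 \<le> ?D" "?D \<le> ?d" using D by auto
  define s where "s = nat \<lceil>(2 * ln ?D + sqrt ?D) / 0.1575\<rceil>"
  define s' where "s' = nat \<lceil>sqrt ?D * ln ?D\<rceil>"
  have lnD: "0 \<le> ln ?D" "ln ?D \<le> ln ?d" using Dp by auto
  have sD: "10 \<le> sqrt ?D" "sqrt ?D \<le> sqrt ?d" "sqrt ?D * sqrt ?D = ?D"
    by (rule real_le_rsqrt) (use Dp in auto)
  have s1: "(2 * ln ?D + sqrt ?D) / 0.1575 \<le> real s" "real s \<le> (2 * ln ?D + sqrt ?D) / 0.1575 + 1"
  proof -
    have "0 \<le> (2 * ln ?D + sqrt ?D) / 0.1575" using lnD sD by simp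
    then show "(2 * ln ?D + sqrt ?D) / 0.1575 \<le> real s" "real s \<le> (2 * ln ?D + sqrt ?D) / 0.1575 + 1"
      unfolding s_def by linarith+
  qed
  have s2: "sqrt ?D * ln ?D \<le> real s'" "real s' \<le> sqrt ?D * ln ?D + 1"
  proof -
    have "0 \<le> sqrt ?D * ln ?D" using lnD sD by simp
    then show "sqrt ?D * ln ?D \<le> real s'" "real s' \<le> sqrt ?D * ln ?D + 1" unfolding s'_def by linarith+
  qed
  \<comment> \<open>The value \<open>2 * sqrt ?D\<close> for \<open>\<eta>\<close> balances the two
    parts of the base: the first grows with \<open>\<eta>\<close>, the second with
    \<open>?D / \<eta>\<close> times a logarithm.\<close>
  obtain B where B: "B \<subseteq> \<Omega>'" "base_of G' B" "card B \<le> s + s'"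
  proof (rule N3.small_base[of "2 * sqrt ?D" s s'])
    show "0 < 2 * sqrt ?D" using sD(1) by linarith
    have "10 * sqrt ?D \<le> sqrt ?D * sqrt ?D" by (rule mult_right_mono) (use sD in auto)
    then show "2 * sqrt ?D \<le> ?D / 4" using sD by simp
    show "2 * ln ?D + 2 * sqrt ?D / 2 \<le> 0.1575 * real s" using s1(1) by (simp add: field_simps)
    have "?D / sqrt ?D = sqrt ?D" by (rule real_div_sqrt) simp
    then have "2 * ?D / (2 * sqrt ?D) = sqrt ?D" by simp
    then show "2 * ?D / (2 * sqrt ?D) * ln ?D \<le> real s'" using s2(1) by simp
  qed
  have base: "base_of G (C \<union> B)"
    using B(2) unfolding base_of_def G'_def by auto
  have sub: "C \<union> B \<subseteq> \<Omega>" using B(1) C(1) unfolding \<Omega>'_def by auto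
  have "card (C \<union> B) \<le> t - 2 + (s + s')" using card_Un_le[of C B] C(2) B(3) by linarith
  then have cb: "real (card (C \<union> B)) \<le> real t + real s + real s'" by linarith
  have "real (card (C \<union> B)) * ln ?d \<le> 14/3 * (?d - 1)"
  proof (rule transitive_bound_numeric[OF _ refl])
    have "real t \<le> 33 * sqrt ?d" using t(4) z(2) sd by linarith
    moreover have "real s \<le> 12.7 * ln ?d + 6.35 * sqrt ?d + 1" using s1(2) lnD sD(1,2) by (simp add: field_simps del: real_sqrt_le_iff)
    moreover have "sqrt ?D * ln ?D \<le> sqrt ?d * ln ?d" by (rule mult_mono) (use lnD sD in auto)
    ultimately show "real (card (C \<union> B)) \<le> 33 * sqrt ?d + (12.7 * ln ?d + 6.35 * sqrt ?d + 1) + (sqrt ?d * ln ?d + 1)"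
      using cb s2(2) by linarith
  qed (use d in simp)
  moreover have "real (card G) \<le> ?d ^ card (C \<union> B)"
    using base_bound[OF G sub base] by (metis of_nat_le_iff of_nat_power)
  ultimately show ?thesis using exp_bound_to_pow d by simp
qed

text \<open>Groups with 3-cycles must be left out, because alternating groups outgrow every
  exponential bound. Above degree 16000 either some point stabiliser has two orbits on the other
  points, and Babai's method applies, or the group is doubly transitive.\<close>

theorem primitive_bound:
  assumes G: "pgroup \<Omega> G" and prim: "primitive_on \<Omega> G" and no: "no_cyc3 G" and d: "2 \<le> card \<Omega>"
  shows "card G \<le> 2 ^ (7 * (card \<Omega> - 1))"
proof (cases "card \<Omega> \<le> 16000")
  case True
  then show ?thesis using bound_medium[OF G no d] by simp
next
  case False
  then have d: "16000 < card \<Omega>" by simp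
  interpret uniprimitive \<Omega> G by unfold_locales (rule G prim)+
  show ?thesis
  proof (cases "\<exists>z\<in>\<Omega>. \<exists>x\<in>\<Omega>. \<exists>y\<in>\<Omega>. x \<noteq> z \<and> y \<noteq> z \<and> \<not> eqv z x y")
    case True
    then show ?thesis using order_bound d by blast
  next
    case F: False
    have tr: "\<exists>g\<in>G. g x = y" if "x \<in> \<Omega>" "y \<in> \<Omega>" for x y using trans that by auto
    have two: "\<exists>g\<in>G. g x = a \<and> g y = b" if h: "x \<in> \<Omega>" "y \<in> \<Omega>" "x \<noteq> y" "a \<in> \<Omega>" "b \<in> \<Omega>" "a \<noteq> b" for x y a b
    proof -
      obtain g where g: "g \<in> G" "g x = a" using tr[OF h(1,4)] by auto
      have "g y \<in> \<Omega>" "g y \<noteq> a" using pgroup_in[OF G g(1)] pgroup_inj[OF G g(1)] h g(2) by auto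
      then have "eqv a (g y) b" using F h(4-6) by (metis (full_types))
      then obtain k where k: "k \<in> G" "k a = a" "k (g y) = b" unfolding eqv_def by auto
      show ?thesis by (rule bexI[of _ "k \<circ> g"]) (use g k pgroup_comp[OF G k(1) g(1)] in auto)
    qed
    have "ktrans \<Omega> G 2" unfolding ktrans_def
    proof (intro allI impI)
      fix B f assume B: "B \<subseteq> \<Omega>" "card B \<le> 2" "inj_on f B" "f ` B \<subseteq> \<Omega>"
      have finB: "finite B" using B(1) fin finite_subset by auto
      consider "card B = 0" | "card B = 1" | "card B = 2" using B(2) by linarith
      then show "\<exists>g\<in>G. \<forall>b\<in>B. g b = f b"
      proof cases
        case 1 then show ?thesis using finB pgroup_id[OF G] by auto
      next
        case 2 then obtain x where "B = {x}" by (auto simp: card_1_singleton_iff)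
        then show ?thesis using tr[of x "f x"] B by auto
      next
        case 3 then obtain x y where "B = {x, y}" "x \<noteq> y" by (auto simp: card_2_iff)
        then show ?thesis using two[of x y "f x" "f y"] B by auto
      qed
    qed
    then show ?thesis by (rule doubly_transitive_bound[OF G _ no d])
  qed
qed

subsection \<open>Actions on sets of blocks\<close>

definition pres :: "('a \<Rightarrow> 'a) set \<Rightarrow> 'a set set \<Rightarrow> bool"
  where "pres M D \<longleftrightarrow> (\<forall>g\<in>M. \<forall>u\<in>D. g ` u \<in> D)"

text \<open>The identity outside \<open>D\<close>, so that the induced maps permute \<open>D\<close>
  in the sense of \<open>permutes\<close> and the results on permutation groups apply with blocks as
  points.\<close>

definition act :: "'a set set \<Rightarrow> ('a \<Rightarrow> 'a) \<Rightarrow> 'a set \<Rightarrow> 'a set"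
  where "act D g u = (if u \<in> D then g ` u else u)"

definition ker :: "('a \<Rightarrow> 'a) set \<Rightarrow> 'a set set \<Rightarrow> ('a \<Rightarrow> 'a) set"
  where "ker M D = {g \<in> M. \<forall>u\<in>D. g ` u = u}"

definition giant :: "('a \<Rightarrow> 'a) set \<Rightarrow> 'a set set \<Rightarrow> bool"
  where "giant M D \<longleftrightarrow> alt3 D (act D ` M)"

lemma o_image: "(f \<circ> g) ` u = f ` g ` u" by (rule image_comp[symmetric])

lemma presD: "pres M D \<Longrightarrow> g \<in> M \<Longrightarrow> u \<in> D \<Longrightarrow> g ` u \<in> D"
  unfolding pres_def by auto

lemma pres_mono: "pres M D \<Longrightarrow> N \<subseteq> M \<Longrightarrow> pres N D"
  unfolding pres_def by auto

lemma giantD: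
  assumes "giant M D" "a \<in> D" "b \<in> D" "c \<in> D" "a \<noteq> b" "b \<noteq> c" "a \<noteq> c"
  obtains g where "g \<in> M" "\<And>u. u \<in> D \<Longrightarrow> g ` u = cyc3 a b c u"
proof -
  obtain g where g: "g \<in> M" "act D g = cyc3 a b c"
    using alt3D[OF assms(1)[unfolded giant_def] assms(2-7)] by auto
  have "g ` u = cyc3 a b c u" if "u \<in> D" for u using fun_cong[OF g(2), of u] that by (simp add: act_def)
  then show ?thesis using that g(1) by blast
qed

lemma giantI:
  assumes "\<And>a b c. a \<in> D \<Longrightarrow> b \<in> D \<Longrightarrow> c \<in> D \<Longrightarrow> a \<noteq> b \<Longrightarrow> b \<noteq> c \<Longrightarrow> a \<noteq> c \<Longrightarrow>
    \<exists>g\<in>M. \<forall>u\<in>D. g ` u = cyc3 a b c u"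
  shows "giant M D"
  unfolding giant_def alt3_def
proof (intro ballI impI)
  fix a b c assume abc: "a \<in> D" "b \<in> D" "c \<in> D" "a \<noteq> b" "b \<noteq> c" "a \<noteq> c"
  obtain g where g: "g \<in> M" "\<forall>u\<in>D. g ` u = cyc3 a b c u" using assms[OF abc] by auto
  have "act D g = cyc3 a b c"
    using g(2) abc by (auto simp: act_def fun_eq_iff cyc3_def)
  then show "cyc3 a b c \<in> act D ` M" using g(1) by force
qed

lemma giant_mono: "giant M D \<Longrightarrow> M \<subseteq> N \<Longrightarrow> giant N D"
  unfolding giant_def alt3_def by blast

lemma act_comp: "pres M D \<Longrightarrow> h \<in> M \<Longrightarrow> act D (g \<circ> h) = act D g \<circ> act D h"
  by (auto simp: act_def fun_eq_iff pres_def image_comp)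

lemma act_id: "act D id = id"
  by (auto simp: act_def fun_eq_iff)

lemma pgroup_act:
  assumes M: "pgroup \<Omega> M" and D: "pres M D" "finite D"
  shows "pgroup D (act D ` M)" and "\<And>g. g \<in> M \<Longrightarrow> act D (inv' g) = inv' (act D g)"
    and "\<And>g. g \<in> M \<Longrightarrow> act D g permutes D"
proof -
  have i: "act D (inv' g) \<circ> act D g = id" "act D g \<circ> act D (inv' g) = id" if g: "g \<in> M" for g
    using act_comp[OF D(1) g, of "inv' g"] act_comp[OF D(1) pgroup_inv[OF M g], of g]
    unfolding pgroup_invo1[OF M g] pgroup_invo2[OF M g] act_id by metis+
  show inv: "act D (inv' g) = inv' (act D g)" if g: "g \<in> M" for g
    using inv_unique_comp[OF i(2,1)[OF g]] by simp
  show perm: "act D g permutes D" if g: "g \<in> M" for g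
  proof (rule bij_imp_permutes)
    show "act D g x = x" if "x \<notin> D" for x using that by (simp add: act_def)
    have "bij (act D g)" using i[OF g] o_bij by blast
    then show "bij_betw (act D g) D D"
      unfolding bij_betw_def using D presD[OF D(1) g]
      by (metis act_def bij_is_inj endo_inj_surj image_subsetI inj_on_subset subset_UNIV)
  qed
  show "pgroup D (act D ` M)" unfolding pgroup_def
  proof (intro conjI ballI)
    show "finite D" by (rule D)
    show "id \<in> act D ` M" using act_id pgroup_id[OF M] by (metis imageI)
    fix f assume "f \<in> act D ` M"
    then obtain g where g: "g \<in> M" "f = act D g" by auto
    show "f permutes D" using perm g by simp
    show "inv' f \<in> act D ` M" using inv[OF g(1)] g pgroup_inv[OF M g(1)] by (metis imageI)
    fix f' assume "f' \<in> act D ` M"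
    then obtain h where h: "h \<in> M" "f' = act D h" by auto
    show "f \<circ> f' \<in> act D ` M" using act_comp[OF D(1) h(1)] g h pgroup_comp[OF M g(1) h(1)] by (metis imageI)
  qed
qed

lemma pgroup_ker: "pgroup \<Omega> M \<Longrightarrow> pgroup \<Omega> (ker M D)"
  unfolding ker_def by (rule pgroup_filter) (simp_all only: o_image image_id id_apply, auto)

lemma ker_sub: "ker M D \<subseteq> M" unfolding ker_def by auto

lemma image_inv_eq:
  assumes "pgroup \<Omega> M" "g \<in> M"
  shows "inv' g ` (g ` u) = u" "g ` (inv' g ` u) = u"
  using pgroup_invo1[OF assms] pgroup_invo2[OF assms] by (simp_all add: image_comp)

lemma ker_normal:
  assumes M: "pgroup \<Omega> M" and D: "pres M D"
  shows "normal_in (ker M D) M"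
  unfolding normal_in_def
proof (intro ballI)
  fix x y assume x: "x \<in> M" and y: "y \<in> ker M D"
  have "(x \<circ> y \<circ> inv' x) ` u = u" if u: "u \<in> D" for u
  proof -
    have "y ` (inv' x ` u) = inv' x ` u" using presD[OF D pgroup_inv[OF M x] u] y unfolding ker_def by auto
    then show ?thesis using image_inv_eq(2)[OF M x, of u] by (simp only: o_image)
  qed
  then show "x \<circ> y \<circ> inv' x \<in> ker M D" using pgroup_conj[OF M x] y unfolding ker_def by auto
qed

lemma act_eq_iff:
  assumes M: "pgroup \<Omega> M" and gh: "g \<in> M" "h \<in> M"
  shows "act D g = act D h \<longleftrightarrow> inv' h \<circ> g \<in> ker M D"
proof -
  have "act D g = act D h \<longleftrightarrow> (\<forall>u\<in>D. g ` u = h ` u)" by (auto simp: act_def fun_eq_iff)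
  also have "\<dots> \<longleftrightarrow> (\<forall>u\<in>D. inv' h ` (g ` u) = u)"
    using image_inv_eq[OF M gh(2)] by metis
  also have "\<dots> \<longleftrightarrow> inv' h \<circ> g \<in> ker M D"
    unfolding ker_def using pgroup_comp[OF M pgroup_inv[OF M gh(2)] gh(1)] by (simp add: image_comp)
  finally show ?thesis .
qed

lemma giant_normal:
  assumes M: "pgroup \<Omega> M" and D: "pres M D" "7 \<le> card D" and gi: "giant M D"
    and N: "pgroup \<Omega> N" "N \<subseteq> M" "normal_in N M" and g: "g \<in> N" "u \<in> D" "g ` u \<noteq> u"
  shows "giant N D"
  unfolding giant_def
proof (rule alt3_normal)
  have fD: "finite D" using D(2) card.infinite by fastforce
  note pM = pgroup_act[OF M D(1) fD]
  show "pgroup D (act D ` M)" by (rule pM(1))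
  show "alt3 D (act D ` M)" using gi unfolding giant_def .
  show "pgroup D (act D ` N)" by (rule pgroup_act(1)[OF N(1) pres_mono[OF D(1) N(2)] fD])
  show "7 \<le> card D" by (rule D)
  show "act D g \<in> act D ` N" using g by auto
  show "act D g \<noteq> id" using g by (auto simp: act_def fun_eq_iff)
  show "normal_in (act D ` N) (act D ` M)" unfolding normal_in_def
  proof (intro ballI)
    fix x y assume "x \<in> act D ` M" "y \<in> act D ` N"
    then obtain x' y' where xy: "x' \<in> M" "x = act D x'" "y' \<in> N" "y = act D y'" by auto
    have "x \<circ> y \<circ> inv' x = act D (x' \<circ> y' \<circ> inv' x')"
      using xy N(2) act_comp[OF D(1)] pM(2)[OF xy(1)] pgroup_inv[OF M xy(1)] by (simp add: subset_iff)
    moreover have "x' \<circ> y' \<circ> inv' x' \<in> N" using N(3) xy unfolding normal_in_def by auto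
    ultimately show "x \<circ> y \<circ> inv' x \<in> act D ` N" by auto
  qed
qed

text \<open>By \<open>cyc3_commutator\<close> a 3-cycle is a commutator of two 3-cycles when two
  further letters are available. So commutators between two giants on \<open>D\<close> again induce
  all 3-cycles; this is how a giant is found inside an intersection.\<close>

lemma giant_comm:
  assumes P: "pgroup \<Omega> P" "giant P D" "pres P D" and Q: "pgroup \<Omega> Q" "giant Q D" "pres Q D"
    and D: "finite D" "5 \<le> card D"
    and R: "\<And>p q. p \<in> P \<Longrightarrow> q \<in> Q \<Longrightarrow> comm p q \<in> R"
  shows "giant R D"
proof (rule giantI)
  fix a b c assume abc: "a \<in> D" "b \<in> D" "c \<in> D" "a \<noteq> b" "b \<noteq> c" "a \<noteq> c"
  obtain d where d: "d \<in> D" "d \<notin> set [a, b, c]" using ex_not_in_list[OF D(1), of "[a, b, c]"] D(2) by auto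
  obtain e where e: "e \<in> D" "e \<notin> set [a, b, c, d]" using ex_not_in_list[OF D(1), of "[a, b, c, d]"] D(2) by auto
  have ne: "a \<noteq> d" "b \<noteq> d" "c \<noteq> d" "a \<noteq> e" "b \<noteq> e" "c \<noteq> e" "d \<noteq> e" using d(2) e(2) by (simp; blast)+
  have bp: "bij (cyc3 a b d)" and bq: "bij (cyc3 a c e)" using abc ne by (simp_all add: bij_cyc3)
  obtain p where p: "p \<in> P" "\<And>u. u \<in> D \<Longrightarrow> p ` u = cyc3 a b d u"
    by (rule giantD[OF P(2), of a b d]) (use abc d(1) ne in simp_all)
  obtain q where q: "q \<in> Q" "\<And>u. u \<in> D \<Longrightarrow> q ` u = cyc3 a c e u"
    by (rule giantD[OF Q(2), of a c e]) (use abc e(1) ne in simp_all)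
  have pi: "inv' p ` u = inv' (cyc3 a b d) u" if u: "u \<in> D" for u
  proof -
    have v: "inv' p ` u \<in> D" by (rule presD[OF P(3) pgroup_inv[OF P(1) p(1)] u])
    have "cyc3 a b d (inv' p ` u) = u" using p(2)[OF v] image_inv_eq(2)[OF P(1) p(1)] by simp
    then show ?thesis using bij_inv_eq_iff[OF bp] by metis
  qed
  have qi: "inv' q ` u = inv' (cyc3 a c e) u" if u: "u \<in> D" for u
  proof -
    have v: "inv' q ` u \<in> D" by (rule presD[OF Q(3) pgroup_inv[OF Q(1) q(1)] u])
    have "cyc3 a c e (inv' q ` u) = u" using q(2)[OF v] image_inv_eq(2)[OF Q(1) q(1)] by simp
    then show ?thesis using bij_inv_eq_iff[OF bq] by metis
  qed
  have "comm p q ` u = cyc3 a b c u" if u: "u \<in> D" for u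
  proof -
    have u1: "inv' q ` u \<in> D" by (rule presD[OF Q(3) pgroup_inv[OF Q(1) q(1)] u])
    have u2: "inv' p ` (inv' q ` u) \<in> D" by (rule presD[OF P(3) pgroup_inv[OF P(1) p(1)] u1])
    have u3: "q ` (inv' p ` (inv' q ` u)) \<in> D" by (rule presD[OF Q(3) q(1) u2])
    have "comm p q ` u = p ` (q ` (inv' p ` (inv' q ` u)))" by (simp only: comm_def o_image)
    also have "\<dots> = comm (cyc3 a b d) (cyc3 a c e) u"
      using p(2)[OF u3] q(2)[OF u2] pi[OF u1] qi[OF u] by (simp add: comm_def)
    also have "\<dots> = cyc3 a b c u" using cyc3_commutator[of a b c d e] abc ne by simp
    finally show ?thesis .
  qed
  then show "\<exists>g\<in>R. \<forall>u\<in>D. g ` u = cyc3 a b c u" using R[OF p(1) q(1)] by blast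
qed

lemma comm_normal_in:
  assumes P: "pgroup \<Omega> P" "p \<in> P" and n: "q \<circ> inv' p \<circ> inv' q \<in> P"
  shows "comm p q \<in> P"
  using pgroup_comp[OF P n] by (simp add: comm_def comp_assoc)

lemma comm_normal_in':
  assumes Q: "pgroup \<Omega> Q" "q \<in> Q" and n: "p \<circ> q \<circ> inv' p \<in> Q"
  shows "comm p q \<in> Q"
  using pgroup_comp[OF Q(1) n pgroup_inv[OF Q]] by (simp add: comm_def)

text \<open>Commutators between two normal subgroups lie in both, so \<open>giant_comm\<close>
  passes from two of them to their intersection, one subgroup at a time.\<close>

lemma giant_INT:
  assumes M: "pgroup \<Omega> M" "giant M D" "pres M D" and D: "finite D" "5 \<le> card D" and I: "finite I"
    and B: "\<And>t. t \<in> I \<Longrightarrow> pgroup \<Omega> (B t)" "\<And>t. t \<in> I \<Longrightarrow> B t \<subseteq> M" "\<And>t. t \<in> I \<Longrightarrow> normal_in (B t) M"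
      "\<And>t. t \<in> I \<Longrightarrow> giant (B t) D"
  shows "giant {g \<in> M. \<forall>t\<in>I. g \<in> B t} D"
  using I B
proof (induction I)
  case empty
  then show ?case using M(2) by simp
next
  case (insert s I)
  let ?P = "{g \<in> M. \<forall>t\<in>I. g \<in> B t}"
  have P: "pgroup \<Omega> ?P"
    by (rule pgroup_filter[OF M(1)]) (use insert.prems(1) pgroup_id pgroup_comp in \<open>blast+\<close>)
  have Bs: "pgroup \<Omega> (B s)" "B s \<subseteq> M" "normal_in (B s) M" "giant (B s) D" using insert.prems by auto
  show ?case
  proof (rule giant_comm[OF P _ _ Bs(1,4) pres_mono[OF M(3) Bs(2)] D])
    show "giant ?P D" by (rule insert.IH) (use insert.prems in auto)
    show "pres ?P D" by (rule pres_mono[OF M(3)]) auto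
    fix p q assume p: "p \<in> ?P" and q: "q \<in> B s"
    have pM: "p \<in> M" using p by auto
    have qM: "q \<in> M" using q Bs(2) by auto
    have "comm p q \<in> B s"
      by (rule comm_normal_in'[OF Bs(1) q]) (use Bs(3) pM q in \<open>auto simp: normal_in_def\<close>)
    moreover have "comm p q \<in> B t" if t: "t \<in> I" for t
    proof (rule comm_normal_in[of \<Omega>])
      show t1: "pgroup \<Omega> (B t)" using insert.prems t by auto
      show "p \<in> B t" using p t by auto
      then show "q \<circ> inv' p \<circ> inv' q \<in> B t"
        using pgroup_inv[OF t1] insert.prems(3)[of t] t qM unfolding normal_in_def by auto
    qed
    ultimately show "comm p q \<in> {g \<in> M. \<forall>t\<in>insert s I. g \<in> B t}"
      using pgroup_comm[OF M(1) pM qM] by auto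
  qed
qed

text \<open>If the action of the kernel on \<open>C\<close> were trivial on \<open>D\<close>, every square would act trivially on \<open>D\<close>,
  because squares lie in every giant.\<close>

lemma giant_ker:
  assumes M: "pgroup \<Omega> M" and C: "pres M C" "7 \<le> card C" "giant M C" and D: "pres M D" "7 \<le> card D" "giant M D"
    and ne: "ker M C \<noteq> ker M D"
  shows "giant (ker M C) D"
proof (cases "ker M C \<subseteq> ker M D")
  case False
  then obtain g u where g: "g \<in> ker M C" "u \<in> D" "g ` u \<noteq> u" unfolding ker_def by auto
  show ?thesis
    by (rule giant_normal[OF M D pgroup_ker[OF M] ker_sub ker_normal[OF M C(1)] g])
next
  case True
  then obtain g u where g: "g \<in> ker M D" "u \<in> C" "g ` u \<noteq> u" using ne unfolding ker_def by auto
  have gi: "giant (ker M D) C"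
    by (rule giant_normal[OF M C pgroup_ker[OF M] ker_sub ker_normal[OF M D(1)] g])
  have fC: "finite C" "finite D" using C(2) D(2) card.infinite by fastforce+
  have sq: "f \<circ> f \<in> ker M D" if f: "f \<in> M" for f
  proof -
    have "act C f \<circ> act C f \<in> act C ` ker M D"
      by (rule alt3_square[OF pgroup_act(1)[OF pgroup_ker[OF M] pres_mono[OF C(1) ker_sub] fC(1)] gi[unfolded giant_def]
            pgroup_act(3)[OF M C(1) fC(1) f]])
    then obtain h where h: "h \<in> ker M D" "act C (f \<circ> f) = act C h" using act_comp[OF C(1) f] by auto
    have hM: "h \<in> M" using h(1) ker_sub by auto
    have "inv' h \<circ> (f \<circ> f) \<in> ker M C"
      using act_eq_iff[OF M pgroup_comp[OF M f f] hM, of C] h(2) by auto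
    then have "h \<circ> (inv' h \<circ> (f \<circ> f)) \<in> ker M D" using True pgroup_comp[OF pgroup_ker[OF M] h(1)] by auto
    then show ?thesis using pgroup_invo2[OF M hM] by (simp add: comp_assoc[symmetric])
  qed
  obtain a where a: "a \<in> D" using ex_not_in_list[OF fC(2), of "[]"] D(2) by auto
  obtain b where b: "b \<in> D" "b \<noteq> a" using ex_not_in_list[OF fC(2), of "[a]"] D(2) by auto
  obtain c where c: "c \<in> D" "c \<noteq> a" "c \<noteq> b" using ex_not_in_list[OF fC(2), of "[a, b]"] D(2) by auto
  obtain f where f: "f \<in> M" "\<And>u. u \<in> D \<Longrightarrow> f ` u = cyc3 a b c u"
    by (rule giantD[OF D(3) a b(1) c(1)]) (use b c in auto)
  have "f ` a = b" "f ` b = c" using f(2) a b c by (auto simp: cyc3_def)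
  then have "(f \<circ> f) ` a = c" by (simp only: o_image)
  then show ?thesis using sq[OF f(1)] a c unfolding ker_def by auto
qed

text \<open>Equal kernels give induced groups of equal order; but if \<open>C\<close> were larger
  than \<open>D\<close>, half of \<open>fact (card C)\<close> would exceed
  \<open>fact (card D)\<close>.\<close>

lemma coincidence_card:
  assumes M: "pgroup \<Omega> M" and C: "pres M C" "3 \<le> card C" "giant M C" and D: "pres M D" "finite D"
    and eq: "ker M C = ker M D"
  shows "card C \<le> card D"
proof (rule ccontr)
  assume lt: "\<not> card C \<le> card D"
  have fC: "finite C" using C(2) card.infinite by fastforce
  have "card (act C ` M) * card (ker M C) = card (act D ` M) * card (ker M D)"
    using card_group_image[OF M ker_sub act_eq_iff[OF M], of C] card_group_image[OF M ker_sub act_eq_iff[OF M], of D] by simp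
  then have ci: "card (act C ` M) = card (act D ` M)" using eq pgroup_card_pos[OF pgroup_ker[OF M], of D] by auto
  have "fact (card C) \<le> 2 * card (act C ` M)"
    by (rule alt3_card[OF pgroup_act(1)[OF M C(1) fC] C(3)[unfolded giant_def]])
  also have "\<dots> \<le> 2 * fact (card D)" using ci pgroup_card_le[OF pgroup_act(1)[OF M D]] by simp
  finally have le: "(fact (card C) :: nat) \<le> 2 * fact (card D)" .
  have "fact (Suc (card D)) \<le> (fact (card C) :: nat)" by (rule fact_mono) (use lt in simp)
  moreover have "card C * fact (card C - 1) = (fact (card C) :: nat)" using C(2) by (cases "card C") auto
  moreover have "fact (card D) \<le> (fact (card C - 1) :: nat)" by (rule fact_mono) (use lt in simp)
  moreover have "3 * (fact (card C - 1) :: nat) \<le> card C * fact (card C - 1)" using C(2) by (rule mult_le_mono1)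
  moreover have "(fact (card D) :: nat) > 0" by simp
  ultimately show False using le by linarith
qed

text \<open>With a common kernel, each induced action determines the other. The resulting
  isomorphism satisfies \<open>alt_iso\<close>, and \<open>letter_match\<close> identifies
  stabilisers of letters.\<close>

lemma coincidence_letter:
  assumes M: "pgroup \<Omega> M" and C: "pres M C" "7 \<le> card C" "giant M C" and D: "pres M D" "7 \<le> card D" "giant M D"
    and eq: "ker M C = ker M D" and d: "d \<in> D"
  obtains c where "c \<in> C" "\<And>g. g \<in> M \<Longrightarrow> g ` c = c \<longleftrightarrow> g ` d = d"
proof -
  have fin: "finite C" "finite D" using C(2) D(2) card.infinite by fastforce+
  define \<phi> where "\<phi> f = act D (SOME g. g \<in> M \<and> act C g = f)" for f
  define \<psi> where "\<psi> f = act C (SOME g. g \<in> M \<and> act D g = f)" for f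
  have e: "act C g = act C h \<longleftrightarrow> act D g = act D h" if "g \<in> M" "h \<in> M" for g h
    using act_eq_iff[OF M that] eq by simp
  have \<phi>: "\<phi> (act C g) = act D g" if "g \<in> M" for g
  proof -
    have "(SOME h. h \<in> M \<and> act C h = act C g) \<in> M \<and> act C (SOME h. h \<in> M \<and> act C h = act C g) = act C g"
      by (rule someI[of _ g]) (use that in auto)
    then show ?thesis unfolding \<phi>_def using e that by blast
  qed
  have \<psi>: "\<psi> (act D g) = act C g" if "g \<in> M" for g
  proof -
    have "(SOME h. h \<in> M \<and> act D h = act D g) \<in> M \<and> act D (SOME h. h \<in> M \<and> act D h = act D g) = act D g"
      by (rule someI[of _ g]) (use that in auto)
    then show ?thesis unfolding \<psi>_def using e that by blast
  qed
  interpret alt_iso C "act C ` M" \<phi> D "act D ` M" \<psi>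
  proof unfold_locales
    show "pgroup C (act C ` M)" "pgroup D (act D ` M)" using pgroup_act(1)[OF M] C(1) D(1) fin by auto
    show "alt3 C (act C ` M)" "alt3 D (act D ` M)" using C(3) D(3) unfolding giant_def by auto
    show "7 \<le> card C" "7 \<le> card D" by (rule C D)+
    fix g assume "g \<in> act C ` M"
    then obtain g' where g': "g' \<in> M" "g = act C g'" by auto
    then show "\<phi> g \<in> act D ` M" "\<psi> (\<phi> g) = g" using \<phi> \<psi> by auto
    fix h assume "h \<in> act C ` M"
    then obtain h' where h': "h' \<in> M" "h = act C h'" by auto
    show "\<phi> (g \<circ> h) = \<phi> g \<circ> \<phi> h"
      using \<phi>[OF g'(1)] \<phi>[OF h'(1)] \<phi>[OF pgroup_comp[OF M g'(1) h'(1)]] act_comp[OF C(1) h'(1), of g']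
        act_comp[OF D(1) h'(1), of g'] g'(2) h'(2) by simp
  next
    fix g assume "g \<in> act D ` M"
    then obtain g' where g': "g' \<in> M" "g = act D g'" by auto
    then show "\<psi> g \<in> act C ` M" "\<phi> (\<psi> g) = g" using \<phi> \<psi> by auto
  qed
  obtain c where c: "c \<in> C" "\<And>f. f \<in> act C ` M \<Longrightarrow> f c = c \<longleftrightarrow> \<phi> f d = d" using letter_match[OF d] by metis
  have "g ` c = c \<longleftrightarrow> g ` d = d" if g: "g \<in> M" for g
    using c(2)[of "act C g"] g \<phi>[OF g] c(1) d by (simp add: act_def)
  then show ?thesis using that c(1) by blast
qed

lemma giant_fix:
  assumes M: "giant M D" and E: "E \<subseteq> D" "\<And>g. g \<in> M \<Longrightarrow> \<forall>c\<in>D - E. g ` c = c \<Longrightarrow> g \<in> N"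
  shows "giant N E"
proof (rule giantI)
  fix a b c assume abc: "a \<in> E" "b \<in> E" "c \<in> E" "a \<noteq> b" "b \<noteq> c" "a \<noteq> c"
  obtain g where g: "g \<in> M" "\<And>u. u \<in> D \<Longrightarrow> g ` u = cyc3 a b c u"
    by (rule giantD[OF M, of a b c]) (use abc E(1) in auto)
  have "g \<in> N" by (rule E(2)[OF g(1)]) (use g(2) abc in \<open>auto simp: cyc3_def\<close>)
  then show "\<exists>g\<in>N. \<forall>u\<in>E. g ` u = cyc3 a b c u" using g(2) E(1) by auto
qed

lemma giant_moves:
  assumes M: "giant M D" "3 \<le> card D" and c: "c \<in> D"
  obtains g where "g \<in> M" "g ` c \<noteq> c"
proof -
  have fD: "finite D" using M(2) card.infinite by fastforce
  obtain a where a: "a \<in> D" "a \<noteq> c" using ex_not_in_list[OF fD, of "[c]"] M(2) by auto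
  obtain b where b: "b \<in> D" "b \<noteq> c" "b \<noteq> a" using ex_not_in_list[OF fD, of "[c, a]"] M(2) by auto
  obtain g where g: "g \<in> M" "\<And>u. u \<in> D \<Longrightarrow> g ` u = cyc3 c a b u"
    by (rule giantD[OF M(1) c a(1) b(1)]) (use a b in auto)
  have "g ` c = a" using g(2)[OF c] a b by (simp add: cyc3_def)
  then show ?thesis using that g(1) a by blast
qed

lemma giant_transitive:
  assumes M: "giant M D" "3 \<le> card D" and ab: "a \<in> D" "b \<in> D" and M': "id \<in> M"
  obtains g where "g \<in> M" "g ` a = b"
proof (cases "a = b")
  case True then show ?thesis using that[of id] M' by simp
next
  case False
  have fD: "finite D" using M(2) card.infinite by fastforce
  obtain c where c: "c \<in> D" "c \<noteq> a" "c \<noteq> b" using ex_not_in_list[OF fD, of "[a, b]"] M(2) by auto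
  obtain g where g: "g \<in> M" "\<And>u. u \<in> D \<Longrightarrow> g ` u = cyc3 a b c u"
    by (rule giantD[OF M(1) ab c(1)]) (use False c in auto)
  have "g ` a = b" using g(2)[OF ab(1)] False c by (simp add: cyc3_def)
  then show ?thesis using that g(1) by blast
qed

subsection \<open>Towers of block systems\<close>

text \<open>An equivalence relation is given by the map that sends a point to its class.\<close>

definition block_map :: "'a set \<Rightarrow> ('a \<Rightarrow> 'a set) \<Rightarrow> bool"
  where "block_map \<Omega> p \<longleftrightarrow> (\<forall>x\<in>\<Omega>. x \<in> p x \<and> p x \<subseteq> \<Omega> \<and> (\<forall>y\<in>p x. p y = p x))"

definition invariant :: "'a set \<Rightarrow> ('a \<Rightarrow> 'a) set \<Rightarrow> ('a \<Rightarrow> 'a set) \<Rightarrow> bool"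
  where "invariant \<Omega> K p \<longleftrightarrow> (\<forall>g\<in>K. \<forall>x\<in>\<Omega>. g ` p x = p (g x))"

definition setstab :: "('a \<Rightarrow> 'a) set \<Rightarrow> ('a \<Rightarrow> 'a set) \<Rightarrow> 'a \<Rightarrow> ('a \<Rightarrow> 'a) set"
  where "setstab K p x = {g \<in> K. g x \<in> p x}"

text \<open>The images of the class \<open>q x\<close> under the stabiliser of \<open>p x\<close>.
  As \<open>K\<close> may be intransitive, these can be only a part of the classes of
  \<open>q\<close> inside \<open>p x\<close>.\<close>

definition blocks :: "('a \<Rightarrow> 'a) set \<Rightarrow> ('a \<Rightarrow> 'a set) \<Rightarrow> ('a \<Rightarrow> 'a set) \<Rightarrow> 'a \<Rightarrow> 'a set set"
  where "blocks K p q x = (\<lambda>g. q (g x)) ` setstab K p x"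

lemma block_mapD:
  assumes "block_map \<Omega> p" "x \<in> \<Omega>"
  shows "x \<in> p x" "p x \<subseteq> \<Omega>" "\<And>y. y \<in> p x \<Longrightarrow> p y = p x"
  using assms unfolding block_map_def by blast+

lemma block_map_eq_iff:
  assumes "block_map \<Omega> p" "x \<in> \<Omega>" "y \<in> \<Omega>"
  shows "p x = p y \<longleftrightarrow> y \<in> p x"
  using block_mapD[OF assms(1)] assms(2,3) by metis

lemma invariantD: "invariant \<Omega> K p \<Longrightarrow> g \<in> K \<Longrightarrow> x \<in> \<Omega> \<Longrightarrow> g ` p x = p (g x)"
  unfolding invariant_def by auto

lemma invariant_mem_iff:
  assumes "pgroup \<Omega> K" "invariant \<Omega> K p" "g \<in> K" "x \<in> \<Omega>"
  shows "g y \<in> p (g x) \<longleftrightarrow> y \<in> p x"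
proof -
  have "inj_on g UNIV" using pgroup_inj[OF assms(1,3)] by (simp add: inj_on_def)
  then show ?thesis unfolding invariantD[OF assms(2-4), symmetric] by (simp add: inj_image_mem_iff)
qed

lemma setstab_K: "g \<in> setstab K p x \<Longrightarrow> g \<in> K"
  unfolding setstab_def by auto

lemma setstab_iff:
  assumes "pgroup \<Omega> K" "block_map \<Omega> p" "invariant \<Omega> K p" "x \<in> \<Omega>" "g \<in> K"
  shows "g \<in> setstab K p x \<longleftrightarrow> p (g x) = p x" "g \<in> setstab K p x \<longleftrightarrow> g ` p x = p x"
  using block_map_eq_iff[OF assms(2,4), of "g x"] invariantD[OF assms(3,5,4)] pgroup_in[OF assms(1,5), of x] assms(4,5)
  unfolding setstab_def by auto

lemma pgroup_setstab:
  assumes K: "pgroup \<Omega> K" and p: "block_map \<Omega> p" "invariant \<Omega> K p" and x: "x \<in> \<Omega>"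
  shows "pgroup \<Omega> (setstab K p x)"
proof (rule pgroup_subI[OF K])
  show "setstab K p x \<subseteq> K" unfolding setstab_def by auto
  show "id \<in> setstab K p x" using setstab_iff[OF K p x pgroup_id[OF K]] by simp
  fix g h assume gh: "g \<in> setstab K p x" "h \<in> setstab K p x"
  then have ghK: "g \<in> K" "h \<in> K" unfolding setstab_def by auto
  have "g ` (h ` p x) = p x" using gh setstab_iff(2)[OF K p x] ghK by simp
  then show "g \<circ> h \<in> setstab K p x"
    using setstab_iff(2)[OF K p x pgroup_comp[OF K ghK]] by (simp add: image_comp)
qed

lemma setstab_sub: "setstab K p x \<subseteq> K" unfolding setstab_def by auto

context
  fixes \<Omega> :: "'a set" and K p q
  assumes K: "pgroup \<Omega> K" and p: "block_map \<Omega> p" "invariant \<Omega> K p" and q: "block_map \<Omega> q" "invariant \<Omega> K q"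
begin

lemma blocks_self: assumes "x \<in> \<Omega>" shows "q x \<in> blocks K p q x"
  unfolding blocks_def using pgroup_id[OF pgroup_setstab[OF K p assms]] by (intro image_eqI[of _ _ id]) auto

lemma blocks_setstab: assumes x: "x \<in> \<Omega>" and g: "g \<in> setstab K p x" and u: "u \<in> blocks K p q x"
  shows "g ` u \<in> blocks K p q x"
proof -
  obtain h where h: "h \<in> setstab K p x" "u = q (h x)" using u unfolding blocks_def by auto
  have hx: "h x \<in> \<Omega>" using x pgroup_in[OF K setstab_K[OF h(1)]] by simp
  have "g ` u = q ((g \<circ> h) x)" using h(2) invariantD[OF q(2) setstab_K[OF g] hx] by simp
  then show ?thesis unfolding blocks_def using pgroup_comp[OF pgroup_setstab[OF K p x] g h(1)] by blast
qed

lemma pres_blocks: "x \<in> \<Omega> \<Longrightarrow> pres (setstab K p x) (blocks K p q x)"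
  unfolding pres_def using blocks_setstab by auto

lemma finite_blocks: "finite (blocks K p q x)"
  unfolding blocks_def using finite_subset[OF setstab_sub pgroup_finite_group[OF K]] by auto

lemma blocks_transitive:
  assumes x: "x \<in> \<Omega>" and u: "u \<in> blocks K p q x" "v \<in> blocks K p q x"
  obtains g where "g \<in> setstab K p x" "g ` u = v"
proof -
  obtain h k where h: "h \<in> setstab K p x" "u = q (h x)" "k \<in> setstab K p x" "v = q (k x)" using u unfolding blocks_def by auto
  have hK: "h \<in> K" "k \<in> K" using h setstab_K by metis+
  have hx: "h x \<in> \<Omega>" using x pgroup_in[OF K hK(1)] by simp
  have g: "k \<circ> inv' h \<in> setstab K p x"
    using pgroup_comp[OF pgroup_setstab[OF K p x] h(3) pgroup_inv[OF pgroup_setstab[OF K p x] h(1)]] .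
  have "(k \<circ> inv' h) ` u = q ((k \<circ> inv' h) (h x))"
    unfolding h(2) by (rule invariantD[OF q(2) setstab_K[OF g] hx])
  also have "\<dots> = v" using pgroup_inv1[OF K hK(1)] h(4) by simp
  finally show ?thesis using that g by blast
qed

lemma blocks_conj:
  assumes x: "x \<in> \<Omega>" and h: "h \<in> K"
  shows "blocks K p q (h x) = (\<lambda>u. h ` u) ` blocks K p q x"
proof -
  have hx: "h x \<in> \<Omega>" using x pgroup_in[OF K h] by simp
  have sub: "(\<lambda>u. h ` u) ` blocks K p q x \<subseteq> blocks K p q (h x)" if x: "x \<in> \<Omega>" and h: "h \<in> K" for x h
  proof clarify
    fix u assume "u \<in> blocks K p q x"
    then obtain g where g: "g \<in> setstab K p x" "u = q (g x)" unfolding blocks_def by auto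
    have gK: "g \<in> K" by (rule setstab_K[OF g(1)])
    have gx: "g x \<in> \<Omega>" using x pgroup_in[OF K gK] by simp
    have c: "h \<circ> g \<circ> inv' h \<in> K" by (rule pgroup_conj[OF K h gK])
    have e: "(h \<circ> g \<circ> inv' h) (h x) = h (g x)" using pgroup_inv1[OF K h] by simp
    have "h (g x) \<in> p (h x)" using invariant_mem_iff[OF K p(2) h x] g(1) unfolding setstab_def by auto
    then have "h \<circ> g \<circ> inv' h \<in> setstab K p (h x)" unfolding setstab_def using c e by simp
    moreover have "h ` u = q ((h \<circ> g \<circ> inv' h) (h x))" unfolding e g(2) by (rule invariantD[OF q(2) h gx])
    ultimately show "h ` u \<in> blocks K p q (h x)" unfolding blocks_def by blast
  qed
  have "blocks K p q (h x) \<subseteq> (\<lambda>u. h ` u) ` blocks K p q x"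
  proof
    fix v assume v: "v \<in> blocks K p q (h x)"
    then have "inv' h ` v \<in> blocks K p q (inv' h (h x))" using sub[OF hx pgroup_inv[OF K h]] by auto
    then have "inv' h ` v \<in> blocks K p q x" using pgroup_inv1[OF K h] by simp
    moreover have "v = h ` (inv' h ` v)" using image_inv_eq(2)[OF K h] by simp
    ultimately show "v \<in> (\<lambda>u. h ` u) ` blocks K p q x" by blast
  qed
  then show ?thesis using sub[OF x h] by auto
qed

end

text \<open>The relations become finer with \<open>i\<close>, from a single class at 0 to points at
  \<open>l\<close>; the conditions for \<open>i\<close> beyond \<open>l\<close> leave the classes
  single points. The section at level \<open>i\<close> and \<open>x\<close> is the action of
  \<open>E i x\<close> on \<open>O' i x\<close>.\<close>

locale tower =
  fixes \<Omega> :: "'a set" and K and r :: "nat \<Rightarrow> 'a \<Rightarrow> 'a set" and l :: nat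
  assumes K: "pgroup \<Omega> K"
    and r_classes: "\<And>i. block_map \<Omega> (r i)" and r_inv: "\<And>i. invariant \<Omega> K (r i)"
    and r_sub: "\<And>i x. x \<in> \<Omega> \<Longrightarrow> r (Suc i) x \<subseteq> r i x"
    and r0: "\<And>x. x \<in> \<Omega> \<Longrightarrow> r 0 x = \<Omega>" and rl: "\<And>x. x \<in> \<Omega> \<Longrightarrow> r l x = {x}"
begin

abbreviation "E i \<equiv> setstab K (r i)"
abbreviation "O' i \<equiv> blocks K (r i) (r (Suc i))"

lemma fin: "finite \<Omega>" by (rule pgroup_finite[OF K])

lemma r_antimono: assumes "i \<le> j" "x \<in> \<Omega>" shows "r j x \<subseteq> r i x"
  using assms(1) by (induction j rule: dec_induct) (use r_sub[OF assms(2)] in auto)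

lemmas r_self = block_mapD(1)[OF r_classes]
lemmas r_img = invariantD[OF r_inv]
lemmas r_mem_iff = invariant_mem_iff[OF K r_inv]
lemmas r_eq_iff = block_map_eq_iff[OF r_classes]
lemmas pgroup_E = pgroup_setstab[OF K r_classes r_inv]
lemmas E_iff = setstab_iff[OF K r_classes r_inv]
lemma O_self: "x \<in> \<Omega> \<Longrightarrow> r (Suc i) x \<in> O' i x"
  by (rule blocks_self[OF K r_classes r_inv r_classes r_inv])
lemma pres_O: "x \<in> \<Omega> \<Longrightarrow> pres (E i x) (O' i x)"
  by (rule pres_blocks[OF K r_classes r_inv r_classes r_inv])
lemma O_conj: "x \<in> \<Omega> \<Longrightarrow> h \<in> K \<Longrightarrow> O' i (h x) = (\<lambda>u. h ` u) ` O' i x"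
  by (rule blocks_conj[OF K r_classes r_inv r_classes r_inv])
lemma finite_O: "finite (O' i x)"
  by (rule finite_blocks[OF K r_classes r_inv r_classes r_inv])
lemma O_trans:
  assumes "x \<in> \<Omega>" "u \<in> O' i x" "v \<in> O' i x"
  obtains g where "g \<in> E i x" "g ` u = v"
  using blocks_transitive[OF K r_classes r_inv r_classes r_inv assms] by blast

lemma E_K: "E i x \<subseteq> K" by (rule setstab_sub)

lemma E_antimono: "i \<le> j \<Longrightarrow> x \<in> \<Omega> \<Longrightarrow> E j x \<subseteq> E i x"
  using r_antimono unfolding setstab_def by auto

text \<open>The kernel of \<open>K\<close> on the classes of level \<open>i\<close>. These groups
  form a normal series from \<open>K\<close> down to the trivial group.\<close>

definition "L i = {g \<in> K. \<forall>x\<in>\<Omega>. g x \<in> r i x}"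

lemma L_K: "L i \<subseteq> K" unfolding L_def by auto

lemma in_\<Omega>: "g \<in> K \<Longrightarrow> g x \<in> \<Omega> \<longleftrightarrow> x \<in> \<Omega>" by (rule pgroup_in[OF K])

lemma r_move: assumes "x \<in> \<Omega>" "g \<in> K" "g x \<in> r i x" shows "r i (g x) = r i x"
  using block_mapD(3)[OF r_classes assms(1,3)] .

lemma pgroup_L: "pgroup \<Omega> (L i)"
  unfolding L_def
proof (rule pgroup_filter[OF K])
  show "\<forall>x\<in>\<Omega>. id x \<in> r i x" using r_self by simp
  fix g h assume gh: "g \<in> K" "h \<in> K" "\<forall>x\<in>\<Omega>. g x \<in> r i x" "\<forall>x\<in>\<Omega>. h x \<in> r i x"
  show "\<forall>x\<in>\<Omega>. (g \<circ> h) x \<in> r i x"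
  proof
    fix x assume x: "x \<in> \<Omega>"
    have "h x \<in> \<Omega>" using in_\<Omega> gh x by simp
    then have "g (h x) \<in> r i (h x)" using gh by auto
    then show "(g \<circ> h) x \<in> r i x" using r_move[OF x gh(2)] gh(4) x by simp
  qed
qed

lemma L_normal: assumes k: "k \<in> K" and g: "g \<in> L i" shows "k \<circ> g \<circ> inv' k \<in> L i"
  unfolding L_def
proof (intro CollectI conjI ballI)
  show "k \<circ> g \<circ> inv' k \<in> K" using pgroup_conj[OF K k] g L_K by auto
  fix x assume x: "x \<in> \<Omega>"
  have y: "inv' k x \<in> \<Omega>" using in_\<Omega>[OF pgroup_inv[OF K k]] x by simp
  then have "g (inv' k x) \<in> r i (inv' k x)" using g unfolding L_def by auto
  then have "k (g (inv' k x)) \<in> r i (k (inv' k x))" using r_mem_iff[OF k y] by simp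
  then show "(k \<circ> g \<circ> inv' k) x \<in> r i x" using pgroup_inv2[OF K k] by simp
qed

lemma L_E: "x \<in> \<Omega> \<Longrightarrow> i \<le> j \<Longrightarrow> L j \<subseteq> E i x"
  using r_antimono unfolding L_def setstab_def by blast

lemma L_antimono: "i \<le> j \<Longrightarrow> L j \<subseteq> L i"
  using r_antimono unfolding L_def by blast

lemma L0: "L 0 = K"
  unfolding L_def using r0 in_\<Omega> by auto

lemma Ll: "L l = {id}"
proof
  show "L l \<subseteq> {id}"
  proof
    fix g assume g: "g \<in> L l"
    have "g x = x" for x
      by (cases "x \<in> \<Omega>") (use g rl pgroup_out[OF K] in \<open>auto simp: L_def\<close>)
    then show "g \<in> {id}" by auto
  qed
  show "{id} \<subseteq> L l" using pgroup_id[OF pgroup_L] by auto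
qed

end

text \<open>The assumption \<open>no_tie\<close> forbids that everything acting trivially on an
  upper section also acts trivially on a lower one of comparable degree. The 1 is subtracted because
  \<open>coincidence\<close> continues its descent after the loss of one letter;
  \<open>sections_untied\<close> shows that this range can be afforded.\<close>

locale giant_tower = tower +
  assumes big: "\<And>i x. i < l \<Longrightarrow> x \<in> \<Omega> \<Longrightarrow> card (O' i x) = 1 \<or> 9 \<le> card (O' i x) \<and> giant (E i x) (O' i x)"
    and no_tie: "\<And>i j x. i < j \<Longrightarrow> j < l \<Longrightarrow> x \<in> \<Omega> \<Longrightarrow> 9 \<le> card (O' j x) \<Longrightarrow> card (O' i x) - 1 \<le> card (O' j x) \<Longrightarrow>
      \<exists>g\<in>ker (E i x) (O' i x) \<inter> E j x. \<exists>u\<in>O' j x. g ` u \<noteq> u"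
begin

lemma normal_giant:
  assumes j: "j < l" and y: "y \<in> \<Omega>" and N: "pgroup \<Omega> N" "N \<subseteq> E j y" "normal_in N (E j y)"
    and m: "g \<in> N" "u \<in> O' j y" "g ` u \<noteq> u"
  shows "9 \<le> card (O' j y)" "giant (E j y) (O' j y)" "giant N (O' j y)"
proof -
  have "card (O' j y) \<noteq> 1"
  proof
    assume "card (O' j y) = 1"
    then obtain v where "O' j y = {v}" by (auto simp: card_1_singleton_iff)
    moreover have "g ` u \<in> O' j y" by (rule presD[OF pres_O[OF y] subsetD[OF N(2) m(1)] m(2)])
    ultimately show False using m(2,3) by simp
  qed
  then show b: "9 \<le> card (O' j y)" "giant (E j y) (O' j y)" using big[OF j y] by auto
  show "giant N (O' j y)"
    by (rule giant_normal[OF pgroup_E[OF y] pres_O[OF y] _ b(2) N m]) (use b(1) in simp)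
qed

text \<open>The dichotomy that lets a descent pass a section. It refers to \<open>\<Gamma>\<close>
  only through its intersection with \<open>E j y\<close>, so it carries over from
  \<open>L i\<close> to a stabiliser of a letter with the same intersection.\<close>

definition "acts_well \<Gamma> j y \<longleftrightarrow> (\<forall>u\<in>O' j y. \<forall>g\<in>\<Gamma> \<inter> E j y. g ` u = u) \<or>
  (9 \<le> card (O' j y) \<and> giant (\<Gamma> \<inter> E j y) (O' j y))"

lemma acts_well_L: assumes "i \<le> j" "j < l" "y \<in> \<Omega>" shows "acts_well (L i) j y"
proof (cases "\<exists>u\<in>O' j y. \<exists>g\<in>L i \<inter> E j y. g ` u \<noteq> u")
  case True
  then obtain u g where ug: "u \<in> O' j y" "g \<in> L i \<inter> E j y" "g ` u \<noteq> u" by auto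
  have "normal_in (L i \<inter> E j y) (E j y)"
    using L_normal E_K pgroup_conj[OF pgroup_E[OF assms(3)]] unfolding normal_in_def by blast
  from normal_giant[OF assms(2,3) pgroup_inter[OF pgroup_L pgroup_E[OF assms(3)]] _ this ug(2,1,3)]
  show ?thesis unfolding acts_well_def by auto
qed (auto simp: acts_well_def)

lemma giant_or_trivial:
  assumes \<Gamma>: "pgroup \<Omega> \<Gamma>" and y: "y \<in> \<Omega>" and w: "acts_well \<Gamma> j y"
    and M: "pgroup \<Omega> M" "M \<subseteq> \<Gamma> \<inter> E j y" "normal_in M \<Gamma>" and g: "g \<in> M" "u \<in> O' j y" "g ` u \<noteq> u"
  shows "9 \<le> card (O' j y)" "giant (\<Gamma> \<inter> E j y) (O' j y)" "giant M (O' j y)"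
proof -
  show w': "9 \<le> card (O' j y)" "giant (\<Gamma> \<inter> E j y) (O' j y)"
    using w M(2) g unfolding acts_well_def by blast+
  show "giant M (O' j y)"
  proof (rule giant_normal[OF pgroup_inter[OF \<Gamma>(1) pgroup_E[OF y]] _ _ w'(2) M(1,2) _ g])
    show "pres (\<Gamma> \<inter> E j y) (O' j y)" by (rule pres_mono[OF pres_O[OF y]]) auto
    show "7 \<le> card (O' j y)" using w' by simp
    show "normal_in M (\<Gamma> \<inter> E j y)" using M(3) unfolding normal_in_def by auto
  qed
qed

text \<open>The kernel of \<open>M\<close> on \<open>O' j y\<close> and its conjugates under \<open>\<Gamma>\<close> are giants on \<open>D\<close>, hence so is their
  intersection, which fixes the blocks of the points \<open>h y\<close>.\<close>

lemma descend:
  assumes \<Gamma>: "pgroup \<Omega> \<Gamma>" "\<Gamma> \<subseteq> K" and M: "pgroup \<Omega> M" "M \<subseteq> \<Gamma>" "normal_in M \<Gamma>"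
    and D: "pres \<Gamma> D" "7 \<le> card D" "giant M D" and y: "y \<in> \<Omega>"
    and Mj: "\<forall>g\<in>M. \<forall>h\<in>\<Gamma>. g (h y) \<in> r j (h y)"
    and w: "acts_well \<Gamma> j y" and ne: "ker M D \<noteq> ker M (O' j y)"
  defines "M' \<equiv> {g \<in> M. \<forall>h\<in>\<Gamma>. g (h y) \<in> r (Suc j) (h y)}"
  shows "pgroup \<Omega> M'" "normal_in M' \<Gamma>" "giant M' D"
proof -
  have fD: "finite D" using D(2) card.infinite by fastforce
  have MK: "M \<subseteq> K" using M \<Gamma> by auto
  have norm: "h \<circ> g \<circ> inv' h \<in> M" if "h \<in> \<Gamma>" "g \<in> M" for g h using M(3) that unfolding normal_in_def by auto
  have inM: "h y \<in> \<Omega>" if "h \<in> \<Gamma>" for h using that \<Gamma>(2) in_\<Omega> y by auto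
  show pM': "pgroup \<Omega> M'" unfolding M'_def
  proof (rule pgroup_filter[OF M(1)])
    show "\<forall>h\<in>\<Gamma>. id (h y) \<in> r (Suc j) (h y)" using r_self inM by simp
    fix a b assume ab: "a \<in> M" "b \<in> M" "\<forall>h\<in>\<Gamma>. a (h y) \<in> r (Suc j) (h y)" "\<forall>h\<in>\<Gamma>. b (h y) \<in> r (Suc j) (h y)"
    show "\<forall>h\<in>\<Gamma>. (a \<circ> b) (h y) \<in> r (Suc j) (h y)"
    proof
      fix h assume h: "h \<in> \<Gamma>"
      have bh: "b \<circ> h \<in> \<Gamma>" using ab(2) h M(2) pgroup_comp[OF \<Gamma>(1)] by auto
      have "a (b (h y)) \<in> r (Suc j) (b (h y))" using ab(3) bh by auto
      then show "(a \<circ> b) (h y) \<in> r (Suc j) (h y)"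
        using r_move[OF inM[OF h], of b "Suc j"] ab(2,4) h MK by auto
    qed
  qed
  show "normal_in M' \<Gamma>" unfolding normal_in_def
  proof (intro ballI)
    fix k g assume k: "k \<in> \<Gamma>" and g: "g \<in> M'"
    have "(k \<circ> g \<circ> inv' k) (h y) \<in> r (Suc j) (h y)" if h: "h \<in> \<Gamma>" for h
    proof -
      have kh: "inv' k \<circ> h \<in> \<Gamma>" using k h pgroup_comp[OF \<Gamma>(1)] pgroup_inv[OF \<Gamma>(1)] by auto
      have "g (inv' k (h y)) \<in> r (Suc j) (inv' k (h y))" using g kh unfolding M'_def by auto
      then have "k (g (inv' k (h y))) \<in> r (Suc j) (k (inv' k (h y)))"
        using r_mem_iff[of k "inv' k (h y)"] k \<Gamma>(2) inM[OF kh] by auto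
      then show ?thesis using pgroup_inv2[OF \<Gamma>(1) k] by simp
    qed
    then show "k \<circ> g \<circ> inv' k \<in> M'" using norm[OF k] g unfolding M'_def by auto
  qed
  have presM: "pres M D" by (rule pres_mono[OF D(1) M(2)])
  \<comment> \<open>The conjugate by \<open>h\<close> of the kernel on \<open>O' j y\<close>, which
    is the kernel of \<open>M\<close> on the section at \<open>h y\<close>.\<close>
  define B where "B h = {g \<in> M. \<forall>u\<in>O' j y. g ` (h ` u) = h ` u}" for h
  have MjE: "M \<subseteq> \<Gamma> \<inter> E j y" using bspec[OF bspec[OF Mj] pgroup_id[OF \<Gamma>(1)]] MK M(2) unfolding setstab_def by auto
  have presMO: "pres M (O' j y)" by (rule pres_mono[OF pres_O[OF y]]) (use MjE in auto)
  have B1: "giant (ker M (O' j y)) D"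
  proof (cases "\<exists>g\<in>M. \<exists>u\<in>O' j y. g ` u \<noteq> u")
    case False
    then have "ker M (O' j y) = M" unfolding ker_def by auto
    then show ?thesis using D(3) by simp
  next
    case True
    then obtain g u where g: "g \<in> M" "u \<in> O' j y" "g ` u \<noteq> u" by auto
    note giant_or_trivial[OF \<Gamma>(1) y w M(1) MjE M(3) g]
    then show ?thesis using giant_ker[OF M(1) presMO _ _ presM D(2,3)] ne by auto
  qed
  have Bconj: "h \<circ> g \<circ> inv' h \<in> B h" if h: "h \<in> \<Gamma>" and g: "g \<in> ker M (O' j y)" for h g
  proof -
    have "(h \<circ> g \<circ> inv' h) ` (h ` u) = h ` u" if u: "u \<in> O' j y" for u
    proof -
      have "g ` u = u" using g u unfolding ker_def by auto
      then show ?thesis using image_inv_eq(1)[OF \<Gamma>(1) h, of u] by (simp only: o_image)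
    qed
    moreover have "h \<circ> g \<circ> inv' h \<in> M" using norm[OF h] g unfolding ker_def by auto
    ultimately show ?thesis unfolding B_def by blast
  qed
  \<comment> \<open>Conjugation by an element of \<open>\<Gamma>\<close>, which permutes
    \<open>D\<close>, merely renames the letters of a 3-cycle.\<close>
  have gB: "giant (B h) D" if h: "h \<in> \<Gamma>" for h
  proof (rule giantI)
    fix a b c assume abc: "a \<in> D" "b \<in> D" "c \<in> D" "a \<noteq> b" "b \<noteq> c" "a \<noteq> c"
    let ?k = "\<lambda>u. inv' h ` u"
    have k: "?k u \<in> D" if "u \<in> D" for u by (rule presD[OF D(1) pgroup_inv[OF \<Gamma>(1) h] that])
    have kk: "h ` ?k u = u" for u by (rule image_inv_eq(2)[OF \<Gamma>(1) h])
    have kinj: "?k u = ?k v \<longleftrightarrow> u = v" for u v using kk by metis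
    obtain g where g: "g \<in> ker M (O' j y)" "\<And>u. u \<in> D \<Longrightarrow> g ` u = cyc3 (?k a) (?k b) (?k c) u"
      by (rule giantD[OF B1 k[OF abc(1)] k[OF abc(2)] k[OF abc(3)]]) (use abc kinj in simp_all)
    have "(h \<circ> g \<circ> inv' h) ` u = cyc3 a b c u" if u: "u \<in> D" for u
    proof -
      have "(h \<circ> g \<circ> inv' h) ` u = h ` (cyc3 (?k a) (?k b) (?k c) (?k u))" using g(2)[OF k[OF u]] by (simp only: o_image)
      also have "\<dots> = cyc3 a b c u" using kk kinj by (simp add: cyc3_def)
      finally show ?thesis .
    qed
    then show "\<exists>g\<in>B h. \<forall>u\<in>D. g ` u = cyc3 a b c u" using Bconj[OF h g(1)] by blast
  qed
  have fam: "giant {g \<in> M. \<forall>h\<in>\<Gamma>. g \<in> B h} D"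
  proof (rule giant_INT[OF M(1) D(3) presM fD _ pgroup_finite_group[OF \<Gamma>(1)]])
    show "5 \<le> card D" using D(2) by simp
    fix h assume h: "h \<in> \<Gamma>"
    show "giant (B h) D" by (rule gB[OF h])
    show "B h \<subseteq> M" unfolding B_def by auto
    have e: "B h = ker M (O' j (h y))"
      unfolding B_def ker_def O_conj[OF y subsetD[OF \<Gamma>(2) h]] by (simp only: ball_simps)
    show "pgroup \<Omega> (B h)" unfolding e by (rule pgroup_ker[OF M(1)])
    have "pres M (O' j (h y))"
      by (rule pres_mono[OF pres_O[OF inM[OF h]]]) (use bspec[OF bspec[OF Mj] h] MK in \<open>auto simp: setstab_def\<close>)
    then show "normal_in (B h) M" unfolding e by (rule ker_normal[OF M(1)])
  qed
  show "giant M' D"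
  proof (rule giant_mono[OF fam])
    show "{g \<in> M. \<forall>h\<in>\<Gamma>. g \<in> B h} \<subseteq> M'"
    proof
      fix g assume g: "g \<in> {g \<in> M. \<forall>h\<in>\<Gamma>. g \<in> B h}"
      have "g (h y) \<in> r (Suc j) (h y)" if h: "h \<in> \<Gamma>" for h
      proof -
        have "g ` (h ` r (Suc j) y) = h ` r (Suc j) y" using g h O_self[OF y] unfolding B_def by auto
        then have "g ` r (Suc j) (h y) = r (Suc j) (h y)" by (simp only: r_img[OF subsetD[OF \<Gamma>(2) h] y])
        then show ?thesis using r_self[OF inM[OF h], of "Suc j"] by blast
      qed
      then show "g \<in> M'" unfolding M'_def using g by auto
    qed
  qed
qed

end

section \<open>Following one section down to the points\<close>

lemma ker_moves: "g \<in> M \<Longrightarrow> g \<notin> ker M D \<Longrightarrow> \<exists>u\<in>D. g ` u \<noteq> u"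
  unfolding ker_def by blast

lemma ker_fix: "g \<in> ker M D \<Longrightarrow> u \<in> D \<Longrightarrow> g ` u = u"
  by (simp add: ker_def)

text \<open>Fixes a section on which the kernel \<open>L i\<close> acts nontrivially, hence as a
  giant by normality. The elements of \<open>C\<close> are the letters of this section.\<close>

locale stage = giant_tower +
  fixes i :: nat and x0
  assumes i: "i < l" and x0: "x0 \<in> \<Omega>" and nontriv: "ker (L i) (O' i x0) \<noteq> L i"
begin

abbreviation "G \<equiv> L i"
abbreviation "C \<equiv> O' i x0"

lemma pC: "pres G C"
  by (rule pres_mono[OF pres_O[OF x0] L_E[OF x0 order_refl]])

lemma C_big: "9 \<le> card C" and giant_C: "giant G C"
proof -
  obtain g u where g: "g \<in> G" "u \<in> C" "g ` u \<noteq> u" using nontriv unfolding ker_def by auto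
  have n: "normal_in G (E i x0)" using L_normal E_K unfolding normal_in_def by blast
  show "9 \<le> card C" "giant G C"
    using normal_giant[OF i x0 pgroup_L L_E[OF x0 order_refl] n g] by auto
qed

lemma fC: "finite C" by (rule finite_O)

lemma G_in: "h \<in> G \<Longrightarrow> h y \<in> \<Omega> \<longleftrightarrow> y \<in> \<Omega>" using in_\<Omega> L_K by blast

text \<open>At level \<open>i\<close> this is \<open>G\<close> itself and at level \<open>l\<close>
  the pointwise stabiliser of the \<open>G\<close>-orbit of \<open>y\<close>. All translates of
  \<open>y\<close> are treated together to keep it normal in \<open>G\<close>.\<close>

definition "Kj j y = {g \<in> G. \<forall>h\<in>G. g (h y) \<in> r j (h y)}"

text \<open>The only obstruction to the descent: at level \<open>j\<close> the action on the blocks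
  around \<open>y\<close> and the action on the letters determine each other.\<close>

definition "coincide j y \<longleftrightarrow> i \<le> j \<and> j < l \<and> pgroup \<Omega> (Kj j y) \<and> normal_in (Kj j y) G \<and> giant (Kj j y) C
  \<and> ker (Kj j y) C = ker (Kj j y) (O' j y)"

lemma Kj_giant:
  assumes y: "y \<in> \<Omega>" and no: "\<And>j. \<not> coincide j y" and j: "i \<le> j" "j \<le> l"
  shows "pgroup \<Omega> (Kj j y) \<and> normal_in (Kj j y) G \<and> giant (Kj j y) C"
  using j
proof (induction j rule: dec_induct)
  case base
  have "Kj i y = G"
    unfolding Kj_def using G_in y by (auto simp: L_def)
  moreover have "normal_in G G" unfolding normal_in_def using pgroup_conj[OF pgroup_L] by auto
  ultimately show ?case using pgroup_L giant_C by simp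
next
  case (step j)
  have IH: "pgroup \<Omega> (Kj j y)" "normal_in (Kj j y) G" "giant (Kj j y) C" using step by auto
  have ne: "ker (Kj j y) C \<noteq> ker (Kj j y) (O' j y)" using no[of j] IH step unfolding coincide_def by auto
  have sub: "Kj j y \<subseteq> G" unfolding Kj_def by auto
  have aw: "acts_well G j y" by (rule acts_well_L) (use step y in auto)
  have eq: "{g \<in> Kj j y. \<forall>h\<in>G. g (h y) \<in> r (Suc j) (h y)} = Kj (Suc j) y"
    unfolding Kj_def using r_sub G_in y by blast
  have C7: "7 \<le> card C" using C_big by simp
  have in': "\<forall>g\<in>Kj j y. \<forall>h\<in>G. g (h y) \<in> r j (h y)" unfolding Kj_def by auto
  show ?case
    using descend[where \<Gamma> = G and M = "Kj j y" and D = C and y = y and j = j, OF pgroup_L L_K IH(1) sub IH(2) pC C7 IH(3) y in' aw ne] unfolding eq by auto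
qed

text \<open>At the level of a coincidence a letter \<open>c\<close> corresponds to the block of
  \<open>y\<close>, so fixing \<open>y\<close> forces \<open>c\<close> to be fixed. Below that level
  the descent is resumed with the stabiliser of \<open>c\<close> acting on the other letters; a
  second coincidence there would be a tie between the levels \<open>j\<close> and
  \<open>k\<close>.\<close>

lemma coincidence:
  assumes y: "y \<in> \<Omega>" and co: "coincide j y"
  obtains c where "c \<in> C" "\<forall>h\<in>G. h y \<in> r (Suc j) y \<longrightarrow> h ` c = c"
    "giant {g \<in> G. g ` c = c \<and> (\<forall>h\<in>G. h ` c = c \<longrightarrow> g (h y) = h y)} (C - {c})"
proof -
  define M where "M = Kj j y"
  let ?u = "r (Suc j) y"
  have j: "i \<le> j" "j < l" and M: "pgroup \<Omega> M" "normal_in M G" "giant M C" and keq: "ker M C = ker M (O' j y)"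
    using co unfolding coincide_def M_def by auto
  have MG: "M \<subseteq> G" unfolding M_def Kj_def by auto
  have ME: "M \<subseteq> G \<inter> E j y"
    using MG L_K pgroup_id[OF pgroup_L] unfolding M_def Kj_def setstab_def by force
  have C3: "3 \<le> card C" "7 \<le> card C" using C_big by auto
  have presMC: "pres M C" by (rule pres_mono[OF pC MG])
  have presMO: "pres M (O' j y)" by (rule pres_mono[OF pres_O[OF y]]) (use ME in auto)
  obtain c1 where "c1 \<in> C" using C_big by (metis card.empty ex_in_conv not_numeral_le_zero)
  then obtain g1 where g1: "g1 \<in> M" "g1 ` c1 \<noteq> c1" using giant_moves[OF M(3) C3(1)] by blast
  have "g1 \<notin> ker M C" using ker_fix[of g1 M C c1] \<open>c1 \<in> C\<close> g1(2) by (rule_tac notI) simp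
  then have "g1 \<notin> ker M (O' j y)" by (simp only: keq not_False_eq_True)
  from ker_moves[OF g1(1) this] obtain u1 where m1: "u1 \<in> O' j y" "g1 ` u1 \<noteq> u1" by (rule bexE)
  note Oj = giant_or_trivial[OF pgroup_L y acts_well_L[OF j y] M(1) ME M(2) g1(1) m1]
  have O7: "7 \<le> card (O' j y)" using Oj by simp
  obtain c where c: "c \<in> C" "\<And>g. g \<in> M \<Longrightarrow> g ` c = c \<longleftrightarrow> g ` ?u = ?u"
    using coincidence_letter[OF M(1) presMC C3(2) M(3) presMO O7 Oj(3) keq O_self[OF y]] by blast
  have conjM: "inv' h \<circ> g \<circ> h \<in> M" if h: "h \<in> G" and g: "g \<in> M" for h g
  proof -
    have "inv' h \<circ> g \<circ> inv' (inv' h) \<in> M" using M(2) pgroup_inv[OF pgroup_L h] g unfolding normal_in_def by auto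
    then show ?thesis using pgroup_bij[OF pgroup_L h] by (simp add: inv_inv_eq)
  qed
  define D where "D = C - {c}"
  have D: "card D = card C - 1" unfolding D_def using c(1) fC by (simp add: card_Diff_singleton)
  have D3: "3 \<le> card D" "7 \<le> card D" using D C_big by auto
  define M0 where "M0 = {g \<in> M. g ` c = c}"
  have gM0: "giant M0 D" unfolding M0_def D_def by (rule giant_fix[OF M(3)]) (use c(1) in auto)
  \<comment> \<open>If \<open>h\<close> kept the block but moved \<open>c\<close>, the stabiliser of
    the block in \<open>M\<close> would fix a second letter, although it is a giant on the letters
    other than \<open>c\<close>.\<close>
  have A: "h ` c = c" if h: "h \<in> G" and hy: "h y \<in> ?u" for h
  proof (rule ccontr)
    assume ne: "h ` c \<noteq> c"
    have hu: "h ` ?u = ?u" using r_img[OF subsetD[OF L_K h] y, of "Suc j"] r_move[OF y subsetD[OF L_K h], of "Suc j"] hy by simp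
    have hc: "h ` c \<in> D" unfolding D_def using presD[OF pC h c(1)] ne by auto
    obtain g where g: "g \<in> M0" "g ` (h ` c) \<noteq> h ` c" using giant_moves[OF gM0 D3(1) hc] .
    have gM: "g \<in> M" "g ` ?u = ?u" using g(1) c(2)[of g] unfolding M0_def by simp_all
    have "(inv' h \<circ> g \<circ> h) ` ?u = ?u"
      using hu gM(2) image_inv_eq(1)[OF pgroup_L h, of ?u] by (simp only: o_image)
    then have "(inv' h \<circ> g \<circ> h) ` c = c" using c(2)[OF conjM[OF h gM(1)]] by simp
    then have "inv' h ` (g ` (h ` c)) = c" by (simp only: o_image)
    then have "g ` (h ` c) = h ` c" using image_inv_eq(2)[OF pgroup_L h, of "g ` (h ` c)"] by simp
    then show False using g(2) by simp
  qed
  define \<Gamma> where "\<Gamma> = {h \<in> G. h ` c = c}"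
  have \<Gamma>: "pgroup \<Omega> \<Gamma>" unfolding \<Gamma>_def by (rule pgroup_filter[OF pgroup_L]) (simp_all only: o_image image_id id_apply)
  have \<Gamma>G: "\<Gamma> \<subseteq> G" "\<Gamma> \<subseteq> K" unfolding \<Gamma>_def using L_K by auto
  have pD: "pres \<Gamma> D" unfolding pres_def
  proof (intro ballI)
    fix g u assume g: "g \<in> \<Gamma>" and u: "u \<in> D"
    have gG: "g \<in> G" "g ` c = c" using g unfolding \<Gamma>_def by auto
    have "g ` u \<noteq> c"
    proof
      assume e: "g ` u = c"
      have "u = inv' g ` (g ` u)" using image_inv_eq(1)[OF pgroup_L gG(1)] by simp
      also have "\<dots> = inv' g ` (g ` c)" using e gG(2) by simp
      also have "\<dots> = c" using image_inv_eq(1)[OF pgroup_L gG(1)] by simp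
      finally show False using u unfolding D_def by auto
    qed
    then show "g ` u \<in> D" using presD[OF pC gG(1)] u unfolding D_def by auto
  qed
  have pM0: "pgroup \<Omega> M0" unfolding M0_def by (rule pgroup_filter[OF M(1)]) (simp_all only: o_image image_id id_apply)
  have M0\<Gamma>: "M0 \<subseteq> \<Gamma>" using MG unfolding M0_def \<Gamma>_def by auto
  have nM0: "normal_in M0 \<Gamma>" unfolding normal_in_def
  proof (intro ballI)
    fix h g assume h: "h \<in> \<Gamma>" and g: "g \<in> M0"
    have "h \<circ> g \<circ> inv' h \<in> M" using M(2) h g unfolding normal_in_def \<Gamma>_def M0_def by auto
    moreover have "h \<circ> g \<circ> inv' h \<in> \<Gamma>" by (rule pgroup_conj[OF \<Gamma> h]) (use g M0\<Gamma> in auto)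
    ultimately show "h \<circ> g \<circ> inv' h \<in> M0" unfolding M0_def \<Gamma>_def by auto
  qed
  \<comment> \<open>The analogue of \<open>Kj\<close> for the stabiliser of \<open>c\<close>. It
    starts at level \<open>Suc j\<close>, where it is all of \<open>M0\<close>.\<close>
  define N where "N k = {g \<in> M0. \<forall>h\<in>\<Gamma>. g (h y) \<in> r k (h y)}" for k
  have \<Gamma>in: "h y \<in> \<Omega>" if "h \<in> \<Gamma>" for h using that \<Gamma>G(2) in_\<Omega> y by auto
  have N0: "N (Suc j) = M0"
  proof -
    have "g (h y) \<in> r (Suc j) (h y)" if g: "g \<in> M0" and h: "h \<in> \<Gamma>" for g h
    proof -
      have hG: "h \<in> G" "h ` c = c" using h unfolding \<Gamma>_def by auto
      have gM: "g \<in> M" "g ` c = c" using g unfolding M0_def by auto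
      have "(inv' h \<circ> g \<circ> h) ` c = c"
        using hG(2) gM(2) image_inv_eq(1)[OF pgroup_L hG(1), of c] by (simp only: o_image)
      then have "(inv' h \<circ> g \<circ> h) ` ?u = ?u" using c(2)[OF conjM[OF hG(1) gM(1)]] by simp
      then have "h ` (inv' h ` (g ` (h ` ?u))) = h ` ?u" by (simp only: o_image)
      then have "g ` (h ` ?u) = h ` ?u" using image_inv_eq(2)[OF pgroup_L hG(1), of "g ` (h ` ?u)"] by simp
      then have "g ` r (Suc j) (h y) = r (Suc j) (h y)" by (simp only: r_img[OF subsetD[OF \<Gamma>G(2) h] y])
      then show ?thesis using r_self[OF \<Gamma>in[OF h], of "Suc j"] by blast
    qed
    then show ?thesis unfolding N_def by auto
  qed
  have walk: "pgroup \<Omega> (N k) \<and> normal_in (N k) \<Gamma> \<and> giant (N k) D" if "Suc j \<le> k" "k \<le> l" for k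
    using that
  proof (induction k rule: dec_induct)
    case base
    show ?case unfolding N0 using pM0 nM0 gM0 by auto
  next
    case (step k)
    have k: "j < k" "k < l" "i \<le> k" using step j by auto
    have Nk: "pgroup \<Omega> (N k)" "normal_in (N k) \<Gamma>" "giant (N k) D" using step by auto
    have NM: "N k \<subseteq> M" "N k \<subseteq> \<Gamma>" using M0\<Gamma> unfolding N_def M0_def by auto
    have \<Gamma>E: "\<Gamma> \<inter> E k y = G \<inter> E k y"
      using A E_antimono[of "Suc j" k y] k y unfolding \<Gamma>_def setstab_def by auto
    have aw: "acts_well \<Gamma> k y" using acts_well_L[OF k(3,2) y] unfolding acts_well_def \<Gamma>E .
    have NE: "N k \<subseteq> \<Gamma> \<inter> E k y"
      using NM \<Gamma>G(2) pgroup_id[OF \<Gamma>] unfolding N_def setstab_def by force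
    have presN: "pres (N k) D" "pres (N k) (O' k y)"
      by (rule pres_mono[OF pD NM(2)], rule pres_mono[OF pres_O[OF y]], use NE in auto)
    have ne: "ker (N k) D \<noteq> ker (N k) (O' k y)"
    proof
      assume eq: "ker (N k) D = ker (N k) (O' k y)"
      obtain c2 where "c2 \<in> D" using D3 by (metis card.empty ex_in_conv not_numeral_le_zero)
      then obtain g2 where g2: "g2 \<in> N k" "g2 ` c2 \<noteq> c2" using giant_moves[OF Nk(3) D3(1)] by blast
      have "g2 \<notin> ker (N k) D" using ker_fix[of g2 "N k" D c2] \<open>c2 \<in> D\<close> g2(2) by (rule_tac notI) simp
      then have "g2 \<notin> ker (N k) (O' k y)" by (simp only: eq not_False_eq_True)
      from ker_moves[OF g2(1) this] obtain u2 where m2: "u2 \<in> O' k y" "g2 ` u2 \<noteq> u2" by (rule bexE)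
      note Ok = giant_or_trivial[OF \<Gamma> y aw Nk(1) NE Nk(2) g2(1) m2]
      have O5: "finite (O' k y)" "5 \<le> card (O' k y)" "3 \<le> card (O' k y)" using Ok(1) finite_O by auto
      \<comment> \<open>Since \<open>D\<close> lacks one letter of \<open>C\<close>, the comparison
        of the two sections loses 1; hence the form of \<open>no_tie\<close>.\<close>
      have "card D \<le> card (O' k y)"
        by (rule coincidence_card[OF Nk(1) presN(1) D3(1) Nk(3) presN(2) finite_O eq])
      moreover have "card (O' j y) \<le> card C"
        by (rule coincidence_card[OF M(1) presMO _ Oj(3) presMC fC keq[symmetric]]) (use O7 in simp)
      ultimately have "card (O' j y) - 1 \<le> card (O' k y)" using D by linarith
      then obtain q v where q: "q \<in> ker (E j y) (O' j y) \<inter> E k y" "v \<in> O' k y" "q ` v \<noteq> v"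
        using no_tie[OF k(1,2) y Ok(1)] by auto
      let ?Q = "ker (E j y) (O' j y) \<inter> E k y"
      have pE: "pgroup \<Omega> (E k y)" "pgroup \<Omega> (E j y)" by (rule pgroup_E[OF y])+
      have pQ: "pgroup \<Omega> ?Q" by (rule pgroup_inter[OF pgroup_ker[OF pE(2)] pE(1)])
      have nQ: "h \<circ> g \<circ> inv' h \<in> ?Q" if h: "h \<in> E k y" and g: "g \<in> ?Q" for h g
        using ker_normal[OF pE(2) pres_O[OF y]] E_antimono[of j k y] k(1) y h g pgroup_conj[OF pE(1) h]
        unfolding normal_in_def by auto
      have "normal_in ?Q (E k y)" using nQ unfolding normal_in_def by auto
      note gQ = normal_giant(3)[OF k(2) y pQ _ this q]
      have gQ: "giant ?Q (O' k y)" by (rule gQ) auto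
      let ?P = "G \<inter> E k y"
      have pP: "pgroup \<Omega> ?P" by (rule pgroup_inter[OF pgroup_L pE(1)])
      have gP: "giant ?P (O' k y)" using Ok(2) unfolding \<Gamma>E .
      have nP: "h \<circ> g \<circ> inv' h \<in> ?P" if h: "h \<in> E k y" and g: "g \<in> ?P" for h g
        using L_normal[of h g i] E_K h g pgroup_conj[OF pE(1) h] by auto
      \<comment> \<open>Commutators of \<open>?P\<close> with \<open>?Q\<close>, and then of
        \<open>N k\<close> with these, provide a giant in the intersection of all three groups. One
        of its elements moves \<open>v\<close>; it is trivial on \<open>O' j y\<close>, hence on
        \<open>C\<close>, hence by the supposed coincidence on \<open>O' k y\<close>, a
        contradiction.\<close>
      let ?Z = "?P \<inter> ?Q"
      have pZ: "pgroup \<Omega> ?Z" by (rule pgroup_inter[OF pP pQ])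
      have presE: "pres S (O' k y)" if "S \<subseteq> E k y" for S by (rule pres_mono[OF pres_O[OF y] that])
      have gZ: "giant ?Z (O' k y)"
      proof (rule giant_comm[OF pP gP _ pQ gQ _ O5(1,2)])
        fix a b assume a: "a \<in> ?P" and b: "b \<in> ?Q"
        have "comm a b \<in> ?P"
          by (rule comm_normal_in[OF pP a]) (rule nP, use b a pgroup_inv[OF pP a] in auto)
        moreover have "comm a b \<in> ?Q"
          by (rule comm_normal_in'[OF pQ b]) (rule nQ, use b a in auto)
        ultimately show "comm a b \<in> ?Z" by auto
      qed (rule presE, blast)+
      have gNZ: "giant (N k \<inter> ?Z) (O' k y)"
      proof (rule giant_comm[OF Nk(1) Ok(3) presN(2) pZ gZ _ O5(1,2)])
        show "pres ?Z (O' k y)" by (rule presE) blast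
        fix a b assume a: "a \<in> N k" and b: "b \<in> ?Z"
        have b\<Gamma>: "b \<in> \<Gamma>" using b \<Gamma>E by auto
        have aP: "a \<in> ?P" using a NE \<Gamma>E by auto
        have "comm a b \<in> N k"
          by (rule comm_normal_in[OF Nk(1) a])
            (use Nk(2) b\<Gamma> pgroup_inv[OF Nk(1) a] in \<open>auto simp: normal_in_def\<close>)
        moreover have "comm a b \<in> ?Z"
        proof (rule comm_normal_in'[OF pZ b])
          show "a \<circ> b \<circ> inv' a \<in> ?Z" using nP[of a b] nQ[of a b] aP b by blast
        qed
        ultimately show "comm a b \<in> N k \<inter> ?Z" by auto
      qed
      obtain g where g: "g \<in> N k \<inter> ?Z" "g ` v \<noteq> v" using giant_moves[OF gNZ O5(3) q(2)] .
      have "g \<in> ker M (O' j y)" using g(1) NM unfolding ker_def by auto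
      then have "g \<in> ker M C" using keq by simp
      then have "g \<in> ker (N k) D" using g(1) unfolding ker_def D_def by auto
      then have "g \<in> ker (N k) (O' k y)" using eq by simp
      then show False using g(2) q(2) unfolding ker_def by auto
    qed
    have eq: "{g \<in> N k. \<forall>h\<in>\<Gamma>. g (h y) \<in> r (Suc k) (h y)} = N (Suc k)"
      unfolding N_def using r_sub \<Gamma>in by blast
    have in': "\<forall>g\<in>N k. \<forall>h\<in>\<Gamma>. g (h y) \<in> r k (h y)" unfolding N_def by auto
    show ?case
      using descend[where \<Gamma> = \<Gamma> and M = "N k" and D = D and y = y and j = k, OF \<Gamma> \<Gamma>G(2) Nk(1) NM(2) Nk(2) pD D3(2) Nk(3) y in' aw ne] unfolding eq by auto
  qed
  have B: "giant {g \<in> G. g ` c = c \<and> (\<forall>h\<in>G. h ` c = c \<longrightarrow> g (h y) = h y)} (C - {c})"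
  proof (rule giant_mono)
    show "giant (N l) (C - {c})" using walk[of l] j unfolding D_def by auto
    show "N l \<subseteq> {g \<in> G. g ` c = c \<and> (\<forall>h\<in>G. h ` c = c \<longrightarrow> g (h y) = h y)}"
    proof
      fix g assume g: "g \<in> N l"
      have "g (h y) = h y" if "h \<in> G" "h ` c = c" for h
        using g that rl[OF \<Gamma>in[of h]] unfolding N_def \<Gamma>_def by auto
      moreover have "g \<in> G" "g ` c = c" using g MG unfolding N_def M0_def by auto
      ultimately show "g \<in> {g \<in> G. g ` c = c \<and> (\<forall>h\<in>G. h ` c = c \<longrightarrow> g (h y) = h y)}" by auto
    qed
  qed
  show ?thesis by (rule that[OF c(1) _ B]) (use A in simp)
qed

end

section \<open>Points that determine a letter\<close>

context stage
begin

text \<open>The dichotomy behind it: for a point outside, the stabiliser of its whole orbit is still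
  a giant on the letters (\<open>giant_off_T\<close>); for a point inside, the letter is unique and
  the other letters remain free (\<open>T_letter\<close>).\<close>

definition "T = {y \<in> \<Omega>. \<exists>c\<in>C. \<forall>g\<in>G. g y = y \<longrightarrow> g ` c = c}"

lemma T_I:
  assumes "y \<in> \<Omega>" "c \<in> C" "\<And>g. g \<in> G \<Longrightarrow> g y = y \<Longrightarrow> g ` c = c"
  shows "y \<in> T"
  unfolding T_def by (intro CollectI conjI bexI[of _ c] ballI impI assms)

lemma T_E:
  assumes "y \<in> T"
  obtains c where "c \<in> C" "\<forall>g\<in>G. g y = y \<longrightarrow> g ` c = c"
proof -
  have "\<exists>c\<in>C. \<forall>g\<in>G. g y = y \<longrightarrow> g ` c = c" using assms unfolding T_def by (rule CollectE) (erule conjE)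
  then show ?thesis by (rule bexE) (rule that)
qed

definition "letter y = (THE c. c \<in> C \<and> (\<forall>g\<in>G. g y = y \<longrightarrow> g ` c = c))"

lemma Kj_l: assumes y: "y \<in> \<Omega>" shows "Kj l y = {g \<in> G. \<forall>h\<in>G. g (h y) = h y}"
  unfolding Kj_def using rl G_in y by auto

lemma giant_off_T:
  assumes y: "y \<in> \<Omega>" "y \<notin> T"
  shows "giant {g \<in> G. \<forall>h\<in>G. g (h y) = h y} C"
proof -
  have "\<not> coincide j y" for j
  proof
    assume "coincide j y"
    from coincidence[OF y(1) this] obtain c where c: "c \<in> C" "\<forall>h\<in>G. h y \<in> r (Suc j) y \<longrightarrow> h ` c = c" .
    have "y \<in> T" by (rule T_I[OF y(1) c(1)]) (use c(2) r_self[OF y(1)] in simp)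
    then show False using y(2) by simp
  qed
  then show ?thesis using Kj_giant[OF y(1), of l] i unfolding Kj_l[OF y(1)] by simp
qed

text \<open>A coincidence must occur, since otherwise some element fixing \<open>y\<close> would
  move the given letter. The letter of this coincidence is the only one fixed, because a giant on
  the other letters also fixes \<open>y\<close>.\<close>

lemma T_letter:
  assumes y: "y \<in> T"
  shows "letter y \<in> C" "\<And>g. g \<in> G \<Longrightarrow> g y = y \<Longrightarrow> g ` letter y = letter y"
    "\<And>c. c \<in> C \<Longrightarrow> (\<And>g. g \<in> G \<Longrightarrow> g y = y \<Longrightarrow> g ` c = c) \<Longrightarrow> c = letter y"
    "giant {g \<in> G. g ` letter y = letter y \<and> (\<forall>h\<in>G. h ` letter y = letter y \<longrightarrow> g (h y) = h y)} (C - {letter y})"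
proof -
  have y\<Omega>: "y \<in> \<Omega>" using y unfolding T_def by auto
  obtain c0 where c0: "c0 \<in> C" "\<forall>g\<in>G. g y = y \<longrightarrow> g ` c0 = c0" using T_E[OF y] .
  have "\<exists>j. coincide j y"
  proof (rule ccontr)
    assume "\<not> ?thesis"
    then have g: "giant (Kj l y) C" using Kj_giant[OF y\<Omega>, of l] i by simp
    have "3 \<le> card C" using C_big by simp
    from giant_moves[OF g this c0(1)] obtain g where "g \<in> Kj l y" "g ` c0 \<noteq> c0" .
    moreover from this(1) have "g \<in> G" "g y = y" unfolding Kj_l[OF y\<Omega>] using pgroup_id[OF pgroup_L] by force+
    ultimately show False using c0(2) by simp
  qed
  then obtain j where "coincide j y" ..
  from coincidence[OF y\<Omega> this] obtain c where c: "c \<in> C" "\<forall>h\<in>G. h y \<in> r (Suc j) y \<longrightarrow> h ` c = c"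
    "giant {g \<in> G. g ` c = c \<and> (\<forall>h\<in>G. h ` c = c \<longrightarrow> g (h y) = h y)} (C - {c})" .
  have fixc: "g ` c = c" if "g \<in> G" "g y = y" for g using c(2) that r_self[OF y\<Omega>] by simp
  have uniq: "c' = c" if c': "c' \<in> C" "\<And>g. g \<in> G \<Longrightarrow> g y = y \<Longrightarrow> g ` c' = c'" for c'
  proof (rule ccontr)
    assume "c' \<noteq> c"
    then have c1: "c' \<in> C - {c}" using c' by simp
    have c3: "3 \<le> card (C - {c})" using C_big c(1) fC by (simp add: card_Diff_singleton)
    obtain g where g: "g \<in> {g \<in> G. g ` c = c \<and> (\<forall>h\<in>G. h ` c = c \<longrightarrow> g (h y) = h y)}" "g ` c' \<noteq> c'"
      using giant_moves[OF c(3) c3 c1] .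
    have gG: "g \<in> G" and all: "\<forall>h\<in>G. h ` c = c \<longrightarrow> g (h y) = h y" using g(1) by simp_all
    have "g y = y" using bspec[OF all pgroup_id[OF pgroup_L]] by simp
    then show False using c'(2)[OF gG] g(2) by simp
  qed
  have e: "letter y = c" unfolding letter_def
  proof (rule the_equality)
    show "c \<in> C \<and> (\<forall>g\<in>G. g y = y \<longrightarrow> g ` c = c)" using c(1) fixc by simp
    fix c' assume "c' \<in> C \<and> (\<forall>g\<in>G. g y = y \<longrightarrow> g ` c' = c')"
    then show "c' = c" by (intro uniq) simp_all
  qed
  show "letter y \<in> C" "\<And>g. g \<in> G \<Longrightarrow> g y = y \<Longrightarrow> g ` letter y = letter y"
    "\<And>c. c \<in> C \<Longrightarrow> (\<And>g. g \<in> G \<Longrightarrow> g y = y \<Longrightarrow> g ` c = c) \<Longrightarrow> c = letter y"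
    "giant {g \<in> G. g ` letter y = letter y \<and> (\<forall>h\<in>G. h ` letter y = letter y \<longrightarrow> g (h y) = h y)} (C - {letter y})"
    unfolding e by (fact c(1), erule (1) fixc, erule uniq, assumption, fact c(3))
qed

lemma T_sub: "T \<subseteq> \<Omega>" unfolding T_def by auto

lemma letter_move:
  assumes y: "y \<in> T" and h: "h \<in> G"
  shows "h y \<in> T" "letter (h y) = h ` letter y"
proof -
  have c: "h ` letter y \<in> C" by (rule presD[OF pC h T_letter(1)[OF y]])
  have f: "g ` (h ` letter y) = h ` letter y" if g: "g \<in> G" "g (h y) = h y" for g
  proof -
    have k: "inv' h \<circ> g \<circ> h \<in> G" using pgroup_comp[OF pgroup_L] pgroup_inv[OF pgroup_L] g h by auto
    have "(inv' h \<circ> g \<circ> h) y = y" using g(2) pgroup_inv1[OF pgroup_L h] by simp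
    then have "(inv' h \<circ> g \<circ> h) ` letter y = letter y" by (rule T_letter(2)[OF y k])
    then have "h ` (inv' h ` (g ` (h ` letter y))) = h ` letter y" by (simp only: o_image)
    then show ?thesis by (simp only: image_inv_eq(2)[OF pgroup_L h])
  qed
  show T: "h y \<in> T" by (rule T_I[OF _ c f]) (use G_in[OF h] subsetD[OF T_sub y] in simp)
  show "letter (h y) = h ` letter y" using T_letter(3)[OF T c f] by simp
qed

text \<open>Elements whose support is confined to points of \<open>T\<close> with letter outside
  \<open>Q\<close>. The sets \<open>Q\<close> used later are large, so the supports are
  small.\<close>

definition "R Q = {g \<in> G. (\<forall>c\<in>Q. g ` c = c) \<and> (\<forall>y\<in>\<Omega>. y \<notin> T \<or> letter y \<in> Q \<longrightarrow> g y = y)}"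

lemma o_image_fix: "\<forall>c\<in>Q. g ` c = c \<Longrightarrow> \<forall>c\<in>Q. h ` c = c \<Longrightarrow> \<forall>c\<in>Q. (g \<circ> h) ` c = c"
  by (simp add: o_image del: image_comp comp_apply image_image)

lemma R_group: "pgroup \<Omega> (R Q)"
  unfolding R_def
proof (rule pgroup_filter[OF pgroup_L], goal_cases)
  case (2 g h)
  then show ?case using o_image_fix[of Q g h] by simp
qed simp

lemma R_G: "R Q \<subseteq> G" unfolding R_def by auto

text \<open>Each point that has to be fixed defines a normal subgroup of the stabiliser of
  \<open>c\<close> that is a giant on the other letters, by \<open>giant_off_T\<close> or
  \<open>T_letter\<close>. Their intersection is a giant by \<open>giant_INT\<close>.\<close>

lemma giant_R_single:
  assumes c: "c \<in> C"
  shows "giant (R {c}) (C - {c})"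
proof -
  define \<Gamma> where "\<Gamma> = {g \<in> G. g ` c = c}"
  have \<Gamma>: "pgroup \<Omega> \<Gamma>" unfolding \<Gamma>_def by (rule pgroup_filter[OF pgroup_L]) (simp_all only: o_image image_id id_apply)
  have card: "5 \<le> card (C - {c})" using C_big c fC by (simp add: card_Diff_singleton)
  define B where "B y = {g \<in> \<Gamma>. \<forall>h\<in>\<Gamma>. g (h y) = h y}" for y
  define I where "I = {y \<in> \<Omega>. y \<notin> T \<or> letter y = c}"
  have presD: "pres \<Gamma> (C - {c})" unfolding pres_def
  proof (intro ballI)
    fix g u assume g: "g \<in> \<Gamma>" and u: "u \<in> C - {c}"
    have gG: "g \<in> G" "g ` c = c" using g unfolding \<Gamma>_def by auto
    have "inv' g ` (g ` u) \<noteq> inv' g ` (g ` c)" using u by (simp only: image_inv_eq(1)[OF pgroup_L gG(1)]) simp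
    then have "g ` u \<noteq> c" using gG(2) by metis
    then show "g ` u \<in> C - {c}" using presD[OF pC gG(1)] u by simp
  qed
  have "giant {g \<in> \<Gamma>. \<forall>y\<in>I. g \<in> B y} (C - {c})"
  proof (rule giant_INT[OF \<Gamma> _ presD _ card])
    show "giant \<Gamma> (C - {c})" by (rule giant_fix[OF giant_C]) (use c in \<open>auto simp: \<Gamma>_def\<close>)
    show "finite (C - {c})" using fC by simp
    show "finite I" using fin unfolding I_def by simp
    fix y assume y: "y \<in> I"
    show "pgroup \<Omega> (B y)" unfolding B_def
    proof (rule pgroup_filter[OF \<Gamma>])
      fix a b assume ab: "a \<in> \<Gamma>" "b \<in> \<Gamma>" "\<forall>h\<in>\<Gamma>. a (h y) = h y" "\<forall>h\<in>\<Gamma>. b (h y) = h y"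
      then show "\<forall>h\<in>\<Gamma>. (a \<circ> b) (h y) = h y" by simp
    qed simp
    show "B y \<subseteq> \<Gamma>" unfolding B_def by auto
    show "normal_in (B y) \<Gamma>" unfolding normal_in_def
    proof (intro ballI)
      fix k g assume k: "k \<in> \<Gamma>" and g: "g \<in> B y"
      have "(k \<circ> g \<circ> inv' k) (h y) = h y" if h: "h \<in> \<Gamma>" for h
      proof -
        have "inv' k \<circ> h \<in> \<Gamma>" by (rule pgroup_comp[OF \<Gamma> pgroup_inv[OF \<Gamma> k] h])
        then have "g ((inv' k \<circ> h) y) = (inv' k \<circ> h) y" using g unfolding B_def by blast
        then show ?thesis using pgroup_inv2[OF \<Gamma> k] by simp
      qed
      moreover have "k \<circ> g \<circ> inv' k \<in> \<Gamma>" by (rule pgroup_conj[OF \<Gamma> k]) (use g in \<open>simp add: B_def\<close>)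
      ultimately show "k \<circ> g \<circ> inv' k \<in> B y" unfolding B_def by blast
    qed
    show "giant (B y) (C - {c})"
    proof (cases "y \<in> T")
      case True
      then have l: "letter y = c" using y unfolding I_def by simp
      have "giant {g \<in> G. g ` c = c \<and> (\<forall>h\<in>G. h ` c = c \<longrightarrow> g (h y) = h y)} (C - {c})"
        using T_letter(4)[OF True] unfolding l .
      then show ?thesis by (rule giant_mono) (auto simp: B_def \<Gamma>_def)
    next
      case False
      have y\<Omega>: "y \<in> \<Omega>" using y unfolding I_def by simp
      show ?thesis by (rule giant_fix[OF giant_off_T[OF y\<Omega> False]]) (use c in \<open>auto simp: B_def \<Gamma>_def\<close>)
    qed
  qed
  then show ?thesis
  proof (rule giant_mono)
    show "{g \<in> \<Gamma>. \<forall>y\<in>I. g \<in> B y} \<subseteq> R {c}"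
    proof
      fix g assume g: "g \<in> {g \<in> \<Gamma>. \<forall>y\<in>I. g \<in> B y}"
      have "g y = y" if y: "y \<in> I" for y
      proof -
        have "\<forall>h\<in>\<Gamma>. g (h y) = h y" using g y unfolding B_def by simp
        from bspec[OF this pgroup_id[OF \<Gamma>]] show ?thesis by simp
      qed
      then show "g \<in> R {c}" using g unfolding R_def I_def \<Gamma>_def by simp
    qed
  qed
qed

text \<open>Commutators are taken between elements of \<open>R Q\<close> that fix \<open>c\<close>
  and elements of \<open>R {c}\<close> that fix the letters in \<open>Q\<close>. Points with letter
  in \<open>Q\<close> are fixed thanks to the first factor and those with letter \<open>c\<close>
  thanks to the second, because each factor permutes the points of a fixed letter among
  themselves.\<close>

lemma giant_R:
  assumes Q: "finite Q" "Q \<noteq> {}" "Q \<subseteq> C" "5 \<le> card (C - Q)"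
  shows "giant (R Q) (C - Q)"
  using Q
proof (induction Q rule: finite_ne_induct)
  case (singleton c)
  then show ?case using giant_R_single[of c] by simp
next
  case (insert c Q)
  have c: "c \<in> C" "c \<notin> Q" "Q \<subseteq> C" using insert by auto
  let ?D = "C - insert c Q"
  have "card ?D \<le> card (C - Q)" by (rule card_mono) (use fC in auto)
  then have IH: "giant (R Q) (C - Q)" using insert by auto
  define P1 where "P1 = {g \<in> R Q. g ` c = c}"
  define P2 where "P2 = {g \<in> R {c}. \<forall>d\<in>Q. g ` d = d}"
  have p1: "pgroup \<Omega> P1" unfolding P1_def by (rule pgroup_filter[OF R_group]) (simp_all only: o_image image_id id_apply)
  have p2: "pgroup \<Omega> P2" unfolding P2_def
  proof (rule pgroup_filter[OF R_group], goal_cases)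
    case (2 g h) then show ?case by (intro o_image_fix)
  qed simp
  have g1: "giant P1 ?D" by (rule giant_fix[OF IH]) (use c in \<open>auto simp: P1_def\<close>)
  have g2: "giant P2 ?D" by (rule giant_fix[OF giant_R_single[OF c(1)]]) (use c in \<open>auto simp: P2_def\<close>)
  have fixes1: "g ` d = d" if "g \<in> P1" "d \<in> insert c Q" for g d
  proof -
    have "\<forall>d\<in>Q. g ` d = d" "g ` c = c" using that(1) unfolding P1_def R_def by simp_all
    then show ?thesis using that(2) by (elim insertE) simp_all
  qed
  have fixes2: "g ` d = d" if "g \<in> P2" "d \<in> insert c Q" for g d
  proof -
    have "\<forall>d\<in>Q. g ` d = d" "g ` c = c" using that(1) unfolding P2_def R_def by simp_all
    then show ?thesis using that(2) by (elim insertE) simp_all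
  qed
  have G12: "P1 \<subseteq> G" "P2 \<subseteq> G" using R_G unfolding P1_def P2_def by blast+
  have pres: "pres P ?D" if P: "pgroup \<Omega> P" "P \<subseteq> G" and fx: "\<And>g d. g \<in> P \<Longrightarrow> d \<in> insert c Q \<Longrightarrow> g ` d = d" for P
    unfolding pres_def
  proof (intro ballI)
    fix g u assume g: "g \<in> P" and u: "u \<in> ?D"
    have "g ` u \<notin> insert c Q"
    proof
      assume a: "g ` u \<in> insert c Q"
      have "u = inv' g ` (g ` u)" by (rule image_inv_eq(1)[OF P(1) g, symmetric])
      also have "\<dots> = g ` u" by (rule fx[OF pgroup_inv[OF P(1) g] a])
      finally have "u \<in> insert c Q" using a by simp
      then show False using u by blast
    qed
    then show "g ` u \<in> ?D" using presD[OF pC subsetD[OF P(2) g]] u by blast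
  qed
  show ?case
  proof (rule giant_comm[OF p1 g1 pres[OF p1 G12(1) fixes1] p2 g2 pres[OF p2 G12(2) fixes2] _ insert.prems(2)])
    show "finite ?D" using fC by simp
    fix a b assume a: "a \<in> P1" and b: "b \<in> P2"
    have aG: "a \<in> G" and bG: "b \<in> G" using a b G12 by auto
    have ai: "inv' a \<in> P1" and bi: "inv' b \<in> P2" using pgroup_inv p1 p2 a b by auto
    have "comm a b ` d = d" if d: "d \<in> insert c Q" for d
      unfolding comm_def by (simp only: o_image fixes1[OF a d] fixes1[OF ai d] fixes2[OF b d] fixes2[OF bi d])
    moreover have "comm a b y = y" if y: "y \<in> \<Omega>" "y \<notin> T \<or> letter y \<in> insert c Q" for y
    proof -
      have f1: "g z = z" if "g \<in> P1" "z \<in> \<Omega>" "z \<notin> T \<or> letter z \<in> Q" for g z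
        using that unfolding P1_def R_def by blast
      have f2: "g z = z" if "g \<in> P2" "z \<in> \<Omega>" "z \<notin> T \<or> letter z = c" for g z
        using that unfolding P2_def R_def by blast
      consider "y \<notin> T" | "y \<in> T" "letter y \<in> Q" | "y \<in> T" "letter y = c" using y(2) by auto
      then show ?thesis
      proof cases
        case 1
        then show ?thesis unfolding comm_def using f1[OF a y(1)] f1[OF ai y(1)] f2[OF b y(1)] f2[OF bi y(1)] by simp
      next
        case 2
        let ?z = "inv' b y"
        have biG: "inv' b \<in> G" using bi G12 by auto
        have "letter ?z = letter y"
          using letter_move(2)[OF 2(1) biG] fixes2[OF bi, of "letter y"] 2(2) by simp
        then have z: "?z \<in> \<Omega>" "?z \<notin> T \<or> letter ?z \<in> Q" using 2 G_in[OF biG] y(1) by auto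
        have "inv' a ?z = ?z" by (rule f1[OF ai z])
        then show ?thesis unfolding comm_def using pgroup_inv2[OF p2 b] f1[OF a y(1)] 2 by simp
      next
        case 3
        let ?z = "inv' a y"
        have aiG: "inv' a \<in> G" using ai G12 by auto
        have "letter ?z = letter y"
          using letter_move(2)[OF 3(1) aiG] fixes1[OF ai, of "letter y"] 3(2) by simp
        then have z: "?z \<in> \<Omega>" "?z \<notin> T \<or> letter ?z = c" using 3 G_in[OF aiG] y(1) by auto
        have "inv' b y = y" by (rule f2[OF bi y(1)]) (use 3 in simp)
        moreover have "b ?z = ?z" by (rule f2[OF b z])
        ultimately show ?thesis unfolding comm_def using pgroup_inv2[OF p1 a] by simp
      qed
    qed
    moreover have "comm a b \<in> G" by (rule pgroup_comm[OF pgroup_L aG bG])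
    ultimately show "comm a b \<in> R (insert c Q)" unfolding R_def by blast
  qed
qed

text \<open>The commutator of elements acting on \<open>C\<close> as the 3-cycles \<open>(a b d)\<close> and \<open>(a c e)\<close>, chosen in
  \<open>R Q1\<close> and \<open>R Q2\<close> such that only the letter \<open>a\<close> lies outside both sets, has small support.\<close>

lemma degree_bound:
  assumes m: "\<And>g. g \<in> K \<Longrightarrow> g \<noteq> id \<Longrightarrow> m \<le> card (mov g)"
  shows "m * card C \<le> 3 * card T"
proof -
  have "C \<noteq> {}" using C_big by auto
  then obtain a where a: "a \<in> C" by blast
  \<comment> \<open>The place where degree 9 is used: \<open>a\<close> and two disjoint sets of four
    letters. With four letters besides \<open>a\<close> there are the five that
    \<open>giant_R\<close> requires.\<close>
  have "card (C - {a}) \<ge> 8" using a C_big fC by (simp add: card_Diff_singleton)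
  then have "4 \<le> card (C - {a})" by linarith
  from obtain_subset_with_card_n[OF this] obtain A1 where A1: "A1 \<subseteq> C - {a}" "card A1 = 4" by blast
  have fA1: "finite A1" by (rule finite_subset[OF A1(1)]) (use fC in simp)
  have "4 \<le> card (C - {a} - A1)" using \<open>card (C - {a}) \<ge> 8\<close> A1 card_Diff_subset[OF fA1 A1(1)] by linarith
  from obtain_subset_with_card_n[OF this] obtain A2 where A2: "A2 \<subseteq> C - {a} - A1" "card A2 = 4" by blast
  have fA2: "finite A2" by (rule finite_subset[OF A2(1)]) (use fC in simp)
  obtain b where b: "b \<in> A1" using ex_not_in_list[OF fA1, of "[]"] A1(2) by auto
  obtain d where d: "d \<in> A1" "d \<notin> set [b]" using ex_not_in_list[OF fA1, of "[b]"] A1(2) by auto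
  obtain c where c: "c \<in> A2" using ex_not_in_list[OF fA2, of "[]"] A2(2) by auto
  obtain e where e: "e \<in> A2" "e \<notin> set [c]" using ex_not_in_list[OF fA2, of "[c]"] A2(2) by auto
  have el: "\<exists>g\<in>R (C - insert a A). g ` a = b' \<and> (\<forall>u\<in>C - insert a A. g ` u = u)"
    if A: "A \<subseteq> C - {a}" "card A = 4" and b': "b' \<in> A" "d' \<in> A" "d' \<noteq> b'" and ne: "C - insert a A \<noteq> {}" for A b' d'
  proof -
    have fA: "finite A" by (rule finite_subset[OF A(1)]) (use fC in simp)
    have eq: "C - (C - insert a A) = insert a A" using A(1) a by blast
    have aA: "a \<notin> A" using A(1) by blast
    have "5 \<le> card (insert a A)" using A(2) fA aA by simp
    then have gi: "giant (R (C - insert a A)) (insert a A)"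
      using giant_R[of "C - insert a A"] ne fC unfolding eq by simp
    have abd: "a \<noteq> b'" "b' \<noteq> d'" "a \<noteq> d'" using aA b' by blast+
    obtain g where g: "g \<in> R (C - insert a A)" "\<And>u. u \<in> insert a A \<Longrightarrow> g ` u = cyc3 a b' d' u"
      by (rule giantD[OF gi, of a b' d']) (use b' abd in simp_all)
    have "g ` a = b'" using g(2)[of a] abd by (simp add: cyc3_def)
    moreover have "\<forall>u\<in>C - insert a A. g ` u = u" using g(1) unfolding R_def by blast
    ultimately show ?thesis using g(1) by blast
  qed
  have A12: "A1 \<subseteq> C - insert a A2" "A2 \<subseteq> C - insert a A1" using A1 A2 by blast+
  have ne: "C - insert a A1 \<noteq> {}" "C - insert a A2 \<noteq> {}" using A12 b c by blast+
  obtain g1 where g1: "g1 \<in> R (C - insert a A1)" "g1 ` a = b" "\<forall>u\<in>C - insert a A1. g1 ` u = u"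
    using el[OF A1 b d(1) _ ne(1)] d(2) by auto
  obtain g2 where g2: "g2 \<in> R (C - insert a A2)" "g2 ` a = c" "\<forall>u\<in>C - insert a A2. g2 ` u = u"
    using el[OF _ A2(2) c e(1) _ ne(2)] A2(1) e(2) by auto
  have gG: "g1 \<in> G" "g2 \<in> G" using g1(1) g2(1) R_G by blast+
  let ?w = "comm g1 g2"
  have w: "?w \<in> K" "?w \<noteq> id"
  proof -
    show "?w \<in> K" using pgroup_comm[OF pgroup_L gG] L_K by blast
    show "?w \<noteq> id"
    proof
      assume w: "?w = id"
      have "?w \<circ> g2 \<circ> g1 = g1 \<circ> g2 \<circ> (inv' g1 \<circ> (inv' g2 \<circ> g2) \<circ> g1)" by (simp only: comm_def comp_assoc)
      also have "\<dots> = g1 \<circ> g2" using pgroup_invo1[OF pgroup_L gG(1)] pgroup_invo1[OF pgroup_L gG(2)] by simp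
      finally have eq: "g2 \<circ> g1 = g1 \<circ> g2" using w by simp
      have "g2 ` b = b" "g1 ` c = c"
        using bspec[OF g2(3) subsetD[OF A12(1) b]] bspec[OF g1(3) subsetD[OF A12(2) c]] .
      then have "(g2 \<circ> g1) ` a = b" "(g1 \<circ> g2) ` a = c" by (simp_all only: o_image g1(2) g2(2))
      then have "b = c" using eq by simp
      then show False using A2(1) b c by blast
    qed
  qed
  define F where "F c = {y \<in> T. letter y = c}" for c
  have fF: "finite (F c)" for c using finite_subset[OF T_sub fin] unfolding F_def by simp
  have mv: "y \<in> \<Omega> \<and> y \<in> T \<and> letter y \<in> insert a A" if g: "g \<in> R (C - insert a A)" and y: "y \<in> mov g" for g y A
  proof -
    have "g \<in> G" using g R_G by blast
    then have y\<Omega>: "y \<in> \<Omega>" using mov_subset[OF pgroup_L] y by blast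
    have "y \<in> T \<and> letter y \<notin> C - insert a A" using g y y\<Omega> unfolding R_def mov_def by blast
    then show ?thesis using y\<Omega> T_letter(1) by blast
  qed
  have "mov g1 \<inter> mov g2 \<subseteq> F a"
  proof
    fix y assume y: "y \<in> mov g1 \<inter> mov g2"
    then have "y \<in> T" "letter y \<in> insert a A1" "letter y \<in> insert a A2" using mv[OF g1(1), of y] mv[OF g2(1), of y] by auto
    then show "y \<in> F a" using A2(1) unfolding F_def by blast
  qed
  then have cF: "card (mov g1 \<inter> mov g2) \<le> card (F a)" by (rule card_mono[OF fF])
  have "m \<le> card (mov ?w)" by (rule m[OF w])
  also have "\<dots> \<le> 3 * card (mov g1 \<inter> mov g2)"
    by (rule card_mov_comm) (use gG pgroup_bij[OF pgroup_L] finite_subset[OF mov_subset[OF pgroup_L] fin] in auto)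
  finally have mF: "m \<le> 3 * card (F a)" using cF by linarith
  \<comment> \<open>Since \<open>G\<close> permutes the sets \<open>F u\<close> transitively,
    \<open>F a\<close> is no larger than their average.\<close>
  have tr: "card (F a) \<le> card (F u)" if u: "u \<in> C" for u
  proof -
    have "3 \<le> card C" using C_big by simp
    from giant_transitive[OF giant_C this a u pgroup_id[OF pgroup_L]] obtain g where g: "g \<in> G" "g ` a = u" .
    have "g ` F a \<subseteq> F u" using letter_move[OF _ g(1)] g(2) unfolding F_def by auto
    moreover have "inj_on g (F a)" using pgroup_inj[OF pgroup_L g(1)] by (simp add: inj_on_def)
    ultimately show ?thesis by (metis card_inj_on_le fF)
  qed
  have "T = (\<Union>u\<in>C. F u)" unfolding F_def using T_letter(1) by auto
  then have "card T = (\<Sum>u\<in>C. card (F u))"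
    by (simp only:) (rule card_UN_disjoint, use fC fF in \<open>auto simp: F_def\<close>)
  also have "\<dots> \<ge> (\<Sum>u\<in>C. card (F a))" by (rule sum_mono) (rule tr)
  finally have "card C * card (F a) \<le> card T" by simp
  then have "3 * (card C * card (F a)) \<le> 3 * card T" by simp
  moreover have "m * card C \<le> 3 * card (F a) * card C" using mF by (rule mult_le_mono1)
  moreover have "3 * card (F a) * card C = 3 * (card C * card (F a))" by (simp only: mult_ac)
  ultimately show ?thesis by linarith
qed

end

section \<open>Order and orbits of the group of a giant tower\<close>

context giant_tower
begin

definition "\<T> i x = {y \<in> \<Omega>. \<exists>c\<in>O' i x. \<forall>g\<in>L i. g y = y \<longrightarrow> g ` c = c}"

text \<open>Sections of one level with the same kernel would be counted repeatedly. One
  representative for each nontrivial kernel is enough to embed \<open>L i\<close> modulo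
  \<open>L (Suc i)\<close> in a product of symmetric groups.\<close>

definition "kernels i = (\<lambda>x. ker (L i) (O' i x)) ` \<Omega> - {L i}"

definition "rep i N = (SOME x. x \<in> \<Omega> \<and> ker (L i) (O' i x) = N)"

abbreviation "C i N \<equiv> O' i (rep i N)"

lemma rep: assumes "N \<in> kernels i" shows "rep i N \<in> \<Omega>" "ker (L i) (C i N) = N" "N \<noteq> L i"
proof -
  have "\<exists>x. x \<in> \<Omega> \<and> ker (L i) (O' i x) = N" using assms unfolding kernels_def by auto
  from someI_ex[OF this] show "rep i N \<in> \<Omega>" "ker (L i) (C i N) = N" unfolding rep_def by auto
  show "N \<noteq> L i" using assms unfolding kernels_def by auto
qed

lemma stage_at: assumes "i < l" "N \<in> kernels i" shows "stage \<Omega> K r l i (rep i N)"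
  by unfold_locales (use assms rep in simp_all)

lemma finite_kernels: "finite (kernels i)" unfolding kernels_def using fin by simp

lemma stage_facts:
  assumes i: "i < l" and N: "N \<in> kernels i"
  shows "9 \<le> card (C i N)" "giant (L i) (C i N)" "pres (L i) (C i N)"
    "\<And>m. (\<And>g. g \<in> K \<Longrightarrow> g \<noteq> id \<Longrightarrow> m \<le> card (mov g)) \<Longrightarrow> m * card (C i N) \<le> 3 * card (\<T> i (rep i N))"
    "\<exists>lt. \<forall>y\<in>\<T> i (rep i N). lt y \<in> C i N \<and> (\<forall>h\<in>L i. lt (h y) = h ` lt y)"
proof -
  interpret S: stage \<Omega> K r l i "rep i N" by (rule stage_at[OF assms])
  have T: "\<T> i (rep i N) = S.T" unfolding \<T>_def S.T_def ..
  show "9 \<le> card (C i N)" "giant (L i) (C i N)" "pres (L i) (C i N)"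
    by (rule S.C_big S.giant_C S.pC)+
  show "m * card (C i N) \<le> 3 * card (\<T> i (rep i N))" if "\<And>g. g \<in> K \<Longrightarrow> g \<noteq> id \<Longrightarrow> m \<le> card (mov g)" for m
    unfolding T by (rule S.degree_bound[OF that])
  show "\<exists>lt. \<forall>y\<in>\<T> i (rep i N). lt y \<in> C i N \<and> (\<forall>h\<in>L i. lt (h y) = h ` lt y)"
    unfolding T by (intro exI[of _ S.letter] ballI conjI S.T_letter(1) S.letter_move(2))
qed

lemma pgroup_kernel: "N \<in> kernels i \<Longrightarrow> pgroup \<Omega> N"
  using pgroup_ker[OF pgroup_L] rep(2) by metis

lemma kernel_sub: "N \<in> kernels i \<Longrightarrow> N \<subseteq> L i"
  using ker_sub rep(2) by metis

lemma kernel_fix: "N \<in> kernels i \<Longrightarrow> g \<in> N \<Longrightarrow> u \<in> C i N \<Longrightarrow> g ` u = u"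
  using ker_fix rep(2) by metis

text \<open>Different kernels make the sections independent: the elements that are trivial on the
  representatives treated so far are still a giant on the next one, by \<open>giant_ker\<close> and
  \<open>giant_INT\<close>.\<close>

lemma joint_transitive:
  assumes i: "i < l" and S: "finite S" "S \<subseteq> kernels i"
    and a: "\<And>N. N \<in> S \<Longrightarrow> a N \<in> C i N" and f: "\<And>N. N \<in> S \<Longrightarrow> f N \<in> C i N"
  shows "\<exists>g\<in>L i. \<forall>N\<in>S. g ` a N = f N"
  using S a f
proof (induction S)
  case empty
  then show ?case using pgroup_id[OF pgroup_L] by auto
next
  case (insert M S)
  have M: "M \<in> kernels i" using insert by auto
  note sM = stage_facts[OF i M]
  obtain g where g: "g \<in> L i" "\<forall>N\<in>S. g ` a N = f N" using insert by auto
  let ?H = "{h \<in> L i. \<forall>N\<in>S. h \<in> N}"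
  have H: "giant ?H (C i M)"
  proof (rule giant_INT[OF pgroup_L sM(2,3) finite_O _ insert.hyps(1)])
    show "5 \<le> card (C i M)" using sM(1) by simp
    fix N assume N: "N \<in> S"
    then have Nk: "N \<in> kernels i" and ne: "N \<noteq> M" using insert by auto
    note sN = stage_facts[OF i Nk]
    show "pgroup \<Omega> N" "N \<subseteq> L i" by (rule pgroup_kernel[OF Nk], rule kernel_sub[OF Nk])
    show "normal_in N (L i)" using ker_normal[OF pgroup_L sN(3)] rep(2)[OF Nk] by simp
    have "giant (ker (L i) (C i N)) (C i M)"
      by (rule giant_ker[OF pgroup_L sN(3) _ sN(2) sM(3) _ sM(2)])
        (use sN(1) sM(1) rep(2)[OF Nk] rep(2)[OF M] ne in simp_all)
    then show "giant N (C i M)" using rep(2)[OF Nk] by simp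
  qed
  have c3: "3 \<le> card (C i M)" using sM(1) by simp
  have ga: "g ` a M \<in> C i M" using presD[OF sM(3) g(1)] insert by simp
  have idH: "id \<in> ?H" using pgroup_id[OF pgroup_L] pgroup_id[OF pgroup_kernel] insert by auto
  have fM: "f M \<in> C i M" using insert by simp
  obtain h where h: "h \<in> ?H" "h ` (g ` a M) = f M" using giant_transitive[OF H c3 ga fM idH] .
  have "(h \<circ> g) ` a N = f N" if N: "N \<in> insert M S" for N
  proof (cases "N = M")
    case True then show ?thesis using h(2) by (simp only: o_image)
  next
    case False
    then have NS: "N \<in> S" using N by simp
    then have "N \<in> kernels i" "h \<in> N" "f N \<in> C i N" using insert h(1) by auto
    then have "h ` f N = f N" by (rule kernel_fix)
    then show ?thesis using g(2) NS by (simp only: o_image)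
  qed
  moreover have "h \<circ> g \<in> L i" using pgroup_comp[OF pgroup_L] h(1) g(1) by simp
  ultimately show ?case by (intro bexI[of _ "h \<circ> g"] ballI)
qed

lemma L_Suc_fix:
  assumes s: "s \<in> L (Suc i)" and x: "x \<in> \<Omega>" and u: "u \<in> O' i x"
  shows "s ` u = u"
proof -
  obtain g where g: "g \<in> E i x" "u = r (Suc i) (g x)" using u unfolding blocks_def by blast
  have gx: "g x \<in> \<Omega>" using in_\<Omega>[OF setstab_K[OF g(1)]] x by simp
  have sK: "s \<in> K" "s (g x) \<in> r (Suc i) (g x)" using s gx unfolding L_def by auto
  show ?thesis unfolding g(2) r_img[OF sK(1) gx] using r_move[OF gx sK] .
qed

definition "\<kappa> y i N = (if y \<in> \<T> i (rep i N) then card (C i N) else 1)"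

text \<open>\<open>L i\<close> moves the letters of \<open>y\<close> in different sections
  independently, while \<open>L (Suc i)\<close> fixes all of them. So a choice of letters and a
  point of the smaller orbit together determine a point of the larger one, from which the letters
  can be read off.\<close>

lemma orbit_step:
  assumes i: "i < l" and y: "y \<in> \<Omega>"
  shows "(\<Prod>N\<in>kernels i. \<kappa> y i N) * card (orb (L (Suc i)) y) \<le> card (orb (L i) y)"
proof -
  let ?S = "{N \<in> kernels i. y \<in> \<T> i (rep i N)}"
  have "\<forall>N. \<exists>lt. N \<in> ?S \<longrightarrow> (lt y \<in> C i N \<and> (\<forall>z\<in>\<T> i (rep i N). \<forall>h\<in>L i. lt (h z) = h ` lt z))"
  proof (intro allI, rule exI, rule impI)
    fix N assume N: "N \<in> ?S"
    then have Nk: "N \<in> kernels i" and yT: "y \<in> \<T> i (rep i N)" by simp_all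
    let ?Q = "\<lambda>lt. \<forall>y\<in>\<T> i (rep i N). lt y \<in> C i N \<and> (\<forall>h\<in>L i. lt (h y) = h ` lt y)"
    have "?Q (SOME lt. ?Q lt)" by (rule someI_ex[OF stage_facts(5)[OF i Nk]])
    then show "(SOME lt. ?Q lt) y \<in> C i N \<and> (\<forall>z\<in>\<T> i (rep i N). \<forall>h\<in>L i. (SOME lt. ?Q lt) (h z) = h ` (SOME lt. ?Q lt) z)"
      using yT by simp
  qed
  from choice[OF this] obtain lt where "\<forall>N. N \<in> ?S \<longrightarrow> (lt N y \<in> C i N \<and> (\<forall>z\<in>\<T> i (rep i N). \<forall>h\<in>L i. lt N (h z) = h ` lt N z))" ..
  then have lt: "\<And>N. N \<in> ?S \<Longrightarrow> lt N y \<in> C i N"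
    "\<And>N h. N \<in> ?S \<Longrightarrow> h \<in> L i \<Longrightarrow> lt N (h y) = h ` lt N y"
    by simp_all
  let ?P = "PiE ?S (C i)"
  have finS: "finite ?S" using finite_kernels by simp
  have "\<forall>f. \<exists>g. f \<in> ?P \<longrightarrow> g \<in> L i \<and> (\<forall>N\<in>?S. g ` lt N y = f N)"
  proof
    fix f
    show "\<exists>g. f \<in> ?P \<longrightarrow> g \<in> L i \<and> (\<forall>N\<in>?S. g ` lt N y = f N)"
    proof (cases "f \<in> ?P")
      case True
      have "\<exists>g\<in>L i. \<forall>N\<in>?S. g ` lt N y = f N"
        by (rule joint_transitive[OF i finS]) (use lt(1) True in \<open>auto simp: PiE_def Pi_def\<close>)
      then show ?thesis by blast
    qed simp
  qed
  from choice[OF this] obtain \<gamma> where "\<forall>f. f \<in> ?P \<longrightarrow> \<gamma> f \<in> L i \<and> (\<forall>N\<in>?S. \<gamma> f ` lt N y = f N)" ..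
  then have \<gamma>: "\<And>f. f \<in> ?P \<Longrightarrow> \<gamma> f \<in> L i" "\<And>f N. f \<in> ?P \<Longrightarrow> N \<in> ?S \<Longrightarrow> \<gamma> f ` lt N y = f N"
    by simp_all
  let ?F = "\<lambda>(f, z). \<gamma> f z"
  have sub: "L (Suc i) \<subseteq> L i" by (rule L_antimono) simp
  have "inj_on ?F (?P \<times> orb (L (Suc i)) y)"
  proof (rule inj_onI, clarify)
    fix f z f' z' assume f: "f \<in> ?P" "f' \<in> ?P" and z: "z \<in> orb (L (Suc i)) y" "z' \<in> orb (L (Suc i)) y"
      and eq: "\<gamma> f z = \<gamma> f' z'"
    have val: "lt N (\<gamma> f z) = f N" if f: "f \<in> ?P" and z: "z \<in> orb (L (Suc i)) y" and N: "N \<in> ?S" for f z N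
    proof -
      obtain s where s: "s \<in> L (Suc i)" "z = s y" using z unfolding orb_def by auto
      have c: "\<gamma> f \<circ> s \<in> L i" by (rule pgroup_comp[OF pgroup_L \<gamma>(1)[OF f]]) (use s sub in auto)
      have "lt N (\<gamma> f z) = (\<gamma> f \<circ> s) ` lt N y" using lt(2)[OF N c] s(2) by simp
      also have "\<dots> = \<gamma> f ` lt N y"
        using L_Suc_fix[OF s(1) rep(1) lt(1)[OF N]] N by (simp only: o_image mem_Collect_eq)
      finally show ?thesis using \<gamma>(2)[OF f N] by simp
    qed
    have "f = f'"
      by (rule PiE_ext[OF f]) (use val[OF f(1) z(1)] val[OF f(2) z(2)] eq in simp)
    then show "f = f' \<and> z = z'" using eq pgroup_inj[OF pgroup_L \<gamma>(1)[OF f(1)]] by simp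
  qed
  moreover have "?F ` (?P \<times> orb (L (Suc i)) y) \<subseteq> orb (L i) y"
  proof clarify
    fix f z assume f: "f \<in> ?P" and "z \<in> orb (L (Suc i)) y"
    then obtain s where s: "s \<in> L (Suc i)" "z = s y" unfolding orb_def by auto
    have "\<gamma> f \<circ> s \<in> L i" by (rule pgroup_comp[OF pgroup_L \<gamma>(1)[OF f]]) (use s sub in auto)
    then have "(\<gamma> f \<circ> s) y \<in> orb (L i) y" unfolding orb_def by blast
    then show "\<gamma> f z \<in> orb (L i) y" using s(2) by simp
  qed
  ultimately have "card (?P \<times> orb (L (Suc i)) y) \<le> card (orb (L i) y)"
    by (rule card_inj_on_le) (rule finite_orb[OF pgroup_L])
  moreover have "card ?P = (\<Prod>N\<in>kernels i. \<kappa> y i N)"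
    unfolding \<kappa>_def card_PiE[OF finS] using finite_kernels by (simp add: prod.inter_filter)
  ultimately show ?thesis by (simp add: card_cartesian_product)
qed

lemma orbit_product:
  assumes y: "y \<in> \<Omega>"
  shows "(\<Prod>i<l. \<Prod>N\<in>kernels i. \<kappa> y i N) \<le> card \<Omega>"
proof -
  have "(\<Prod>i<j. \<Prod>N\<in>kernels i. \<kappa> y i N) * card (orb (L j) y) \<le> card (orb (L 0) y)" if "j \<le> l" for j
    using that
  proof (induction j)
    case (Suc j)
    have "(\<Prod>i<Suc j. \<Prod>N\<in>kernels i. \<kappa> y i N) * card (orb (L (Suc j)) y)
      = (\<Prod>i<j. \<Prod>N\<in>kernels i. \<kappa> y i N) * ((\<Prod>N\<in>kernels j. \<kappa> y j N) * card (orb (L (Suc j)) y))" by simp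
    also have "\<dots> \<le> (\<Prod>i<j. \<Prod>N\<in>kernels i. \<kappa> y i N) * card (orb (L j) y)"
      by (rule mult_le_mono2[OF orbit_step[OF _ y]]) (use Suc in simp)
    also have "\<dots> \<le> card (orb (L 0) y)" using Suc by simp
    finally show ?case .
  qed simp
  from this[of l] have "(\<Prod>i<l. \<Prod>N\<in>kernels i. \<kappa> y i N) * card (orb (L l) y) \<le> card (orb (L 0) y)" by simp
  moreover have "orb (L l) y = {y}" unfolding Ll orb_def by simp
  moreover have "card (orb (L 0) y) \<le> card \<Omega>" by (rule card_mono[OF fin orb_subset[OF pgroup_L y]])
  ultimately show ?thesis by simp
qed

lemma card_step:
  assumes i: "i < l"
  shows "card (L i) \<le> (\<Prod>N\<in>kernels i. fact (card (C i N))) * card (L (Suc i))"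
proof -
  let ?N = "kernels i"
  let ?F = "\<lambda>g. \<lambda>N\<in>?N. act (C i N) g"
  let ?S = "{g \<in> L i. \<forall>N\<in>?N. g \<in> N}"
  have eq: "card (L i) = card (?F ` L i) * card ?S"
  proof (rule card_group_image[OF pgroup_L])
    fix g h assume gh: "g \<in> L i" "h \<in> L i"
    have "?F g = ?F h \<longleftrightarrow> (\<forall>N\<in>?N. act (C i N) g = act (C i N) h)"
      by (auto simp: restrict_def fun_eq_iff)
    also have "\<dots> \<longleftrightarrow> (\<forall>N\<in>?N. inv' h \<circ> g \<in> N)"
      using act_eq_iff[OF pgroup_L gh] rep(2) by simp
    also have "\<dots> \<longleftrightarrow> inv' h \<circ> g \<in> ?S"
      using pgroup_comp[OF pgroup_L pgroup_inv[OF pgroup_L gh(2)] gh(1)] by simp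
    finally show "?F g = ?F h \<longleftrightarrow> inv' h \<circ> g \<in> ?S" .
  qed auto
  have le1: "card (?F ` L i) \<le> (\<Prod>N\<in>?N. fact (card (C i N)))"
  proof -
    have "?F ` L i \<subseteq> PiE ?N (\<lambda>N. {p. p permutes C i N})"
      using pgroup_act(3)[OF pgroup_L stage_facts(3)[OF i] finite_O] by auto
    then have "card (?F ` L i) \<le> card (PiE ?N (\<lambda>N. {p. p permutes C i N}))"
      by (rule card_mono[rotated]) (intro finite_PiE finite_kernels finite_permutations finite_O)
    also have "\<dots> = (\<Prod>N\<in>?N. card {p. p permutes C i N})" by (rule card_PiE[OF finite_kernels])
    also have "\<dots> = (\<Prod>N\<in>?N. fact (card (C i N)))" by (intro prod.cong refl card_permutations finite_O)
    finally show ?thesis .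
  qed
  have le2: "card ?S \<le> card (L (Suc i))"
  proof (rule card_mono[OF pgroup_finite_group[OF pgroup_L]], rule subsetI)
    fix g assume g: "g \<in> ?S"
    have "g x \<in> r (Suc i) x" if x: "x \<in> \<Omega>" for x
    proof -
      have "g \<in> ker (L i) (O' i x)" proof (cases "ker (L i) (O' i x) = L i")
        case True then show ?thesis using g by simp
      next
        case False
        then have "ker (L i) (O' i x) \<in> ?N" using x unfolding kernels_def by simp
        then show ?thesis using g by blast
      qed
      then have "g ` r (Suc i) x = r (Suc i) x" by (rule ker_fix[OF _ O_self[OF x]])
      then show ?thesis using r_self[OF x, of "Suc i"] by blast
    qed
    then show "g \<in> L (Suc i)" using g L_K unfolding L_def by blast
  qed
  show ?thesis unfolding eq by (rule mult_le_mono[OF le1 le2])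
qed

lemma card_product: "card K \<le> (\<Prod>i<l. \<Prod>N\<in>kernels i. fact (card (C i N)))"
proof -
  have "card (L 0) \<le> (\<Prod>i<j. \<Prod>N\<in>kernels i. fact (card (C i N))) * card (L j)" if "j \<le> l" for j
    using that
  proof (induction j)
    case (Suc j)
    then have "card (L 0) \<le> (\<Prod>i<j. \<Prod>N\<in>kernels i. fact (card (C i N))) * card (L j)" by simp
    also have "\<dots> \<le> (\<Prod>i<j. \<Prod>N\<in>kernels i. fact (card (C i N))) * ((\<Prod>N\<in>kernels j. fact (card (C j N))) * card (L (Suc j)))"
      by (rule mult_le_mono2[OF card_step]) (use Suc in simp)
    finally show ?case by (simp add: mult_ac)
  qed simp
  from this[of l] show ?thesis using L0 Ll by simp
qed

text \<open>A factor \<open>fact k\<close> is estimated by \<open>k ^ k\<close>, so that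
  \<open>m * k\<close> appears and can be traded for three times the number of points in
  \<open>\<T>\<close>, each of weight \<open>ln k\<close>. After exchanging the sums every point is
  charged the logarithm in \<open>orbit_product\<close>.\<close>

theorem order_bound:
  assumes m: "\<And>g. g \<in> K \<Longrightarrow> g \<noteq> id \<Longrightarrow> m \<le> card (mov g)"
  shows "real m * ln (card K) \<le> 3 * card \<Omega> * ln (card \<Omega>)"
proof -
  let ?k = "\<lambda>i N. card (C i N)"
  have k: "9 \<le> ?k i N" if "i < l" "N \<in> kernels i" for i N using stage_facts(1) that by auto
  have "ln (real (card K)) \<le> ln (real (\<Prod>i<l. \<Prod>N\<in>kernels i. fact (?k i N)))"
    using card_product pgroup_card_pos[OF K] by (subst ln_le_cancel_iff) (auto simp del: of_nat_prod intro!: prod_pos)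
  also have "\<dots> = (\<Sum>i<l. \<Sum>N\<in>kernels i. ln (fact (?k i N)))"
  proof -
    have "ln (real (\<Prod>i<l. \<Prod>N\<in>kernels i. fact (?k i N))) = ln (\<Prod>i<l. \<Prod>N\<in>kernels i. (fact (?k i N) :: real))" by simp
    also have "\<dots> = (\<Sum>i<l. ln (\<Prod>N\<in>kernels i. (fact (?k i N) :: real)))"
      by (rule ln_prod) (use finite_kernels in auto)
    also have "\<dots> = (\<Sum>i<l. \<Sum>N\<in>kernels i. ln (fact (?k i N)))"
      by (intro sum.cong refl ln_prod) (use finite_kernels in auto)
    finally show ?thesis .
  qed
  also have "\<dots> \<le> (\<Sum>i<l. \<Sum>N\<in>kernels i. real (?k i N) * ln (?k i N))"
  proof (intro sum_mono)
    fix i N assume "i \<in> {..<l}" "N \<in> kernels i"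
    then have k1: "0 < ?k i N" using k[of i N] by simp
    have "fact (?k i N) \<le> real (?k i N ^ ?k i N)" using fact_le_power[of "?k i N"] by simp
    then have "ln (fact (?k i N)) \<le> ln (real (?k i N) ^ ?k i N)" using k1 by (subst ln_le_cancel_iff) auto
    then show "ln (fact (?k i N)) \<le> real (?k i N) * ln (?k i N)" using k1 by (simp add: ln_realpow)
  qed
  finally have "real m * ln (card K) \<le> real m * (\<Sum>i<l. \<Sum>N\<in>kernels i. real (?k i N) * ln (?k i N))"
    by (rule mult_left_mono) simp
  also have "\<dots> = (\<Sum>i<l. \<Sum>N\<in>kernels i. real (m * ?k i N) * ln (?k i N))"
    by (simp add: sum_distrib_left mult_ac)
  also have "\<dots> \<le> (\<Sum>i<l. \<Sum>N\<in>kernels i. 3 * (\<Sum>y\<in>\<Omega>. ln (\<kappa> y i N)))"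
  proof (intro sum_mono)
    fix i N assume iN: "i \<in> {..<l}" "N \<in> kernels i"
    then have il: "i < l" by simp
    have "m * ?k i N \<le> 3 * card (\<T> i (rep i N))" by (rule stage_facts(4)[OF il iN(2)]) (rule m)
    then have "real (m * ?k i N) \<le> real (3 * card (\<T> i (rep i N)))" by (simp only: of_nat_le_iff)
    then have "real (m * ?k i N) * ln (?k i N) \<le> real (3 * card (\<T> i (rep i N))) * ln (?k i N)"
      by (rule mult_right_mono) (use k[OF il iN(2)] in simp)
    also have "\<dots> = 3 * (\<Sum>y\<in>\<T> i (rep i N). ln (?k i N))" by simp
    also have "(\<Sum>y\<in>\<T> i (rep i N). ln (?k i N)) = (\<Sum>y\<in>\<Omega>. ln (\<kappa> y i N))"
      by (rule sum.mono_neutral_cong_left) (use fin in \<open>auto simp: \<kappa>_def \<T>_def\<close>)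
    finally show "real (m * ?k i N) * ln (?k i N) \<le> 3 * (\<Sum>y\<in>\<Omega>. ln (\<kappa> y i N))" .
  qed
  also have "\<dots> = 3 * (\<Sum>i<l. \<Sum>N\<in>kernels i. \<Sum>y\<in>\<Omega>. ln (\<kappa> y i N))" by (simp add: sum_distrib_left)
  also have "(\<Sum>i<l. \<Sum>N\<in>kernels i. \<Sum>y\<in>\<Omega>. ln (\<kappa> y i N)) = (\<Sum>i<l. \<Sum>y\<in>\<Omega>. \<Sum>N\<in>kernels i. ln (\<kappa> y i N))"
    by (intro sum.cong refl sum.swap)
  also have "\<dots> = (\<Sum>y\<in>\<Omega>. \<Sum>i<l. \<Sum>N\<in>kernels i. ln (\<kappa> y i N))" by (rule sum.swap)
  also have "\<dots> \<le> (\<Sum>y\<in>\<Omega>. ln (card \<Omega>))"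
  proof (rule sum_mono)
    fix y assume y: "y \<in> \<Omega>"
    have pos: "\<kappa> y i N > 0" if "i < l" "N \<in> kernels i" for i N using k[OF that] unfolding \<kappa>_def by auto
    have "(\<Sum>i<l. \<Sum>N\<in>kernels i. ln (real (\<kappa> y i N))) = (\<Sum>i<l. ln (\<Prod>N\<in>kernels i. real (\<kappa> y i N)))"
      by (intro sum.cong refl ln_prod[symmetric]) (use finite_kernels pos in fastforce)+
    also have "\<dots> = ln (\<Prod>i<l. \<Prod>N\<in>kernels i. real (\<kappa> y i N))"
      by (rule ln_prod[symmetric]) (use finite_kernels pos in fastforce)+
    also have "\<dots> = ln (real (\<Prod>i<l. \<Prod>N\<in>kernels i. \<kappa> y i N))" by simp
    also have "\<dots> \<le> ln (real (card \<Omega>))"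
    proof (subst ln_le_cancel_iff)
      show "0 < real (\<Prod>i<l. \<Prod>N\<in>kernels i. \<kappa> y i N)" using pos by (auto simp del: of_nat_prod intro!: prod_pos)
      show "0 < real (card \<Omega>)" using y fin by (auto simp: card_gt_0_iff)
      show "real (\<Prod>i<l. \<Prod>N\<in>kernels i. \<kappa> y i N) \<le> real (card \<Omega>)" using orbit_product[OF y] by (simp only: of_nat_le_iff)
    qed
    finally show "(\<Sum>i<l. \<Sum>N\<in>kernels i. ln (real (\<kappa> y i N))) \<le> ln (real (card \<Omega>))" .
  qed
  finally show ?thesis by simp
qed

end

subsection \<open>The weight of a tower\<close>

text \<open>The union of the blocks of the section at \<open>x\<close>, see
  \<open>sweep_Union\<close>.\<close>

definition sweep :: "('a \<Rightarrow> 'a) set \<Rightarrow> ('a \<Rightarrow> 'a set) \<Rightarrow> ('a \<Rightarrow> 'a set) \<Rightarrow> 'a \<Rightarrow> 'a set"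
  where "sweep K p q x = {z \<in> p x. \<exists>g\<in>K. z \<in> q (g x)}"

text \<open>Over a class of \<open>q\<close> the terms \<open>1 / card (q x)\<close> add up to 1,
  and likewise over a sweep for the other terms. So classes minus sweeps are counted, and every
  section of degree \<open>d\<close> contributes \<open>d - 1\<close>. As a sum over points it is
  bounded by \<open>card \<Omega>\<close> and telescopes under \<open>refinement\<close>.\<close>

definition weight :: "'a set \<Rightarrow> ('a \<Rightarrow> 'a) set \<Rightarrow> ('a \<Rightarrow> 'a set) \<Rightarrow> ('a \<Rightarrow> 'a set) \<Rightarrow> real"
  where "weight \<Omega> K p q = (\<Sum>x\<in>\<Omega>. 1 / card (q x) - 1 / card (sweep K p q x))"

locale layer =
  fixes \<Omega> :: "'a set" and K p q
  assumes K: "pgroup \<Omega> K" and p: "block_map \<Omega> p" "invariant \<Omega> K p" and q: "block_map \<Omega> q" "invariant \<Omega> K q"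
    and sub: "\<And>x. x \<in> \<Omega> \<Longrightarrow> q x \<subseteq> p x"
begin

lemma fin: "finite \<Omega>" by (rule pgroup_finite[OF K])

lemma in_\<Omega>: "g \<in> K \<Longrightarrow> g x \<in> \<Omega> \<longleftrightarrow> x \<in> \<Omega>" by (rule pgroup_in[OF K])

lemma fin_p: "x \<in> \<Omega> \<Longrightarrow> finite (p x)" using block_mapD(2)[OF p(1)] fin finite_subset by blast

lemma fin_q: "x \<in> \<Omega> \<Longrightarrow> finite (q x)" using block_mapD(2)[OF q(1)] fin finite_subset by blast

lemma sweep_sub: "sweep K p q x \<subseteq> p x" unfolding sweep_def by auto

lemma fin_sweep: "x \<in> \<Omega> \<Longrightarrow> finite (sweep K p q x)" using sweep_sub fin_p finite_subset by blast

lemma q_sweep: "x \<in> \<Omega> \<Longrightarrow> q x \<subseteq> sweep K p q x"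
  unfolding sweep_def using sub pgroup_id[OF K] by (auto intro!: bexI[of _ id])

lemma q_pos: "x \<in> \<Omega> \<Longrightarrow> 0 < card (q x)"
  using block_mapD(1)[OF q(1)] fin_q by (metis card_gt_0_iff empty_iff)

lemma card_q: "x \<in> \<Omega> \<Longrightarrow> g \<in> K \<Longrightarrow> card (q (g x)) = card (q x)"
  using invariantD[OF q(2)] pgroup_inj[OF K] by (metis card_image inj_onI)

lemma sweep_Union:
  assumes x: "x \<in> \<Omega>"
  shows "sweep K p q x = \<Union>(blocks K p q x)"
proof
  show "sweep K p q x \<subseteq> \<Union>(blocks K p q x)"
  proof
    fix z assume "z \<in> sweep K p q x"
    then obtain g where z: "z \<in> p x" "g \<in> K" "z \<in> q (g x)" unfolding sweep_def by auto
    have gx: "g x \<in> \<Omega>" using in_\<Omega>[OF z(2)] x by simp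
    have "p z = p x" "p z = p (g x)" using block_mapD(3)[OF p(1)] x gx z sub by blast+
    then have "g x \<in> p x" using block_mapD(1)[OF p(1) gx] by simp
    then have "q (g x) \<in> blocks K p q x" unfolding blocks_def setstab_def using z(2) by blast
    then show "z \<in> \<Union>(blocks K p q x)" using z(3) by blast
  qed
  show "\<Union>(blocks K p q x) \<subseteq> sweep K p q x"
  proof clarify
    fix z u assume "z \<in> u" "u \<in> blocks K p q x"
    then obtain g where g: "g \<in> K" "g x \<in> p x" "z \<in> q (g x)" unfolding blocks_def setstab_def by auto
    have gx: "g x \<in> \<Omega>" using in_\<Omega>[OF g(1)] x by simp
    have "z \<in> p (g x)" using g(3) sub[OF gx] by blast
    also have "p (g x) = p x" by (rule block_mapD(3)[OF p(1) x g(2)])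
    finally show "z \<in> sweep K p q x" unfolding sweep_def using g by blast
  qed
qed

lemma card_sweep:
  assumes x: "x \<in> \<Omega>"
  shows "card (sweep K p q x) = card (blocks K p q x) * card (q x)"
proof -
  have mem: "\<exists>y\<in>\<Omega>. u = q y \<and> card u = card (q x)" if "u \<in> blocks K p q x" for u
    using that card_q[OF x] in_\<Omega> x unfolding blocks_def setstab_def by auto
  have "card (q x) * card (blocks K p q x) = card (\<Union>(blocks K p q x))"
  proof (rule card_partition)
    show "finite (blocks K p q x)" by (rule finite_blocks[OF K p q])
    show "finite (\<Union>(blocks K p q x))" using fin_sweep[OF x] sweep_Union[OF x] by simp
    fix u assume "u \<in> blocks K p q x"
    then show "card u = card (q x)" using mem by blast
    fix v assume v: "v \<in> blocks K p q x" "u \<noteq> v"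
    obtain y z where yz: "y \<in> \<Omega>" "u = q y" "z \<in> \<Omega>" "v = q z" using mem \<open>u \<in> blocks K p q x\<close> v by meson
    show "u \<inter> v = {}"
    proof (rule ccontr)
      assume "u \<inter> v \<noteq> {}"
      then obtain w where "w \<in> q y" "w \<in> q z" using yz by auto
      then have "q y = q z" using block_mapD(3)[OF q(1)] yz by metis
      then show False using yz v by simp
    qed
  qed
  then show ?thesis using sweep_Union[OF x] by (simp add: mult.commute)
qed

lemma sweep_conj: "x \<in> \<Omega> \<Longrightarrow> g \<in> K \<Longrightarrow> card (sweep K p q (g x)) = card (sweep K p q x)"
proof -
  assume x: "x \<in> \<Omega>" and g: "g \<in> K"
  have "inj_on (\<lambda>u. g ` u) (blocks K p q x)" by (rule inj_onI) (metis image_inv_eq(1)[OF K g])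
  then have "card (blocks K p q (g x)) = card (blocks K p q x)"
    unfolding blocks_conj[OF K p q x g] by (rule card_image)
  then show ?thesis using card_sweep[OF x] card_sweep[of "g x"] in_\<Omega>[OF g, of x] card_q[OF x g] x by simp
qed

lemma term_nonneg: "x \<in> \<Omega> \<Longrightarrow> 1 / real (card (sweep K p q x)) \<le> 1 / card (q x)"
  using card_mono[OF fin_sweep q_sweep, of x] q_pos[of x] by (simp add: frac_le)

lemma weight_nonneg: "0 \<le> weight \<Omega> K p q"
  unfolding weight_def by (rule sum_nonneg) (use term_nonneg in force)

lemma weight_le: "weight \<Omega> K p q \<le> card \<Omega>"
proof -
  have "weight \<Omega> K p q \<le> (\<Sum>x\<in>\<Omega>. 1)" unfolding weight_def
  proof (rule sum_mono)
    fix x assume x: "x \<in> \<Omega>"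
    have "1 / real (card (q x)) \<le> 1" using q_pos[OF x] by simp
    moreover have "0 \<le> 1 / real (card (sweep K p q x))" by simp
    ultimately show "1 / real (card (q x)) - 1 / real (card (sweep K p q x)) \<le> 1" by linarith
  qed
  then show ?thesis by simp
qed

text \<open>The union of the classes of \<open>q\<close> that meet the orbit of \<open>x\<close>. It
  splits into sweeps of equal size, one for each class of \<open>p\<close> met by the orbit.\<close>

definition "reach x = {z \<in> \<Omega>. \<exists>g\<in>K. z \<in> q (g x)}"

lemma sweep_eq_reach:
  assumes x: "x \<in> \<Omega>" and g: "g \<in> K"
  shows "sweep K p q (g x) = reach x \<inter> p (g x)"
proof
  have gx: "g x \<in> \<Omega>" using in_\<Omega>[OF g] x by simp
  show "sweep K p q (g x) \<subseteq> reach x \<inter> p (g x)"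
  proof
    fix z assume "z \<in> sweep K p q (g x)"
    then obtain h where z: "z \<in> p (g x)" "h \<in> K" "z \<in> q (h (g x))" unfolding sweep_def by auto
    then have "h \<circ> g \<in> K" "z \<in> q ((h \<circ> g) x)" using pgroup_comp[OF K _ g] by auto
    then show "z \<in> reach x \<inter> p (g x)" unfolding reach_def using z(1) block_mapD(2)[OF p(1) gx] by blast
  qed
  show "reach x \<inter> p (g x) \<subseteq> sweep K p q (g x)"
  proof
    fix z assume z: "z \<in> reach x \<inter> p (g x)"
    then obtain h where h: "h \<in> K" "z \<in> q (h x)" unfolding reach_def by auto
    have "h \<circ> inv' g \<in> K" using pgroup_comp[OF K h(1) pgroup_inv[OF K g]] .
    moreover have "z \<in> q ((h \<circ> inv' g) (g x))" using h(2) pgroup_inv1[OF K g] by simp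
    ultimately show "z \<in> sweep K p q (g x)" unfolding sweep_def using z by blast
  qed
qed

lemma card_reach:
  assumes x: "x \<in> \<Omega>"
  shows "card (reach x) = card (p ` orb K x) * (card (blocks K p q x) * card (q x))"
proof -
  let ?C = "(\<lambda>B. reach x \<inter> B) ` (p ` orb K x)"
  have orbD: "\<exists>g\<in>K. y = g x" if "y \<in> orb K x" for y using that unfolding orb_def by auto
  have self: "g x \<in> reach x \<inter> p (g x)" if g: "g \<in> K" for g
    unfolding sweep_eq_reach[OF x g, symmetric]
    using q_sweep[of "g x"] block_mapD(1)[OF q(1), of "g x"] in_\<Omega>[OF g] x by blast
  have U: "\<Union>?C = reach x"
  proof
    show "reach x \<subseteq> \<Union>?C"
    proof
      fix z assume z: "z \<in> reach x"
      then obtain g where g: "g \<in> K" "z \<in> q (g x)" unfolding reach_def by auto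
      have "z \<in> p (g x)" using g sub[of "g x"] in_\<Omega>[OF g(1)] x by auto
      moreover have "g x \<in> orb K x" using g(1) unfolding orb_def by blast
      ultimately show "z \<in> \<Union>?C" using z by blast
    qed
  qed auto
  have meet: "p (g x) = p (h x)" if gh: "g \<in> K" "h \<in> K" and ne: "p (g x) \<inter> p (h x) \<noteq> {}" for g h
    using block_mapD(3)[OF p(1)] in_\<Omega> gh x ne by (metis disjoint_iff)
  have inj: "inj_on (\<lambda>B. reach x \<inter> B) (p ` orb K x)"
  proof (rule inj_onI)
    fix A B assume "A \<in> p ` orb K x" "B \<in> p ` orb K x" and eq: "reach x \<inter> A = reach x \<inter> B"
    then obtain g h where gh: "g \<in> K" "h \<in> K" "A = p (g x)" "B = p (h x)" unfolding orb_def by auto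
    have "g x \<in> A \<inter> B" using self[OF gh(1)] eq gh by blast
    then show "A = B" using meet[OF gh(1,2)] gh(3,4) by blast
  qed
  have "(card (blocks K p q x) * card (q x)) * card ?C = card (\<Union>?C)"
  proof (rule card_partition)
    show "finite ?C" using finite_orb[OF K] by simp
    show "finite (\<Union>?C)" unfolding U reach_def using fin by simp
    fix c assume "c \<in> ?C"
    then obtain g where g: "g \<in> K" "c = reach x \<inter> p (g x)" using orbD by auto
    show "card c = card (blocks K p q x) * card (q x)"
      unfolding g(2) sweep_eq_reach[OF x g(1), symmetric] sweep_conj[OF x g(1)] by (rule card_sweep[OF x])
    fix c' assume c': "c' \<in> ?C" "c \<noteq> c'"
    then obtain h where h: "h \<in> K" "c' = reach x \<inter> p (h x)" using orbD by auto
    show "c \<inter> c' = {}"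
    proof (rule ccontr)
      assume "c \<inter> c' \<noteq> {}"
      then have "p (g x) \<inter> p (h x) \<noteq> {}" using g h by blast
      from meet[OF g(1) h(1) this] show False using c'(2) g h by simp
    qed
  qed
  then show ?thesis using card_image[OF inj] U by (simp add: mult_ac)
qed

text \<open>Serves to compare the numbers of conjugates of sections at different levels: each step
  down multiplies this number by at least the degree of the section.\<close>

lemma card_classes:
  assumes x: "x \<in> \<Omega>"
  shows "card (p ` orb K x) * card (blocks K p q x) \<le> card (q ` orb K x)"
proof -
  have "reach x \<subseteq> (\<Union>u\<in>q ` orb K x. u)" unfolding reach_def orb_def by auto
  moreover have "finite (\<Union>u\<in>q ` orb K x. u)"
  proof (rule finite_UN_I)
    show "finite (q ` orb K x)" by (rule finite_imageI[OF finite_orb[OF K]])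
    show "finite u" if "u \<in> q ` orb K x" for u
      using that fin_q in_\<Omega> x unfolding orb_def by auto
  qed
  ultimately have "card (reach x) \<le> card (\<Union>u\<in>q ` orb K x. u)" by (rule card_mono[rotated])
  also have "\<dots> \<le> (\<Sum>u\<in>q ` orb K x. card u)" by (rule card_UN_le) (simp add: finite_orb[OF K])
  also have "\<dots> = (\<Sum>u\<in>q ` orb K x. card (q x))"
    by (rule sum.cong) (use card_q[OF x] in \<open>auto simp: orb_def\<close>)
  finally have "card (p ` orb K x) * card (blocks K p q x) * card (q x) \<le> card (q ` orb K x) * card (q x)"
    unfolding card_reach[OF x] by (simp only: sum_constant mult_ac of_nat_id)
  then show ?thesis using q_pos[OF x] by simp
qed

lemma blocks_pos: "x \<in> \<Omega> \<Longrightarrow> 1 \<le> card (blocks K p q x)"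
  using blocks_self[OF K p q] finite_blocks[OF K p q] by (metis One_nat_def Suc_leI card_gt_0_iff empty_iff)

lemma classes_pos: "x \<in> \<Omega> \<Longrightarrow> 1 \<le> card (p ` orb K x)"
  using orb_self[OF K] finite_orb[OF K] by (metis One_nat_def Suc_leI card_gt_0_iff empty_iff finite_imageI image_is_empty)

end

lemma invariant_mono: "invariant \<Omega> K p \<Longrightarrow> K' \<subseteq> K \<Longrightarrow> invariant \<Omega> K' p"
  by (simp add: invariant_def subset_iff)

lemma layer_subgroup:
  assumes "layer \<Omega> K p q" "K' \<subseteq> K" "pgroup \<Omega> K'"
  shows "layer \<Omega> K' p q"
proof -
  interpret layer \<Omega> K p q by (rule assms)
  show ?thesis
    by unfold_locales (rule assms(3) p(1) q(1) sub invariant_mono[OF p(2) assms(2)] invariant_mono[OF q(2) assms(2)], assumption?)+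
qed

lemma sweep_mono: "K' \<subseteq> K \<Longrightarrow> sweep K' p q x \<subseteq> sweep K p q x"
  unfolding sweep_def by auto

lemma weight_diff:
  assumes l: "layer \<Omega> K p q" and K': "K' \<subseteq> K" "pgroup \<Omega> K'"
  shows "weight \<Omega> K p q - weight \<Omega> K' p q = (\<Sum>x\<in>\<Omega>. 1 / card (sweep K' p q x) - 1 / card (sweep K p q x))"
    and "x \<in> \<Omega> \<Longrightarrow> 0 \<le> 1 / real (card (sweep K' p q x)) - 1 / card (sweep K p q x)"
proof -
  interpret A: layer \<Omega> K p q by (rule l)
  interpret B: layer \<Omega> K' p q by (rule layer_subgroup[OF l K'])
  show "weight \<Omega> K p q - weight \<Omega> K' p q = (\<Sum>x\<in>\<Omega>. 1 / card (sweep K' p q x) - 1 / card (sweep K p q x))"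
    unfolding weight_def by (simp add: sum_subtractf[symmetric])
  assume x: "x \<in> \<Omega>"
  have "0 < card (sweep K' p q x)" using B.card_sweep[OF x] B.blocks_pos[OF x] B.q_pos[OF x] by simp
  moreover have "card (sweep K' p q x) \<le> card (sweep K p q x)"
    by (rule card_mono[OF A.fin_sweep[OF x] sweep_mono[OF K'(1)]])
  ultimately show "0 \<le> 1 / real (card (sweep K' p q x)) - 1 / card (sweep K p q x)"
    by (simp add: frac_le)
qed

lemma weight_mono:
  assumes "layer \<Omega> K p q" "K' \<subseteq> K" "pgroup \<Omega> K'"
  shows "weight \<Omega> K' p q \<le> weight \<Omega> K p q"
proof -
  have "0 \<le> weight \<Omega> K p q - weight \<Omega> K' p q"
    unfolding weight_diff(1)[OF assms] by (rule sum_nonneg) (rule weight_diff(2)[OF assms])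
  then show ?thesis by simp
qed

text \<open>For \<open>K'\<close> the sweeps of points in \<open>reach x\<close> shrink to single
  classes of \<open>q\<close>. On each of the former sweeps the loss adds up to the degree minus 1,
  and elsewhere the weight does not increase because sweeps can only shrink.\<close>

lemma weight_drop:
  assumes l: "layer \<Omega> K p q" and K': "K' \<subseteq> K" "pgroup \<Omega> K'" and x: "x \<in> \<Omega>"
    and fx: "\<And>y g. y \<in> orb K x \<Longrightarrow> g \<in> K' \<Longrightarrow> g y \<in> p y \<Longrightarrow> q (g y) = q y"
  shows "(real (card (blocks K p q x)) - 1) * card (p ` orb K x) \<le> weight \<Omega> K p q - weight \<Omega> K' p q"
proof -
  interpret A: layer \<Omega> K p q by (rule l)
  interpret B: layer \<Omega> K' p q by (rule layer_subgroup[OF l K'])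
  let ?d = "real (card (blocks K p q x))" and ?e = "real (card (q x))"
  have pos: "1 \<le> ?d" "0 < ?e" using A.blocks_pos[OF x] A.q_pos[OF x] by simp_all
  have t: "1 / ?e - 1 / (?d * ?e) \<le> 1 / card (sweep K' p q z) - 1 / card (sweep K p q z)" if z: "z \<in> A.reach x" for z
  proof -
    obtain g where g: "g \<in> K" "z \<in> q (g x)" "z \<in> \<Omega>" using z unfolding A.reach_def by auto
    have gx: "g x \<in> \<Omega>" "g x \<in> orb K x" using A.in_\<Omega>[OF g(1)] x g(1) unfolding orb_def by auto
    have qz: "q z = q (g x)" by (rule block_mapD(3)[OF A.q(1) gx(1) g(2)])
    have pz: "p z = p (g x)" by (rule block_mapD(3)[OF A.p(1) gx(1)]) (use A.sub[OF gx(1)] g(2) in blast)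
    have "sweep K p q z = sweep K p q (g x)"
    proof -
      have "q (h z) = q (h (g x))" if "h \<in> K" for h
        using invariantD[OF A.q(2) that g(3)] invariantD[OF A.q(2) that gx(1)] qz by simp
      then show ?thesis unfolding sweep_def pz by blast
    qed
    then have 1: "real (card (sweep K p q z)) = ?d * ?e"
      using A.sweep_conj[OF x g(1)] A.card_sweep[OF x] by simp
    have "sweep K' p q z \<subseteq> q z"
    proof
      fix w assume "w \<in> sweep K' p q z"
      then obtain h where h: "w \<in> p z" "h \<in> K'" "w \<in> q (h z)" unfolding sweep_def by auto
      have hK: "h \<in> K" using h(2) K'(1) by blast
      have qh: "q (h z) = q (h (g x))"
        using invariantD[OF A.q(2) hK g(3)] invariantD[OF A.q(2) hK gx(1)] qz by simp
      have hg: "h (g x) \<in> \<Omega>" using A.in_\<Omega>[OF hK] gx by simp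
      have "w \<in> p (h (g x))" using h(3) qh A.sub[OF hg] by blast
      then have "p (h (g x)) = p (g x)" using block_mapD(3)[OF A.p(1)] hg gx(1) h(1) pz by metis
      then have "h (g x) \<in> p (g x)" using block_mapD(1)[OF A.p(1) hg] by simp
      from fx[OF gx(2) h(2) this] show "w \<in> q z" using h(3) qh qz by simp
    qed
    then have "sweep K' p q z = q z" using B.q_sweep[OF g(3)] by blast
    then have 2: "real (card (sweep K' p q z)) = ?e" using qz A.card_q[OF x g(1)] by simp
    show ?thesis unfolding 1 2 ..
  qed
  have "(?d - 1) * card (p ` orb K x) = real (card (A.reach x)) * (1 / ?e - 1 / (?d * ?e))"
    unfolding A.card_reach[OF x] using pos by (simp add: field_simps)
  also have "\<dots> = (\<Sum>z\<in>A.reach x. 1 / ?e - 1 / (?d * ?e))" by simp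
  also have "\<dots> \<le> (\<Sum>z\<in>A.reach x. 1 / card (sweep K' p q z) - 1 / card (sweep K p q z))"
    by (rule sum_mono) (rule t)
  also have "\<dots> \<le> (\<Sum>z\<in>\<Omega>. 1 / card (sweep K' p q z) - 1 / card (sweep K p q z))"
    by (rule sum_mono2) (use A.fin weight_diff(2)[OF l K'] in \<open>auto simp: A.reach_def\<close>)
  finally show ?thesis unfolding weight_diff(1)[OF l K'] .
qed

text \<open>Label the points of the orbit of \<open>x\<close> by transporting every translate of the set of blocks
  back to the one of \<open>x\<close>. Elements preserving the labels fix every block that they keep in its class.\<close>

lemma payment:
  assumes l: "layer \<Omega> K p q" and x: "x \<in> \<Omega>"
  defines "X \<equiv> act (blocks K p q x) ` setstab K p x"
  obtains K' where "pgroup \<Omega> K'" "K' \<subseteq> K" "card K \<le> card X ^ card (p ` orb K x) * card K'"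
    "\<And>y g. y \<in> orb K x \<Longrightarrow> g \<in> K' \<Longrightarrow> g y \<in> p y \<Longrightarrow> q (g y) = q y"
proof -
  interpret A: layer \<Omega> K p q by (rule l)
  note K = A.K
  let ?A = "orb K x" and ?P = "p ` orb K x"
  have AO: "y \<in> \<Omega>" if "y \<in> ?A" for y using that x A.in_\<Omega> unfolding orb_def by auto
  have Amove: "g y \<in> ?A" if y: "y \<in> ?A" and g: "g \<in> K" for y g
  proof -
    obtain h where "h \<in> K" "y = h x" using y unfolding orb_def by blast
    then have "g y = (g \<circ> h) x" "g \<circ> h \<in> K" using pgroup_comp[OF K g] by auto
    then show ?thesis unfolding orb_def by blast
  qed
  have "\<forall>B. \<exists>t. B \<in> ?P \<longrightarrow> t \<in> K \<and> p (t x) = B" unfolding orb_def by auto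
  from choice[OF this] obtain t where t: "\<And>B. B \<in> ?P \<Longrightarrow> t B \<in> K" "\<And>B. B \<in> ?P \<Longrightarrow> p (t B x) = B" by blast
  define v where "v y = inv' (t (p y)) y" for y
  define \<beta> where "\<beta> y = q (v y)" for y
  have tK: "t (p y) \<in> K" if "y \<in> ?A" for y using t(1) that by blast
  have v: "v y \<in> p x" "v y \<in> ?A" if y: "y \<in> ?A" for y
  proof -
    have "t (p y) (v y) = y" unfolding v_def using pgroup_inv2[OF K tK[OF y]] by simp
    moreover have "y \<in> p (t (p y) x)" using t(2)[of "p y"] y block_mapD(1)[OF A.p(1) AO[OF y]] by auto
    ultimately show "v y \<in> p x" using invariant_mem_iff[OF K A.p(2) tK[OF y] x, of "v y"] by simp
    show "v y \<in> ?A" unfolding v_def by (rule Amove[OF y pgroup_inv[OF K tK[OF y]]])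
  qed
  define K' where "K' = {g \<in> K. \<forall>y\<in>?A. \<beta> (g y) = \<beta> y}"
  have K': "pgroup \<Omega> K'" unfolding K'_def
    by (rule pgroup_filter[OF K]) (use Amove in auto)
  have K'K: "K' \<subseteq> K" unfolding K'_def by auto
  have fixq: "q (g y) = q y" if y: "y \<in> ?A" and g: "g \<in> K'" "g y \<in> p y" for y g
  proof -
    have gK: "g \<in> K" using g K'K by auto
    have gy: "g y \<in> ?A" by (rule Amove[OF y gK])
    have pe: "p (g y) = p y" by (rule block_mapD(3)[OF A.p(1) AO[OF y] g(2)])
    have e: "q (v (g y)) = q (v y)" using g(1) y unfolding K'_def \<beta>_def by auto
    have bk: "t (p z) ` q (v z) = q z" if z: "z \<in> ?A" for z
      using invariantD[OF A.q(2) tK[OF z] AO[OF v(2)[OF z]]] pgroup_inv2[OF K tK[OF z]] unfolding v_def by simp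
    show ?thesis using bk[OF gy] bk[OF y] e pe by simp
  qed
  let ?F = "\<lambda>g. \<lambda>y\<in>?A. \<beta> (inv' g y)"
  have "card K = card (?F ` K) * card K'"
  proof (rule card_group_image[OF K K'K])
    fix g h assume gh: "g \<in> K" "h \<in> K"
    have "?F g = ?F h \<longleftrightarrow> (\<forall>y\<in>?A. \<beta> (inv' g y) = \<beta> (inv' h y))"
      by (auto simp: restrict_def fun_eq_iff)
    also have "\<dots> \<longleftrightarrow> (\<forall>z\<in>?A. \<beta> z = \<beta> (inv' h (g z)))"
    proof
      assume *: "\<forall>y\<in>?A. \<beta> (inv' g y) = \<beta> (inv' h y)"
      show "\<forall>z\<in>?A. \<beta> z = \<beta> (inv' h (g z))"
        using *[rule_format, OF Amove[OF _ gh(1)]] pgroup_inv1[OF K gh(1)] by simp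
    next
      assume *: "\<forall>z\<in>?A. \<beta> z = \<beta> (inv' h (g z))"
      show "\<forall>y\<in>?A. \<beta> (inv' g y) = \<beta> (inv' h y)"
        using *[rule_format, OF Amove[OF _ pgroup_inv[OF K gh(1)]]] pgroup_inv2[OF K gh(1)] by simp
    qed
    also have "\<dots> \<longleftrightarrow> inv' h \<circ> g \<in> K'"
      unfolding K'_def using pgroup_comp[OF K pgroup_inv[OF K gh(2)] gh(1)] by auto
    finally show "?F g = ?F h \<longleftrightarrow> inv' h \<circ> g \<in> K'" .
  qed
  \<comment> \<open>On a class \<open>B\<close> the labels seen through \<open>inv' g\<close> arise
    from the original ones by a single element \<open>e B\<close> of the stabiliser. So one element
    of \<open>X\<close> for each class determines the labelling, as in a wreath product.\<close>
  moreover have "card (?F ` K) \<le> card X ^ card ?P"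
  proof -
    let ?\<Psi> = "\<lambda>\<xi>. \<lambda>y\<in>?A. \<xi> (p y) (q (v y))"
    let ?Pi = "PiE ?P (\<lambda>_. X)"
    have finP: "finite ?P" using finite_orb[OF K] by simp
    have finX: "finite X" unfolding X_def using finite_subset[OF setstab_sub pgroup_finite_group[OF K]] by auto
    have finPi: "finite ?Pi" by (intro finite_PiE finP finX)
    have "?F ` K \<subseteq> ?\<Psi> ` ?Pi"
    proof clarify
      fix g assume g: "g \<in> K"
      have gi: "inv' g \<in> K" by (rule pgroup_inv[OF K g])
      define B' where "B' B = p (inv' g (t B x))" for B
      define e where "e B = inv' (t (B' B)) \<circ> inv' g \<circ> t B" for B
      have tBx: "t B x \<in> ?A" if "B \<in> ?P" for B using t(1)[OF that] unfolding orb_def by blast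
      have B'P: "B' B \<in> ?P" if "B \<in> ?P" for B unfolding B'_def using Amove[OF tBx[OF that] gi] by blast
      have eE: "e B \<in> setstab K p x" if B: "B \<in> ?P" for B
      proof -
        have tK': "t (B' B) \<in> K" by (rule t(1)[OF B'P[OF B]])
        have eK: "e B \<in> K" unfolding e_def using pgroup_comp[OF K] pgroup_inv[OF K] gi t(1) B tK' by auto
        have "inv' g (t B x) \<in> \<Omega>" by (rule AO[OF Amove[OF tBx[OF B] gi]])
        then have "inv' g (t B x) \<in> B' B" unfolding B'_def by (rule block_mapD(1)[OF A.p(1)])
        then have "inv' g (t B x) \<in> p (t (B' B) x)" using t(2)[OF B'P[OF B]] by simp
        moreover have "t (B' B) (e B x) = inv' g (t B x)" unfolding e_def using pgroup_inv2[OF K tK'] by simp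
        ultimately have "e B x \<in> p x" using invariant_mem_iff[OF K A.p(2) tK' x, of "e B x"] by simp
        then show ?thesis using eK unfolding setstab_def by simp
      qed
      define \<xi> where "\<xi> = (\<lambda>B\<in>?P. act (blocks K p q x) (e B))"
      have "\<xi> \<in> ?Pi" unfolding \<xi>_def X_def using eE by auto
      moreover have "?F g = ?\<Psi> \<xi>"
      proof (rule restrict_ext)
        fix y assume y: "y \<in> ?A"
        let ?B = "p y"
        have B: "?B \<in> ?P" using y by blast
        have "q (v y) \<in> blocks K p q x"
        proof -
          obtain h where "h \<in> K" "v y = h x" using v(2)[OF y] unfolding orb_def by auto
          then show ?thesis using v(1)[OF y] unfolding blocks_def setstab_def by auto
        qed
        then have "\<xi> ?B (q (v y)) = e ?B ` q (v y)" unfolding \<xi>_def using B by (simp add: act_def)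
        also have "\<dots> = q (e ?B (v y))"
          by (rule invariantD[OF A.q(2) setstab_K[OF eE[OF B]] AO[OF v(2)[OF y]]])
        also have "e ?B (v y) = v (inv' g y)"
        proof -
          have "p (inv' g y) = inv' g ` p y" by (rule invariantD[OF A.p(2) gi AO[OF y], symmetric])
          also have "p y = p (t ?B x)" using t(2)[OF B] by simp
          also have "inv' g ` p (t ?B x) = B' ?B" unfolding B'_def by (rule invariantD[OF A.p(2) gi AO[OF tBx[OF B]]])
          finally have "p (inv' g y) = B' ?B" .
          then show ?thesis unfolding e_def v_def using pgroup_inv2[OF K tK[OF y]] by simp
        qed
        finally show "\<beta> (inv' g y) = \<xi> ?B (q (v y))" unfolding \<beta>_def by simp
      qed
      ultimately show "?F g \<in> ?\<Psi> ` ?Pi" by blast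
    qed
    then have "card (?F ` K) \<le> card (?\<Psi> ` ?Pi)" by (rule card_mono[rotated]) (use finPi in simp)
    also have "\<dots> \<le> card ?Pi" by (rule card_image_le[OF finPi])
    also have "\<dots> = card X ^ card ?P" using card_PiE[OF finP, of "\<lambda>_. X"] by simp
    finally show ?thesis .
  qed
  ultimately have "card K \<le> card X ^ card ?P * card K'" by simp
  then show ?thesis using that[OF K' K'K] fixq by blast
qed

text \<open>The new classes are the translates of the union of a block of imprimitivity. The group is transitive on
  the old classes inside a new one, so both sweeps are determined and the weights telescope.\<close>

lemma refinement:
  assumes l: "layer \<Omega> K p q" and x: "x \<in> \<Omega>"
    and \<B>: "\<B> \<subseteq> blocks K p q x" "2 \<le> card \<B>" "\<B> \<noteq> blocks K p q x"
    and bl: "\<And>f. f \<in> act (blocks K p q x) ` setstab K p x \<Longrightarrow> f ` \<B> = \<B> \<or> f ` \<B> \<inter> \<B> = {}"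
  obtains p' where "block_map \<Omega> p'" "invariant \<Omega> K p'" "\<forall>y\<in>\<Omega>. q y \<subseteq> p' y" "\<forall>y\<in>\<Omega>. p' y \<subseteq> p y"
    "\<exists>y\<in>\<Omega>. p' y \<noteq> q y" "\<exists>y\<in>\<Omega>. p' y \<noteq> p y" "weight \<Omega> K p p' + weight \<Omega> K p' q = weight \<Omega> K p q"
proof -
  interpret A: layer \<Omega> K p q by (rule l)
  note K = A.K
  let ?D = "blocks K p q x"
  define U where "U = \<Union>\<B>"
  have blk: "\<exists>y\<in>\<Omega>. y \<in> p x \<and> u = q y" if "u \<in> ?D" for u
    using that A.in_\<Omega> x unfolding blocks_def setstab_def by auto
  have qU: "q y \<in> \<B>" "y \<in> p x" "y \<in> \<Omega>" if y: "y \<in> U" for y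
  proof -
    obtain u where u: "u \<in> \<B>" "y \<in> u" using y unfolding U_def by auto
    then obtain z where z: "z \<in> \<Omega>" "z \<in> p x" "u = q z" using blk \<B>(1) by blast
    have "q y = q z" by (rule block_mapD(3)[OF A.q(1) z(1)]) (use u(2) z(3) in simp)
    then show "q y \<in> \<B>" using u(1) z(3) by simp
    have "y \<in> p z" using A.sub[OF z(1)] u(2) z(3) by blast
    then show "y \<in> p x" using block_mapD(3)[OF A.p(1) x z(2)] by simp
    then show "y \<in> \<Omega>" using block_mapD(2)[OF A.p(1) x] by blast
  qed
  have qUsub: "q y \<subseteq> U" if "y \<in> U" for y using qU(1)[OF that] unfolding U_def by blast
  have Ublock: "g ` U = U" if g: "g \<in> K" and ne: "g ` U \<inter> U \<noteq> {}" for g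
  proof -
    obtain y where y: "y \<in> U" "g y \<in> U" using ne by auto
    have "p (g x) = g ` p x" by (rule invariantD[OF A.p(2) g x, symmetric])
    also have "p x = p y" using block_mapD(3)[OF A.p(1) x qU(2)[OF y(1)]] by simp
    also have "g ` p y = p (g y)" by (rule invariantD[OF A.p(2) g qU(3)[OF y(1)]])
    also have "\<dots> = p x" by (rule block_mapD(3)[OF A.p(1) x qU(2)[OF y(2)]])
    finally have gE: "g \<in> setstab K p x" using setstab_iff(1)[OF K A.p x g] by simp
    let ?f = "act ?D g"
    have f: "?f u = g ` u" if "u \<in> \<B>" for u using that \<B>(1) by (auto simp: act_def)
    have "?f (q y) = q (g y)" using f[OF qU(1)[OF y(1)]] invariantD[OF A.q(2) g qU(3)[OF y(1)]] by simp
    then have "?f ` \<B> \<inter> \<B> \<noteq> {}" using qU(1)[OF y(1)] qU(1)[OF y(2)] by blast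
    then have "?f ` \<B> = \<B>" using bl[of ?f] gE by blast
    then have "(\<lambda>u. g ` u) ` \<B> = \<B>" using f by simp
    then show "g ` U = U" unfolding U_def by (metis image_Union)
  qed
  have translates: "g ` U = h ` U" if gh: "g \<in> K" "h \<in> K" and y: "y \<in> g ` U" "y \<in> h ` U" for g h y
  proof -
    have k: "inv' h \<circ> g \<in> K" by (rule pgroup_comp[OF K pgroup_inv[OF K gh(2)] gh(1)])
    have "inv' h y \<in> inv' h ` (g ` U)" "inv' h y \<in> inv' h ` (h ` U)" using y by blast+
    then have "(inv' h \<circ> g) ` U \<inter> U \<noteq> {}" by (simp only: o_image image_inv_eq(1)[OF K gh(2)]) blast
    from Ublock[OF k this] have "h ` (inv' h ` (g ` U)) = h ` U" by (simp only: o_image)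
    then show ?thesis by (simp only: image_inv_eq(2)[OF K gh(2)])
  qed
  \<comment> \<open>Translates of \<open>U\<close> are equal or disjoint, so the union is over a
    single set; it names the translate containing \<open>y\<close> without a choice. Points outside
    all translates keep their class of \<open>q\<close>.\<close>
  define p' where "p' y = (if \<exists>g\<in>K. y \<in> g ` U then \<Union>{g ` U |g. g \<in> K \<and> y \<in> g ` U} else q y)" for y
  have p'U: "p' y = g ` U" if g: "g \<in> K" "y \<in> g ` U" for g y
  proof -
    have "{h ` U |h. h \<in> K \<and> y \<in> h ` U} = {g ` U}" using translates[OF _ g(1) _ g(2)] g by blast
    then show ?thesis unfolding p'_def using g by auto
  qed
  have p'q: "p' y = q y" if "\<And>g. g \<in> K \<Longrightarrow> y \<notin> g ` U" for y unfolding p'_def using that by auto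
  have gU: "y \<in> \<Omega>" "q y \<subseteq> g ` U" "g ` U \<subseteq> p y" if g: "g \<in> K" "y \<in> g ` U" for g y
  proof -
    obtain z where z: "z \<in> U" "y = g z" using g by auto
    show "y \<in> \<Omega>" using A.in_\<Omega>[OF g(1)] qU(3)[OF z(1)] z(2) by simp
    have "q y = g ` q z" using invariantD[OF A.q(2) g(1) qU(3)[OF z(1)]] z(2) by simp
    then show "q y \<subseteq> g ` U" using qUsub[OF z(1)] by blast
    have "U \<subseteq> p z" using qU(2) block_mapD(3)[OF A.p(1) x qU(2)[OF z(1)]] by blast
    then have "g ` U \<subseteq> g ` p z" by blast
    then show "g ` U \<subseteq> p y" using invariantD[OF A.p(2) g(1) qU(3)[OF z(1)]] z(2) by simp
  qed
  have qsub: "q y \<subseteq> p' y" if y: "y \<in> \<Omega>" for y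
    by (cases "\<exists>g\<in>K. y \<in> g ` U") (use p'U p'q gU(2) in fastforce)+
  have psub: "p' y \<subseteq> p y" if y: "y \<in> \<Omega>" for y
  proof (cases "\<exists>g\<in>K. y \<in> g ` U")
    case True then show ?thesis using p'U gU(3) by metis
  next
    case False then show ?thesis using p'q[of y] A.sub[OF y] by auto
  qed
  have bm: "block_map \<Omega> p'" unfolding block_map_def
  proof (intro ballI conjI)
    fix y assume y: "y \<in> \<Omega>"
    show "y \<in> p' y" using qsub[OF y] block_mapD(1)[OF A.q(1) y] by blast
    show "p' y \<subseteq> \<Omega>" using psub[OF y] block_mapD(2)[OF A.p(1) y] by blast
    fix z assume z: "z \<in> p' y"
    show "p' z = p' y"
    proof (cases "\<exists>g\<in>K. y \<in> g ` U")
      case True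
      then obtain g where g: "g \<in> K" "y \<in> g ` U" by blast
      then have "z \<in> g ` U" using p'U z by simp
      then show ?thesis using p'U g by simp
    next
      case False
      then have e: "p' y = q y" using p'q by blast
      have qz: "q z = q y" by (rule block_mapD(3)[OF A.q(1) y]) (use z e in simp)
      have "z \<notin> g ` U" if g: "g \<in> K" for g
      proof
        assume "z \<in> g ` U"
        then have "q y \<subseteq> g ` U" using gU(2)[OF g, of z] by (simp only: qz)
        then show False using False g block_mapD(1)[OF A.q(1) y] by blast
      qed
      then show ?thesis using p'q[of z] e qz by simp
    qed
  qed
  have inv: "invariant \<Omega> K p'" unfolding invariant_def
  proof (intro ballI)
    fix h y assume h: "h \<in> K" and y: "y \<in> \<Omega>"
    have mv: "h y \<in> h ` (g ` U)" if "y \<in> g ` U" for g using that by blast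
    show "h ` p' y = p' (h y)"
    proof (cases "\<exists>g\<in>K. y \<in> g ` U")
      case True
      then obtain g where g: "g \<in> K" "y \<in> g ` U" by blast
      have "p' (h y) = (h \<circ> g) ` U" by (rule p'U[OF pgroup_comp[OF K h g(1)]]) (use mv[OF g(2)] in \<open>simp only: o_image\<close>)
      then show ?thesis using p'U[OF g] by (simp only: o_image)
    next
      case False
      have "h y \<notin> g ` U" if g: "g \<in> K" for g
      proof
        assume "h y \<in> g ` U"
        then have "inv' h (h y) \<in> inv' h ` (g ` U)" by blast
        then have "y \<in> (inv' h \<circ> g) ` U" by (simp only: o_image pgroup_inv1[OF K h])
        then show False using False pgroup_comp[OF K pgroup_inv[OF K h] g] by blast
      qed
      then have "p' (h y) = q (h y)" "p' y = q y" using p'q False by blast+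
      then show ?thesis using invariantD[OF A.q(2) h y] by simp
    qed
  qed
  have lower: "sweep K p' q y = p' y" if y: "y \<in> \<Omega>" for y
  proof
    show "p' y \<subseteq> sweep K p' q y"
    proof
      fix z assume z: "z \<in> p' y"
      show "z \<in> sweep K p' q y"
      proof (cases "\<exists>g\<in>K. y \<in> g ` U")
        case True
        then obtain g where g: "g \<in> K" "y \<in> g ` U" by blast
        then have "z \<in> g ` U" using p'U z by simp
        then obtain y' z' where yz: "y' \<in> U" "y = g y'" "z' \<in> U" "z = g z'" using g(2) by auto
        obtain e where e: "e \<in> setstab K p x" "e ` q y' = q z'"
          using blocks_transitive[OF K A.p A.q x] qU(1)[OF yz(1)] qU(1)[OF yz(3)] \<B>(1) by blast
        have eK: "e \<in> K" by (rule setstab_K[OF e(1)])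
        let ?h = "g \<circ> e \<circ> inv' g"
        have hK: "?h \<in> K" by (rule pgroup_conj[OF K g(1) eK])
        have "?h y = g (e y')" using yz(2) pgroup_inv1[OF K g(1)] by simp
        then have "q (?h y) = g ` q (e y')"
          using invariantD[OF A.q(2) g(1), of "e y'"] A.in_\<Omega>[OF eK] qU(3)[OF yz(1)] by simp
        also have "q (e y') = q z'" using invariantD[OF A.q(2) eK qU(3)[OF yz(1)]] e(2) by simp
        finally have "z \<in> q (?h y)" using block_mapD(1)[OF A.q(1) qU(3)[OF yz(3)]] yz(4) by simp
        then show ?thesis unfolding sweep_def using z hK by blast
      next
        case False
        then have "p' y = q y" using p'q by blast
        then show ?thesis unfolding sweep_def using z by (auto intro!: bexI[OF _ pgroup_id[OF K]])
      qed
    qed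
  qed (auto simp: sweep_def)
  have upper: "sweep K p p' y = sweep K p q y" if y: "y \<in> \<Omega>" for y
  proof
    show "sweep K p q y \<subseteq> sweep K p p' y" unfolding sweep_def using qsub A.in_\<Omega> y by blast
    show "sweep K p p' y \<subseteq> sweep K p q y"
    proof
      fix z assume "z \<in> sweep K p p' y"
      then obtain g where z: "z \<in> p y" "g \<in> K" "z \<in> p' (g y)" unfolding sweep_def by auto
      have gy: "g y \<in> \<Omega>" using A.in_\<Omega>[OF z(2)] y by simp
      have "z \<in> sweep K p' q (g y)" using lower[OF gy] z(3) by simp
      then obtain h where h: "h \<in> K" "z \<in> q (h (g y))" unfolding sweep_def by auto
      then have "h \<circ> g \<in> K" "z \<in> q ((h \<circ> g) y)" using pgroup_comp[OF K _ z(2)] by auto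
      then show "z \<in> sweep K p q y" unfolding sweep_def using z(1) by blast
    qed
  qed
  have w: "weight \<Omega> K p p' + weight \<Omega> K p' q = weight \<Omega> K p q"
    unfolding weight_def sum.distrib[symmetric] by (rule sum.cong) (simp_all add: lower upper)
  have "\<B> \<noteq> {}" using \<B>(2) by auto
  then obtain u where u: "u \<in> \<B>" by blast
  then obtain y where y: "y \<in> \<Omega>" "u = q y" using blk \<B>(1) by blast
  have yU: "y \<in> U" using u y block_mapD(1)[OF A.q(1) y(1)] unfolding U_def by blast
  have p'y: "p' y = U" using p'U[OF pgroup_id[OF K], of y] yU by simp
  have disj: "u1 = u2" if "u1 \<in> ?D" "u2 \<in> ?D" "w \<in> u1" "w \<in> u2" for u1 u2 w
    using blk[OF that(1)] blk[OF that(2)] that(3,4) block_mapD(3)[OF A.q(1)] by metis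
  have nonempty: "\<exists>w. w \<in> u1" if "u1 \<in> ?D" for u1 using blk[OF that] block_mapD(1)[OF A.q(1)] by blast
  have s1: "\<exists>y\<in>\<Omega>. p' y \<noteq> q y"
  proof (rule bexI[OF _ y(1)])
    have "finite \<B>" using \<B>(2) card.infinite by fastforce
    then obtain v where v: "v \<in> \<B>" "v \<noteq> u" using ex_not_in_list[of \<B> "[u]"] \<B>(2) by auto
    obtain w where w: "w \<in> v" using nonempty v(1) \<B>(1) by blast
    then have "w \<in> U" unfolding U_def using v by blast
    moreover have "w \<notin> u" using disj[of u v w] u v w \<B>(1) by blast
    ultimately show "p' y \<noteq> q y" using p'y y(2) by blast
  qed
  have s2: "\<exists>y\<in>\<Omega>. p' y \<noteq> p y"
  proof (rule bexI[OF _ y(1)])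
    obtain v where v: "v \<in> ?D" "v \<notin> \<B>" using \<B>(1,3) by blast
    obtain w where w: "w \<in> v" using nonempty v(1) by blast
    have "w \<notin> U"
    proof
      assume "w \<in> U"
      then obtain v' where "v' \<in> \<B>" "w \<in> v'" unfolding U_def by blast
      then show False using disj[of v v' w] v w \<B>(1) by blast
    qed
    moreover have "w \<in> p y"
    proof -
      obtain z where z: "z \<in> \<Omega>" "z \<in> p x" "v = q z" using blk[OF v(1)] by blast
      have "w \<in> p z" using A.sub[OF z(1)] w z(3) by blast
      moreover have "p z = p x" by (rule block_mapD(3)[OF A.p(1) x z(2)])
      moreover have "p y = p x" by (rule block_mapD(3)[OF A.p(1) x qU(2)[OF yU]])
      ultimately show ?thesis by simp
    qed
    ultimately show "p' y \<noteq> p y" using p'y by blast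
  qed
  show ?thesis by (rule that[OF bm inv _ _ s1 s2 w]) (use qsub psub in blast)+
qed

section \<open>Total weight and length of towers\<close>

context tower
begin

lemma layer: "layer \<Omega> K (r i) (r (Suc i))"
  by unfold_locales (rule K r_classes r_inv r_sub, assumption?)+

end

lemma tower_subgroup:
  assumes "tower \<Omega> K r l" "K' \<subseteq> K" "pgroup \<Omega> K'"
  shows "tower \<Omega> K' r l"
proof -
  interpret tower \<Omega> K r l by (rule assms)
  show ?thesis
    by unfold_locales (rule assms(3) r_classes r_sub r0 rl invariant_mono[OF r_inv assms(2)], assumption?)+
qed

definition strict_tower :: "'a set \<Rightarrow> (nat \<Rightarrow> 'a \<Rightarrow> 'a set) \<Rightarrow> nat \<Rightarrow> bool"
  where "strict_tower \<Omega> r l \<longleftrightarrow> (\<forall>i<l. \<exists>x\<in>\<Omega>. r (Suc i) x \<noteq> r i x)"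

definition total_weight :: "'a set \<Rightarrow> ('a \<Rightarrow> 'a) set \<Rightarrow> (nat \<Rightarrow> 'a \<Rightarrow> 'a set) \<Rightarrow> nat \<Rightarrow> real"
  where "total_weight \<Omega> K r l = (\<Sum>i<l. weight \<Omega> K (r i) (r (Suc i)))"

text \<open>Each strict step lowers the sum of the class sizes. The bound is crude, but any bound
  independent of the tower serves for \<open>cost\<close>.\<close>

lemma tower_length:
  assumes t: "tower \<Omega> K r l" and s: "strict_tower \<Omega> r l"
  shows "l \<le> card \<Omega> * card \<Omega>"
proof -
  interpret tower \<Omega> K r l by (rule t)
  have finr: "finite (r i x)" if "x \<in> \<Omega>" for i x using block_mapD(2)[OF r_classes that] fin finite_subset by blast
  have "j + (\<Sum>x\<in>\<Omega>. card (r j x)) \<le> card \<Omega> * card \<Omega>" if "j \<le> l" for j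
    using that
  proof (induction j)
    case 0
    have "(\<Sum>x\<in>\<Omega>. card (r 0 x)) = (\<Sum>x\<in>\<Omega>. card \<Omega>)" by (rule sum.cong) (simp_all add: r0)
    then show ?case by simp
  next
    case (Suc j)
    have "(\<Sum>x\<in>\<Omega>. card (r (Suc j) x)) < (\<Sum>x\<in>\<Omega>. card (r j x))"
    proof (rule sum_strict_mono_ex1[OF fin])
      show "\<forall>x\<in>\<Omega>. card (r (Suc j) x) \<le> card (r j x)" using r_sub finr by (simp add: card_mono)
      have "j < l" using Suc.prems by simp
      then obtain x where x: "x \<in> \<Omega>" "r (Suc j) x \<noteq> r j x" using s unfolding strict_tower_def by blast
      then have "r (Suc j) x \<subset> r j x" using r_sub by blast
      then show "\<exists>x\<in>\<Omega>. card (r (Suc j) x) < card (r j x)" using x(1) psubset_card_mono[OF finr] by blast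
    qed
    then show ?case using Suc by simp
  qed
  from this[of l] show ?thesis by simp
qed

lemma sum_insert_step:
  fixes f f' :: "nat \<Rightarrow> real"
  assumes "i < l" "\<And>j. j < i \<Longrightarrow> f' j = f j" "f' i + f' (Suc i) = f i" "\<And>j. i < j \<Longrightarrow> f' (Suc j) = f j"
  shows "sum f' {..<Suc l} = sum f {..<l}"
proof -
  have "sum f' {..<Suc (Suc i + k)} = sum f {..<Suc i + k}" for k
  proof (induction k)
    case 0
    have "sum f' {..<i} = sum f {..<i}" by (rule sum.cong) (use assms(2) in auto)
    then show ?case using assms(3) by simp
  qed (use assms(4) in simp)
  from this[of "l - Suc i"] show ?thesis using assms(1) by simp
qed

lemma card_image_determined:
  assumes "finite A" "\<And>y z. y \<in> A \<Longrightarrow> z \<in> A \<Longrightarrow> f y = f z \<Longrightarrow> g y = g z"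
  shows "card (g ` A) \<le> card (f ` A)"
proof -
  have "g ` A \<subseteq> (\<lambda>v. g (inv_into A f v)) ` (f ` A)"
  proof clarify
    fix y assume y: "y \<in> A"
    have "f (inv_into A f (f y)) = f y" "inv_into A f (f y) \<in> A" using y by (auto simp: f_inv_into_f inv_into_into)
    then have "g (inv_into A f (f y)) = g y" using assms(2) y by blast
    then show "g y \<in> (\<lambda>v. g (inv_into A f v)) ` (f ` A)" using y by (metis image_eqI)
  qed
  then have "card (g ` A) \<le> card ((\<lambda>v. g (inv_into A f v)) ` (f ` A))"
    by (rule card_mono[rotated]) (use assms(1) in simp)
  also have "\<dots> \<le> card (f ` A)" by (rule card_image_le) (use assms(1) in simp)
  finally show ?thesis .
qed

text \<open>In degrees up to 8 even the full symmetric group can be paid for, so the surviving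
  sections have degree at least 9, as \<open>degree_bound\<close> demands.\<close>

lemma fact_le_small: "d \<le> 8 \<Longrightarrow> fact d \<le> (2::nat) ^ (7 * (d - 1))"
proof -
  assume "d \<le> 8"
  then have "d \<in> {0, 1, 2, 3, 4, 5, 6, 7, 8}" by auto
  then show ?thesis by (elim insertE) (simp_all add: fact_numeral)
qed

lemma imprimitiveE:
  assumes "\<not> primitive_on \<Omega> G" "transitive_on \<Omega> G"
  obtains B where "B \<subseteq> \<Omega>" "2 \<le> card B" "B \<noteq> \<Omega>" "\<forall>g\<in>G. g ` B = B \<or> g ` B \<inter> B = {}"
proof -
  have "\<exists>B\<subseteq>\<Omega>. 2 \<le> card B \<and> (\<forall>g\<in>G. g ` B = B \<or> g ` B \<inter> B = {}) \<and> B \<noteq> \<Omega>"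
  proof (rule ccontr)
    assume neg: "\<not> ?thesis"
    have "primitive_on \<Omega> G" unfolding primitive_on_def
    proof (intro conjI assms(2) allI impI, rule ccontr)
      fix B assume "B \<subseteq> \<Omega>" "2 \<le> card B" "\<forall>g\<in>G. g ` B = B \<or> g ` B \<inter> B = {}" "B \<noteq> \<Omega>"
      then have "\<exists>B\<subseteq>\<Omega>. 2 \<le> card B \<and> (\<forall>g\<in>G. g ` B = B \<or> g ` B \<inter> B = {}) \<and> B \<noteq> \<Omega>"
        by (intro exI conjI)
      then show False by (rule notE[OF neg])
    qed
    then show False using assms(1) by simp
  qed
  then show ?thesis by (elim exE conjE) (rule that)
qed

lemma transitive_blocks:
  assumes l: "layer \<Omega> K p q" and x: "x \<in> \<Omega>"
  shows "pgroup (blocks K p q x) (act (blocks K p q x) ` setstab K p x)"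
    and "transitive_on (blocks K p q x) (act (blocks K p q x) ` setstab K p x)"
proof -
  interpret layer \<Omega> K p q by (rule l)
  show "pgroup (blocks K p q x) (act (blocks K p q x) ` setstab K p x)"
    by (rule pgroup_act(1)[OF pgroup_setstab[OF K p x] pres_blocks[OF K p q x] finite_blocks[OF K p q]])
  show "transitive_on (blocks K p q x) (act (blocks K p q x) ` setstab K p x)"
    unfolding transitive_on_def
  proof (intro ballI)
    fix u v assume uv: "u \<in> blocks K p q x" "v \<in> blocks K p q x"
    obtain g where "g \<in> setstab K p x" "g ` u = v" using blocks_transitive[OF K p q x uv] by blast
    then show "\<exists>f\<in>act (blocks K p q x) ` setstab K p x. f u = v" using uv by (auto simp: act_def)
  qed
qed

text \<open>Among all towers for subgroups \<open>K\<close> whose index in \<open>H\<close> is paid for by the loss of weight, one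
  with the smallest group and then the longest tower has only giant sections.\<close>

locale extremal =
  fixes \<Omega> :: "'a set" and H
  assumes H: "pgroup \<Omega> H" and n2: "2 \<le> card \<Omega>"
begin

definition "good K r l \<longleftrightarrow> tower \<Omega> K r l \<and> strict_tower \<Omega> r l \<and> K \<subseteq> H \<and>
  real (card H) \<le> card K * 2 powr (7 * (card \<Omega> - total_weight \<Omega> K r l))"

text \<open>The lexicographic order, first by \<open>card K\<close> and then by decreasing length,
  as one number: the multiplier exceeds every possible length by
  \<open>tower_length\<close>.\<close>

definition "cost K l = card K * Suc (card \<Omega> * card \<Omega>) + (card \<Omega> * card \<Omega> - l)"

lemma good_start: "good H (\<lambda>i x. if i = 0 then (if x \<in> \<Omega> then \<Omega> else {x}) else {x}) 1"
proof -
  let ?r = "\<lambda>i x. if i = (0::nat) then (if x \<in> \<Omega> then \<Omega> else {x}) else {x}"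
  have gO: "g ` \<Omega> = \<Omega>" if "g \<in> H" for g
    using permutes_image[OF pgroup_permutes[OF H that]] .
  have t: "tower \<Omega> H ?r 1"
  proof unfold_locales
    show "pgroup \<Omega> H" by (rule H)
    show "block_map \<Omega> (?r i)" for i unfolding block_map_def by auto
    show "invariant \<Omega> H (?r i)" for i unfolding invariant_def using gO pgroup_in[OF H] by auto
  qed auto
  then interpret tower \<Omega> H ?r 1 .
  have s: "strict_tower \<Omega> ?r 1"
  proof -
    obtain x where x: "x \<in> \<Omega>" using n2 by (metis card.empty ex_in_conv not_numeral_le_zero)
    have "{x} \<noteq> \<Omega>" using n2 by auto
    then show ?thesis unfolding strict_tower_def using x by auto
  qed
  have "total_weight \<Omega> H ?r 1 \<le> card \<Omega>"
    using layer.weight_le[OF layer[of 0]] unfolding total_weight_def by simp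
  then have "1 \<le> (2::real) powr (7 * (card \<Omega> - total_weight \<Omega> H ?r 1))" by (intro ge_one_powr_ge_zero) auto
  then have "real (card H) * 1 \<le> card H * 2 powr (7 * (card \<Omega> - total_weight \<Omega> H ?r 1))"
    by (intro mult_left_mono) auto
  then show ?thesis unfolding good_def using t s by simp
qed

lemma ex_extremal:
  obtains K r l where "good K r l" "\<And>K' r' l'. good K' r' l' \<Longrightarrow> cost K l \<le> cost K' l'"
proof -
  let ?P = "\<lambda>(K, r, l). good K r l" and ?f = "\<lambda>(K, r, l). cost K l"
  obtain c where "?P c" "\<And>c'. ?P c' \<Longrightarrow> ?f c \<le> ?f c'"
    using ex_has_least_nat[of ?P _ ?f] good_start by (metis (mono_tags, lifting) case_prod_conv)
  then show ?thesis using that by (cases c) fastforce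
qed

end

locale extremal_tower = extremal + tower +
  assumes gd: "good K r l" and minimal: "\<And>K' r' l'. good K' r' l' \<Longrightarrow> cost K l \<le> cost K' l'"
begin

lemma strict: "strict_tower \<Omega> r l" using gd unfolding good_def by auto

text \<open>The same tower for a subgroup whose index is paid by the loss of weight is good again.
  The loss makes the subgroup proper, and a smaller group is cheaper whatever the length.\<close>

lemma no_cheap_subgroup:
  assumes K': "K' \<subseteq> K" "pgroup \<Omega> K'" and lt: "total_weight \<Omega> K' r l < total_weight \<Omega> K r l"
    and c: "real (card K) \<le> 2 powr (7 * (total_weight \<Omega> K r l - total_weight \<Omega> K' r l)) * card K'"
  shows False
proof -
  let ?w = "total_weight \<Omega> K r l" and ?w' = "total_weight \<Omega> K' r l"
  have "real (card H) \<le> card K * 2 powr (7 * (card \<Omega> - ?w))" using gd unfolding good_def by auto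
  also have "\<dots> \<le> (2 powr (7 * (?w - ?w')) * card K') * 2 powr (7 * (card \<Omega> - ?w))"
    by (rule mult_right_mono[OF c]) simp
  also have "\<dots> = card K' * 2 powr (7 * (card \<Omega> - ?w'))"
    by (simp add: powr_add[symmetric] algebra_simps)
  finally have "good K' r l"
    unfolding good_def using tower_subgroup[OF tower_axioms K'] strict K'(1) gd unfolding good_def by auto
  from minimal[OF this] have "card K * Suc (card \<Omega> * card \<Omega>) \<le> card K' * Suc (card \<Omega> * card \<Omega>)"
    unfolding cost_def by linarith
  then have "card K \<le> card K'" by (simp only: mult_le_cancel2)
  moreover have "K' \<noteq> K" using lt by auto
  then have "card K' < card K" using K'(1) psubset_card_mono[OF pgroup_finite_group[OF K]] by auto
  ultimately show False by simp
qed

lemma total_weight_drop: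
  assumes K': "K' \<subseteq> K" "pgroup \<Omega> K'" and I: "I \<subseteq> {..<l}"
  shows "(\<Sum>i\<in>I. weight \<Omega> K (r i) (r (Suc i)) - weight \<Omega> K' (r i) (r (Suc i)))
    \<le> total_weight \<Omega> K r l - total_weight \<Omega> K' r l"
proof -
  have "(\<Sum>i\<in>I. weight \<Omega> K (r i) (r (Suc i)) - weight \<Omega> K' (r i) (r (Suc i)))
    \<le> (\<Sum>i<l. weight \<Omega> K (r i) (r (Suc i)) - weight \<Omega> K' (r i) (r (Suc i)))"
    by (rule sum_mono2) (use I weight_mono[OF layer K'] in auto)
  then show ?thesis unfolding total_weight_def by (simp add: sum_subtractf)
qed

text \<open>Otherwise \<open>payment\<close> would kill the section at a price of at most
  \<open>2 ^ (7 * (d - 1))\<close> for each conjugate, and by \<open>weight_drop\<close> each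
  conjugate gives up a weight of at least \<open>d - 1\<close>.\<close>

lemma sections_large:
  assumes i: "i < l" and x: "x \<in> \<Omega>" and ne1: "card (O' i x) \<noteq> 1"
  shows "2 ^ (7 * (card (O' i x) - 1)) < card (act (O' i x) ` E i x)"
proof (rule ccontr)
  assume le: "\<not> ?thesis"
  let ?X = "act (O' i x) ` E i x" and ?d = "card (O' i x)" and ?P = "card (r i ` orb K x)"
  interpret L: layer \<Omega> K "r i" "r (Suc i)" by (rule layer)
  have d: "2 \<le> ?d" using L.blocks_pos[OF x] ne1 by simp
  obtain K' where K': "pgroup \<Omega> K'" "K' \<subseteq> K" "card K \<le> card ?X ^ ?P * card K'"
    "\<And>y g. y \<in> orb K x \<Longrightarrow> g \<in> K' \<Longrightarrow> g y \<in> r i y \<Longrightarrow> r (Suc i) (g y) = r (Suc i) y"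
    using payment[OF layer x] by blast
  have "(real ?d - 1) * ?P \<le> weight \<Omega> K (r i) (r (Suc i)) - weight \<Omega> K' (r i) (r (Suc i))"
    by (rule weight_drop[OF layer K'(2,1) x]) (rule K'(4))
  also have "\<dots> \<le> total_weight \<Omega> K r l - total_weight \<Omega> K' r l"
    using total_weight_drop[OF K'(2,1), of "{i}"] i by simp
  finally have drop: "(real ?d - 1) * ?P \<le> total_weight \<Omega> K r l - total_weight \<Omega> K' r l" .
  have "0 < (real ?d - 1) * ?P" using d L.classes_pos[OF x] by (intro mult_pos_pos) auto
  then have lt: "total_weight \<Omega> K' r l < total_weight \<Omega> K r l" using drop by linarith
  have "card K \<le> (2 ^ (7 * (?d - 1))) ^ ?P * card K'"
    using K'(3) power_mono[of "card ?X" "2 ^ (7 * (?d - 1))" ?P] le by (meson le_trans mult_le_mono1 not_le zero_le)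
  then have "real (card K) \<le> real ((2 ^ (7 * (?d - 1))) ^ ?P * card K')" by (simp only: of_nat_le_iff)
  also have "\<dots> = 2 powr (7 * ((real ?d - 1) * ?P)) * card K'"
  proof -
    have "real ((2 ^ (7 * (?d - 1))) ^ ?P) = 2 ^ (7 * (?d - 1) * ?P)" by (simp add: power_mult)
    also have "\<dots> = 2 powr real (7 * (?d - 1) * ?P)" by (simp add: powr_realpow del: of_nat_mult)
    also have "real (7 * (?d - 1) * ?P) = 7 * ((real ?d - 1) * ?P)" using d by (simp add: of_nat_diff)
    finally show ?thesis by simp
  qed
  also have "\<dots> \<le> 2 powr (7 * (total_weight \<Omega> K r l - total_weight \<Omega> K' r l)) * card K'"
    using drop by (intro mult_right_mono powr_mono) auto
  finally show False by (rule no_cheap_subgroup[OF K'(2,1) lt])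
qed

text \<open>A block of imprimitivity would yield, by \<open>refinement\<close>, a longer tower for
  the same group with the same total weight, hence one of smaller cost.\<close>

lemma sections_primitive:
  assumes i: "i < l" and x: "x \<in> \<Omega>"
  shows "primitive_on (O' i x) (act (O' i x) ` E i x)"
proof (rule ccontr)
  assume "\<not> ?thesis"
  from imprimitiveE[OF this transitive_blocks(2)[OF layer x]] obtain \<B> where B: "\<B> \<subseteq> O' i x" "2 \<le> card \<B>" "\<B> \<noteq> O' i x"
    "\<forall>f\<in>act (O' i x) ` E i x. f ` \<B> = \<B> \<or> f ` \<B> \<inter> \<B> = {}" .
  from refinement[OF layer x B(1-3) bspec[OF B(4)]] obtain p' where p': "block_map \<Omega> p'" "invariant \<Omega> K p'" "\<forall>y\<in>\<Omega>. r (Suc i) y \<subseteq> p' y" "\<forall>y\<in>\<Omega>. p' y \<subseteq> r i y"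
    "\<exists>y\<in>\<Omega>. p' y \<noteq> r (Suc i) y" "\<exists>y\<in>\<Omega>. p' y \<noteq> r i y"
    "weight \<Omega> K (r i) p' + weight \<Omega> K p' (r (Suc i)) = weight \<Omega> K (r i) (r (Suc i))" .
  define r' where "r' j = (if j \<le> i then r j else if j = Suc i then p' else r (j - 1))" for j
  have r'1: "r' j = r j" if "j \<le> i" for j using that unfolding r'_def by simp
  have r'2: "r' (Suc i) = p'" unfolding r'_def by simp
  have r'3: "r' (Suc j) = r j" if "i < j" for j using that unfolding r'_def by simp
  have cases': "j < i \<or> j = i \<or> j = Suc i \<or> (\<exists>k. j = Suc k \<and> i < k)" for j
    by (cases j) auto
  have t': "tower \<Omega> K r' (Suc l)"
  proof unfold_locales
    show "pgroup \<Omega> K" by (rule K)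
    show "block_map \<Omega> (r' j)" for j unfolding r'_def using p'(1) r_classes by simp
    show "invariant \<Omega> K (r' j)" for j unfolding r'_def using p'(2) r_inv by simp
    show "r' (Suc j) y \<subseteq> r' j y" if y: "y \<in> \<Omega>" for j y
      using cases'[of j]
    proof (elim disjE exE conjE)
      assume "j < i" then show ?thesis using r_sub[OF y] by (simp add: r'1)
    next
      assume "j = i" then show ?thesis using p'(4) y by (simp add: r'1 r'2)
    next
      assume "j = Suc i" then show ?thesis using p'(3) y by (simp add: r'2 r'3)
    next
      fix k assume "j = Suc k" "i < k" then show ?thesis using r_sub[OF y] by (simp add: r'3)
    qed
    show "r' 0 y = \<Omega>" if "y \<in> \<Omega>" for y using r0[OF that] by (simp add: r'1)
    show "r' (Suc l) y = {y}" if "y \<in> \<Omega>" for y using rl[OF that] i by (simp add: r'3)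
  qed
  have s': "strict_tower \<Omega> r' (Suc l)" unfolding strict_tower_def
  proof (intro allI impI)
    fix j assume j: "j < Suc l"
    show "\<exists>y\<in>\<Omega>. r' (Suc j) y \<noteq> r' j y"
      using cases'[of j]
    proof (elim disjE exE conjE)
      assume "j < i" then show ?thesis using strict i unfolding strict_tower_def by (simp add: r'1)
    next
      assume "j = i" then show ?thesis using p'(6) by (simp add: r'1 r'2)
    next
      assume "j = Suc i" then show ?thesis using p'(5) by (auto simp: r'2 r'3)
    next
      fix k assume "j = Suc k" "i < k" then show ?thesis using strict j unfolding strict_tower_def by (simp add: r'3)
    qed
  qed
  have w': "total_weight \<Omega> K r' (Suc l) = total_weight \<Omega> K r l" unfolding total_weight_def
    by (rule sum_insert_step[OF i]) (use p'(7) in \<open>simp_all add: r'1 r'2 r'3\<close>)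
  have "good K r' (Suc l)" using t' s' w' gd unfolding good_def by auto
  from minimal[OF this] tower_length[OF t' s'] show False unfolding cost_def by simp
qed

text \<open>A primitive section too large for \<open>primitive_bound\<close> contains a 3-cycle, and
  then all of them by Jordan's theorem.\<close>

lemma sections_giant:
  assumes i: "i < l" and x: "x \<in> \<Omega>" and ne1: "card (O' i x) \<noteq> 1"
  shows "9 \<le> card (O' i x)" "giant (E i x) (O' i x)"
proof -
  let ?X = "act (O' i x) ` E i x" and ?d = "card (O' i x)"
  note X = transitive_blocks(1)[OF layer x, of i]
  note large = sections_large[OF assms]
  have d: "2 \<le> ?d" using layer.blocks_pos[OF layer[of i] x] ne1 by simp
  have "\<not> no_cyc3 ?X"
    using primitive_bound[OF X sections_primitive[OF i x] _ d] large by auto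
  then show "giant (E i x) (O' i x)"
    unfolding giant_def no_cyc3_def using primitive_cyc3_alt3[OF X sections_primitive[OF i x]] by blast
  show "9 \<le> ?d"
  proof (rule ccontr)
    assume "\<not> 9 \<le> ?d"
    then have "fact ?d \<le> (2::nat) ^ (7 * (?d - 1))" by (intro fact_le_small) simp
    moreover have "card ?X \<le> fact ?d" by (rule pgroup_card_le[OF X])
    ultimately show False using large by simp
  qed
qed

text \<open>In a tied pair the subgroup that kills section \<open>i\<close> kills section
  \<open>j\<close> as well. To each conjugate of the upper section there belong at least
  \<open>?di\<close> conjugates of the lower one, and together these lose weight
  \<open>?di * (?dj - 1)\<close>, enough to pay even for a factor \<open>fact ?di\<close>.\<close>

lemma sections_untied:
  assumes ij: "i < j" "j < l" and x: "x \<in> \<Omega>" and dj: "9 \<le> card (O' j x)" "card (O' i x) - 1 \<le> card (O' j x)"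
  shows "\<exists>g\<in>ker (E i x) (O' i x) \<inter> E j x. \<exists>u\<in>O' j x. g ` u \<noteq> u"
proof (rule ccontr)
  assume "\<not> ?thesis"
  then have tie: "\<And>g u. g \<in> ker (E i x) (O' i x) \<Longrightarrow> g \<in> E j x \<Longrightarrow> u \<in> O' j x \<Longrightarrow> g ` u = u" by blast
  let ?di = "card (O' i x)" and ?dj = "card (O' j x)"
  let ?Pi = "card (r i ` orb K x)" and ?Pj = "card (r j ` orb K x)" and ?X = "act (O' i x) ` E i x"
  interpret Li: layer \<Omega> K "r i" "r (Suc i)" by (rule layer)
  interpret Lj: layer \<Omega> K "r j" "r (Suc j)" by (rule layer)
  have di: "2 \<le> ?di"
  proof (rule ccontr)
    assume "\<not> 2 \<le> ?di"
    then have "?di = 1" using Li.blocks_pos[OF x] by linarith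
    then obtain v where v: "O' i x = {v}" by (auto simp: card_1_singleton_iff)
    have "g \<in> ker (E i x) (O' i x)" if "g \<in> E j x" for g
    proof -
      have gE: "g \<in> E i x" using E_antimono[of i j x] ij x that by auto
      have "g ` v \<in> O' i x" by (rule presD[OF pres_O[OF x] gE]) (simp add: v)
      then show ?thesis unfolding ker_def v using gE by simp
    qed
    then have triv: "g ` u = u" if "g \<in> E j x" "u \<in> O' j x" for g u using tie that by blast
    obtain u where u: "u \<in> O' j x" using O_self[OF x] by blast
    obtain w where w: "w \<in> O' j x" "w \<notin> set [u]" using ex_not_in_list[OF finite_O, of "[u]" j x] dj(1) by auto
    obtain g where "g \<in> E j x" "g ` u = w" using O_trans[OF x u w(1)] by blast
    then show False using triv[OF _ u] w(2) by simp
  qed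
  obtain K' where K': "pgroup \<Omega> K'" "K' \<subseteq> K" "card K \<le> card ?X ^ ?Pi * card K'"
    "\<And>y g. y \<in> orb K x \<Longrightarrow> g \<in> K' \<Longrightarrow> g y \<in> r i y \<Longrightarrow> r (Suc i) (g y) = r (Suc i) y"
    using payment[OF layer x] by blast
  \<comment> \<open>An element of \<open>K'\<close> that keeps the class of \<open>y\<close> at
    level \<open>j\<close> fixes every block of the section of \<open>y\<close> at level
    \<open>i\<close>. Conjugated back to \<open>x\<close> by \<open>h\<close>, it falls under the
    tie and therefore fixes the lower blocks too.\<close>
  have K'j: "r (Suc j) (g y) = r (Suc j) y" if y: "y \<in> orb K x" and g: "g \<in> K'" "g y \<in> r j y" for y g
  proof -
    obtain h where h: "h \<in> K" "y = h x" using y unfolding orb_def by blast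
    have y\<Omega>: "y \<in> \<Omega>" using in_\<Omega>[OF h(1)] x h(2) by simp
    have gK: "g \<in> K" using g(1) K'(2) by blast
    have gEj: "g \<in> E j y" using gK g(2) unfolding setstab_def by simp
    have gEi: "g \<in> E i y" using E_antimono[of i j y] ij y\<Omega> gEj by auto
    have fixi: "g ` u = u" if u: "u \<in> O' i y" for u
    proof -
      obtain k where k: "k \<in> E i y" "u = r (Suc i) (k y)" using u unfolding blocks_def by blast
      have kK: "k \<in> K" by (rule setstab_K[OF k(1)])
      have ky: "k y \<in> \<Omega>" using in_\<Omega>[OF kK] y\<Omega> by simp
      have "(k \<circ> h) x \<in> orb K x" using pgroup_comp[OF K kK h(1)] unfolding orb_def by blast
      then have o: "k y \<in> orb K x" using h(2) by simp
      have "g \<circ> k \<in> E i y" by (rule pgroup_comp[OF pgroup_E[OF y\<Omega>] gEi k(1)])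
      then have "g (k y) \<in> r i y" unfolding setstab_def by simp
      moreover have "r i (k y) = r i y" using E_iff(1)[OF y\<Omega> kK] k(1) by simp
      ultimately have "r (Suc i) (g (k y)) = r (Suc i) (k y)" using K'(4)[OF o g(1)] by simp
      then show ?thesis using r_img[OF gK ky] k(2) by simp
    qed
    let ?g = "inv' h \<circ> g \<circ> h"
    have gK': "?g \<in> K" using pgroup_comp[OF K] pgroup_inv[OF K] h(1) gK by auto
    have bk: "h (?g z) = g (h z)" for z using pgroup_inv2[OF K h(1)] by simp
    have cE: "?g \<in> E k x" if "g \<in> E k y" for k
      using that gK' r_mem_iff[OF h(1) x, of "?g x" k] bk[of x] h(2) unfolding setstab_def by simp
    have himg: "h ` u \<in> O' k y" if "u \<in> O' k x" for u k
      using O_conj[OF x h(1)] h(2) that by blast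
    have "?g ` u = u" if u: "u \<in> O' i x" for u
    proof -
      have "g ` (h ` u) = h ` u" by (rule fixi[OF himg[OF u]])
      then show ?thesis by (simp only: o_image image_inv_eq(1)[OF K h(1)])
    qed
    then have "?g \<in> ker (E i x) (O' i x)" unfolding ker_def using cE[OF gEi] by blast
    from tie[OF this cE[OF gEj] O_self[OF x]] have "?g ` r (Suc j) x = r (Suc j) x" .
    then have "h ` (inv' h ` (g ` (h ` r (Suc j) x))) = h ` r (Suc j) x" by (simp only: o_image)
    then have "g ` (h ` r (Suc j) x) = h ` r (Suc j) x" by (simp only: image_inv_eq(2)[OF K h(1)])
    then have "g ` r (Suc j) y = r (Suc j) y" using r_img[OF h(1) x] h(2) by simp
    then show ?thesis using r_img[OF gK y\<Omega>] by simp
  qed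
  have "(\<Sum>k\<in>{i, j}. weight \<Omega> K (r k) (r (Suc k)) - weight \<Omega> K' (r k) (r (Suc k)))
    \<le> total_weight \<Omega> K r l - total_weight \<Omega> K' r l"
    by (rule total_weight_drop[OF K'(2,1)]) (use ij in auto)
  moreover have "(real ?di - 1) * ?Pi \<le> weight \<Omega> K (r i) (r (Suc i)) - weight \<Omega> K' (r i) (r (Suc i))"
    by (rule weight_drop[OF layer K'(2,1) x]) (rule K'(4))
  moreover have "(real ?dj - 1) * ?Pj \<le> weight \<Omega> K (r j) (r (Suc j)) - weight \<Omega> K' (r j) (r (Suc j))"
    by (rule weight_drop[OF layer K'(2,1) x]) (rule K'j)
  ultimately have drop: "(real ?di - 1) * ?Pi + (real ?dj - 1) * ?Pj \<le> total_weight \<Omega> K r l - total_weight \<Omega> K' r l"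
    using ij by simp
  have Pj: "?Pi * ?di \<le> ?Pj"
  proof -
    have "?Pi * ?di \<le> card (r (Suc i) ` orb K x)" by (rule Li.card_classes[OF x])
    also have "\<dots> \<le> ?Pj"
    proof (rule card_image_determined[OF finite_orb[OF K]])
      fix y z assume y: "y \<in> orb K x" and z: "z \<in> orb K x" and eq: "r j y = r j z"
      have yz: "y \<in> \<Omega>" "z \<in> \<Omega>" using y z orb_subset[OF K x] by auto
      have "z \<in> r j y" using eq r_self[OF yz(2), of j] by simp
      then have "z \<in> r (Suc i) y" using r_antimono[of "Suc i" j y] ij yz by auto
      then show "r (Suc i) y = r (Suc i) z" using r_eq_iff[OF yz] by simp
    qed
    finally show ?thesis .
  qed
  \<comment> \<open>This rests on \<open>?di - 1 \<le> ?dj\<close> and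
    \<open>?dj \<le> 7 * (?dj - 1)\<close>. The left side is the exponent obtained below from
    \<open>fact ?di \<le> 2 ^ (?di * (?di - 1))\<close>.\<close>
  have num: "real ?di * (real ?di - 1) * ?Pi \<le> 7 * ((real ?di - 1) * ?Pi + (real ?dj - 1) * ?Pj)"
  proof -
    have "real (?Pi * ?di) \<le> real ?Pj" using Pj by (simp only: of_nat_le_iff)
    then have "(real ?dj - 1) * (real ?Pi * ?di) \<le> (real ?dj - 1) * ?Pj" using dj(1) by (intro mult_left_mono) auto
    moreover have "real ?di * ((real ?di - 1) * ?Pi) \<le> real ?di * ((7 * (real ?dj - 1)) * ?Pi)"
      using dj di by (intro mult_left_mono mult_right_mono) auto
    moreover have "0 \<le> (real ?di - 1) * ?Pi" using di by simp
    ultimately show ?thesis by (simp add: algebra_simps)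
  qed
  have Ppos: "0 < real ?Pi" using Li.classes_pos[OF x] by simp
  have lt: "total_weight \<Omega> K' r l < total_weight \<Omega> K r l"
  proof -
    have "0 < real ?di * (real ?di - 1) * ?Pi" using di Ppos by (intro mult_pos_pos) auto
    from less_le_trans[OF this num] have "0 < (real ?di - 1) * ?Pi + (real ?dj - 1) * ?Pj" by simp
    from less_le_trans[OF this drop] show ?thesis by simp
  qed
  have "card ?X \<le> fact ?di" by (rule pgroup_card_le[OF transitive_blocks(1)[OF layer x]])
  also have "fact ?di \<le> ?di ^ ?di" using fact_le_power[of ?di, where 'a = nat] by simp
  also have "\<dots> \<le> (2 ^ (?di - 1)) ^ ?di"
  proof (rule power_mono)
    have "?di - 1 < 2 ^ (?di - 1)" by (rule less_exp)
    then show "?di \<le> 2 ^ (?di - 1)" by linarith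
  qed simp
  finally have cX: "card ?X \<le> 2 ^ (?di * (?di - 1))" by (simp add: power_mult[symmetric] mult.commute)
  have "card K \<le> (2 ^ (?di * (?di - 1))) ^ ?Pi * card K'"
    using K'(3) power_mono[OF cX, of ?Pi] by (meson le_trans mult_le_mono1 zero_le)
  then have "real (card K) \<le> real ((2 ^ (?di * (?di - 1))) ^ ?Pi * card K')" by (simp only: of_nat_le_iff)
  also have "\<dots> = 2 powr (real ?di * (real ?di - 1) * ?Pi) * card K'"
  proof -
    have "real ((2 ^ (?di * (?di - 1))) ^ ?Pi) = 2 ^ (?di * (?di - 1) * ?Pi)" by (simp add: power_mult)
    also have "\<dots> = 2 powr real (?di * (?di - 1) * ?Pi)" by (simp add: powr_realpow del: of_nat_mult)
    also have "real (?di * (?di - 1) * ?Pi) = real ?di * (real ?di - 1) * ?Pi" using di by (simp add: of_nat_diff)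
    finally show ?thesis by simp
  qed
  also have "\<dots> \<le> 2 powr (7 * (total_weight \<Omega> K r l - total_weight \<Omega> K' r l)) * card K'"
    using order_trans[OF num mult_left_mono[OF drop, of 7]] by (intro mult_right_mono powr_mono) auto
  finally show False by (rule no_cheap_subgroup[OF K'(2,1) lt])
qed

lemma giant_tower: "giant_tower \<Omega> K r l"
proof unfold_locales
  fix i x assume "i < l" "x \<in> \<Omega>"
  then show "card (O' i x) = 1 \<or> 9 \<le> card (O' i x) \<and> giant (E i x) (O' i x)"
    using sections_giant by (cases "card (O' i x) = 1") simp_all
qed (rule sections_untied)

end

section \<open>The bound for arbitrary permutation groups\<close>

theorem minimal_degree_bound:
  assumes H: "pgroup \<Omega> H" and n: "2 \<le> card \<Omega>"
    and m: "\<And>g. g \<in> H \<Longrightarrow> g \<noteq> id \<Longrightarrow> m \<le> card (mov g)"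
  shows "real m * ln (card H) \<le> 7 * card \<Omega> * real m * ln 2 + 3 * card \<Omega> * ln (card \<Omega>)"
proof -
  interpret extremal \<Omega> H by unfold_locales (rule H n)+
  obtain K r l where gd: "good K r l" and min: "\<And>K' r' l'. good K' r' l' \<Longrightarrow> cost K l \<le> cost K' l'"
    using ex_extremal by blast
  have t: "tower \<Omega> K r l" using gd unfolding good_def by simp
  interpret T: tower \<Omega> K r l by (rule t)
  interpret X: extremal_tower \<Omega> H K r l by unfold_locales (rule gd, rule min)
  have KH: "K \<subseteq> H" using gd unfolding good_def by simp
  have "real m * ln (card K) \<le> 3 * card \<Omega> * ln (card \<Omega>)"
    by (rule giant_tower.order_bound[OF X.giant_tower]) (use m KH in blast)
  moreover have "ln (card H) \<le> ln (card K) + 7 * card \<Omega> * ln 2"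
  proof -
    have Kpos: "0 < real (card K)" "0 < real (card H)" using pgroup_card_pos[OF T.K] pgroup_card_pos[OF H] by simp_all
    have w0: "0 \<le> total_weight \<Omega> K r l" unfolding total_weight_def
      by (rule sum_nonneg) (rule layer.weight_nonneg[OF T.layer])
    have "real (card H) \<le> card K * 2 powr (7 * (card \<Omega> - total_weight \<Omega> K r l))" using gd unfolding good_def by simp
    also have "\<dots> \<le> card K * 2 powr (7 * card \<Omega>)" using w0 by (intro mult_left_mono powr_mono) auto
    finally have "ln (card H) \<le> ln (card K * 2 powr (7 * card \<Omega>))" using Kpos by (subst ln_le_cancel_iff) auto
    also have "\<dots> = ln (card K) + 7 * card \<Omega> * ln 2" using Kpos by (simp add: ln_mult_pos ln_powr)
    finally show ?thesis .
  qed
  then have "real m * ln (card H) \<le> real m * (ln (card K) + 7 * card \<Omega> * ln 2)" by (rule mult_left_mono) simp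
  ultimately show ?thesis by (simp add: algebra_simps)
qed

theorem theoremA:
  fixes n m :: nat and H :: "(nat \<Rightarrow> nat) set"
  assumes "subgroup H (sym_group n)"
    and "H \<noteq> {id}"
    and "m = minimal_degree H"
  shows "(real m \<le> log 2 (real n) \<longrightarrow> real (card H) \<le> real n powr (10 * real n / real m))
       \<and> (real m \<ge> log 2 (real n) \<longrightarrow> real (card H) \<le> 2 powr (10 * real n))"
proof -
  interpret S: subgroup H "sym_group n" by (rule assms)
  have perm: "g permutes {1..n}" if "g \<in> H" for g using S.subset that by (auto simp: sym_group_carrier)
  have H: "pgroup {1..n} H" unfolding pgroup_def
  proof (intro conjI ballI)
    show "finite {1..n}" by simp
    show "id \<in> H" using S.one_closed by (simp add: sym_group_one)
    fix g assume g: "g \<in> H"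
    show "g permutes {1..n}" by (rule perm[OF g])
    show "inv' g \<in> H" using S.m_inv_closed[OF g] sym_group_inv_equality[of g n] S.subset g by (metis subsetD)
    fix h assume h: "h \<in> H"
    show "g \<circ> h \<in> H" using S.m_closed[OF g h] by (simp add: sym_group_mult)
  qed
  obtain h where h: "h \<in> H" "h \<noteq> id" "card (supp h) = m" using minimal_degree_attained(1)[OF assms(1,2)] assms(3) by auto
  have mv: "mov g = supp g" for g :: "nat \<Rightarrow> nat" unfolding mov_def supp_def ..
  have fs: "finite (supp h)" using mov_subset[OF H h(1)] finite_subset unfolding mv by blast
  obtain a where a: "h a \<noteq> a" using h(2) by (auto simp: fun_eq_iff)
  have "h (h a) \<noteq> h a" using a pgroup_inj[OF H h(1)] by metis
  then have "{a, h a} \<subseteq> supp h" using a unfolding supp_def by auto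
  then have "card {a, h a} \<le> card (supp h)" by (rule card_mono[OF fs])
  moreover have "card {a, h a} = 2" using a by simp
  ultimately have m2: "2 \<le> m" using h(3) by simp
  have mn: "m \<le> n" using card_mono[OF _ mov_subset[OF H h(1)]] h(3) unfolding mv by simp
  have n: "2 \<le> card {1..n}" "2 \<le> n" using m2 mn by auto
  \<comment> \<open>The two terms are equal in size when \<open>m * ln 2 = ln n\<close>, the
    boundary between the two cases; in each case the smaller term is absorbed by the larger one, and
    the coefficients add up to 10.\<close>
  have b: "real m * ln (card H) \<le> 7 * real n * real m * ln 2 + 3 * real n * ln n"
    using minimal_degree_bound[OF H n(1), of m] minimal_degree_attained(2)[OF assms(1,2)] assms(3) unfolding mv by simp
  have Hpos: "0 < real (card H)" using pgroup_card_pos[OF H] by simp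
  have mpos: "0 < real m" using m2 by simp
  show ?thesis
  proof (intro conjI impI)
    assume "real m \<le> log 2 (real n)"
    then have "real m * ln 2 \<le> ln n" by (simp add: log_def pos_le_divide_eq)
    then have "7 * real n * (real m * ln 2) \<le> 7 * real n * ln n" by (rule mult_left_mono) simp
    then have "real m * ln (card H) \<le> 10 * real n * ln n" using b by (simp add: mult_ac)
    then have "ln (card H) \<le> 10 * real n / real m * ln n" using mpos by (simp add: field_simps)
    then have "exp (ln (card H)) \<le> exp (10 * real n / real m * ln n)" by simp
    then show "real (card H) \<le> real n powr (10 * real n / real m)" using Hpos n(2) by (simp add: powr_def)
  next
    assume "real m \<ge> log 2 (real n)"
    then have "ln n \<le> real m * ln 2" by (simp add: log_def pos_divide_le_eq)
    then have "3 * real n * ln n \<le> 3 * real n * (real m * ln 2)" by (rule mult_left_mono) simp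
    then have "real m * ln (card H) \<le> real m * (10 * real n * ln 2)" using b by (simp add: algebra_simps)
    then have "ln (card H) \<le> 10 * real n * ln 2" using mpos by simp
    then have "exp (ln (card H)) \<le> exp (10 * real n * ln 2)" by simp
    then show "real (card H) \<le> 2 powr (10 * real n)" using Hpos by (simp add: powr_def)
  qed
qed

end
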